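(* Assume $\boldsymbol{f}\in\mathbf{H}(\mathrm{div},\Omega)$ and $\mu,\varepsilon_\sigma\in PW^{1,\infty}(\Omega)$. For each $h>0$ let $\mathbf{u}^*_h\in U_{ad}$ be a global solution of the discrete optimal control problem $\min\{j_h(\mathbf{u}_h):\mathbf{u}_h\in U_{ad}\}$. Then there exist subsequences of $\{\mathbf{u}^*_h\}_{h>0}$ (still indexed by $h$) such that $\mathbf{u}^*_h\to\mathbf{u}^*$ in $\mathbb{R}^\ell$ as $h\downarrow0$, where $\mathbf{u}^*\in U_{ad}$ is a global solution of the continuous optimal control problem $\min\{j(\mathbf{u}):\mathbf{u}\in U_{ad}\}$.
   Context: $\Omega\subset\mathbb{R}^3$ is an open, bounded, simply connected polyhedral domain with Lipschitz boundary $\Gamma$ and outward unit normal $\boldsymbol{n}$. $\mathbf{L}^2(\Omega;\mathbb{C})$ is the space of $\mathbb{C}^3$-valued square integrable fields; $(\boldsymbol v,\boldsymbol w)_\Omega=\int_\Omega \boldsymbol v\cdot\overline{\boldsymbol w}$ and $\|\cdot\|_\Omega$ are its inner product and norm. $\mathbf{H}(\mathrm{div},\Omega)$ and $\mathbf{H}(\mathbf{curl},\Omega)$ are the spaces of $\boldsymbol{w}\in\mathbf{L}^2(\Omega;\mathbb{C})$ with square integrable divergence, respectively curl, with graph norms; $\mathbf{H}_0(\mathbf{curl},\Omega)=\{\boldsymbol{w}\in\mathbf{H}(\mathbf{curl},\Omega):\boldsymbol{w}\times\boldsymbol{n}=\mathbf{0}\text{ on }\Gamma\}$. Data: $\omega>0$;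 $\mu\in L^\infty(\Omega)$ real with $\mu\ge\mu_0>0$; $\varepsilon,\sigma\in L^\infty(\Omega)$ real with $0<\varepsilon_+\le\varepsilon\le\varepsilon^+$ and $0<\sigma_+\le\sigma\le\sigma^+$ (constants); $\varepsilon_\sigma:=\varepsilon+i\sigma\omega^{-1}$; $\ell\in\mathbb{N}$; $\mathcal{P}=\{\Omega_k\}_{k=1}^\ell$ is a partition of $\Omega$ into pairwise disjoint subdomains with $\overline\Omega=\cup_k\overline{\Omega}_k$; $PW^{1,\infty}(\Omega)=\{\zeta\in L^\infty(\Omega;\mathbb{C}):\zeta|_{\Omega_k}\in W^{1,\infty}(\Omega_k;\mathbb{C}),\ 1\le k\le\ell\}$. For $\mathbf{u}\in\mathbb{R}^\ell$, $\varepsilon_\sigma\cdot\mathbf{u}$ denotes the function equal to $\mathbf{u}_k\varepsilon_\sigma$ on $\Omega_k$. $\boldsymbol{f},\boldsymbol{y}_\Omega,\boldsymbol{E}_\Omega\in\mathbf{L}^2(\Omega;\mathbb{C})$, $\alpha>0$. Vector inequalities are componentwise; $\mathbf{a},\mathbf{b}\in\mathbb{R}^\ell$ with $\mathbf{0}<\mathbf{a}<\mathbf{b}$ and $U_{ad}:=\{\mathbf{v}\in\mathbb{R}^\ell:\mathbf{a}\le\mathbf{v}\le\mathbf{b}\}$. Meshes: $\{\mathscr{T}_h\}_{h>0}$ is a collection of conforming, shape regular simplicial meshes of $\overline\Omega$, all refinements of an initial mesh, with $h=\max_{T\in\mathscr{T}_h}\mathrm{diam}(T)$, such that each $T\in\mathscr{T}_h$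 is contained in (the closure of) one element of $\mathcal{P}$. $\mathbf{V}(\mathscr{T}_h)=\{\boldsymbol{v}_h\in\mathbf{H}_0(\mathbf{curl},\Omega):\boldsymbol{v}_h|_T\in[\mathbb{P}_0(T)]^3\oplus\boldsymbol{x}\times[\widetilde{\mathbb{P}}_0(T)]^3\ \forall T\in\mathscr{T}_h\}$ is the lowest-order Nédélec space ($\widetilde{\mathbb P}_0$: homogeneous polynomials of degree $0$). For $\mathbf{u}>\mathbf{0}$, $\mathcal{S}\mathbf{u}=\boldsymbol{y}\in\mathbf{H}_0(\mathbf{curl},\Omega)$ is the unique solution of $(\mu^{-1}\mathbf{curl}\,\boldsymbol{y},\mathbf{curl}\,\boldsymbol{w})_\Omega-\omega^2((\varepsilon_\sigma\cdot\mathbf{u})\boldsymbol{y},\boldsymbol{w})_\Omega=(\boldsymbol{f},\boldsymbol{w})_\Omega$ for all $\boldsymbol{w}\in\mathbf{H}_0(\mathbf{curl},\Omega)$; $\mathcal{S}_h\mathbf{u}=\boldsymbol{y}_h\in\mathbf{V}(\mathscr{T}_h)$ is the unique solution of the same equation with $\boldsymbol{y}$ replaced by $\boldsymbol{y}_h$ and test functions ranging over $\mathbf{V}(\mathscr{T}_h)$. With $\mathcal{J}(\boldsymbol{y},\mathbf{u})=\tfrac12\|\boldsymbol{y}-\boldsymbol{y}_\Omega\|_\Omega^2+\tfrac12\|\mathbf{curl}\,\boldsymbol{y}-\boldsymbol{E}_\Omega\|_\Omega^2+\tfrac{\alpha}{2}\|\mathbf{u}\|_{\mathbb{R}^\ell}^2$,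 set $j(\mathbf{u})=\mathcal{J}(\mathcal{S}\mathbf{u},\mathbf{u})$ and $j_h(\mathbf{u})=\mathcal{J}(\mathcal{S}_h\mathbf{u},\mathbf{u})$. *)

theory Defs
  imports "HOL-Analysis.Analysis"
begin

text \<open>
  Conventions. A field on \<open>\<Omega>\<close> is a total function on \<open>real^3\<close> of which only the values on
  \<open>\<Omega>\<close> matter, up to null sets; function spaces are sets of such representatives, and their members
  are not identified when they agree almost everywhere.
\<close>


section \<open>Smooth functions and classical differential operators\<close>

definition pderiv_at :: "3 \<Rightarrow> (real^3 \<Rightarrow> 'b::real_normed_vector) \<Rightarrow> real^3 \<Rightarrow> 'b" where
  "pderiv_at i f x = frechet_derivative f (at x) (axis i 1)"

primrec C_k :: "nat \<Rightarrow> (real^3 \<Rightarrow> 'b::real_normed_vector) \<Rightarrow> bool" where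
  "C_k 0 f \<longleftrightarrow> continuous_on UNIV f"
| "C_k (Suc k) f \<longleftrightarrow> (\<forall>x. f differentiable (at x)) \<and> (\<forall>i. C_k k (pderiv_at i f))"

definition C_inf :: "(real^3 \<Rightarrow> 'b::real_normed_vector) set" where
  "C_inf = {\<phi>. \<forall>k. C_k k \<phi>}"

definition C_inf_c :: "(real^3) set \<Rightarrow> (real^3 \<Rightarrow> 'b::real_normed_vector) set" where
  "C_inf_c \<Omega> = {\<phi> \<in> C_inf. \<exists>K. compact K \<and> K \<subseteq> \<Omega> \<and> (\<forall>x. x \<notin> K \<longrightarrow> \<phi> x = 0)}"

definition smooth_curl :: "(real^3 \<Rightarrow> complex^3) \<Rightarrow> real^3 \<Rightarrow> complex^3" where
  "smooth_curl \<phi> x = vector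
     [pderiv_at 2 \<phi> x $ 3 - pderiv_at 3 \<phi> x $ 2,
      pderiv_at 3 \<phi> x $ 1 - pderiv_at 1 \<phi> x $ 3,
      pderiv_at 1 \<phi> x $ 2 - pderiv_at 2 \<phi> x $ 1]"

definition smooth_grad :: "(real^3 \<Rightarrow> complex) \<Rightarrow> real^3 \<Rightarrow> complex^3" where
  "smooth_grad \<phi> x = (\<chi> i. pderiv_at i \<phi> x)"


section \<open>Lebesgue and Sobolev spaces\<close>

text \<open>Bilinear (no conjugation), in contrast to \<open>L2_inner\<close> below.\<close>

definition cdot :: "complex^3 \<Rightarrow> complex^3 \<Rightarrow> complex" where
  "cdot v w = (\<Sum>i\<in>UNIV. v $ i * w $ i)"

definition L2 :: "(real^3) set \<Rightarrow> (real^3 \<Rightarrow> 'b::real_normed_vector) set" where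
  "L2 \<Omega> = {w \<in> borel_measurable (lebesgue_on \<Omega>).
             integrable (lebesgue_on \<Omega>) (\<lambda>x. (norm (w x))\<^sup>2)}"

definition L2_inner :: "(real^3) set \<Rightarrow> (real^3 \<Rightarrow> complex^3) \<Rightarrow> (real^3 \<Rightarrow> complex^3) \<Rightarrow> complex" where
  "L2_inner \<Omega> v w = (LINT x|lebesgue_on \<Omega>. (\<Sum>i\<in>UNIV. v x $ i * cnj (w x $ i)))"

definition L2_norm :: "(real^3) set \<Rightarrow> (real^3 \<Rightarrow> complex^3) \<Rightarrow> real" where
  "L2_norm \<Omega> w = sqrt (Re (L2_inner \<Omega> w w))"

definition L_inf :: "(real^3) set \<Rightarrow> (real^3 \<Rightarrow> 'b::real_normed_vector) set" where
  "L_inf \<Omega> = {\<zeta> \<in> borel_measurable (lebesgue_on \<Omega>).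
                \<exists>C. AE x in lebesgue_on \<Omega>. norm (\<zeta> x) \<le> C}"

definition has_weak_pderiv ::
  "(real^3) set \<Rightarrow> 3 \<Rightarrow> (real^3 \<Rightarrow> complex) \<Rightarrow> (real^3 \<Rightarrow> complex) \<Rightarrow> bool" where
  "has_weak_pderiv \<Omega> i \<zeta> g \<longleftrightarrow>
     (\<forall>\<phi>\<in>C_inf_c \<Omega>. (LINT x|lebesgue_on \<Omega>. \<zeta> x * pderiv_at i \<phi> x)
                      = - (LINT x|lebesgue_on \<Omega>. g x * \<phi> x))"

definition W1_inf :: "(real^3) set \<Rightarrow> (real^3 \<Rightarrow> complex) set" where
  "W1_inf \<Omega> = {\<zeta> \<in> L_inf \<Omega>. \<forall>i. \<exists>g\<in>L_inf \<Omega>. has_weak_pderiv \<Omega> i \<zeta> g}"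

definition PW1_inf :: "(real^3) set \<Rightarrow> ('l \<Rightarrow> (real^3) set) \<Rightarrow> (real^3 \<Rightarrow> complex) set" where
  "PW1_inf \<Omega> P = {\<zeta> \<in> L_inf \<Omega>. \<forall>k. \<zeta> \<in> W1_inf (P k)}"

definition has_weak_div ::
  "(real^3) set \<Rightarrow> (real^3 \<Rightarrow> complex^3) \<Rightarrow> (real^3 \<Rightarrow> complex) \<Rightarrow> bool" where
  "has_weak_div \<Omega> w d \<longleftrightarrow>
     (\<forall>\<phi>\<in>C_inf_c \<Omega>. (LINT x|lebesgue_on \<Omega>. cdot (w x) (smooth_grad \<phi> x))
                      = - (LINT x|lebesgue_on \<Omega>. d x * \<phi> x))"

definition has_weak_curl ::
  "(real^3) set \<Rightarrow> (real^3 \<Rightarrow> complex^3) \<Rightarrow> (real^3 \<Rightarrow> complex^3) \<Rightarrow> bool" where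
  "has_weak_curl \<Omega> w c \<longleftrightarrow>
     (\<forall>\<phi>\<in>C_inf_c \<Omega>. (LINT x|lebesgue_on \<Omega>. cdot (w x) (smooth_curl \<phi> x))
                      = (LINT x|lebesgue_on \<Omega>. cdot (c x) (\<phi> x)))"

definition H_div :: "(real^3) set \<Rightarrow> (real^3 \<Rightarrow> complex^3) set" where
  "H_div \<Omega> = {w \<in> L2 \<Omega>. \<exists>d\<in>L2 \<Omega>. has_weak_div \<Omega> w d}"

definition H_curl :: "(real^3) set \<Rightarrow> (real^3 \<Rightarrow> complex^3) set" where
  "H_curl \<Omega> = {w \<in> L2 \<Omega>. \<exists>c\<in>L2 \<Omega>. has_weak_curl \<Omega> w c}"

text \<open>A representative of the weak curl, which is determined almost everywhere in \<open>\<Omega>\<close>.\<close>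

definition curl :: "(real^3) set \<Rightarrow> (real^3 \<Rightarrow> complex^3) \<Rightarrow> real^3 \<Rightarrow> complex^3" where
  "curl \<Omega> w = (SOME c. c \<in> L2 \<Omega> \<and> has_weak_curl \<Omega> w c)"

text \<open>
  For \<open>w\<close> in \<open>H(curl)\<close> the trace \<open>w \<times> n\<close> is in general only a distribution on the boundary
  \<open>\<Gamma>\<close>; it is defined by Green's formula
  \<open>\<integral>\<^sub>\<Gamma> (w \<times> n) \<cdot> \<phi> = \<integral>\<^sub>\<Omega> w \<cdot> curl \<phi> - \<integral>\<^sub>\<Omega> curl w \<cdot> \<phi>\<close>
  for \<open>\<phi>\<close> smooth up to the boundary.
\<close>

definition tangential_trace ::
  "(real^3) set \<Rightarrow> (real^3 \<Rightarrow> complex^3) \<Rightarrow> (real^3 \<Rightarrow> complex^3) \<Rightarrow> complex" where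
  "tangential_trace \<Omega> w \<phi> =
     (LINT x|lebesgue_on \<Omega>. cdot (w x) (smooth_curl \<phi> x))
       - (LINT x|lebesgue_on \<Omega>. cdot (curl \<Omega> w x) (\<phi> x))"

definition H0_curl :: "(real^3) set \<Rightarrow> (real^3 \<Rightarrow> complex^3) set" where
  "H0_curl \<Omega> = {w \<in> H_curl \<Omega>. \<forall>\<phi>\<in>C_inf. tangential_trace \<Omega> w \<phi> = 0}"


section \<open>Domains, partitions and meshes\<close>

text \<open>Locally, in suitable Cartesian coordinates, \<open>\<Omega>\<close> is the strict epigraph of a Lipschitz function.\<close>

definition lipschitz_boundary :: "(real^3) set \<Rightarrow> bool" where
  "lipschitz_boundary \<Omega> \<longleftrightarrow>
     (\<forall>p\<in>frontier \<Omega>. \<exists>(Q :: real^3 \<Rightarrow> real^3) r L (\<gamma> :: real^2 \<Rightarrow> real).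
        orthogonal_transformation Q \<and> 0 < r \<and> L-lipschitz_on UNIV \<gamma> \<and>
        (\<forall>y\<in>ball p r. y \<in> \<Omega> \<longleftrightarrow>
           \<gamma> (vector [Q (y - p) $ 1, Q (y - p) $ 2]) < Q (y - p) $ 3))"

definition polyhedral_lipschitz_domain :: "(real^3) set \<Rightarrow> bool" where
  "polyhedral_lipschitz_domain \<Omega> \<longleftrightarrow>
     \<Omega> \<noteq> {} \<and> open \<Omega> \<and> connected \<Omega> \<and> bounded \<Omega> \<and> lipschitz_boundary \<Omega> \<and>
     (\<exists>\<P>. finite \<P> \<and> (\<forall>A\<in>\<P>. polytope A) \<and> closure \<Omega> = \<Union>\<P>)"

text \<open>
  The last condition is implicit in the notion of a partition: the closures may cover \<open>closure \<Omega>\<close>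
  although the open sets \<open>P k\<close> miss a set of positive measure, and then functions would not be
  determined as elements of \<open>L_inf \<Omega>\<close> by their values on the \<open>P k\<close>.
\<close>

definition domain_partition :: "(real^3) set \<Rightarrow> ('l::finite \<Rightarrow> (real^3) set) \<Rightarrow> bool" where
  "domain_partition \<Omega> P \<longleftrightarrow>
     (\<forall>k. P k \<noteq> {} \<and> open (P k) \<and> connected (P k) \<and> P k \<subseteq> \<Omega>) \<and>
     (\<forall>k k'. k \<noteq> k' \<longrightarrow> P k \<inter> P k' = {}) \<and>
     closure \<Omega> = (\<Union>k. closure (P k)) \<and>
     negligible (\<Omega> - (\<Union>k. P k))"

definition conforming_mesh :: "(real^3) set \<Rightarrow> (real^3) set set \<Rightarrow> bool" where
  "conforming_mesh \<Omega> \<T> \<longleftrightarrow>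
     triangulation \<T> \<and> (\<forall>K\<in>\<T>. 3 simplex K) \<and> \<Union>\<T> = closure \<Omega>"

definition mesh_refines :: "(real^3) set set \<Rightarrow> (real^3) set set \<Rightarrow> bool" where
  "mesh_refines \<T> \<T>\<^sub>0 \<longleftrightarrow> (\<forall>K\<in>\<T>. \<exists>K\<^sub>0\<in>\<T>\<^sub>0. K \<subseteq> K\<^sub>0)"

definition inball_diameter :: "(real^3) set \<Rightarrow> real" where
  "inball_diameter K = Sup {2 * r |r. 0 \<le> r \<and> (\<exists>c. cball c r \<subseteq> K)}"

definition shape_regular :: "(real^3) set set set \<Rightarrow> bool" where
  "shape_regular \<M> \<longleftrightarrow>
     (\<exists>\<kappa>. \<forall>\<T>\<in>\<M>. \<forall>K\<in>\<T>. diameter K \<le> \<kappa> * inball_diameter K)"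

definition mesh_size :: "(real^3) set set \<Rightarrow> real" where
  "mesh_size \<T> = Max (diameter ` \<T>)"


section \<open>The lowest-order Nedelec space\<close>

text \<open>The library's cross product is available for real vectors only.\<close>

definition ccross :: "real^3 \<Rightarrow> complex^3 \<Rightarrow> complex^3" where
  "ccross x b = vector
     [of_real (x $ 2) * b $ 3 - of_real (x $ 3) * b $ 2,
      of_real (x $ 3) * b $ 1 - of_real (x $ 1) * b $ 3,
      of_real (x $ 1) * b $ 2 - of_real (x $ 2) * b $ 1]"

text \<open>
  Almost everywhere, since two neighbouring elements share a face, on which only the tangential
  components of the two polynomials agree.
\<close>

definition nedelec_space :: "(real^3) set \<Rightarrow> (real^3) set set \<Rightarrow> (real^3 \<Rightarrow> complex^3) set" where
  "nedelec_space \<Omega> \<T> =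
     {v \<in> H0_curl \<Omega>. \<forall>K\<in>\<T>. \<exists>a b. AE x in lebesgue_on K. v x = a + ccross x b}"


section \<open>The state equation and the reduced cost functionals\<close>

definition eps_sigma :: "real \<Rightarrow> (real^3 \<Rightarrow> real) \<Rightarrow> (real^3 \<Rightarrow> real) \<Rightarrow> real^3 \<Rightarrow> complex" where
  "eps_sigma \<omega> \<epsilon> \<sigma> x = of_real (\<epsilon> x) + \<i> * of_real (\<sigma> x) * of_real (inverse \<omega>)"

definition piecewise_scale ::
  "('l::finite \<Rightarrow> (real^3) set) \<Rightarrow> (real^3 \<Rightarrow> complex) \<Rightarrow> real^'l \<Rightarrow> real^3 \<Rightarrow> complex" where
  "piecewise_scale P \<zeta> u x = (\<Sum>k\<in>UNIV. if x \<in> P k then of_real (u $ k) * \<zeta> x else 0)"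

text \<open>
  \<open>W\<close> is both trial and test space: \<open>H0_curl \<Omega>\<close> for the continuous problem and
  \<open>nedelec_space \<Omega> \<T>\<close> for the discrete one.
\<close>

definition solves_state_eq ::
  "(real^3) set \<Rightarrow> (real^3 \<Rightarrow> real) \<Rightarrow> real \<Rightarrow> (real^3 \<Rightarrow> complex) \<Rightarrow> (real^3 \<Rightarrow> complex^3)
    \<Rightarrow> (real^3 \<Rightarrow> complex^3) set \<Rightarrow> (real^3 \<Rightarrow> complex^3) \<Rightarrow> bool" where
  "solves_state_eq \<Omega> \<mu> \<omega> \<zeta> f W y \<longleftrightarrow>
     y \<in> W \<and>
     (\<forall>w\<in>W. L2_inner \<Omega> (\<lambda>x. inverse (\<mu> x) *\<^sub>R curl \<Omega> y x) (curl \<Omega> w)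
              - of_real (\<omega>\<^sup>2) * L2_inner \<Omega> (\<lambda>x. \<zeta> x *s y x) w
            = L2_inner \<Omega> f w)"

text \<open>
  The solution is unique up to null sets, so \<open>SOME\<close> picks a representative; the cost
  functional does not depend on the choice.
\<close>

definition control_to_state ::
  "(real^3) set \<Rightarrow> ('l::finite \<Rightarrow> (real^3) set) \<Rightarrow> (real^3 \<Rightarrow> real) \<Rightarrow> real \<Rightarrow> (real^3 \<Rightarrow> complex)
    \<Rightarrow> (real^3 \<Rightarrow> complex^3) \<Rightarrow> (real^3 \<Rightarrow> complex^3) set \<Rightarrow> real^'l \<Rightarrow> real^3 \<Rightarrow> complex^3" where
  "control_to_state \<Omega> P \<mu> \<omega> \<zeta> f W u =
     (SOME y. solves_state_eq \<Omega> \<mu> \<omega> (piecewise_scale P \<zeta> u) f W y)"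

definition cost ::
  "(real^3) set \<Rightarrow> (real^3 \<Rightarrow> complex^3) \<Rightarrow> (real^3 \<Rightarrow> complex^3) \<Rightarrow> real
    \<Rightarrow> (real^3 \<Rightarrow> complex^3) \<Rightarrow> real^'l \<Rightarrow> real" where
  "cost \<Omega> y\<^sub>\<Omega> E\<^sub>\<Omega> \<alpha> y u =
     1/2 * (L2_norm \<Omega> (\<lambda>x. y x - y\<^sub>\<Omega> x))\<^sup>2
     + 1/2 * (L2_norm \<Omega> (\<lambda>x. curl \<Omega> y x - E\<^sub>\<Omega> x))\<^sup>2
     + \<alpha>/2 * (norm u)\<^sup>2"

definition U_ad :: "real^'l \<Rightarrow> real^'l \<Rightarrow> (real^'l) set" where
  "U_ad a b = {v. \<forall>k. a $ k \<le> v $ k \<and> v $ k \<le> b $ k}"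

definition global_solution :: "('c \<Rightarrow> real) \<Rightarrow> 'c set \<Rightarrow> 'c \<Rightarrow> bool" where
  "global_solution j U u \<longleftrightarrow> u \<in> U \<and> (\<forall>v\<in>U. j u \<le> j v)"

end

theory Submission
  imports Defs
begin

text \<open>
  Multiplying the state equation by \<open>1 + \<i>\<tau>\<close> with \<open>\<tau>\<close> large makes the real part of its sesquilinear form
  coercive on \<open>H(curl)\<close>, uniformly in the control, so that Cea's lemma reduces the convergence
  \<open>\<S>\<^sub>h u\<^sub>h \<rightarrow> \<S> u\<close> for \<open>u\<^sub>h \<rightarrow> u\<close> to the density of the Nedelec spaces. No regularity of the solution is needed:
  fields in \<open>H\<^sub>0(curl)\<close> are approximated by smooth compactly supported fields, by pushing them into the domain
  along the cones supplied by the Lipschitz boundary and mollifying, and these by their Whitney interpolants,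
  whose weak curl is computed from the Lipschitz continuity of the hat functions. A subsequence
  of the discrete minimisers converges by compactness of \<open>U_ad\<close>, and minimality passes to the limit.
\<close>

section \<open>Smooth functions\<close>

text \<open>The complex problem is handled as a real one. A field paired with its curl is a point of
  a product of two real L2 spaces, whose norm is the graph norm, and the real part of the rotated
  form is a real bilinear form there. Trial spaces are invariant under multiplication by \<i>, so no
  equation is lost. In this product H_0(curl) is a closed graph, and the representative that
  \<open>curl\<close> picks arbitrarily never enters a limit.

  The trace is defined by Green's formula against fields smooth on all of space. A vanishing trace
  therefore says that the extensions by zero of w and curl w satisfy the curl identity on the whole
  space, so cutting off, shifting and mollifying produce no boundary terms.

  Finite element fields must have vanishing trace too. The interpolant uses only vertices near the
  compact support of the smooth field; once the mesh is fine, their stars lie inside \<Omega>, and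
  the hat functions extend by zero as Lipschitz functions. The curl of f grad g then comes from the
  symmetry of mixed difference quotients.\<close>

lemma pderiv_at_eq:
  assumes "(f has_derivative D) (at x)"
  shows "pderiv_at i f x = D (axis i 1)"
  using frechet_derivative_at[OF assms] unfolding pderiv_at_def by simp

lemma C_k_Suc_imp: "C_k (Suc k) f \<Longrightarrow> C_k k f"
proof (induction k arbitrary: f)
  case 0
  then show ?case
    by (auto simp: continuous_on_eq_continuous_at differentiable_imp_continuous_within)
next
  case (Suc k)
  then show ?case by (metis C_k.simps(2))
qed

lemma C_inf_differentiable: "f \<in> C_inf \<Longrightarrow> f differentiable (at x)"
  unfolding C_inf_def by (auto dest: spec[of _ "Suc 0"])

lemma C_inf_pderiv: "f \<in> C_inf \<Longrightarrow> pderiv_at i f \<in> C_inf"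
proof -
  assume "f \<in> C_inf"
  then have "C_k (Suc k) f" for k by (simp add: C_inf_def del: C_k.simps)
  then show ?thesis by (simp add: C_inf_def)
qed

lemma C_inf_continuous: "f \<in> C_inf \<Longrightarrow> continuous_on S f"
  unfolding C_inf_def by (auto dest!: spec[of _ 0] intro: continuous_on_subset)

lemma C_inf_has_derivative:
  assumes "f \<in> C_inf"
  shows "(f has_derivative (\<lambda>h. \<Sum>i\<in>UNIV. (h $ i) *\<^sub>R pderiv_at i f x)) (at x)"
proof -
  have d: "(f has_derivative frechet_derivative f (at x)) (at x)"
    using C_inf_differentiable[OF assms] frechet_derivative_works by blast
  then interpret bounded_linear "frechet_derivative f (at x)"
    by (rule has_derivative_bounded_linear)
  have "frechet_derivative f (at x) h = (\<Sum>i\<in>UNIV. (h $ i) *\<^sub>R pderiv_at i f x)" for h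
  proof -
    have "h = (\<Sum>i\<in>UNIV. (h $ i) *\<^sub>R axis i 1)"
      by (simp add: vec_eq_iff axis_def if_distrib cong: if_cong)
    then show ?thesis
      unfolding pderiv_at_def by (metis (no_types, lifting) scaleR sum sum.cong)
  qed
  then have "frechet_derivative f (at x) = (\<lambda>h. \<Sum>i\<in>UNIV. (h $ i) *\<^sub>R pderiv_at i f x)" by (rule ext)
  with d show ?thesis by simp
qed

lemma C_k_const: "C_k k (\<lambda>x. c)"
proof (induction k arbitrary: c)
  case (Suc k)
  have "pderiv_at i (\<lambda>x. c) = (\<lambda>x. 0)" for i
    by (rule ext, rule pderiv_at_eq[where D = "\<lambda>x. 0"], simp)
  then show ?case using Suc by simp
qed simp

lemma C_k_add: "C_k k f \<Longrightarrow> C_k k g \<Longrightarrow> C_k k (\<lambda>x. f x + g x)"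
proof (induction k arbitrary: f g)
  case 0
  then show ?case by (simp add: continuous_on_add)
next
  case (Suc k)
  have "pderiv_at i (\<lambda>x. f x + g x) = (\<lambda>x. pderiv_at i f x + pderiv_at i g x)" for i
  proof
    fix x
    have "((\<lambda>x. f x + g x) has_derivative
        (\<lambda>h. frechet_derivative f (at x) h + frechet_derivative g (at x) h)) (at x)"
      using Suc.prems by (intro has_derivative_add) (auto simp: frechet_derivative_works[symmetric])
    then show "pderiv_at i (\<lambda>x. f x + g x) x = pderiv_at i f x + pderiv_at i g x"
      by (subst pderiv_at_eq) (auto simp: pderiv_at_def)
  qed
  with Suc show ?case by auto
qed

lemma (in bounded_bilinear) C_k_prod: "C_k k f \<Longrightarrow> C_k k g \<Longrightarrow> C_k k (\<lambda>x. prod (f x) (g x))"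
proof (induction k arbitrary: f g)
  case 0
  then show ?case by (simp add: continuous_on)
next
  case (Suc k)
  have D: "((\<lambda>x. prod (f x) (g x)) has_derivative
      (\<lambda>h. prod (f x) (frechet_derivative g (at x) h) + prod (frechet_derivative f (at x) h) (g x))) (at x)" for x
    using Suc.prems by (intro FDERIV) (auto simp: frechet_derivative_works[symmetric])
  have "pderiv_at i (\<lambda>x. prod (f x) (g x)) = (\<lambda>x. prod (f x) (pderiv_at i g x) + prod (pderiv_at i f x) (g x))" for i
    by (rule ext, subst pderiv_at_eq[OF D], simp add: pderiv_at_def)
  moreover have "C_k k (\<lambda>x. prod (f x) (pderiv_at i g x) + prod (pderiv_at i f x) (g x))" for i
    using Suc by (intro C_k_add Suc.IH) (auto intro: C_k_Suc_imp simp del: C_k.simps, auto)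
  ultimately show ?case using D by (auto simp: differentiable_def)
qed

lemma (in bounded_linear) C_k_linear: "C_k k g \<Longrightarrow> C_k k (\<lambda>x. f (g x))"
proof (induction k arbitrary: g)
  case 0
  then show ?case by (simp add: continuous_on)
next
  case (Suc k)
  have D: "((\<lambda>x. f (g x)) has_derivative (\<lambda>h. f (frechet_derivative g (at x) h))) (at x)" for x
    using Suc.prems by (intro has_derivative) (auto simp: frechet_derivative_works[symmetric])
  have "pderiv_at i (\<lambda>x. f (g x)) = (\<lambda>x. f (pderiv_at i g x))" for i
    by (rule ext, subst pderiv_at_eq[OF D], simp add: pderiv_at_def)
  with Suc D show ?case by (auto simp: differentiable_def)
qed

lemma C_inf_const: "(\<lambda>x. c) \<in> C_inf"
  by (simp add: C_inf_def C_k_const)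

lemma C_inf_add: "f \<in> C_inf \<Longrightarrow> g \<in> C_inf \<Longrightarrow> (\<lambda>x. f x + g x) \<in> C_inf"
  by (simp add: C_inf_def C_k_add)

lemma C_inf_linear: "bounded_linear L \<Longrightarrow> g \<in> C_inf \<Longrightarrow> (\<lambda>x. L (g x)) \<in> C_inf"
  by (simp add: C_inf_def bounded_linear.C_k_linear)

lemma C_inf_prod:
  "bounded_bilinear p \<Longrightarrow> f \<in> C_inf \<Longrightarrow> g \<in> C_inf \<Longrightarrow> (\<lambda>x. p (f x) (g x)) \<in> C_inf"
  by (simp add: C_inf_def bounded_bilinear.C_k_prod)

lemmas C_inf_mult = C_inf_prod[OF bounded_bilinear_mult]
  and C_inf_scaleR = C_inf_prod[OF bounded_bilinear_scaleR]
  and C_inf_inner = C_inf_prod[OF bounded_bilinear_inner]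

lemma C_inf_uminus: "f \<in> C_inf \<Longrightarrow> (\<lambda>x. - f x) \<in> C_inf"
  by (rule C_inf_linear[OF bounded_linear_minus[OF bounded_linear_ident]])

lemma C_inf_diff: "f \<in> C_inf \<Longrightarrow> g \<in> C_inf \<Longrightarrow> (\<lambda>x. f x - g x) \<in> C_inf"
  using C_inf_add[OF _ C_inf_uminus, of f g] by simp

lemma C_inf_ident: "(\<lambda>x. x) \<in> C_inf"
proof -
  have "pderiv_at i (\<lambda>x. x) = (\<lambda>x. axis i 1)" for i
    by (rule ext, rule pderiv_at_eq[where D = "\<lambda>x. x"], simp)
  then have "C_k k (\<lambda>x. x)" for k
    by (cases k) (auto simp: C_k_const)
  then show ?thesis by (simp add: C_inf_def)
qed

lemma C_k_affine:
  fixes f :: "real^3 \<Rightarrow> 'b::real_normed_vector"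
  shows "C_k k f \<Longrightarrow> C_k k (\<lambda>x. f (c + s *\<^sub>R x))"
proof (induction k arbitrary: f)
  case 0
  then have "continuous_on UNIV f" by simp
  then have "continuous_on UNIV (f \<circ> (\<lambda>x. c + s *\<^sub>R x))"
    by (intro continuous_on_compose) (auto intro!: continuous_intros intro: continuous_on_subset)
  then show ?case by (simp add: o_def)
next
  case (Suc k)
  have D: "((\<lambda>x. f (c + s *\<^sub>R x)) has_derivative
     (\<lambda>h. frechet_derivative f (at (c + s *\<^sub>R x)) (s *\<^sub>R h))) (at x)" for x
  proof -
    have "(f has_derivative frechet_derivative f (at (c + s *\<^sub>R x))) (at (c + s *\<^sub>R x))"
      using Suc.prems by (auto simp: frechet_derivative_works[symmetric])
    then show ?thesis
      by (intro has_derivative_compose[of "\<lambda>x. c + s *\<^sub>R x" "\<lambda>h. s *\<^sub>R h" x UNIV f, simplified])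
        (auto intro!: derivative_eq_intros)
  qed
  have "pderiv_at i (\<lambda>x. f (c + s *\<^sub>R x)) = (\<lambda>x. s *\<^sub>R pderiv_at i f (c + s *\<^sub>R x))" for i
  proof
    fix x
    have "linear (frechet_derivative f (at (c + s *\<^sub>R x)))"
      using Suc.prems by (auto intro: linear_frechet_derivative)
    then show "pderiv_at i (\<lambda>x. f (c + s *\<^sub>R x)) x = s *\<^sub>R pderiv_at i f (c + s *\<^sub>R x)"
      by (subst pderiv_at_eq[OF D]) (simp add: pderiv_at_def linear_cmul)
  qed
  moreover have "C_k k (\<lambda>x. s *\<^sub>R pderiv_at i f (c + s *\<^sub>R x))" for i
    using Suc by (intro bounded_linear.C_k_linear[OF bounded_linear_scaleR_right]) auto
  ultimately show ?case using D by (auto simp: differentiable_def)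
qed

lemma C_inf_affine: "f \<in> C_inf \<Longrightarrow> (\<lambda>x. f (c + s *\<^sub>R x)) \<in> C_inf"
  by (simp add: C_inf_def C_k_affine)

text \<open>The sequence \<open>d\<close> lists the successive derivatives of the outer function \<open>d 0\<close>.\<close>

lemma C_k_compose_real:
  assumes q: "q \<in> C_inf"
    and d: "\<And>n x. (d n has_real_derivative d (Suc n) (q x)) (at (q x))"
  shows "C_k k (\<lambda>x. d n (q x))"
proof (induction k arbitrary: n)
  case 0
  have "isCont (\<lambda>x. d n (q x)) x" for x
  proof (rule isCont_o2[where g = "d n"])
    show "isCont q x"
      using C_inf_continuous[OF q, of UNIV] by (simp add: continuous_on_eq_continuous_at)
    show "isCont (d n) (q x)"
      by (rule DERIV_isCont[OF d])
  qed
  then show ?case by (simp add: continuous_at_imp_continuous_on)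
next
  case (Suc k)
  have D: "((\<lambda>x. d n (q x)) has_derivative (\<lambda>h. frechet_derivative q (at x) h * d (Suc n) (q x))) (at x)" for x
  proof -
    have "(q has_derivative frechet_derivative q (at x)) (at x)"
      using C_inf_differentiable[OF q, of x] frechet_derivative_works by blast
    from has_derivative_compose[OF this, of "d n" "\<lambda>h. d (Suc n) (q x) * h"] d[of n x]
    have "((\<lambda>x. d n (q x)) has_derivative (\<lambda>h. d (Suc n) (q x) * frechet_derivative q (at x) h)) (at x)"
      by (simp add: has_field_derivative_def)
    then show ?thesis by (simp add: mult.commute)
  qed
  have "pderiv_at i (\<lambda>x. d n (q x)) = (\<lambda>x. pderiv_at i q x * d (Suc n) (q x))" for i
    by (rule ext, subst pderiv_at_eq[OF D], simp add: pderiv_at_def)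
  moreover have "C_k k (\<lambda>x. pderiv_at i q x * d (Suc n) (q x))" for i
    using C_inf_pderiv[OF q] Suc
    by (intro bounded_bilinear.C_k_prod[OF bounded_bilinear_mult]) (auto simp: C_inf_def)
  ultimately show ?case using D by (auto simp: differentiable_def)
qed

lemma C_inf_inverse:
  assumes q: "q \<in> C_inf" and pos: "\<And>x. q x > (0::real)"
  shows "(\<lambda>x. inverse (q x)) \<in> C_inf"
proof -
  \<comment> \<open>The successive derivatives of \<open>1/t\<close>.
    \<open>C_k_compose_real\<close> asks for them only at values of \<open>q\<close>, which are
    positive.\<close>
  define d where "d n t = (-1) ^ n * fact n * inverse (t ^ Suc n)" for n :: nat and t :: real
  have "(d n has_real_derivative d (Suc n) t) (at t)" if "t > 0" for n t
    unfolding d_def using that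
    by (auto intro!: derivative_eq_intros simp: field_simps simp del: power_Suc)
       (simp add: field_simps power_add[symmetric])
  from C_k_compose_real[where d = d and n = 0, OF q this] pos
  have "C_k k (\<lambda>x. d 0 (q x))" for k by blast
  then show ?thesis by (simp add: C_inf_def d_def)
qed

section \<open>The flat function exp(-1/t) and smooth bumps\<close>

fun flat_poly :: "nat \<Rightarrow> real poly" where
  "flat_poly 0 = 1"
| "flat_poly (Suc n) = [:0, 0, 1:] * (flat_poly n - pderiv (flat_poly n))"

text \<open>With \<open>s = 1/t\<close>, the derivative in \<open>t\<close> of
  \<open>p(s) exp(-s)\<close> is \<open>s^2 (p(s) - p'(s)) exp(-s)\<close>. The recursion of
  \<open>flat_poly\<close> records this factor, so these are the successive derivatives of
  \<open>exp(-1/t)\<close> extended by zero.\<close>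

definition flat_deriv :: "nat \<Rightarrow> real \<Rightarrow> real" where
  "flat_deriv n t = (if t > 0 then poly (flat_poly n) (inverse t) * exp (- inverse t) else 0)"

definition flat :: "real \<Rightarrow> real" where
  "flat t = (if t > 0 then exp (- inverse t) else 0)"

lemma poly_times_exp_tendsto_0: "((\<lambda>s. poly p s * exp (- s)) \<longlongrightarrow> 0) (at_top :: real filter)"
proof (induction p)
  case (pCons a p)
  have *: "((\<lambda>s::real. s ^ k * exp (- s)) \<longlongrightarrow> 0) at_top" for k
    using tendsto_power_div_exp_0[of k] by (simp add: divide_inverse flip: exp_minus)
  have "((\<lambda>s. s * poly p s * exp (- s)) \<longlongrightarrow> 0) at_top"
  proof -
    have "((\<lambda>s. (\<Sum>i\<le>degree p. coeff p i * (s ^ Suc i * exp (- s)))) \<longlongrightarrow> (\<Sum>i\<le>degree p. coeff p i * 0)) at_top"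
      by (intro tendsto_sum tendsto_mult tendsto_const *)
    then show ?thesis
      by (simp add: poly_altdef sum_distrib_left sum_distrib_right mult_ac)
  qed
  moreover have "((\<lambda>s. a * exp (- s)) \<longlongrightarrow> a * 0) at_top"
    by (intro tendsto_mult tendsto_const) (use *[of 0] in simp)
  ultimately show ?case
    using tendsto_add by (fastforce simp: algebra_simps)
qed simp

lemma flat_deriv_has_derivative: "(flat_deriv n has_real_derivative flat_deriv (Suc n) t) (at t)"
proof -
  consider "t > 0" | "t < 0" | "t = 0" by linarith
  then show ?thesis
  proof cases
    case 1
    have "((\<lambda>t. poly (flat_poly n) (inverse t) * exp (- inverse t)) has_real_derivative flat_deriv (Suc n) t) (at t)"
      using 1 unfolding flat_deriv_def
      by (auto intro!: derivative_eq_intros DERIV_chain2[OF poly_DERIV] simp: field_simps power2_eq_square)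
    then show ?thesis
      by (rule has_field_derivative_transform_within_open[where S = "{0<..}"])
         (use 1 in \<open>auto simp: flat_deriv_def\<close>)
  next
    case 2
    have "((\<lambda>t. 0) has_real_derivative flat_deriv (Suc n) t) (at t)"
      using 2 unfolding flat_deriv_def by auto
    then show ?thesis
      by (rule has_field_derivative_transform_within_open[where S = "{..<0}"])
         (use 2 in \<open>auto simp: flat_deriv_def\<close>)
  next
    case 3
    \<comment> \<open>Dividing by \<open>h\<close> multiplies the polynomial in \<open>1/h\<close>
      by one more factor \<open>[:0, 1:]\<close>, so the right difference quotient has the same form
      and the exponential still wins.\<close>
    have "((\<lambda>h. flat_deriv n h / h) \<longlongrightarrow> 0) (at_right 0)"
    proof -
      have "((\<lambda>h. poly ([:0, 1:] * flat_poly n) (inverse h) * exp (- inverse h)) \<longlongrightarrow> 0) (at_right (0::real))"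
        by (rule filterlim_compose[OF poly_times_exp_tendsto_0 filterlim_inverse_at_top_right])
      moreover have "\<forall>\<^sub>F h in at_right 0. poly ([:0, 1:] * flat_poly n) (inverse h) * exp (- inverse h) = flat_deriv n h / h"
        using eventually_at_right_less[of "0::real"]
        by eventually_elim (simp add: flat_deriv_def field_simps)
      ultimately show ?thesis by (rule Lim_transform_eventually)
    qed
    moreover have "((\<lambda>h. flat_deriv n h / h) \<longlongrightarrow> 0) (at_left 0)"
      by (rule Lim_transform_eventually[OF tendsto_const])
         (use eventually_at_left_real[of "-1" "0::real"] in \<open>auto simp: flat_deriv_def elim: eventually_mono\<close>)
    ultimately have "((\<lambda>h. flat_deriv n h / h) \<longlongrightarrow> 0) (at 0)"
      by (simp add: filterlim_split_at)
    then show ?thesis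
      using 3 by (simp add: DERIV_def flat_deriv_def)
  qed
qed

lemma C_inf_flat: "q \<in> C_inf \<Longrightarrow> (\<lambda>x. flat (q x)) \<in> C_inf"
proof -
  assume q: "q \<in> C_inf"
  have "C_k k (\<lambda>x. flat_deriv 0 (q x))" for k
    using q by (rule C_k_compose_real) (rule flat_deriv_has_derivative)
  moreover have "flat_deriv 0 = flat" by (auto simp: flat_deriv_def flat_def)
  ultimately show ?thesis by (simp add: C_inf_def)
qed

lemma flat_nonneg: "flat t \<ge> 0" and flat_pos_iff: "flat t > 0 \<longleftrightarrow> t > 0"
  and flat_eq_0: "t \<le> 0 \<Longrightarrow> flat t = 0"
  by (auto simp: flat_def)

lemma C_inf_norm_square: "(\<lambda>x. (norm (x - p))\<^sup>2) \<in> C_inf"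
  unfolding power2_norm_eq_inner by (intro C_inf_inner C_inf_diff C_inf_ident C_inf_const)

text \<open>The centre \<open>s\<close> is free because the kernel used near the boundary sits off
  the origin: it shifts and smooths at once.\<close>

lemma smooth_kernel_exists:
  assumes "r > 0"
  obtains k :: "real^3 \<Rightarrow> real"
  where "k \<in> C_inf" "\<And>x. k x \<ge> 0" "\<And>x. x \<notin> ball s r \<Longrightarrow> k x = 0"
    "integrable lborel k" "(LINT x|lborel. k x) = 1"
proof -
  \<comment> \<open>The squared distance is smooth everywhere, unlike the distance, and
    \<open>flat\<close> turns the sign of \<open>r^2 - |x - s|^2\<close> into the support
    condition.\<close>
  define g where "g x = flat (r\<^sup>2 - (norm (x - s))\<^sup>2)" for x :: "real^3"
  have g: "g \<in> C_inf"
    unfolding g_def by (intro C_inf_flat C_inf_diff C_inf_const C_inf_norm_square)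
  have supp: "g x = 0" if "x \<notin> ball s r" for x
    using that assms unfolding g_def
    by (intro flat_eq_0) (simp add: dist_norm norm_minus_commute power_mono)
  have pos: "g x > 0" if "x \<in> ball s r" for x
    using that assms unfolding g_def flat_pos_iff
    by (simp add: dist_norm norm_minus_commute power_strict_mono)
  have gnn: "g x \<ge> 0" for x by (simp add: g_def flat_nonneg)
  have int: "integrable lborel g"
  proof -
    have "integrable lborel (\<lambda>x. indicator (cball s r) x *\<^sub>R g x)"
      by (intro borel_integrable_compact C_inf_continuous g) auto
    moreover have "(\<lambda>x. indicator (cball s r) x *\<^sub>R g x) = g"
    proof
      fix x
      show "indicator (cball s r) x *\<^sub>R g x = g x"
        using supp[of x] by (cases "x \<in> ball s r") auto
    qed
    ultimately show ?thesis by simp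
  qed
  have I: "(LINT x|lborel. g x) > 0"
  proof (rule ccontr)
    assume "\<not> ?thesis"
    moreover have nn: "(LINT x|lborel. g x) \<ge> 0"
      by (intro integral_nonneg_AE) (auto simp: g_def flat_nonneg)
    ultimately have "(LINT x|lborel. g x) = 0" by simp
    then have "AE x in lborel. g x = 0"
      by (subst (asm) integral_nonneg_eq_0_iff_AE[OF int]) (simp_all add: g_def flat_nonneg)
    then have "AE x in lborel. x \<notin> ball s r"
      by eventually_elim (use pos in fastforce)
    then have "ball s r \<in> null_sets lborel"
      by (subst AE_iff_null_sets) auto
    then have "negligible (ball s r)"
      by (simp add: negligible_iff_null_sets null_sets_completionI)
    then show False
      using assms open_not_negligible[of "ball s r"] by auto
  qed
  define I where "I = (LINT x|lborel. g x)"
  show ?thesis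
  proof (rule that[of "\<lambda>x. inverse I * g x"])
    show "(\<lambda>x. inverse I * g x) \<in> C_inf"
      by (intro C_inf_mult g C_inf_const)
  qed (use I supp int gnn in \<open>auto simp: I_def\<close>)
qed

lemma smooth_cutoff_exists:
  assumes "0 < r" "r < R"
  obtains \<beta> :: "real^3 \<Rightarrow> real"
  where "\<beta> \<in> C_inf" "\<And>x. x \<in> ball p r \<Longrightarrow> \<beta> x = 1" "\<And>x. x \<notin> ball p R \<Longrightarrow> \<beta> x = 0"
proof -
  define A where "A x = flat (R\<^sup>2 - (norm (x - p))\<^sup>2)" for x :: "real^3"
  define B where "B x = flat ((norm (x - p))\<^sup>2 - r\<^sup>2)" for x :: "real^3"
  have AB: "A \<in> C_inf" "B \<in> C_inf"
    unfolding A_def B_def by (intro C_inf_flat C_inf_diff C_inf_const C_inf_norm_square)+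
  \<comment> \<open>\<open>A\<close> vanishes off the large ball and \<open>B\<close> on the small
    one; as \<open>r < R\<close>, never both, so the quotient \<open>A / (A + B)\<close> is smooth
    and has the right values.\<close>
  have pos: "A x + B x > 0" for x
  proof -
    have "r\<^sup>2 < R\<^sup>2" using assms by (simp add: power_strict_mono)
    then have "R\<^sup>2 - (norm (x - p))\<^sup>2 > 0 \<or> (norm (x - p))\<^sup>2 - r\<^sup>2 > 0" by linarith
    then have "A x > 0 \<or> B x > 0" unfolding A_def B_def flat_pos_iff .
    moreover have "A x \<ge> 0" "B x \<ge> 0" unfolding A_def B_def by (rule flat_nonneg)+
    ultimately show ?thesis by linarith
  qed
  show ?thesis
  proof (rule that[of "\<lambda>x. A x * inverse (A x + B x)"])
    show "(\<lambda>x. A x * inverse (A x + B x)) \<in> C_inf"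
      by (intro C_inf_mult C_inf_inverse C_inf_add AB pos)
    fix x
    show "A x * inverse (A x + B x) = 1" if "x \<in> ball p r"
    proof -
      have "B x = 0" unfolding B_def using that assms
        by (intro flat_eq_0) (simp add: dist_norm norm_minus_commute power_mono)
      with pos[of x] show ?thesis by simp
    qed
    show "A x * inverse (A x + B x) = 0" if "x \<notin> ball p R"
    proof -
      have "A x = 0" unfolding A_def using that assms
        by (intro flat_eq_0) (simp add: dist_norm norm_minus_commute power_mono)
      then show ?thesis by simp
    qed
  qed
qed

section \<open>The Hilbert space of square integrable functions\<close>

definition sqint :: "('a::euclidean_space \<Rightarrow> 'b::euclidean_space) \<Rightarrow> bool" where
  "sqint f \<longleftrightarrow> f \<in> borel_measurable lebesgue \<and> integrable lebesgue (\<lambda>x. (norm (f x))\<^sup>2)"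

lemma sqint_measurable: "sqint f \<Longrightarrow> f \<in> borel_measurable lebesgue"
  and sqint_integrable: "sqint f \<Longrightarrow> integrable lebesgue (\<lambda>x. (norm (f x))\<^sup>2)"
  by (simp_all add: sqint_def)

lemma sqint_bound:
  assumes "g \<in> borel_measurable lebesgue" "integrable lebesgue h"
    "AE x in lebesgue. (norm (g x))\<^sup>2 \<le> h x"
  shows "sqint g"
  unfolding sqint_def
proof
  show "integrable lebesgue (\<lambda>x. (norm (g x))\<^sup>2)"
    by (rule Bochner_Integration.integrable_bound[OF assms(2)])
       (use assms in \<open>auto elim: eventually_mono\<close>)
qed (rule assms)

lemma sqint_0: "sqint (\<lambda>x. 0)"
  by (simp add: sqint_def)

lemma sqint_scaleR: "sqint f \<Longrightarrow> sqint (\<lambda>x. c *\<^sub>R f x)"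
  by (auto simp: sqint_def power_mult_distrib)

lemma sqint_uminus: "sqint f \<Longrightarrow> sqint (\<lambda>x. - f x)"
  by (simp add: sqint_def)

lemma norm_add_square_le: "(norm (a + b))\<^sup>2 \<le> 2 * (norm a)\<^sup>2 + 2 * (norm (b::'a::real_normed_vector))\<^sup>2"
proof -
  have "(norm (a + b))\<^sup>2 \<le> (norm a + norm b)\<^sup>2"
    by (intro power_mono norm_triangle_ineq) auto
  also have "\<dots> \<le> 2 * (norm a)\<^sup>2 + 2 * (norm b)\<^sup>2"
    using zero_le_power2[of "norm a - norm b"] unfolding power2_sum power2_diff by linarith
  finally show ?thesis .
qed

lemma sqint_add:
  assumes "sqint f" "sqint g" shows "sqint (\<lambda>x. f x + g x)"
proof (rule sqint_bound)
  show "integrable lebesgue (\<lambda>x. 2 * (norm (f x))\<^sup>2 + 2 * (norm (g x))\<^sup>2)"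
    using assms by (auto simp: sqint_def)
  show "(\<lambda>x. f x + g x) \<in> borel_measurable lebesgue"
    using assms by (auto simp: sqint_def)
qed (simp add: norm_add_square_le)

lemma sqint_diff: "sqint f \<Longrightarrow> sqint g \<Longrightarrow> sqint (\<lambda>x. f x - g x)"
  using sqint_add[OF _ sqint_uminus, of f g] by simp

lemma sqint_cong_AE:
  "sqint f \<Longrightarrow> AE x in lebesgue. f x = g x \<Longrightarrow> g \<in> borel_measurable lebesgue \<Longrightarrow> sqint g"
  by (rule sqint_bound[OF _ sqint_integrable]) auto

lemma sqint_prod_integrable:
  assumes "bounded_bilinear p" and fg: "sqint f" "sqint g"
  shows "integrable lebesgue (\<lambda>x. p (f x) (g x) :: 'c::euclidean_space)"
proof -
  interpret bounded_bilinear p by fact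
  obtain K where K: "\<And>a b. norm (p a b) \<le> norm a * norm b * K" "K > 0"
    using pos_bounded by blast
  show ?thesis
  proof (rule Bochner_Integration.integrable_bound)
    show "integrable lebesgue (\<lambda>x. K * ((norm (f x))\<^sup>2 + (norm (g x))\<^sup>2))"
      using fg by (auto simp: sqint_def)
    have "continuous_on UNIV (\<lambda>z. p (fst z) (snd z))"
      by (intro continuous_on continuous_intros)
    from borel_measurable_continuous_onI[OF this]
    have "(\<lambda>z. p (fst z) (snd z)) \<in> borel_measurable borel" .
    from measurable_compose[OF _ this, of "\<lambda>x. (f x, g x)" lebesgue] fg
    show "(\<lambda>x. p (f x) (g x)) \<in> borel_measurable lebesgue"
      by (simp add: sqint_def borel_measurable_Pair)
    have "norm (p a b) \<le> K * ((norm a)\<^sup>2 + (norm b)\<^sup>2)" for a b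
    proof -
      have "norm a * norm b \<le> (norm a)\<^sup>2 + (norm b)\<^sup>2"
        using sum_squares_bound[of "norm a" "norm b"] zero_le_power2[of "norm a"] zero_le_power2[of "norm b"]
          norm_ge_zero[of a] norm_ge_zero[of b] mult_nonneg_nonneg[of "norm a" "norm b"] by linarith
      then have "norm a * norm b * K \<le> ((norm a)\<^sup>2 + (norm b)\<^sup>2) * K"
        using K(2) by (simp add: mult_right_mono)
      with K(1)[of a b] show ?thesis by (simp add: mult.commute)
    qed
    then show "AE x in lebesgue. norm (p (f x) (g x)) \<le> norm (K * ((norm (f x))\<^sup>2 + (norm (g x))\<^sup>2))"
      using K(2) by (auto intro!: AE_I2 intro: order_trans[OF _ abs_ge_self])
  qed
qed

lemmas sqint_inner_integrable = sqint_prod_integrable[OF bounded_bilinear_inner]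

\<comment> \<open>The relation is only a partial equivalence: a function that is not square
  integrable belongs to no class, and \<open>cls\<close> says nothing about it. Hence the
  \<open>sqint\<close> hypotheses of the rules on \<open>cls\<close>.\<close>
quotient_type (overloaded) ('a, 'b) l2 = "'a::euclidean_space \<Rightarrow> 'b::euclidean_space" /
  partial: "\<lambda>f g. sqint f \<and> sqint g \<and> (AE x in lebesgue. f x = g x)"
  morphisms rep_l2 cls
proof (rule part_equivpI)
  show "\<exists>f::'a \<Rightarrow> 'b. sqint f \<and> sqint f \<and> (AE x in lebesgue. f x = f x)"
    using sqint_0 by auto
qed (auto intro!: sympI transpI elim: eventually_elim2)

instantiation l2 :: (euclidean_space, euclidean_space) real_inner
begin

lift_definition zero_l2 :: "('a, 'b) l2" is "\<lambda>x. 0" by (simp add: sqint_0)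

lift_definition uminus_l2 :: "('a, 'b) l2 \<Rightarrow> ('a, 'b) l2" is "\<lambda>f x. - f x"
  by (auto simp: sqint_uminus)

lift_definition plus_l2 :: "('a, 'b) l2 \<Rightarrow> ('a, 'b) l2 \<Rightarrow> ('a, 'b) l2" is "\<lambda>f g x. f x + g x"
  by (auto simp: sqint_add elim: eventually_elim2)

lift_definition minus_l2 :: "('a, 'b) l2 \<Rightarrow> ('a, 'b) l2 \<Rightarrow> ('a, 'b) l2" is "\<lambda>f g x. f x - g x"
  by (auto simp: sqint_diff elim: eventually_elim2)

lift_definition scaleR_l2 :: "real \<Rightarrow> ('a, 'b) l2 \<Rightarrow> ('a, 'b) l2" is "\<lambda>c f x. c *\<^sub>R f x"
  by (auto simp: sqint_scaleR)

lift_definition inner_l2 :: "('a, 'b) l2 \<Rightarrow> ('a, 'b) l2 \<Rightarrow> real" is "\<lambda>f g. LINT x|lebesgue. f x \<bullet> g x"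
proof -
  fix f f' g g' :: "'a \<Rightarrow> 'b"
  assume *: "sqint f \<and> sqint f' \<and> (AE x in lebesgue. f x = f' x)"
    "sqint g \<and> sqint g' \<and> (AE x in lebesgue. g x = g' x)"
  then have "AE x in lebesgue. f x \<bullet> g x = f' x \<bullet> g' x"
    by (auto elim: eventually_elim2)
  then show "(LINT x|lebesgue. f x \<bullet> g x) = (LINT x|lebesgue. f' x \<bullet> g' x)"
    using * by (intro integral_cong_AE) (auto simp: sqint_def)
qed

definition norm_l2 :: "('a, 'b) l2 \<Rightarrow> real" where "norm_l2 f = sqrt (f \<bullet> f)"
definition dist_l2 :: "('a, 'b) l2 \<Rightarrow> ('a, 'b) l2 \<Rightarrow> real" where "dist_l2 f g = norm (f - g)"
definition sgn_l2 :: "('a, 'b) l2 \<Rightarrow> ('a, 'b) l2" where "sgn_l2 f = inverse (norm f) *\<^sub>R f"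
definition uniformity_l2 :: "(('a, 'b) l2 \<times> ('a, 'b) l2) filter" where
  "uniformity_l2 = (INF e\<in>{0 <..}. principal {(x, y). dist x y < e})"
definition open_l2 :: "('a, 'b) l2 set \<Rightarrow> bool" where
  "open_l2 U \<longleftrightarrow> (\<forall>x\<in>U. \<forall>\<^sub>F (x', y) in uniformity. x' = x \<longrightarrow> y \<in> U)"

instance
proof
  fix f g h :: "('a, 'b) l2" and a b :: real
  show "f + g + h = f + (g + h)" by transfer (simp add: add.assoc sqint_add)
  show "f + g = g + f" by transfer (simp add: add.commute sqint_add)
  show "0 + f = f" by transfer simp
  show "- f + f = 0" by transfer (simp add: sqint_0)
  show "f - g = f + - g" by transfer (simp add: sqint_diff)
  show "a *\<^sub>R (f + g) = a *\<^sub>R f + a *\<^sub>R g"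
    by transfer (simp add: scaleR_add_right sqint_add sqint_scaleR)
  show "(a + b) *\<^sub>R f = a *\<^sub>R f + b *\<^sub>R f"
    by transfer (simp add: scaleR_add_left sqint_add sqint_scaleR)
  show "a *\<^sub>R b *\<^sub>R f = (a * b) *\<^sub>R f" by transfer (simp add: sqint_scaleR)
  show "1 *\<^sub>R f = f" by transfer simp
  show "f \<bullet> g = g \<bullet> f" by transfer (simp add: inner_commute)
  show "(f + g) \<bullet> h = f \<bullet> h + g \<bullet> h"
    by transfer (simp add: inner_add_left sqint_inner_integrable)
  show "a *\<^sub>R f \<bullet> g = a * (f \<bullet> g)" by transfer simp
  show "0 \<le> f \<bullet> f" by transfer (simp add: integral_nonneg_AE)
  show "f \<bullet> f = 0 \<longleftrightarrow> f = 0"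
  proof transfer
    fix f :: "'a \<Rightarrow> 'b" assume "sqint f \<and> sqint f \<and> (AE x in lebesgue. f x = f x)"
    then have "(LINT x|lebesgue. f x \<bullet> f x) = 0 \<longleftrightarrow> (AE x in lebesgue. f x \<bullet> f x = 0)"
      by (intro integral_nonneg_eq_0_iff_AE sqint_inner_integrable) auto
    then show "(LINT x|lebesgue. f x \<bullet> f x) = 0 \<longleftrightarrow> sqint f \<and> sqint (\<lambda>x. 0::'b) \<and> (AE x in lebesgue. f x = 0)"
      using \<open>sqint f \<and> _\<close> by (simp add: sqint_0)
  qed
qed (simp_all add: norm_l2_def dist_l2_def sgn_l2_def uniformity_l2_def open_l2_def)

end

lemma cls_eq_iff: "sqint f \<Longrightarrow> sqint g \<Longrightarrow> cls f = cls g \<longleftrightarrow> (AE x in lebesgue. f x = g x)"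
  using Quotient3_rel[OF Quotient3_l2, of f g] by auto

lemma cls_add: "sqint f \<Longrightarrow> sqint g \<Longrightarrow> cls f + cls g = cls (\<lambda>x. f x + g x)"
  by (simp add: plus_l2.abs_eq)

lemma cls_diff: "sqint f \<Longrightarrow> sqint g \<Longrightarrow> cls f - cls g = cls (\<lambda>x. f x - g x)"
  by (simp add: minus_l2.abs_eq)

lemma cls_scaleR: "sqint f \<Longrightarrow> c *\<^sub>R cls f = cls (\<lambda>x. c *\<^sub>R f x)"
  by (simp add: scaleR_l2.abs_eq)

lemma inner_cls: "sqint f \<Longrightarrow> sqint g \<Longrightarrow> cls f \<bullet> cls g = (LINT x|lebesgue. f x \<bullet> g x)"
  by (simp add: inner_l2.abs_eq)

lemma norm_cls: "sqint f \<Longrightarrow> (norm (cls f))\<^sup>2 = (LINT x|lebesgue. (norm (f x))\<^sup>2)"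
  by (simp add: power2_norm_eq_inner inner_cls)

lemma zero_cls: "0 = cls (\<lambda>x. 0)"
  by (simp add: zero_l2_def)

text \<open>Translation, Fubini and mollification are carried out with Borel functions on
  \<open>lborel\<close>, so Lebesgue measurable fields are first altered on a null set, one
  coordinate at a time.\<close>

lemma borel_representative:
  fixes f :: "'a::euclidean_space \<Rightarrow> 'b::euclidean_space"
  assumes "f \<in> borel_measurable lebesgue"
  obtains g where "g \<in> borel_measurable borel" "AE x in lebesgue. f x = g x"
proof -
  have "\<exists>g\<in>borel_measurable lborel. (AE x in lborel. f x \<bullet> i = g x)" for i
    using assms by (intro completion_ex_borel_measurable_real) auto
  then obtain g where g: "\<And>i. g i \<in> borel_measurable lborel" "\<And>i. AE x in lborel. f x \<bullet> i = g i x"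
    by metis
  show ?thesis
  proof (rule that[of "\<lambda>x. \<Sum>i\<in>Basis. g i x *\<^sub>R i"])
    show "(\<lambda>x. \<Sum>i\<in>Basis. g i x *\<^sub>R i) \<in> borel_measurable borel"
      using g(1) by (intro borel_measurable_sum borel_measurable_scaleR) auto
    have "AE x in lborel. \<forall>i\<in>Basis. f x \<bullet> i = g i x"
      using g(2) by (intro AE_finite_allI) auto
    then have "AE x in lborel. f x = (\<Sum>i\<in>Basis. g i x *\<^sub>R i)"
    proof eventually_elim
      case (elim x)
      then have "(\<Sum>i\<in>Basis. g i x *\<^sub>R i) = (\<Sum>i\<in>Basis. (f x \<bullet> i) *\<^sub>R i)" by simp
      then show ?case by (simp add: euclidean_representation)
    qed
    then show "AE x in lebesgue. f x = (\<Sum>i\<in>Basis. g i x *\<^sub>R i)"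
      by (rule AE_completion)
  qed
qed

section \<open>Completeness of the space of classes\<close>

lemma l2_representative:
  obtains f where "sqint f" "F = cls f" "f \<in> borel_measurable borel"
proof -
  obtain f where f: "sqint f" "F = cls f"
    by (induction F rule: l2.abs_induct) auto
  obtain g where g: "g \<in> borel_measurable borel" "AE x in lebesgue. f x = g x"
    using borel_representative[OF sqint_measurable[OF f(1)]] .
  have gm: "g \<in> borel_measurable lebesgue"
    using g(1) by (simp add: measurable_completion)
  have "sqint g" by (rule sqint_cong_AE[OF f(1) g(2) gm])
  with f g cls_eq_iff[of f g] that show ?thesis by metis
qed

text \<open>Fatou's lemma. The norm bound is asked from \<open>N\<close> on only, since the limit
  inferior ignores initial terms.\<close>

lemma sqint_AE_limit:
  assumes f: "\<And>n. sqint (f n)" "AE x in lebesgue. (\<lambda>n. f n x) \<longlonglongrightarrow> g x"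
    and g: "g \<in> borel_measurable lebesgue"
    and C: "\<And>n. n \<ge> N \<Longrightarrow> norm (cls (f n)) \<le> C"
  shows "sqint g" "norm (cls g) \<le> C"
proof -
  have "C \<ge> 0" using norm_ge_zero[of "cls (f N)"] C[of N] by linarith
  have "(\<integral>\<^sup>+x. ennreal ((norm (g x))\<^sup>2) \<partial>lebesgue) =
      (\<integral>\<^sup>+x. liminf (\<lambda>n. ennreal ((norm (f n x))\<^sup>2)) \<partial>lebesgue)"
  proof (rule nn_integral_cong_AE, use f(2) in eventually_elim)
    case (elim x)
    then have "(\<lambda>n. ennreal ((norm (f n x))\<^sup>2)) \<longlonglongrightarrow> ennreal ((norm (g x))\<^sup>2)"
      by (intro tendsto_ennrealI tendsto_intros)
    then show ?case using lim_imp_Liminf[OF sequentially_bot] by metis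
  qed
  also have "\<dots> \<le> liminf (\<lambda>n. \<integral>\<^sup>+x. ennreal ((norm (f n x))\<^sup>2) \<partial>lebesgue)"
    using f(1) by (intro nn_integral_liminf) (auto simp: sqint_def)
  also have "\<dots> \<le> ennreal (C\<^sup>2)"
  proof (rule Liminf_le)
    show "\<forall>\<^sub>F n in sequentially. (\<integral>\<^sup>+x. ennreal ((norm (f n x))\<^sup>2) \<partial>lebesgue) \<le> ennreal (C\<^sup>2)"
      using eventually_ge_at_top[of N]
    proof eventually_elim
      case (elim n)
      have "(\<integral>\<^sup>+x. ennreal ((norm (f n x))\<^sup>2) \<partial>lebesgue) = ennreal ((norm (cls (f n)))\<^sup>2)"
        using f(1) by (simp add: norm_cls nn_integral_eq_integral sqint_integrable)
      also have "\<dots> \<le> ennreal (C\<^sup>2)" using C[OF elim] by (intro ennreal_leI power_mono) auto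
      finally show ?case .
    qed
  qed simp
  finally have *: "(\<integral>\<^sup>+x. ennreal ((norm (g x))\<^sup>2) \<partial>lebesgue) \<le> ennreal (C\<^sup>2)" .
  show s: "sqint g" unfolding sqint_def
  proof
    show "integrable lebesgue (\<lambda>x. (norm (g x))\<^sup>2)"
      using g * by (intro integrableI_bounded) (auto intro: le_less_trans)
  qed (rule g)
  have "(norm (cls g))\<^sup>2 \<le> C\<^sup>2"
    using * by (simp add: norm_cls[OF s] nn_integral_eq_integral[OF sqint_integrable[OF s]] integral_nonneg_AE)
  then show "norm (cls g) \<le> C" using \<open>C \<ge> 0\<close> by (rule power2_le_imp_le)
qed

lemma Cauchy_fast_subseq:
  fixes X :: "nat \<Rightarrow> 'a::metric_space"
  assumes "Cauchy X" "\<And>n. e n > 0"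
  obtains r :: "nat \<Rightarrow> nat" where "strict_mono r" "\<And>n m. m \<ge> r n \<Longrightarrow> dist (X m) (X (r n)) < e n"
proof -
  have ex: "\<exists>M. \<forall>m\<ge>M. \<forall>k\<ge>M. dist (X m) (X k) < e n" for n
    using assms by (auto simp: Cauchy_def)
  have "\<exists>r. \<forall>n. (\<forall>m\<ge>r n. \<forall>k\<ge>r n. dist (X m) (X k) < e n) \<and> r n < r (Suc n)"
  proof (rule dependent_nat_choice)
    fix x n
    obtain M where "\<forall>m\<ge>M. \<forall>k\<ge>M. dist (X m) (X k) < e (Suc n)" using ex by blast
    then show "\<exists>y. (\<forall>m\<ge>y. \<forall>k\<ge>y. dist (X m) (X k) < e (Suc n)) \<and> x < y"
      by (intro exI[of _ "max M (Suc x)"]) auto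
  qed (rule ex)
  then obtain r where r: "\<And>n m k. m \<ge> r n \<Longrightarrow> k \<ge> r n \<Longrightarrow> dist (X m) (X k) < e n"
    and inc: "\<And>n. r n < r (Suc n)" by blast
  show ?thesis
    by (rule that[of r]) (auto simp: strict_mono_Suc_iff inc r)
qed

text \<open>Fast Cauchy subsequences converge pointwise because
  \<open>\<Sum>n. 4 ^ n * \<parallel>f (r (n + 1)) - f (r n)\<parallel>\<^sup>2\<close> is finite.\<close>

lemma l2_Cauchy_AE_convergent:
  fixes f :: "nat \<Rightarrow> 'a::euclidean_space \<Rightarrow> 'b::euclidean_space"
  assumes f: "\<And>n. sqint (f n)" and C: "Cauchy (\<lambda>n. cls (f n))"
  obtains r g where "strict_mono r" "sqint g" "AE x in lebesgue. (\<lambda>n. f (r n) x) \<longlonglongrightarrow> g x"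
    "(\<lambda>n. cls (f n)) \<longlonglongrightarrow> cls g"
proof -
  obtain r :: "nat \<Rightarrow> nat" where r: "strict_mono r"
    and r': "\<And>n m. m \<ge> r n \<Longrightarrow> dist (cls (f m)) (cls (f (r n))) < (1/4) ^ n"
    using Cauchy_fast_subseq[OF C, of "\<lambda>n. (1/4) ^ n"] by auto
  define D where "D n x = f (r (Suc n)) x - f (r n) x" for n x
  have D: "sqint (D n)" for n unfolding D_def by (intro sqint_diff f)
  have "(norm (cls (D n)))\<^sup>2 \<le> ((1/4) ^ n)\<^sup>2" for n
  proof (rule power_mono)
    show "norm (cls (D n)) \<le> (1/4) ^ n"
      using r'[of n "r (Suc n)"] strict_mono_mono[OF r] f
      by (simp add: D_def[abs_def] cls_diff[symmetric] dist_norm monoD less_imp_le)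
  qed simp
  then have Dn: "(LINT x|lebesgue. (norm (D n x))\<^sup>2) \<le> ((1/4) ^ n)\<^sup>2" for n
    by (simp add: norm_cls[OF D, symmetric])
  have "(\<integral>\<^sup>+x. (\<Sum>n. ennreal (4 ^ n * (norm (D n x))\<^sup>2)) \<partial>lebesgue) =
      (\<Sum>n. \<integral>\<^sup>+x. ennreal (4 ^ n * (norm (D n x))\<^sup>2) \<partial>lebesgue)"
    using sqint_measurable[OF D] by (intro nn_integral_suminf) auto
  also have "\<dots> \<le> (\<Sum>n. ennreal ((1/4) ^ n))"
  proof (rule suminf_le)
    fix n
    have "(\<integral>\<^sup>+x. ennreal (4 ^ n * (norm (D n x))\<^sup>2) \<partial>lebesgue) = ennreal (4 ^ n * (LINT x|lebesgue. (norm (D n x))\<^sup>2))"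
      using sqint_integrable[OF D[of n]]
      by (subst nn_integral_eq_integral) auto
    also have "\<dots> \<le> ennreal (4 ^ n * ((1/4) ^ n)\<^sup>2)"
      using Dn[of n] by (intro ennreal_leI mult_left_mono) auto
    also have "4 ^ n * ((1/4) ^ n)\<^sup>2 = (1/4::real) ^ n"
      by (simp add: power2_eq_square power_divide)
    finally show "(\<integral>\<^sup>+x. ennreal (4 ^ n * (norm (D n x))\<^sup>2) \<partial>lebesgue) \<le> ennreal ((1/4) ^ n)" .
  qed auto
  also have "\<dots> < \<infinity>"
    by (simp add: suminf_ennreal2 summable_geometric)
  finally have "AE x in lebesgue. (\<Sum>n. ennreal (4 ^ n * (norm (D n x))\<^sup>2)) \<noteq> \<infinity>"
    using sqint_measurable[OF D] by (intro nn_integral_PInf_AE) auto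
  then have conv: "AE x in lebesgue. convergent (\<lambda>n. f (r n) x)"
  proof eventually_elim
    case (elim x)
    then have "summable (\<lambda>n. 4 ^ n * (norm (D n x))\<^sup>2)"
      by (intro summable_suminf_not_top) auto
    then have "(\<lambda>n. 4 ^ n * (norm (D n x))\<^sup>2) \<longlonglongrightarrow> 0" by (rule summable_LIMSEQ_zero)
    then have "Bseq (\<lambda>n. 4 ^ n * (norm (D n x))\<^sup>2)"
      by (intro convergent_imp_Bseq convergentI)
    then obtain B where B: "\<And>n. norm (4 ^ n * (norm (D n x))\<^sup>2) \<le> B"
      by (rule BseqE) auto
    \<comment> \<open>Mere boundedness of the weighted squares already makes the increments
      geometrically small, so the telescoping series converges absolutely.\<close>
    have Dle: "norm (D n x) \<le> sqrt B * (1/2) ^ n" for n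
    proof -
      have "norm (D n x) = sqrt (4 ^ n * (norm (D n x))\<^sup>2) * (1/2) ^ n"
      proof -
        have "(4::real) ^ n = (2 ^ n)\<^sup>2" by (simp add: power2_eq_square flip: power_mult_distrib)
        then show ?thesis by (simp add: real_sqrt_mult power_divide)
      qed
      also have "\<dots> \<le> sqrt B * (1/2) ^ n"
        using B[of n] by (intro mult_right_mono real_sqrt_le_mono) auto
      finally show ?thesis .
    qed
    have "summable (\<lambda>n. D n x)"
      by (rule summable_comparison_test'[OF summable_mult[OF summable_geometric] Dle]) simp
    then have "convergent (\<lambda>n. \<Sum>i<n. D i x)" by (simp add: summable_iff_convergent)
    moreover have "(\<Sum>i<n. D i x) = f (r n) x - f (r 0) x" for n
      unfolding D_def by (rule sum_lessThan_telescope)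
    ultimately have "convergent (\<lambda>n. f (r 0) x + (f (r n) x - f (r 0) x))"
      using convergent_add[OF convergent_const] by fastforce
    then show ?case by simp
  qed
  define g where "g x = lim (\<lambda>n. f (r n) x)" for x
  have gm: "g \<in> borel_measurable lebesgue"
    unfolding g_def using sqint_measurable[OF f] by (intro borel_measurable_lim_metric) auto
  have AE: "AE x in lebesgue. (\<lambda>n. f (r n) x) \<longlonglongrightarrow> g x"
    using conv by eventually_elim (simp add: g_def convergent_LIMSEQ_iff)
  \<comment> \<open>Let \<open>m\<close> tend to infinity in \<open>f (r m) - f (r n)\<close>. Fatou
    keeps the bound \<open>(1/4) ^ n\<close>, which upgrades pointwise convergence to convergence in
    norm.\<close>
  have *: "sqint (\<lambda>x. g x - f (r n) x)" "norm (cls (\<lambda>x. g x - f (r n) x)) \<le> (1/4) ^ n" for n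
  proof -
    have 1: "sqint (\<lambda>x. f (r m) x - f (r n) x)" for m by (intro sqint_diff f)
    have 2: "AE x in lebesgue. (\<lambda>m. f (r m) x - f (r n) x) \<longlonglongrightarrow> g x - f (r n) x"
      using AE by eventually_elim (intro tendsto_intros)
    have 3: "(\<lambda>x. g x - f (r n) x) \<in> borel_measurable lebesgue"
      using gm sqint_measurable[OF f] by auto
    have 4: "norm (cls (\<lambda>x. f (r m) x - f (r n) x)) \<le> (1/4) ^ n" if "m \<ge> n" for m
      using r'[of n "r m"] strict_mono_mono[OF r] that f
      by (simp add: cls_diff[symmetric] dist_norm monoD less_imp_le)
    show "sqint (\<lambda>x. g x - f (r n) x)" "norm (cls (\<lambda>x. g x - f (r n) x)) \<le> (1/4) ^ n"
      using sqint_AE_limit[OF 1 2 3 4] by auto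
  qed
  have g: "sqint g" using sqint_add[OF *(1)[of 0] f[of "r 0"]] by simp
  have "(\<lambda>n. cls (f (r n)) - cls g) \<longlonglongrightarrow> 0"
  proof (rule Lim_null_comparison)
    show "(\<lambda>n. (1/4) ^ n :: real) \<longlonglongrightarrow> 0" by (rule LIMSEQ_power_zero) simp
    have "norm (cls (f (r n)) - cls g) \<le> (1/4) ^ n" for n
      using *(2)[of n] cls_diff[OF g f, of "r n"] by (simp add: norm_minus_commute)
    then show "\<forall>\<^sub>F n in sequentially. norm (cls (f (r n)) - cls g) \<le> (1/4) ^ n" by simp
  qed
  then have "((\<lambda>n. cls (f n)) \<circ> r) \<longlonglongrightarrow> cls g" by (simp add: LIM_zero_iff o_def)
  from Cauchy_converges_subseq[OF C r this] AE r g that show ?thesis by blast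
qed

instance l2 :: (euclidean_space, euclidean_space) complete_space
proof
  fix X :: "nat \<Rightarrow> ('a, 'b) l2" assume C: "Cauchy X"
  have "\<exists>f. sqint f \<and> X n = cls f" for n by (rule l2_representative[of "X n"]) auto
  then have "\<exists>f. \<forall>n. sqint (f n) \<and> X n = cls (f n)" by (rule choice[OF allI])
  then obtain f where f: "\<And>n. sqint (f n)" "\<And>n. X n = cls (f n)" by auto
  have X: "X = (\<lambda>n. cls (f n))" using f(2) by auto
  show "convergent X"
    by (rule l2_Cauchy_AE_convergent[OF f(1) C[unfolded X]]) (auto simp: X convergent_def)
qed

section \<open>Lax--Milgram and Galerkin approximation\<close>

text \<open>The representing vector minimises \<open>|v|^2 - 2 F v\<close> over \<open>V\<close>;
  the minimum is attained because minimising sequences are Cauchy and \<open>V\<close> is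
  complete.\<close>

lemma riesz_representation:
  fixes F :: "'h::real_inner \<Rightarrow> real"
  assumes V: "subspace V" "complete V" and F: "bounded_linear F"
  obtains y where "y \<in> V" "\<And>w. w \<in> V \<Longrightarrow> inner y w = F w"
proof -
  interpret F: bounded_linear F by (rule F)
  obtain K where K: "\<And>x. \<bar>F x\<bar> \<le> K * norm x" "K > 0"
    using F.pos_bounded by (metis mult.commute real_norm_def)
  define \<Phi> where "\<Phi> v = (norm v)\<^sup>2 - 2 * F v" for v
  define m where "m = (INF v\<in>V. \<Phi> v)"
  have "0 \<in> V" using V subspace_0 by blast
  \<comment> \<open>Complete the square: \<open>|v|^2 - 2 K |v|\<close> is at least
    \<open>- K^2\<close>.\<close>
  have low: "\<Phi> v \<ge> - K\<^sup>2" for v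
  proof -
    have "0 \<le> (norm v - K)\<^sup>2" by simp
    moreover have "F v \<le> K * norm v" using K(1)[of v] by linarith
    ultimately show ?thesis by (simp add: \<Phi>_def power2_diff algebra_simps)
  qed
  have bdd: "bdd_below (\<Phi> ` V)" by (rule bdd_belowI2) (rule low)
  have m_le: "m \<le> \<Phi> v" if "v \<in> V" for v
    unfolding m_def using bdd that by (rule cINF_lower)
  have "\<exists>v\<in>V. \<Phi> v < m + 1 / Suc n" for n
    using cInf_lessD[of "\<Phi> ` V" "m + 1 / Suc n"] \<open>0 \<in> V\<close> unfolding m_def by fastforce
  then obtain v where v: "\<And>n. v n \<in> V" "\<And>n. \<Phi> (v n) < m + 1 / Suc n" by metis
  \<comment> \<open>The midpoint of \<open>x\<close> and \<open>y\<close> cannot go below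
    \<open>m\<close>; the parallelogram law converts this into closeness of two almost
    minimisers.\<close>
  have para: "(norm (x - y))\<^sup>2 \<le> 2 * (\<Phi> x - m) + 2 * (\<Phi> y - m)" if "x \<in> V" "y \<in> V" for x y
  proof -
    have "(1/2) *\<^sub>R (x + y) \<in> V" using V that by (simp add: subspace_add subspace_scale)
    note m_le[OF this]
    moreover have "(norm ((1/2) *\<^sub>R (x + y)))\<^sup>2 = (norm (x + y))\<^sup>2 / 4"
      by (simp only: norm_scaleR) (simp add: power_mult_distrib power2_eq_square)
    ultimately have "4 * m \<le> (norm (x + y))\<^sup>2 - 4 * F x - 4 * F y"
      unfolding \<Phi>_def by (simp add: F.scaleR F.add field_simps del: norm_scaleR scaleR_add_right)
    moreover have "(norm (x - y))\<^sup>2 + (norm (x + y))\<^sup>2 = 2 * (norm x)\<^sup>2 + 2 * (norm y)\<^sup>2"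
      by (simp add: power2_norm_eq_inner inner_diff_left inner_diff_right inner_add_left inner_add_right)
    ultimately show ?thesis by (simp add: \<Phi>_def)
  qed
  have "Cauchy v"
  proof (rule CauchyI)
    fix e :: real assume "e > 0"
    then obtain N where N: "1 / Suc N < e\<^sup>2 / 4"
      using nat_approx_posE[of "e\<^sup>2 / 4"] by auto
    have "norm (v i - v k) < e" if "i \<ge> N" "k \<ge> N" for i k
    proof -
      have *: "\<Phi> (v n) - m < e\<^sup>2 / 4" if "n \<ge> N" for n
      proof -
        have "1 / real (Suc n) \<le> 1 / Suc N" using that by (simp add: field_simps)
        with v(2)[of n] N show ?thesis by linarith
      qed
      have "(norm (v i - v k))\<^sup>2 \<le> 2 * (\<Phi> (v i) - m) + 2 * (\<Phi> (v k) - m)"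
        by (rule para[OF v(1) v(1)])
      also have "\<dots> < 2 * (e\<^sup>2 / 4) + 2 * (e\<^sup>2 / 4)"
        using *[OF that(1)] *[OF that(2)] by (intro add_strict_mono mult_strict_left_mono) auto
      finally have "(norm (v i - v k))\<^sup>2 < e\<^sup>2" by simp
      then show ?thesis using \<open>e > 0\<close> by (simp add: power_less_imp_less_base)
    qed
    then show "\<exists>M. \<forall>i\<ge>M. \<forall>k\<ge>M. norm (v i - v k) < e" by blast
  qed
  then obtain y where y: "y \<in> V" "v \<longlonglongrightarrow> y"
    using V(2) v(1) unfolding complete_def by blast
  have "(\<lambda>n. \<Phi> (v n)) \<longlonglongrightarrow> \<Phi> y"
    unfolding \<Phi>_def by (intro tendsto_intros F.tendsto y)
  moreover have "(\<lambda>n. m + 1 / Suc n) \<longlonglongrightarrow> m + 0"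
    by (intro tendsto_intros LIMSEQ_inverse_real_of_nat[unfolded inverse_eq_divide])
  ultimately have "\<Phi> y \<le> m + 0"
    by (rule LIMSEQ_le) (use v(2) less_imp_le in blast)
  then have y_min: "\<Phi> y \<le> \<Phi> w" if "w \<in> V" for w
    using m_le[OF that] by simp
  show ?thesis
  proof (rule that[OF y(1)])
    fix w assume w: "w \<in> V"
    have *: "0 \<le> 2 * t * (inner y w - F w) + t\<^sup>2 * (norm w)\<^sup>2" for t
    proof -
      have "y + t *\<^sub>R w \<in> V" using V(1) y(1) w by (simp add: subspace_add subspace_scale)
      note y_min[OF this]
      moreover have "(norm (y + t *\<^sub>R w))\<^sup>2 = (norm y)\<^sup>2 + 2 * t * inner y w + t\<^sup>2 * (norm w)\<^sup>2"
        unfolding power2_norm_eq_inner inner_add_left inner_add_right inner_scaleR_left inner_scaleR_right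
          inner_commute[of w y] by (simp add: power2_eq_square algebra_simps)
      ultimately show ?thesis by (simp add: \<Phi>_def F.add F.scaleR algebra_simps)
    qed
    show "inner y w = F w"
    proof (cases "w = 0")
      case False
      define d where "d = inner y w - F w"
      \<comment> \<open>The value of \<open>t\<close> at which the quadratic polynomial in
        \<open>t\<close> is smallest.\<close>
      have "0 \<le> 2 * (- d / (norm w)\<^sup>2) * d + (- d / (norm w)\<^sup>2)\<^sup>2 * (norm w)\<^sup>2"
        unfolding d_def by (rule *)
      also have "\<dots> = - (d\<^sup>2 / (norm w)\<^sup>2)"
        using False by (simp add: field_simps power2_eq_square)
      finally have "d = 0" using False by (simp add: divide_le_0_iff)
      then show ?thesis by (simp add: d_def)
    qed (simp add: F.zero)
  qed
qed

text \<open>Without symmetry there is nothing to minimise. Riesz turns the form into a map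
  \<open>A\<close> and the functional into a vector \<open>g\<close>, and the damped iteration
  \<open>x - \<tau> (A x - g)\<close> contracts \<open>V\<close>; its fixed point solves
  \<open>A x = g\<close>.\<close>

lemma lax_milgram:
  fixes b :: "'h::real_inner \<Rightarrow> 'h \<Rightarrow> real"
  assumes V: "subspace V" "complete V" and b: "bounded_bilinear b" and F: "bounded_linear F"
    and c: "c > 0" "\<And>v. v \<in> V \<Longrightarrow> c * (norm v)\<^sup>2 \<le> b v v"
  obtains y where "y \<in> V" "\<And>w. w \<in> V \<Longrightarrow> b y w = F w"
proof -
  interpret b: bounded_bilinear b by (rule b)
  obtain K where K: "\<And>x y. \<bar>b x y\<bar> \<le> norm x * norm y * K" "K > 0"
    using b.pos_bounded by auto
  have "\<exists>z. z \<in> V \<and> (\<forall>w\<in>V. inner z w = b x w)" for x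
    by (rule riesz_representation[OF V b.bounded_linear_right[of x]]) auto
  then have "\<exists>A. \<forall>x. A x \<in> V \<and> (\<forall>w\<in>V. inner (A x) w = b x w)" by (rule choice[OF allI])
  then obtain A where A: "\<And>x. A x \<in> V" "\<And>x w. w \<in> V \<Longrightarrow> inner (A x) w = b x w" by auto
  obtain g where g: "g \<in> V" "\<And>w. w \<in> V \<Longrightarrow> inner g w = F w"
    by (rule riesz_representation[OF V F]) auto
  \<comment> \<open>\<open>\<tau> = c / M^2\<close> minimises
    \<open>1 - 2 \<tau> c + \<tau>^2 M^2\<close>, with minimum \<open>1 - c^2 / M^2\<close>. Taking
    \<open>M\<close> at least \<open>c\<close> keeps this nonnegative, so that its square root
    \<open>q\<close> is a contraction factor.\<close>
  define M where "M = max K c"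
  define \<tau> where "\<tau> = c / M\<^sup>2"
  have M: "M > 0" "c \<le> M" "K \<le> M" using c by (auto simp: M_def)
  define T where "T x = x - \<tau> *\<^sub>R (A x - g)" for x
  define q where "q = sqrt (1 - c\<^sup>2 / M\<^sup>2)"
  have q2: "0 \<le> 1 - c\<^sup>2 / M\<^sup>2"
    using M c by (simp add: field_simps power_mono)
  have "\<exists>!x\<in>V. T x = x"
  proof (rule Banach_fix[OF V(2)])
    show "V \<noteq> {}" using g(1) by blast
    show "0 \<le> q" unfolding q_def using q2 by simp
    show "q < 1" unfolding q_def using c M by simp
    show "T ` V \<subseteq> V"
      unfolding T_def using V(1) A(1) g(1) by (auto intro!: subspace_diff subspace_scale)
    fix x y assume xy: "x \<in> V" "y \<in> V"
    define d where "d = x - y"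
    define e where "e = A x - A y"
    have de: "d \<in> V" "e \<in> V" using V(1) A(1) xy by (auto simp: d_def e_def subspace_diff)
    have e: "inner e w = b d w" if "w \<in> V" for w
      using that A(2) by (simp add: e_def d_def inner_diff_left b.diff_left)
    have "(norm e)\<^sup>2 = b d e" using e[OF de(2)] by (simp add: power2_norm_eq_inner)
    also have "\<dots> \<le> norm d * norm e * K" using K(1)[of d e] by linarith
    also have "\<dots> \<le> norm d * norm e * M" using M by (simp add: mult_left_mono)
    finally have "norm e * norm e \<le> (M * norm d) * norm e" by (simp add: power2_eq_square mult_ac)
    then have ed: "norm e \<le> M * norm d"
      using M by (cases "norm e = 0") (simp_all add: mult_le_cancel_right)
    have "(norm (d - \<tau> *\<^sub>R e))\<^sup>2 = (norm d)\<^sup>2 - 2 * \<tau> * b d d + \<tau>\<^sup>2 * (norm e)\<^sup>2"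
      unfolding e[OF de(1), symmetric] power2_norm_eq_inner inner_diff_left inner_diff_right
        inner_scaleR_left inner_scaleR_right inner_commute[of d e]
      by (simp add: power2_eq_square algebra_simps)
    also have "\<dots> \<le> (norm d)\<^sup>2 - 2 * \<tau> * (c * (norm d)\<^sup>2) + \<tau>\<^sup>2 * (M * norm d)\<^sup>2"
      using c(2)[OF de(1)] c(1) M ed
      by (intro add_mono diff_mono mult_left_mono power_mono) (auto simp: \<tau>_def)
    also have "\<dots> = (1 - c\<^sup>2 / M\<^sup>2) * (norm d)\<^sup>2"
    proof -
      have "\<tau> * c = c\<^sup>2 / M\<^sup>2" "\<tau>\<^sup>2 * M\<^sup>2 = c\<^sup>2 / M\<^sup>2"
        using M by (simp_all add: \<tau>_def power2_eq_square)
      then have "2 * \<tau> * (c * (norm d)\<^sup>2) = 2 * (c\<^sup>2 / M\<^sup>2) * (norm d)\<^sup>2"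
        "\<tau>\<^sup>2 * (M * norm d)\<^sup>2 = c\<^sup>2 / M\<^sup>2 * (norm d)\<^sup>2"
        by (metis mult.assoc, metis power_mult_distrib mult.assoc)
      then show ?thesis by (simp add: left_diff_distrib)
    qed
    also have "\<dots> = (q * norm d)\<^sup>2"
      using q2 by (simp add: q_def power_mult_distrib)
    finally have "norm (d - \<tau> *\<^sub>R e) \<le> q * norm d"
      by (rule power2_le_imp_le) (rule mult_nonneg_nonneg[OF \<open>0 \<le> q\<close> norm_ge_zero])
    moreover have "T x - T y = d - \<tau> *\<^sub>R e"
      unfolding T_def d_def e_def by (simp add: scaleR_diff_right)
    ultimately show "dist (T x) (T y) \<le> q * dist x y"
      by (simp add: d_def dist_norm)
  qed
  then obtain x where x: "x \<in> V" "T x = x" by blast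
  then have "A x = g" using c M by (auto simp: T_def \<tau>_def)
  then show ?thesis using that[OF x(1)] A(2)[of _ x] g(2) by auto
qed

text \<open>Cea's argument with forms that vary along the sequence: coercivity is applied to
  \<open>y\<^sub>n n - v n\<close>, which lies in the discrete space, and the change of form costs
  only \<open>e n\<close> times the norm of the bounded sequence \<open>v\<close>.\<close>

lemma galerkin_convergence:
  fixes b :: "'h::real_normed_vector \<Rightarrow> 'h \<Rightarrow> real" and b\<^sub>n :: "nat \<Rightarrow> 'h \<Rightarrow> 'h \<Rightarrow> real"
  assumes V\<^sub>n: "\<And>n. subspace (V\<^sub>n n)" "\<And>n. V\<^sub>n n \<subseteq> V"
    and b: "bounded_bilinear b" "\<And>n. bounded_bilinear (b\<^sub>n n)"
    and c: "c > 0" "\<And>n v. v \<in> V\<^sub>n n \<Longrightarrow> c * (norm v)\<^sup>2 \<le> b\<^sub>n n v v"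
    and diff: "\<And>n v w. \<bar>b\<^sub>n n v w - b v w\<bar> \<le> e n * norm v * norm w" "e \<longlonglongrightarrow> 0"
    and y\<^sub>n: "\<And>n. y\<^sub>n n \<in> V\<^sub>n n" "\<And>n w. w \<in> V\<^sub>n n \<Longrightarrow> b\<^sub>n n (y\<^sub>n n) w = F w"
    and y: "\<And>w. w \<in> V \<Longrightarrow> b y w = F w"
    and v: "\<And>n. v n \<in> V\<^sub>n n" "v \<longlonglongrightarrow> y"
  shows "y\<^sub>n \<longlonglongrightarrow> y"
proof -
  interpret b: bounded_bilinear b by (rule b)
  obtain K where K: "\<And>x y. \<bar>b x y\<bar> \<le> norm x * norm y * K" "K > 0"
    using b.pos_bounded by auto
  have est: "c * norm (y\<^sub>n n - v n) \<le> norm (y - v n) * K + e n * norm (v n)" for n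
  proof -
    interpret bn: bounded_bilinear "b\<^sub>n n" by (rule b)
    define d where "d = y\<^sub>n n - v n"
    have d: "d \<in> V\<^sub>n n" unfolding d_def using V\<^sub>n(1) y\<^sub>n(1) v(1) by (rule subspace_diff)
    have "c * (norm d)\<^sup>2 \<le> b\<^sub>n n d d" by (rule c(2)[OF d])
    also have "\<dots> = F d - b\<^sub>n n (v n) d"
      using y\<^sub>n(2)[OF d] by (simp add: d_def bn.diff_left)
    also have "F d = b y d" using y[of d] V\<^sub>n(2)[of n] d by auto
    also have "b y d - b\<^sub>n n (v n) d = b (y - v n) d - (b\<^sub>n n (v n) d - b (v n) d)"
      by (simp add: b.diff_left)
    also have "\<dots> \<le> norm (y - v n) * norm d * K + e n * norm (v n) * norm d"
      using K(1)[of "y - v n" d] diff(1)[of n "v n" d] by linarith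
    finally have "(c * norm d) * norm d \<le> (norm (y - v n) * K + e n * norm (v n)) * norm d"
      by (simp add: power2_eq_square algebra_simps)
    moreover have "0 \<le> e n * norm (v n)" if "norm d \<noteq> 0"
    proof -
      have "0 \<le> e n * norm (v n) * norm d" using diff(1)[of n "v n" d] by linarith
      then show ?thesis using that by (simp add: zero_le_mult_iff)
    qed
    \<comment> \<open>The sign of \<open>e n\<close> is read off from \<open>diff\<close> by testing
      with \<open>v n\<close> itself; this settles the case where the error \<open>d\<close> is
      zero.\<close>
    moreover have "0 \<le> e n * norm (v n)"
    proof (cases "norm (v n) = 0")
      case False
      have "0 \<le> e n * norm (v n) * norm (v n)" using diff(1)[of n "v n" "v n"] by linarith
      then show ?thesis using False by (simp add: zero_le_mult_iff)
    qed simp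
    ultimately show ?thesis
      using K(2) unfolding d_def[symmetric]
      by (cases "norm d = 0") (simp_all add: mult_le_cancel_right)
  qed
  have "(\<lambda>n. (norm (y - v n) * K + e n * norm (v n)) / c) \<longlonglongrightarrow> (norm (y - y) * K + 0 * norm y) / c"
    using c(1) by (intro tendsto_intros v(2) diff(2)) auto
  then have lim: "(\<lambda>n. (norm (y - v n) * K + e n * norm (v n)) / c) \<longlonglongrightarrow> 0" by simp
  have "(\<lambda>n. y\<^sub>n n - v n) \<longlonglongrightarrow> 0"
    by (rule Lim_null_comparison[OF _ lim]) (use est c(1) in \<open>auto simp: field_simps\<close>)
  from tendsto_add[OF this v(2)] show ?thesis by simp
qed

section \<open>Translation and mollification\<close>

lemma distr_lborel_reflect: "distr lborel borel (\<lambda>y. x - y) = (lborel :: 'a::euclidean_space measure)"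
proof -
  have "lborel = density (distr lborel borel (\<lambda>y. x + (-1) *\<^sub>R y)) (\<lambda>_::'a. ennreal (\<bar>-1\<bar> ^ DIM('a)))"
    using lborel_affine[of "-1" x] by simp
  then show ?thesis by (simp add: density_1)
qed

lemma distr_lborel_shift: "distr lborel borel (\<lambda>y. y - x) = (lborel :: 'a::euclidean_space measure)"
proof -
  have "(\<lambda>y. y - x) = (+) (- x)" by (simp add: fun_eq_iff)
  then show ?thesis by (simp only: lborel_distr_plus)
qed

lemma lborel_integral_reflect:
  fixes f :: "'a::euclidean_space \<Rightarrow> 'b::euclidean_space"
  assumes "f \<in> borel_measurable borel"
  shows "(LINT y|lborel. f (x - y)) = (LINT y|lborel. f y)"
  using assms by (subst (2) distr_lborel_reflect[of x, symmetric]) (simp add: integral_distr)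

lemma lborel_integral_shift:
  fixes f :: "'a::euclidean_space \<Rightarrow> 'b::euclidean_space"
  assumes "f \<in> borel_measurable borel"
  shows "(LINT y|lborel. f (y - x)) = (LINT y|lborel. f y)"
  using assms by (subst (2) distr_lborel_shift[of x, symmetric]) (simp add: integral_distr)

lemma lborel_integrable_shift:
  fixes f :: "'a::euclidean_space \<Rightarrow> 'b::euclidean_space"
  assumes "f \<in> borel_measurable borel"
  shows "integrable lborel (\<lambda>y. f (y - x)) \<longleftrightarrow> integrable lborel f"
  using assms by (subst (2) distr_lborel_shift[of x, symmetric]) (simp add: integrable_distr_eq)

lemma sqint_borel_iff:
  assumes "f \<in> borel_measurable borel"
  shows "sqint f \<longleftrightarrow> integrable lborel (\<lambda>x. (norm (f x))\<^sup>2)"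
  using assms by (simp add: sqint_def integrable_completion measurable_completion)

lemma norm_cls_borel:
  assumes "f \<in> borel_measurable borel" "sqint f"
  shows "(norm (cls f))\<^sup>2 = (LINT x|lborel. (norm (f x))\<^sup>2)"
  using assms by (simp add: norm_cls integral_completion)

lemma borel_shift[measurable]:
  "f \<in> borel_measurable borel \<Longrightarrow> (\<lambda>x. f (x - z)) \<in> borel_measurable (borel :: 'a::euclidean_space measure)"
  by simp

lemma sqint_shift:
  fixes f :: "'a::euclidean_space \<Rightarrow> 'b::euclidean_space"
  assumes "f \<in> borel_measurable borel" "sqint f"
  shows "sqint (\<lambda>x. f (x - z))" and "norm (cls (\<lambda>x. f (x - z))) = norm (cls f)"
proof -
  have m: "(\<lambda>x. (norm (f x))\<^sup>2) \<in> borel_measurable borel" using assms by simp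
  show s: "sqint (\<lambda>x. f (x - z))"
    using assms lborel_integrable_shift[OF m, of z] by (simp add: sqint_borel_iff)
  have "(norm (cls (\<lambda>x. f (x - z))))\<^sup>2 = (norm (cls f))\<^sup>2"
    using assms lborel_integral_shift[OF m, of z] s by (simp add: norm_cls_borel)
  then show "norm (cls (\<lambda>x. f (x - z))) = norm (cls f)" by simp
qed

lemma cls_shift_diff:
  fixes f :: "'a::euclidean_space \<Rightarrow> 'b::euclidean_space"
  assumes "f \<in> borel_measurable borel" "sqint f" "g \<in> borel_measurable borel" "sqint g"
  shows "norm (cls (\<lambda>x. f (x - z)) - cls (\<lambda>x. g (x - z))) = norm (cls f - cls g)"
  using sqint_shift[of "\<lambda>x. f x - g x" z] assms
  by (simp add: cls_diff sqint_shift sqint_diff)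

section \<open>Continuity of translation in L2\<close>

definition translation_continuous :: "('a::euclidean_space \<Rightarrow> 'b::euclidean_space) \<Rightarrow> bool" where
  "translation_continuous f \<longleftrightarrow> f \<in> borel_measurable borel \<and> sqint f
     \<and> ((\<lambda>z. cls (\<lambda>x. f (x - z))) \<longlongrightarrow> cls f) (at 0)"

lemma translation_continuous_0: "translation_continuous (\<lambda>x. 0)"
  by (simp add: translation_continuous_def sqint_0)

lemma translation_continuous_add:
  assumes "translation_continuous f" "translation_continuous g"
  shows "translation_continuous (\<lambda>x. f x + g x)"
  using assms tendsto_add[of "\<lambda>z. cls (\<lambda>x. f (x - z))" "cls f" "at 0" "\<lambda>z. cls (\<lambda>x. g (x - z))" "cls g"]
  unfolding translation_continuous_def by (auto simp: cls_add sqint_shift intro: sqint_add)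

lemma translation_continuous_sum:
  "finite I \<Longrightarrow> (\<And>i. i \<in> I \<Longrightarrow> translation_continuous (f i)) \<Longrightarrow> translation_continuous (\<lambda>x. \<Sum>i\<in>I. f i x)"
  by (induction rule: finite_induct) (auto simp: translation_continuous_0 translation_continuous_add)

text \<open>Translations are isometries, so an approximation of \<open>f\<close> by \<open>g\<close>
  is equally good after translating; the three-term estimate then works uniformly in
  \<open>z\<close>.\<close>

lemma translation_continuous_approx:
  fixes f :: "'a::euclidean_space \<Rightarrow> 'b::euclidean_space"
  assumes f: "f \<in> borel_measurable borel" "sqint f"
    and g: "\<And>e. e > 0 \<Longrightarrow> \<exists>g. translation_continuous g \<and> norm (cls g - cls f) < e"
  shows "translation_continuous f"
  unfolding translation_continuous_def
proof (intro conjI f tendstoI)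
  fix e :: real assume "e > 0"
  obtain g where g: "translation_continuous g" "norm (cls g - cls f) < e / 3"
    using g[of "e / 3"] \<open>e > 0\<close> by auto
  have "\<forall>\<^sub>F z in at 0. dist (cls (\<lambda>x. g (x - z))) (cls g) < e / 3"
    using g(1) \<open>e > 0\<close> unfolding translation_continuous_def by (intro tendstoD) auto
  then show "\<forall>\<^sub>F z in at 0. dist (cls (\<lambda>x. f (x - z))) (cls f) < e"
  proof eventually_elim
    case (elim z)
    have "dist (cls (\<lambda>x. f (x - z))) (cls (\<lambda>x. g (x - z))) < e / 3"
      using cls_shift_diff[of f g z] f g
      by (simp add: translation_continuous_def dist_norm norm_minus_commute)
    moreover have "dist (cls g) (cls f) < e / 3" using g by (simp add: dist_norm)
    moreover have "dist (cls (\<lambda>x. f (x - z))) (cls f) \<le> dist (cls (\<lambda>x. f (x - z))) (cls (\<lambda>x. g (x - z)))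
        + dist (cls (\<lambda>x. g (x - z))) (cls g) + dist (cls g) (cls f)"
      using dist_triangle[of "cls (\<lambda>x. f (x - z))" "cls f" "cls g"]
        dist_triangle[of "cls (\<lambda>x. f (x - z))" "cls g" "cls (\<lambda>x. g (x - z))"] by linarith
    ultimately show ?case using elim by linarith
  qed
qed

text \<open>For an open set \<open>U\<close>, lower semicontinuity of the indicator gives
  \<open>\<langle>1\<^sub>U(\<cdot> - z), 1\<^sub>U\<rangle> \<longrightarrow> \<parallel>1\<^sub>U\<parallel>\<^sup>2\<close> as \<open>z \<longrightarrow> 0\<close> by dominated convergence.\<close>

lemma translation_continuous_open:
  fixes v :: "'b::euclidean_space" and U :: "'a::euclidean_space set"
  assumes U: "open U" "emeasure lborel U < \<infinity>"
  shows "translation_continuous (\<lambda>x. indicator U x *\<^sub>R v)"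
proof -
  let ?f = "\<lambda>x. indicator U x *\<^sub>R v"
  have m: "?f \<in> borel_measurable borel" using U by simp
  have i: "integrable lborel (indicator U :: 'a \<Rightarrow> real)" using U by simp
  have sq: "(norm (?f x))\<^sup>2 = indicator U x * (norm v)\<^sup>2" for x by (simp add: indicator_def)
  have s: "sqint ?f" unfolding sqint_borel_iff[OF m] sq using i by simp
  have "((\<lambda>z. cls (\<lambda>x. ?f (x - z)) \<bullet> cls ?f) \<longlongrightarrow> cls ?f \<bullet> cls ?f) (at 0)"
  proof (subst tendsto_at_iff_sequentially, intro allI impI, unfold o_def)
    fix Z :: "nat \<Rightarrow> 'a" assume Z: "Z \<longlonglongrightarrow> 0"
    have "(\<lambda>n. LINT x|lebesgue. ?f (x - Z n) \<bullet> ?f x) \<longlonglongrightarrow> (LINT x|lebesgue. ?f x \<bullet> ?f x)"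
    proof (rule integral_dominated_convergence)
      show "integrable lebesgue (\<lambda>x. indicator U x * (v \<bullet> v))"
        using i by (simp add: integrable_completion)
      show "AE x in lebesgue. (\<lambda>n. ?f (x - Z n) \<bullet> ?f x) \<longlonglongrightarrow> ?f x \<bullet> ?f x"
      proof (rule AE_I2)
        fix x show "(\<lambda>n. ?f (x - Z n) \<bullet> ?f x) \<longlonglongrightarrow> ?f x \<bullet> ?f x"
        proof (cases "x \<in> U")
          case True
          have "(\<lambda>n. x - Z n) \<longlonglongrightarrow> x - 0" by (intro tendsto_intros Z)
          then have "\<forall>\<^sub>F n in sequentially. x - Z n \<in> U"
            using U(1) True by (simp add: topological_tendstoD)
          then have "\<forall>\<^sub>F n in sequentially. ?f x \<bullet> ?f x = ?f (x - Z n) \<bullet> ?f x"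
            by eventually_elim (simp add: True)
          then show ?thesis by (rule Lim_transform_eventually[OF tendsto_const])
        qed simp
      qed
      show "AE x in lebesgue. norm (?f (x - Z n) \<bullet> ?f x) \<le> indicator U x * (v \<bullet> v)" for n
        by (auto simp: indicator_def)
      show "(\<lambda>x. ?f x \<bullet> ?f x) \<in> borel_measurable lebesgue"
        by (intro borel_measurable_inner measurable_completion) (use m in simp_all)
      show "(\<lambda>x. ?f (x - Z n) \<bullet> ?f x) \<in> borel_measurable lebesgue" for n
        by (intro borel_measurable_inner measurable_completion) (use m borel_shift[OF m] in simp_all)
    qed
    then show "(\<lambda>n. cls (\<lambda>x. ?f (x - Z n)) \<bullet> cls ?f) \<longlonglongrightarrow> cls ?f \<bullet> cls ?f"
      using sqint_shift[OF m s] s by (simp add: inner_cls)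
  qed
  \<comment> \<open>Because the translate has the same norm,
    \<open>|f_z - f|^2 = 2 |f|^2 - 2 <f_z, f>\<close>, and convergence of the inner products is
    enough.\<close>
  then have "((\<lambda>z. 2 * (cls ?f \<bullet> cls ?f) - 2 * (cls (\<lambda>x. ?f (x - z)) \<bullet> cls ?f)) \<longlongrightarrow> 2 * (cls ?f \<bullet> cls ?f) - 2 * (cls ?f \<bullet> cls ?f)) (at 0)"
    by (rule tendsto_diff[OF tendsto_const tendsto_mult_left])
  moreover have "2 * (cls ?f \<bullet> cls ?f) - 2 * (cls (\<lambda>x. ?f (x - z)) \<bullet> cls ?f) = (norm (cls (\<lambda>x. ?f (x - z)) - cls ?f))\<^sup>2" for z
  proof -
    have "(norm (cls (\<lambda>x. ?f (x - z)) - cls ?f))\<^sup>2 =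
      (norm (cls (\<lambda>x. ?f (x - z))))\<^sup>2 - 2 * (cls (\<lambda>x. ?f (x - z)) \<bullet> cls ?f) + (norm (cls ?f))\<^sup>2"
      unfolding power2_norm_eq_inner inner_diff_left inner_diff_right inner_commute[of "cls ?f" "cls (\<lambda>x. ?f (x - z))"]
      by simp
    then show ?thesis unfolding sqint_shift(2)[OF m s] by (simp add: power2_norm_eq_inner)
  qed
  ultimately have "((\<lambda>z. (norm (cls (\<lambda>x. ?f (x - z)) - cls ?f))\<^sup>2) \<longlongrightarrow> 0) (at 0)"
    by (simp only: diff_self)
  from tendsto_real_sqrt[OF this] have "((\<lambda>z. norm (cls (\<lambda>x. ?f (x - z)) - cls ?f)) \<longlongrightarrow> 0) (at 0)"
    by (simp only: real_sqrt_abs abs_norm_cancel real_sqrt_zero)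
  then have "((\<lambda>z. cls (\<lambda>x. ?f (x - z))) \<longlongrightarrow> cls ?f) (at 0)"
    by (rule LIM_zero_cancel[OF tendsto_norm_zero_cancel])
  then show ?thesis
    unfolding translation_continuous_def using m s by blast
qed

text \<open>Outer regularity: \<open>A\<close> is an open set of finite measure up to a set of small
  measure.\<close>

lemma translation_continuous_indicator:
  fixes v :: "'b::euclidean_space" and A :: "'a::euclidean_space set"
  assumes A: "A \<in> sets borel" "emeasure lborel A < \<infinity>"
  shows "translation_continuous (\<lambda>x. indicator A x *\<^sub>R v)"
proof (rule translation_continuous_approx)
  let ?f = "\<lambda>x. indicator A x *\<^sub>R v"
  show m: "?f \<in> borel_measurable borel" using A by simp
  have sq: "(norm (indicator B x *\<^sub>R v))\<^sup>2 = indicator B x * (norm v)\<^sup>2" for x and B :: "'a set"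
    by (simp add: indicator_def)
  show s: "sqint ?f"
    unfolding sqint_borel_iff[OF m] sq using A by simp
  fix e :: real assume e: "e > 0"
  \<comment> \<open>A measure excess of \<open>d\<close> changes the squared norm by at most
    \<open>d |v|^2\<close>, which is below \<open>e^2\<close>; the added 1 covers
    \<open>v = 0\<close>.\<close>
  define d where "d = e\<^sup>2 / ((norm v)\<^sup>2 + 1)"
  have d: "d > 0" "d * (norm v)\<^sup>2 < e\<^sup>2"
  proof -
    have p: "(norm v)\<^sup>2 + 1 > 0" by (rule add_nonneg_pos) auto
    then show "d > 0" using e by (simp add: d_def)
    show "d * (norm v)\<^sup>2 < e\<^sup>2" using p e by (simp add: d_def field_simps)
  qed
  obtain U where U: "open U" "A \<subseteq> U" "U - A \<in> lmeasurable" "emeasure lebesgue (U - A) < ennreal d"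
    using sets_lebesgue_outer_open[of A d] A(1) d by auto
  have UA: "U - A \<in> sets borel" using U A by auto
  have fUA: "emeasure lborel (U - A) < ennreal d" using U UA by simp
  have "emeasure lborel U \<le> emeasure lborel A + emeasure lborel (U - A)"
    using emeasure_subadditive[of A lborel "U - A"] A UA U(2) by (simp add: Un_absorb1)
  also have "\<dots> < \<infinity>"
    using A(2) fUA by (simp add: less_top[symmetric]) (metis ennreal_less_top not_less_iff_gr_or_eq order_less_trans)
  finally have g: "translation_continuous (\<lambda>x. indicator U x *\<^sub>R v)"
    by (rule translation_continuous_open[OF U(1)])
  have eq: "indicator U x *\<^sub>R v - ?f x = indicator (U - A) x *\<^sub>R v" for x
    using U(2) by (auto simp: indicator_def)
  have m': "(\<lambda>x. indicator (U - A) x *\<^sub>R v) \<in> borel_measurable borel" using UA by simp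
  have s': "sqint (\<lambda>x. indicator (U - A) x *\<^sub>R v)"
    using sqint_diff[OF _ s, of "\<lambda>x. indicator U x *\<^sub>R v"] g unfolding eq translation_continuous_def by simp
  have "(norm (cls (\<lambda>x. indicator U x *\<^sub>R v) - cls ?f))\<^sup>2 = (norm (cls (\<lambda>x. indicator (U - A) x *\<^sub>R v)))\<^sup>2"
    using g s by (simp add: cls_diff translation_continuous_def eq)
  also have "\<dots> = measure lborel (U - A) * (norm v)\<^sup>2"
    unfolding norm_cls_borel[OF m' s'] sq using UA by simp
  also have "\<dots> \<le> d * (norm v)\<^sup>2"
  proof (rule mult_right_mono)
    show "measure lborel (U - A) \<le> d"
      using fUA d(1) by (simp add: measure_def enn2real_leI less_imp_le)
  qed simp
  also have "\<dots> < e\<^sup>2" by (rule d)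
  finally have "norm (cls (\<lambda>x. indicator U x *\<^sub>R v) - cls ?f) < e"
    using e by (intro power_less_imp_less_base[of _ 2 e]) auto
  with g show "\<exists>g. translation_continuous g \<and> norm (cls g - cls ?f) < e" by blast
qed

lemma sqint_translation_continuous:
  fixes f :: "'a::euclidean_space \<Rightarrow> 'b::euclidean_space"
  assumes f: "f \<in> borel_measurable borel" "sqint f"
  shows "translation_continuous f"
proof (rule translation_continuous_approx[OF f])
  fix e :: real assume e: "e > 0"
  have fl: "f \<in> borel_measurable lborel" using f by simp
  from borel_measurable_implies_sequence_metric[OF fl, of 0] obtain S where
    S: "\<And>i. simple_function lborel (S i)" "\<And>x. (\<lambda>i. S i x) \<longlonglongrightarrow> f x"
      "\<And>i x. norm (S i x) \<le> 2 * norm (f x)"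
    by (auto simp: dist_norm)
  have fi: "integrable lborel (\<lambda>x. (norm (f x))\<^sup>2)" using f by (simp add: sqint_borel_iff)
  have Sm: "S i \<in> borel_measurable borel" for i
    using borel_measurable_simple_function[OF S(1)[of i]] by simp
  have Sb: "(norm (S i x))\<^sup>2 \<le> 4 * (norm (f x))\<^sup>2" for i x
    using power_mono[OF S(3)[of i x], of 2] by (simp add: power_mult_distrib)
  have Si: "sqint (S i)" for i
    unfolding sqint_borel_iff[OF Sm]
    by (rule Bochner_Integration.integrable_bound[of _ "\<lambda>x. 4 * (norm (f x))\<^sup>2"]) (use fi Sm Sb in auto)
  have tc: "translation_continuous (S i)" for i
  proof -
    have fin: "finite (range (S i))" using S(1)[of i] by (auto simp: simple_function_def)
    have *: "translation_continuous (\<lambda>x. indicator (S i -` {y}) x *\<^sub>R y)" for y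
    proof (cases "y = 0")
      case False
      have A: "S i -` {y} \<in> sets borel" using measurable_sets[OF Sm[of i], of "{y}"] by simp
      \<comment> \<open>Chebyshev's inequality: a square integrable function takes a nonzero value
        on a set of finite measure only.\<close>
      have "emeasure lborel (S i -` {y}) < \<infinity>"
      proof -
        have "integrable lborel (\<lambda>x. indicator (S i -` {y}) x :: real)"
        proof (rule Bochner_Integration.integrable_bound)
          show "integrable lborel (\<lambda>x. (norm (S i x))\<^sup>2 / (norm y)\<^sup>2)"
            using Si[of i] unfolding sqint_borel_iff[OF Sm] by simp
          have "norm (indicator (S i -` {y}) x :: real) \<le> norm ((norm (S i x))\<^sup>2 / (norm y)\<^sup>2)" for x
            using False by (cases "S i x = y") simp_all
          then show "AE x in lborel. norm (indicator (S i -` {y}) x :: real) \<le> norm ((norm (S i x))\<^sup>2 / (norm y)\<^sup>2)"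
            by simp
        qed (use A in simp)
        then show ?thesis using A by (simp add: integrable_indicator_iff)
      qed
      then show ?thesis by (rule translation_continuous_indicator[OF A])
    qed (simp add: translation_continuous_0)
    have "S i = (\<lambda>x. \<Sum>y\<in>range (S i). indicator (S i -` {y}) x *\<^sub>R y)"
    proof
      fix x
      show "S i x = (\<Sum>y\<in>range (S i). indicator (S i -` {y}) x *\<^sub>R y)"
        using simple_function_indicator_representation_banach[OF S(1)[of i], of x]
        unfolding space_lborel space_borel Int_UNIV_right by blast
    qed
    moreover have "translation_continuous (\<lambda>x. \<Sum>y\<in>range (S i). indicator (S i -` {y}) x *\<^sub>R y)"
      by (rule translation_continuous_sum[OF fin *])
    ultimately show ?thesis by (rule iffD2[OF arg_cong[where f = translation_continuous]])
  qed
  have "(\<lambda>i. LINT x|lborel. (norm (S i x - f x))\<^sup>2) \<longlonglongrightarrow> (LINT x|(lborel :: 'a measure). 0)"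
  proof (rule integral_dominated_convergence)
    show "integrable lborel (\<lambda>x. 10 * (norm (f x))\<^sup>2)" using fi by simp
    \<comment> \<open>\<open>10 = 2 * 4 + 2\<close>, from
      \<open>|a + b|^2 \<le> 2 |a|^2 + 2 |b|^2\<close> and
      \<open>|S i x| \<le> 2 |f x|\<close>.\<close>
    have "(norm (S i x - f x))\<^sup>2 \<le> 10 * (norm (f x))\<^sup>2" for i x
      using norm_add_square_le[of "S i x" "- f x"] Sb[of i x] by simp
    then show "AE x in lborel. norm ((norm (S i x - f x))\<^sup>2) \<le> 10 * (norm (f x))\<^sup>2" for i
      by simp
    show "AE x in lborel. (\<lambda>i. (norm (S i x - f x))\<^sup>2) \<longlonglongrightarrow> 0"
    proof (rule AE_I2)
      fix x
      have "(\<lambda>i. (norm (S i x - f x))\<^sup>2) \<longlonglongrightarrow> (norm (f x - f x))\<^sup>2" by (intro tendsto_intros S)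
      then show "(\<lambda>i. (norm (S i x - f x))\<^sup>2) \<longlonglongrightarrow> 0" by simp
    qed
  qed (use Sm f in auto)
  then have "(\<lambda>i. (norm (cls (S i) - cls f))\<^sup>2) \<longlonglongrightarrow> 0"
    using Si f Sm by (simp add: cls_diff norm_cls_borel sqint_diff)
  then have "\<forall>\<^sub>F i in sequentially. (norm (cls (S i) - cls f))\<^sup>2 < e\<^sup>2"
    by (rule order_tendstoD(2)) (use e in simp)
  then obtain i where "(norm (cls (S i) - cls f))\<^sup>2 < e\<^sup>2"
    using eventually_happens' sequentially_bot by blast
  then have "norm (cls (S i) - cls f) < e" using e by (intro power_less_imp_less_base[of _ 2 e]) auto
  with tc show "\<exists>g. translation_continuous g \<and> norm (cls g - cls f) < e" by blast
qed

lemma translation_small: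
  fixes f :: "'a::euclidean_space \<Rightarrow> 'b::euclidean_space"
  assumes "f \<in> borel_measurable borel" "sqint f" "e > 0"
  obtains d where "d > 0" "\<And>z. norm z < d \<Longrightarrow> norm (cls (\<lambda>x. f (x - z)) - cls f) < e"
proof -
  have "((\<lambda>z. cls (\<lambda>x. f (x - z))) \<longlongrightarrow> cls f) (at 0)"
    using sqint_translation_continuous[OF assms(1,2)] by (simp add: translation_continuous_def)
  then obtain d where d: "d > 0" "\<And>z. z \<noteq> 0 \<Longrightarrow> norm z < d \<Longrightarrow> dist (cls (\<lambda>x. f (x - z))) (cls f) < e"
    using assms(3) unfolding tendsto_iff eventually_at by auto
  show ?thesis
  proof (rule that[OF d(1)])
    fix z :: 'a assume "norm z < d"
    then show "norm (cls (\<lambda>x. f (x - z)) - cls f) < e"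
      using d(2)[of z] assms(3) by (cases "z = 0") (simp_all add: dist_norm)
  qed
qed

section \<open>Mollification as an average of translates\<close>

definition mollify :: "('a::euclidean_space \<Rightarrow> real) \<Rightarrow> ('a \<Rightarrow> 'b::euclidean_space) \<Rightarrow> 'a \<Rightarrow> 'b" where
  "mollify k w x = (LINT y|lborel. k (x - y) *\<^sub>R w y)"

text \<open>Jensen's inequality for the square under the probability density \<open>k\<close>. The
  right-hand side is an extended integral, so the inequality can be used at every point before
  anything is known to be integrable there; where it is infinite, nothing is claimed about
  \<open>k *\<^sub>R g\<close>.\<close>

lemma jensen_kernel:
  fixes g :: "'a::euclidean_space \<Rightarrow> 'b::euclidean_space"
  assumes k: "\<And>x. k x \<ge> 0" "integrable lborel k" "(LINT x|lborel. k x) = 1"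
    and g: "g \<in> borel_measurable borel"
  shows "integrable lborel (\<lambda>z. k z *\<^sub>R g z) \<or> (\<integral>\<^sup>+z. ennreal (k z * (norm (g z))\<^sup>2) \<partial>lborel) = \<infinity>"
    and "ennreal ((norm (LINT z|lborel. k z *\<^sub>R g z))\<^sup>2) \<le> (\<integral>\<^sup>+z. ennreal (k z * (norm (g z))\<^sup>2) \<partial>lborel)"
proof -
  have km[measurable]: "k \<in> borel_measurable borel" using borel_measurable_integrable[OF k(2)] by simp
  note g[measurable]
  have main: "integrable lborel (\<lambda>z. k z *\<^sub>R g z) \<and>
      ennreal ((norm (LINT z|lborel. k z *\<^sub>R g z))\<^sup>2) \<le> (\<integral>\<^sup>+z. ennreal (k z * (norm (g z))\<^sup>2) \<partial>lborel)"
    if fin: "(\<integral>\<^sup>+z. ennreal (k z * (norm (g z))\<^sup>2) \<partial>lborel) < \<infinity>"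
  proof -
    have i2: "integrable lborel (\<lambda>z. k z * (norm (g z))\<^sup>2)"
      by (rule integrableI_nonneg) (use k fin in auto)
    have i1: "integrable lborel (\<lambda>z. k z *\<^sub>R g z)"
    proof (rule Bochner_Integration.integrable_bound)
      show "integrable lborel (\<lambda>z. k z + k z * (norm (g z))\<^sup>2)" using k i2 by simp
      have "norm (k z *\<^sub>R g z) \<le> norm (k z + k z * (norm (g z))\<^sup>2)" for z
      proof -
        have "norm (g z) \<le> 1 + (norm (g z))\<^sup>2"
        proof -
          have "2 * norm (g z) \<le> 1 + (norm (g z))\<^sup>2" using sum_squares_bound[of 1 "norm (g z)"] by simp
          then show ?thesis using norm_ge_zero[of "g z"] by linarith
        qed
        from mult_left_mono[OF this k(1)[of z]] show ?thesis using k(1)[of z] by (simp add: algebra_simps)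
      qed
      then show "AE z in lborel. norm (k z *\<^sub>R g z) \<le> norm (k z + k z * (norm (g z))\<^sup>2)" by simp
    qed simp
    define m where "m = (LINT z|lborel. k z *\<^sub>R g z)"
    define B where "B z = k z *\<^sub>R g z \<bullet> m" for z
    have B: "integrable lborel B" "(LINT z|lborel. B z) = m \<bullet> m"
      unfolding B_def using i1 by (auto simp only: m_def integral_inner_left integrable_inner_left)
    \<comment> \<open>The variance of \<open>g\<close> under the density \<open>k\<close>; expanding
      it gives the inequality.\<close>
    have "0 \<le> (LINT z|lborel. k z * (norm (g z - m))\<^sup>2)"
      using k(1) by (intro integral_nonneg_AE) simp
    also have "(\<lambda>z. k z * (norm (g z - m))\<^sup>2) = (\<lambda>z. k z * (norm (g z))\<^sup>2 - 2 * B z + (norm m)\<^sup>2 * k z)"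
      unfolding power2_norm_eq_inner inner_diff_left inner_diff_right B_def
      by (simp add: fun_eq_iff inner_commute algebra_simps)
    also have "(LINT z|lborel. \<dots> z) = (LINT z|lborel. k z * (norm (g z))\<^sup>2) - 2 * (m \<bullet> m) + (norm m)\<^sup>2"
      using B i2 k(2,3) by simp
    finally have "(norm m)\<^sup>2 \<le> (LINT z|lborel. k z * (norm (g z))\<^sup>2)"
      by (simp add: power2_norm_eq_inner)
    with i1 i2 k(1) show ?thesis
      by (simp add: m_def nn_integral_eq_integral ennreal_leI)
  qed
  show "integrable lborel (\<lambda>z. k z *\<^sub>R g z) \<or> (\<integral>\<^sup>+z. ennreal (k z * (norm (g z))\<^sup>2) \<partial>lborel) = \<infinity>"
    using main by (auto simp: less_top)
  show "ennreal ((norm (LINT z|lborel. k z *\<^sub>R g z))\<^sup>2) \<le> (\<integral>\<^sup>+z. ennreal (k z * (norm (g z))\<^sup>2) \<partial>lborel)"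
    using main by (cases "(\<integral>\<^sup>+z. ennreal (k z * (norm (g z))\<^sup>2) \<partial>lborel) < \<infinity>") (auto simp: less_top[symmetric])
qed

text \<open>The error \<open>mollify k w - w\<close> is the \<open>k\<close>-average of the
  differences \<open>w (x - z) - w x\<close>. By Jensen and Fubini its norm is at most the largest
  translation error over the support of \<open>k\<close>, which may lie away from the
  origin.\<close>

lemma mollify_approx:
  fixes w :: "'a::euclidean_space \<Rightarrow> 'b::euclidean_space"
  assumes k: "\<And>x. k x \<ge> 0" "integrable lborel k" "(LINT x|lborel. k x) = 1"
    and w: "w \<in> borel_measurable borel" "sqint w"
    and e: "\<And>z. k z \<noteq> 0 \<Longrightarrow> norm (cls (\<lambda>x. w (x - z)) - cls w) \<le> e"
  shows "mollify k w \<in> borel_measurable borel" "sqint (mollify k w)" "norm (cls (mollify k w) - cls w) \<le> e"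
proof -
  have km[measurable]: "k \<in> borel_measurable borel" using borel_measurable_integrable[OF k(2)] by simp
  note w(1)[measurable]
  have "(\<lambda>x. LINT y|lborel. k (x - y) *\<^sub>R w y) \<in> borel_measurable lborel"
    by (intro lborel.borel_measurable_lebesgue_integral) measurable
  then show m[measurable]: "mollify k w \<in> borel_measurable borel"
    by (simp add: mollify_def[abs_def])
  have "e \<ge> 0"
  proof -
    obtain z where "k z \<noteq> 0" using k(3) by (cases "\<forall>z. k z = 0") auto
    from order_trans[OF norm_ge_zero e[OF this]] show ?thesis .
  qed
  have eq: "mollify k w x = (LINT z|lborel. k z *\<^sub>R w (x - z))" for x
    using lborel_integral_reflect[of "\<lambda>y. k (x - y) *\<^sub>R w y" x] by (simp add: mollify_def)
  have ptw: "ennreal ((norm (mollify k w x - w x))\<^sup>2) \<le> (\<integral>\<^sup>+z. ennreal (k z * (norm (w (x - z) - w x))\<^sup>2) \<partial>lborel)" for x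
  proof -
    have gm: "(\<lambda>z. w (x - z) - w x) \<in> borel_measurable borel" by measurable
    show ?thesis
    proof (cases "(\<integral>\<^sup>+z. ennreal (k z * (norm (w (x - z) - w x))\<^sup>2) \<partial>lborel) = \<infinity>")
      case False
      then have i: "integrable lborel (\<lambda>z. k z *\<^sub>R (w (x - z) - w x))"
        using jensen_kernel(1)[OF k gm] by blast
      have i': "integrable lborel (\<lambda>z. k z *\<^sub>R w x)" using k(2) by simp
      have "(LINT z|lborel. k z *\<^sub>R (w (x - z) - w x)) + (LINT z|lborel. k z *\<^sub>R w x) = mollify k w x"
        unfolding eq using Bochner_Integration.integral_add[OF i i'] by (simp add: algebra_simps)
      then have "mollify k w x - w x = (LINT z|lborel. k z *\<^sub>R (w (x - z) - w x))"
        using k(2,3) by (simp add: algebra_simps)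
      then show ?thesis using jensen_kernel(2)[OF k gm] by simp
    qed simp
  qed
  have sd: "sqint (\<lambda>x. w (x - z) - w x)" for z by (intro sqint_diff sqint_shift w)
  have bound: "(\<integral>\<^sup>+x. ennreal ((norm (mollify k w x - w x))\<^sup>2) \<partial>lborel) \<le> ennreal (e\<^sup>2)"
  proof -
    have "(\<integral>\<^sup>+x. ennreal ((norm (mollify k w x - w x))\<^sup>2) \<partial>lborel)
        \<le> (\<integral>\<^sup>+x. \<integral>\<^sup>+z. ennreal (k z * (norm (w (x - z) - w x))\<^sup>2) \<partial>lborel \<partial>lborel)"
      by (intro nn_integral_mono ptw)
    also have "\<dots> = (\<integral>\<^sup>+z. \<integral>\<^sup>+x. ennreal (k z * (norm (w (x - z) - w x))\<^sup>2) \<partial>lborel \<partial>lborel)"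
      by (rule lborel_pair.Fubini') measurable
    also have "\<dots> \<le> (\<integral>\<^sup>+z. ennreal (k z * e\<^sup>2) \<partial>lborel)"
    proof (rule nn_integral_mono)
      fix z
      show "(\<integral>\<^sup>+x. ennreal (k z * (norm (w (x - z) - w x))\<^sup>2) \<partial>lborel) \<le> ennreal (k z * e\<^sup>2)"
      proof (cases "k z = 0")
        case False
        have "(\<integral>\<^sup>+x. ennreal (k z * (norm (w (x - z) - w x))\<^sup>2) \<partial>lborel) = ennreal (k z * (LINT x|lborel. (norm (w (x - z) - w x))\<^sup>2))"
          using sd[of z] k(1)[of z] by (subst nn_integral_eq_integral) (auto simp: sqint_borel_iff)
        also have "(LINT x|lborel. (norm (w (x - z) - w x))\<^sup>2) = (norm (cls (\<lambda>x. w (x - z)) - cls w))\<^sup>2"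
          using w sd[of z] by (simp add: cls_diff sqint_shift norm_cls_borel)
        finally show ?thesis
          using e[OF False] k(1)[of z] by (auto intro!: ennreal_leI mult_left_mono power_mono)
      qed simp
    qed
    also have "\<dots> = ennreal (e\<^sup>2)"
      using k by (simp add: nn_integral_eq_integral)
    finally show ?thesis .
  qed
  have i: "integrable lborel (\<lambda>x. (norm (mollify k w x - w x))\<^sup>2)"
    by (rule integrableI_nonneg) (use bound in \<open>auto intro: le_less_trans\<close>)
  have s: "sqint (\<lambda>x. mollify k w x - w x)" by (subst sqint_borel_iff) (use i in auto)
  show sm: "sqint (mollify k w)" using sqint_add[OF s w(2)] by simp
  have "(norm (cls (\<lambda>x. mollify k w x - w x)))\<^sup>2 \<le> e\<^sup>2"
    using bound by (subst norm_cls_borel) (auto simp: s nn_integral_eq_integral[OF i] integral_nonneg_AE)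
  then show "norm (cls (mollify k w) - cls w) \<le> e"
    unfolding cls_diff[OF sm w(2)] using \<open>e \<ge> 0\<close> by (rule power2_le_imp_le)
qed

section \<open>Weak curls on the whole space\<close>

lemma bounded_bilinear_ccross: "bounded_bilinear ccross"
proof -
  have "bilinear ccross"
    unfolding bilinear_def linear_iff
    by (auto simp: ccross_def vec_eq_iff forall_3 algebra_simps scaleR_conv_of_real[where 'a = complex])
  then show ?thesis by (simp add: bilinear_conv_bounded_bilinear)
qed

text \<open>Writing the curl as the sum of \<open>e_i \<times> \<partial>_i\<close> reduces its
  product rule, its action on kernels and its Taylor coefficients to bilinearity of the cross
  product.\<close>

lemma smooth_curl_eq: "smooth_curl \<phi> x = (\<Sum>i\<in>UNIV. ccross (axis i 1) (pderiv_at i \<phi> x))"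
  by (simp add: smooth_curl_def ccross_def vec_eq_iff forall_3 sum_3 axis_def)

lemma ccross_inner: "ccross a u \<bullet> b = - (u \<bullet> ccross a b)"
  by (simp add: ccross_def inner_vec_def sum_3 inner_complex_def algebra_simps)

text \<open>Each of the three components is at most \<open>2 |a| |b|\<close>, and
  \<open>3 * 2^2 = 12\<close> is rounded up to \<open>4^2\<close>.\<close>

lemma norm_ccross_le: "norm (ccross a b) \<le> 4 * norm a * norm b"
proof -
  have 1: "\<bar>a $ i\<bar> * norm (b $ j) \<le> norm a * norm b" for i j
    by (intro mult_mono component_le_norm_cart Finite_Cartesian_Product.norm_nth_le) auto
  have 2: "norm (of_real (a $ i) * b $ j - of_real (a $ k) * b $ l) \<le> 2 * (norm a * norm b)" for i j k l
    using norm_triangle_ineq4[of "of_real (a $ i) * b $ j" "of_real (a $ k) * b $ l"] 1[of i j] 1[of k l]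
    by (simp add: norm_mult)
  have "(norm (ccross a b))\<^sup>2 = (\<Sum>i\<in>UNIV. (norm (ccross a b $ i))\<^sup>2)"
    by (simp add: norm_vec_def L2_set_def sum_nonneg)
  also have "\<dots> \<le> (\<Sum>i\<in>(UNIV::3 set). (2 * (norm a * norm b))\<^sup>2)"
  proof (rule sum_mono)
    fix i :: 3
    have "norm (ccross a b $ i) \<le> 2 * (norm a * norm b)"
      using 2 exhaust_3[of i] by (auto simp: ccross_def)
    then show "(norm (ccross a b $ i))\<^sup>2 \<le> (2 * (norm a * norm b))\<^sup>2" by (rule power_mono) simp
  qed
  also have "\<dots> = 12 * (norm a * norm b)\<^sup>2" by (simp add: power2_eq_square)
  also have "\<dots> \<le> (4 * norm a * norm b)\<^sup>2" by (simp add: power_mult_distrib)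
  finally show ?thesis by (rule power2_le_imp_le) simp
qed

definition cnjv :: "complex^3 \<Rightarrow> complex^3" where
  "cnjv b = (\<chi> i. cnj (b $ i))"

lemma bounded_linear_cnjv: "bounded_linear cnjv"
  unfolding linear_conv_bounded_linear[symmetric] linear_iff
  by (auto simp: cnjv_def vec_eq_iff)

lemma bounded_linear_vscale: "bounded_linear (\<lambda>b :: complex^3. z *s b)"
  unfolding linear_conv_bounded_linear[symmetric] linear_iff
  by (auto simp: vec_eq_iff algebra_simps)

lemma Re_cdot: "Re (cdot a b) = a \<bullet> cnjv b"
  by (simp add: cdot_def cnjv_def inner_vec_def inner_complex_def)

lemma Im_cdot: "Im (cdot a b) = a \<bullet> cnjv ((- \<i>) *s b)"
  by (simp add: cdot_def cnjv_def inner_vec_def inner_complex_def sum_3)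

lemma pderiv_at_linear:
  assumes "bounded_linear L" "\<phi> \<in> C_inf"
  shows "pderiv_at i (\<lambda>x. L (\<phi> x)) x = L (pderiv_at i \<phi> x)"
proof -
  have "(\<phi> has_derivative frechet_derivative \<phi> (at x)) (at x)"
    using C_inf_differentiable[OF assms(2)] frechet_derivative_works by blast
  from bounded_linear.has_derivative[OF assms(1) this] show ?thesis
    by (subst pderiv_at_eq) (auto simp: pderiv_at_def)
qed

lemma smooth_curl_cnjv: "\<phi> \<in> C_inf \<Longrightarrow> smooth_curl (\<lambda>x. cnjv (\<phi> x)) x = cnjv (smooth_curl \<phi> x)"
  unfolding smooth_curl_def pderiv_at_linear[OF bounded_linear_cnjv]
  by (simp add: cnjv_def vec_eq_iff forall_3)

lemma smooth_curl_vscale: "\<phi> \<in> C_inf \<Longrightarrow> smooth_curl (\<lambda>x. z *s \<phi> x) x = z *s smooth_curl \<phi> x"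
  unfolding smooth_curl_def pderiv_at_linear[OF bounded_linear_vscale]
  by (simp add: vec_eq_iff forall_3 algebra_simps)

lemma continuous_smooth_curl: "\<phi> \<in> C_inf \<Longrightarrow> continuous_on UNIV (smooth_curl \<phi>)"
  unfolding smooth_curl_eq[abs_def]
  by (intro continuous_on_sum bounded_bilinear.continuous_on[OF bounded_bilinear_ccross]
      continuous_on_const C_inf_continuous C_inf_pderiv)

lemma sqint_restrict_continuous:
  assumes "continuous_on UNIV \<phi>" "compact K"
  shows "sqint (\<lambda>x. indicator K x *\<^sub>R \<phi> x)"
proof -
  have K: "K \<in> sets borel" using assms(2) by (simp add: compact_imp_closed)
  have \<phi>: "\<phi> \<in> borel_measurable borel" using assms(1) by (simp add: borel_measurable_continuous_onI)
  have m: "(\<lambda>x. indicator K x *\<^sub>R \<phi> x) \<in> borel_measurable borel"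
    using K \<phi> by (intro borel_measurable_scaleR) auto
  have "continuous_on K (\<lambda>x. (norm (\<phi> x))\<^sup>2)"
    by (intro continuous_intros continuous_on_subset[OF assms(1)]) auto
  from borel_integrable_compact[OF assms(2) this]
  have "integrable lborel (\<lambda>x. indicator K x *\<^sub>R (norm (\<phi> x))\<^sup>2)" .
  moreover have "(norm (indicator K x *\<^sub>R \<phi> x))\<^sup>2 = indicator K x *\<^sub>R (norm (\<phi> x))\<^sup>2" for x
    by (simp add: indicator_def)
  ultimately show ?thesis unfolding sqint_borel_iff[OF m] by simp
qed

text \<open>Smooth test fields need not be square integrable. Cutting them off outside a ball that
  contains the support of \<open>w\<close> changes no pairing with \<open>w\<close> and makes the L2
  theory applicable.\<close>

lemma test_restrict:
  fixes w :: "'a::euclidean_space \<Rightarrow> 'b::euclidean_space"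
  assumes "bounded S" "\<And>x. x \<notin> S \<Longrightarrow> w x = 0" "continuous_on UNIV \<phi>" "bounded_bilinear p"
  obtains \<psi> where "sqint \<psi>" "\<And>x. p (w x) (\<phi> x) = p (w x) (\<psi> x)" "\<And>x. x \<in> S \<Longrightarrow> \<psi> x = \<phi> x"
proof -
  interpret bounded_bilinear p by fact
  obtain R where R: "S \<subseteq> cball 0 R" using bounded_subset_ballD[OF assms(1), of 0] ball_subset_cball by blast
  show ?thesis
  proof (rule that[of "\<lambda>x. indicator (cball 0 R) x *\<^sub>R \<phi> x"])
    show "sqint (\<lambda>x. indicator (cball 0 R) x *\<^sub>R \<phi> x)"
      by (rule sqint_restrict_continuous[OF assms(3)]) simp
    show "p (w x) (\<phi> x) = p (w x) (indicator (cball 0 R) x *\<^sub>R \<phi> x)" for x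
    proof (cases "x \<in> S")
      case True
      then have "x \<in> cball 0 R" using R by blast
      then show ?thesis by simp
    next
      case False
      from assms(2)[OF this] show ?thesis by (simp only: zero_left)
    qed
    fix x assume "x \<in> S"
    then have "x \<in> cball 0 R" using R by blast
    then show "indicator (cball 0 R) x *\<^sub>R \<phi> x = \<phi> x" by simp
  qed
qed

lemma test_integrable:
  fixes w :: "'a::euclidean_space \<Rightarrow> 'b::euclidean_space" and \<phi> :: "'a \<Rightarrow> 'd::euclidean_space"
  assumes "sqint w" "bounded S" "\<And>x. x \<notin> S \<Longrightarrow> w x = 0" "continuous_on UNIV \<phi>" "bounded_bilinear p"
  shows "integrable lebesgue (\<lambda>x. p (w x) (\<phi> x) :: 'c::euclidean_space)"
  by (rule test_restrict[OF assms(2-5)]) (auto simp: sqint_prod_integrable[OF assms(5,1)])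

lemmas test_integrable_inner = test_integrable[OF _ _ _ _ bounded_bilinear_inner]

text \<open>The test function enters through the real inner product of the field values; for real and
  imaginary parts of all test functions this is the complex bilinear pairing.\<close>

definition curl_pair ::
  "(real^3) set \<Rightarrow> (real^3 \<Rightarrow> complex^3) \<Rightarrow> (real^3 \<Rightarrow> complex^3) \<Rightarrow> bool" where
  "curl_pair S w c \<longleftrightarrow> sqint w \<and> sqint c \<and> (\<forall>x. x \<notin> S \<longrightarrow> w x = 0 \<and> c x = 0) \<and>
     (\<forall>\<phi>\<in>C_inf. (LINT x|lebesgue. w x \<bullet> smooth_curl \<phi> x) = (LINT x|lebesgue. c x \<bullet> \<phi> x))"

lemma bounded_bilinear_cdot: "bounded_bilinear cdot"
proof -
  have "bilinear cdot"
    unfolding bilinear_def linear_iff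
    by (auto simp: cdot_def sum.distrib algebra_simps sum_distrib_left scaleR_conv_of_real[where 'a = complex])
  then show ?thesis by (simp add: bilinear_conv_bounded_bilinear)
qed

lemma Re_integral_cdot:
  assumes "integrable M (\<lambda>x. cdot (f x) (g x))"
  shows "Re (LINT x|M. cdot (f x) (g x)) = (LINT x|M. f x \<bullet> cnjv (g x))"
  using integral_bounded_linear[OF bounded_linear_Re assms] by (simp add: Re_cdot)

lemma Im_integral_cdot:
  assumes "integrable M (\<lambda>x. cdot (f x) (g x))"
  shows "Im (LINT x|M. cdot (f x) (g x)) = (LINT x|M. f x \<bullet> cnjv ((- \<i>) *s g x))"
  using integral_bounded_linear[OF bounded_linear_Im assms] by (simp add: Im_cdot)

text \<open>Real pairings with all test fields determine the complex ones: the conjugate of \<phi>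
  tests the real part, the conjugate of \<open>- \<i> \<phi>\<close> the imaginary part.\<close>

lemma curl_pair_iff_cdot:
  assumes S: "bounded S" "\<And>x. x \<notin> S \<Longrightarrow> w x = 0 \<and> c x = 0" and wc: "sqint w" "sqint c"
  shows "curl_pair S w c \<longleftrightarrow>
    (\<forall>\<phi>\<in>C_inf. (LINT x|lebesgue. cdot (w x) (smooth_curl \<phi> x)) = (LINT x|lebesgue. cdot (c x) (\<phi> x)))"
    (is "_ \<longleftrightarrow> ?R")
proof -
  have i: "integrable lebesgue (\<lambda>x. cdot (w x) (smooth_curl \<phi> x))" "integrable lebesgue (\<lambda>x. cdot (c x) (\<phi> x))"
    if "\<phi> \<in> C_inf" for \<phi>
    using test_integrable[OF wc(1) S(1) _ continuous_smooth_curl[OF that] bounded_bilinear_cdot]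
      test_integrable[OF wc(2) S(1) _ C_inf_continuous[OF that] bounded_bilinear_cdot] S(2) by blast+
  have cc: "cnjv (cnjv b) = b" for b by (simp add: cnjv_def)
  have Cc: "(\<lambda>x. cnjv (\<phi> x)) \<in> C_inf" if "\<phi> \<in> C_inf" for \<phi> :: "real^3 \<Rightarrow> complex^3"
    using that by (rule C_inf_linear[OF bounded_linear_cnjv])
  have Ci: "(\<lambda>x. z *s \<phi> x) \<in> C_inf" if "\<phi> \<in> C_inf" for \<phi> :: "real^3 \<Rightarrow> complex^3" and z
    using that by (rule C_inf_linear[OF bounded_linear_vscale])
  show ?thesis
  proof
    assume L: "curl_pair S w c"
    then have L: "(LINT x|lebesgue. w x \<bullet> smooth_curl \<phi> x) = (LINT x|lebesgue. c x \<bullet> \<phi> x)"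
      if "\<phi> \<in> C_inf" for \<phi> using that by (simp add: curl_pair_def)
    show ?R
    proof
      fix \<phi> :: "real^3 \<Rightarrow> complex^3" assume \<phi>: "\<phi> \<in> C_inf"
      show "(LINT x|lebesgue. cdot (w x) (smooth_curl \<phi> x)) = (LINT x|lebesgue. cdot (c x) (\<phi> x))"
      proof (rule complex_eqI)
        show "Re (LINT x|lebesgue. cdot (w x) (smooth_curl \<phi> x)) = Re (LINT x|lebesgue. cdot (c x) (\<phi> x))"
          using L[OF Cc[OF \<phi>]] by (simp add: Re_integral_cdot i[OF \<phi>] smooth_curl_cnjv \<phi>)
        show "Im (LINT x|lebesgue. cdot (w x) (smooth_curl \<phi> x)) = Im (LINT x|lebesgue. cdot (c x) (\<phi> x))"
          using L[OF Cc[OF Ci[OF \<phi>, of "- \<i>"]]]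
          unfolding Im_integral_cdot[OF i(1)[OF \<phi>]] Im_integral_cdot[OF i(2)[OF \<phi>]]
            smooth_curl_cnjv[OF Ci[OF \<phi>]] smooth_curl_vscale[OF \<phi>] .
      qed
    qed
  next
    assume R: ?R
    show "curl_pair S w c" unfolding curl_pair_def
    proof (intro conjI ballI wc)
      fix \<phi> :: "real^3 \<Rightarrow> complex^3" assume \<phi>: "\<phi> \<in> C_inf"
      note \<phi>' = Cc[OF \<phi>]
      from R \<phi>' have "Re (LINT x|lebesgue. cdot (w x) (smooth_curl (\<lambda>x. cnjv (\<phi> x)) x))
          = Re (LINT x|lebesgue. cdot (c x) (cnjv (\<phi> x)))" by simp
      then show "(LINT x|lebesgue. w x \<bullet> smooth_curl \<phi> x) = (LINT x|lebesgue. c x \<bullet> \<phi> x)"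
        unfolding smooth_curl_cnjv[OF \<phi>] cc
          Re_integral_cdot[OF i(1)[OF \<phi>'], unfolded smooth_curl_cnjv[OF \<phi>] cc]
          Re_integral_cdot[OF i(2)[OF \<phi>'], unfolded cc] .
    qed (use S in auto)
  qed
qed

lemma curl_pair_add:
  assumes "bounded S" "curl_pair S w c" "curl_pair S w' c'"
  shows "curl_pair S (\<lambda>x. w x + w' x) (\<lambda>x. c x + c' x)"
proof -
  have i: "integrable lebesgue (\<lambda>x. u x \<bullet> smooth_curl \<phi> x)" "integrable lebesgue (\<lambda>x. d x \<bullet> \<phi> x)"
    if "\<phi> \<in> C_inf" "curl_pair S u d" for \<phi> u d
    using test_integrable_inner[OF _ assms(1) _ continuous_smooth_curl[OF that(1)], of u]
      test_integrable_inner[OF _ assms(1) _ C_inf_continuous[OF that(1)], of d] that(2)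
    unfolding curl_pair_def by blast+
  show ?thesis
    using assms(2,3) i[OF _ assms(2)] i[OF _ assms(3)]
    unfolding curl_pair_def by (simp add: inner_add_left sqint_add)
qed

lemma curl_pair_scaleR: "curl_pair S w c \<Longrightarrow> curl_pair S (\<lambda>x. r *\<^sub>R w x) (\<lambda>x. r *\<^sub>R c x)"
  unfolding curl_pair_def by (simp add: sqint_scaleR)

lemma curl_pair_0: "curl_pair S (\<lambda>x. 0) (\<lambda>x. 0)"
  unfolding curl_pair_def by (simp add: sqint_0)

lemma norm_vscale: "norm (z *s (b :: complex^3)) = norm z * norm b"
proof -
  have "(norm (z *s b))\<^sup>2 = (norm z * norm b)\<^sup>2"
    by (simp add: norm_vec_def L2_set_def sum_nonneg power_mult_distrib norm_mult sum_distrib_left)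
  then show ?thesis by (rule power2_eq_imp_eq) auto
qed

lemma inner_vscale: "(z *s (a :: complex^3)) \<bullet> b = a \<bullet> (cnj z *s b)"
  by (simp add: inner_vec_def inner_complex_def sum_3 algebra_simps)

lemma sqint_vscale: "sqint w \<Longrightarrow> sqint (\<lambda>x. z *s w x :: complex^3)"
  unfolding sqint_def norm_vscale
  by (auto simp: power_mult_distrib intro: borel_measurable_continuous_onI
      measurable_compose[OF _ borel_measurable_continuous_onI[OF linear_continuous_on[OF bounded_linear_vscale]]])

lemma curl_pair_vscale: "curl_pair S w c \<Longrightarrow> curl_pair S (\<lambda>x. z *s w x) (\<lambda>x. z *s c x)"
  unfolding curl_pair_def
proof (elim conjE, intro conjI allI ballI impI)
  fix \<phi> :: "real^3 \<Rightarrow> complex^3" assume \<phi>: "\<phi> \<in> C_inf"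
  assume "\<forall>\<phi>\<in>C_inf. (LINT x|lebesgue. w x \<bullet> smooth_curl \<phi> x) = (LINT x|lebesgue. c x \<bullet> \<phi> x)"
  from this C_inf_linear[OF bounded_linear_vscale \<phi>, of "cnj z"]
  show "(LINT x|lebesgue. (z *s w x) \<bullet> smooth_curl \<phi> x) = (LINT x|lebesgue. (z *s c x) \<bullet> \<phi> x)"
    by (auto simp: inner_vscale smooth_curl_vscale \<phi>)
qed (auto simp: sqint_vscale)

lemma curl_pair_mono: "curl_pair S w c \<Longrightarrow> S \<subseteq> T \<Longrightarrow> curl_pair T w c"
  unfolding curl_pair_def by blast

lemma curl_pair_cong_AE:
  assumes "curl_pair S w c" "sqint w'" "sqint c'" "AE x in lebesgue. w x = w' x" "AE x in lebesgue. c x = c' x"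
    "\<And>x. x \<notin> T \<Longrightarrow> w' x = 0 \<and> c' x = 0"
  shows "curl_pair T w' c'"
  unfolding curl_pair_def
proof (intro conjI ballI assms(2,3))
  fix \<phi> :: "real^3 \<Rightarrow> complex^3" assume \<phi>: "\<phi> \<in> C_inf"
  have m: "\<phi> \<in> borel_measurable lebesgue" "smooth_curl \<phi> \<in> borel_measurable lebesgue"
    using C_inf_continuous[OF \<phi>] continuous_smooth_curl[OF \<phi>]
    by (auto intro!: measurable_completion borel_measurable_continuous_onI)
  have "(LINT x|lebesgue. w' x \<bullet> smooth_curl \<phi> x) = (LINT x|lebesgue. w x \<bullet> smooth_curl \<phi> x)"
    "(LINT x|lebesgue. c' x \<bullet> \<phi> x) = (LINT x|lebesgue. c x \<bullet> \<phi> x)"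
    using assms m by (auto intro!: integral_cong_AE borel_measurable_inner simp: curl_pair_def sqint_measurable elim: eventually_mono)
  then show "(LINT x|lebesgue. w' x \<bullet> smooth_curl \<phi> x) = (LINT x|lebesgue. c' x \<bullet> \<phi> x)"
    using assms(1) \<phi> by (simp add: curl_pair_def)
qed (use assms(6) in auto)

definition curl_graph :: "(real^3) set \<Rightarrow> ((real^3, complex^3) l2 \<times> (real^3, complex^3) l2) set" where
  "curl_graph S = {(cls w, cls c) |w c. curl_pair S w c}"

text \<open>\<open>curl_pair\<close> demands that fields vanish at every point outside
  \<open>S\<close>, while a limit class determines its representatives almost everywhere only; hence
  the correction by the indicator of \<open>S\<close>.\<close>

lemma l2_limit_representative:
  fixes f :: "nat \<Rightarrow> 'a::euclidean_space \<Rightarrow> 'b::euclidean_space"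
  assumes "\<And>n. sqint (f n)" "(\<lambda>n. cls (f n)) \<longlonglongrightarrow> F" "\<And>n x. x \<notin> S \<Longrightarrow> f n x = 0" "S \<in> sets lebesgue"
  obtains r g where "strict_mono r" "sqint g" "F = cls g" "\<And>x. x \<notin> S \<Longrightarrow> g x = 0"
    "AE x in lebesgue. (\<lambda>n. f (r n) x) \<longlonglongrightarrow> g x"
proof -
  obtain r g where g: "strict_mono r" "sqint g" "AE x in lebesgue. (\<lambda>n. f (r n) x) \<longlonglongrightarrow> g x"
    "(\<lambda>n. cls (f n)) \<longlonglongrightarrow> cls g"
    using l2_Cauchy_AE_convergent[OF assms(1) LIMSEQ_imp_Cauchy[OF assms(2)]] by blast
  define g' where "g' x = indicator S x *\<^sub>R g x" for x
  have AE: "AE x in lebesgue. g x = g' x"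
    using g(3)
  proof eventually_elim
    case (elim x)
    show ?case
    proof (cases "x \<in> S")
      case False
      then have "(\<lambda>n. 0) \<longlonglongrightarrow> g x" using elim assms(3) by simp
      then show ?thesis using False by (simp add: g'_def LIMSEQ_const_iff)
    qed (simp add: g'_def)
  qed
  have m: "g' \<in> borel_measurable lebesgue"
    unfolding g'_def using sqint_measurable[OF g(2)] assms(4) by (intro borel_measurable_scaleR) auto
  have s: "sqint g'" by (rule sqint_cong_AE[OF g(2) AE m])
  show ?thesis
  proof (rule that[OF g(1) s])
    have "cls g = cls g'" using cls_eq_iff[OF g(2) s] AE by blast
    then show "F = cls g'" using LIMSEQ_unique[OF assms(2) g(4)] by simp
    show "AE x in lebesgue. (\<lambda>n. f (r n) x) \<longlonglongrightarrow> g' x"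
      using g(3) AE by eventually_elim simp
  qed (simp add: g'_def)
qed

text \<open>For a fixed test field both sides of the curl identity are continuous functionals on L2,
  so the identity survives limits of the pair.\<close>

lemma curl_graph_closed:
  assumes S: "bounded S" "S \<in> sets lebesgue"
  shows "closed (curl_graph S)"
  unfolding closed_sequential_limits
proof (intro allI impI, elim conjE)
  fix X :: "nat \<Rightarrow> (real^3, complex^3) l2 \<times> (real^3, complex^3) l2" and l
  assume X: "\<forall>n. X n \<in> curl_graph S" and l: "X \<longlonglongrightarrow> l"
  have "\<forall>n. \<exists>p. X n = (cls (fst p), cls (snd p)) \<and> curl_pair S (fst p) (snd p)"
    using X unfolding curl_graph_def by auto
  from choice[OF this] obtain p where p: "\<And>n. X n = (cls (fst (p n)), cls (snd (p n)))"
    "\<And>n. curl_pair S (fst (p n)) (snd (p n))" by blast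
  define w c where "w n = fst (p n)" and "c n = snd (p n)" for n
  have wc: "curl_pair S (w n) (c n)" and Xwc: "X n = (cls (w n), cls (c n))" for n
    using p by (auto simp: w_def c_def)
  have s: "sqint (w n)" "sqint (c n)" and z: "\<And>x. x \<notin> S \<Longrightarrow> w n x = 0" "\<And>x. x \<notin> S \<Longrightarrow> c n x = 0" for n
    using wc[of n] by (auto simp: curl_pair_def)
  have lim: "(\<lambda>n. cls (w n)) \<longlonglongrightarrow> fst l" "(\<lambda>n. cls (c n)) \<longlonglongrightarrow> snd l"
    using tendsto_fst[OF l] tendsto_snd[OF l] by (simp_all add: Xwc)
  obtain w' where w': "sqint w'" "fst l = cls w'" "\<And>x. x \<notin> S \<Longrightarrow> w' x = 0"
    using l2_limit_representative[OF s(1) lim(1) z(1) S(2)] by metis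
  obtain c' where c': "sqint c'" "snd l = cls c'" "\<And>x. x \<notin> S \<Longrightarrow> c' x = 0"
    using l2_limit_representative[OF s(2) lim(2) z(2) S(2)] by metis
  \<comment> \<open>On fields supported in the bounded set \<open>S\<close>, pairing with \<phi> is
    the inner product with a square integrable truncation of \<phi>.\<close>
  have pass: "(\<lambda>n. LINT x|lebesgue. f n x \<bullet> \<phi> x) \<longlonglongrightarrow> (LINT x|lebesgue. f' x \<bullet> \<phi> x)"
    if h: "\<And>n. sqint (f n)" "sqint f'" "\<And>n x. x \<notin> S \<Longrightarrow> f n x = 0" "\<And>x. x \<notin> S \<Longrightarrow> f' x = 0"
      "(\<lambda>n. cls (f n)) \<longlonglongrightarrow> cls f'" "continuous_on UNIV \<phi>" for f f' and \<phi> :: "real^3 \<Rightarrow> complex^3"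
  proof -
    obtain \<psi> where \<psi>: "sqint \<psi>" "\<And>x. x \<in> S \<Longrightarrow> \<psi> x = \<phi> x"
      by (rule test_restrict[where w = f', OF S(1) h(4) h(6) bounded_bilinear_inner]) (assumption | rule that)+
    have "u x \<bullet> \<phi> x = u x \<bullet> \<psi> x" if "\<And>x. x \<notin> S \<Longrightarrow> u x = 0" for u x
      using that[of x] \<psi>(2)[of x] by (cases "x \<in> S") auto
    then have "(LINT x|lebesgue. f n x \<bullet> \<phi> x) = cls (f n) \<bullet> cls \<psi>" "(LINT x|lebesgue. f' x \<bullet> \<phi> x) = cls f' \<bullet> cls \<psi>" for n
      using h \<psi>(1) by (simp_all add: inner_cls)
    then show ?thesis using tendsto_inner[OF h(5) tendsto_const] by simp
  qed
  have "curl_pair S w' c'" unfolding curl_pair_def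
  proof (intro conjI ballI w'(1) c'(1))
    fix \<phi> :: "real^3 \<Rightarrow> complex^3" assume \<phi>: "\<phi> \<in> C_inf"
    have "(\<lambda>n. LINT x|lebesgue. w n x \<bullet> smooth_curl \<phi> x) \<longlonglongrightarrow> (LINT x|lebesgue. w' x \<bullet> smooth_curl \<phi> x)"
      using lim w' by (intro pass s z continuous_smooth_curl \<phi>) auto
    moreover have "(\<lambda>n. LINT x|lebesgue. c n x \<bullet> \<phi> x) \<longlonglongrightarrow> (LINT x|lebesgue. c' x \<bullet> \<phi> x)"
      using lim c' by (intro pass s z C_inf_continuous \<phi>) auto
    moreover have "(LINT x|lebesgue. w n x \<bullet> smooth_curl \<phi> x) = (LINT x|lebesgue. c n x \<bullet> \<phi> x)" for n
      using wc[of n] \<phi> by (simp add: curl_pair_def)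
    ultimately show "(LINT x|lebesgue. w' x \<bullet> smooth_curl \<phi> x) = (LINT x|lebesgue. c' x \<bullet> \<phi> x)"
      using LIMSEQ_unique by simp
  qed (use w' c' in auto)
  moreover have "l = (cls w', cls c')" by (simp add: prod_eq_iff w'(2) c'(2))
  ultimately show "l \<in> curl_graph S" unfolding curl_graph_def by blast
qed

section \<open>Gradients and cutoff functions\<close>

definition grad :: "(real^3 \<Rightarrow> real) \<Rightarrow> real^3 \<Rightarrow> real^3" where
  "grad \<beta> x = (\<chi> i. pderiv_at i \<beta> x)"

lemma grad_eq_sum: "grad \<beta> x = (\<Sum>i\<in>UNIV. pderiv_at i \<beta> x *\<^sub>R axis i 1)"
  by (simp add: grad_def vec_eq_iff axis_def if_distrib cong: if_cong)

lemma grad_continuous: "\<beta> \<in> C_inf \<Longrightarrow> continuous_on UNIV (grad \<beta>)"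
  unfolding grad_eq_sum[abs_def]
  by (intro continuous_intros C_inf_continuous C_inf_pderiv)

lemma grad_locally_constant:
  assumes "open U" "\<And>x. x \<in> U \<Longrightarrow> \<beta> x = a" "x \<in> U"
  shows "grad \<beta> x = 0"
proof -
  have "((\<lambda>x. a) has_derivative (\<lambda>h. 0)) (at x)" by simp
  then have "(\<beta> has_derivative (\<lambda>h. 0)) (at x)"
    by (rule has_derivative_transform_within_open[OF _ assms(1)]) (use assms in auto)
  then show ?thesis by (simp add: grad_def vec_eq_iff pderiv_at_eq)
qed

lemma grad_eq_0: "closed T \<Longrightarrow> (\<And>x. x \<notin> T \<Longrightarrow> \<beta> x = 0) \<Longrightarrow> x \<notin> T \<Longrightarrow> grad \<beta> x = 0"
  by (rule grad_locally_constant[of "- T" \<beta> 0]) auto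

lemma smooth_curl_scale:
  assumes "\<beta> \<in> C_inf" "\<phi> \<in> C_inf"
  shows "smooth_curl (\<lambda>x. \<beta> x *\<^sub>R \<phi> x) x = \<beta> x *\<^sub>R smooth_curl \<phi> x + ccross (grad \<beta> x) (\<phi> x)"
proof -
  interpret C: bounded_bilinear ccross by (rule bounded_bilinear_ccross)
  have "((\<lambda>x. \<beta> x *\<^sub>R \<phi> x) has_derivative
      (\<lambda>h. \<beta> x *\<^sub>R frechet_derivative \<phi> (at x) h + frechet_derivative \<beta> (at x) h *\<^sub>R \<phi> x)) (at x)"
    using C_inf_differentiable[OF assms(1), of x] C_inf_differentiable[OF assms(2), of x]
    by (intro has_derivative_scaleR) (auto simp: frechet_derivative_works[symmetric])
  then have "pderiv_at i (\<lambda>x. \<beta> x *\<^sub>R \<phi> x) x = \<beta> x *\<^sub>R pderiv_at i \<phi> x + pderiv_at i \<beta> x *\<^sub>R \<phi> x" for i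
    by (subst pderiv_at_eq) (auto simp: pderiv_at_def)
  then show ?thesis
    unfolding smooth_curl_eq grad_eq_sum
    by (simp add: C.add_right C.scaleR_right C.sum_left C.scaleR_left sum.distrib scaleR_sum_right)
qed

lemma sqint_bilinear_bounded:
  fixes w :: "'a::euclidean_space \<Rightarrow> 'b::euclidean_space" and p :: "'c::euclidean_space \<Rightarrow> 'b \<Rightarrow> 'd::euclidean_space"
  assumes w: "sqint w" "bounded S" "\<And>x. x \<notin> S \<Longrightarrow> w x = 0" and p: "bounded_bilinear p" and g: "continuous_on UNIV g"
  shows "sqint (\<lambda>x. p (g x) (w x))"
proof -
  interpret bounded_bilinear p by fact
  obtain K where K: "\<And>a b. norm (p a b) \<le> norm a * norm b * K" "K > 0"
    using pos_bounded by blast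
  obtain R where R: "S \<subseteq> cball 0 R" using bounded_subset_ballD[OF w(2), of 0] ball_subset_cball by blast
  have "compact (g ` cball 0 R)"
    by (intro compact_continuous_image continuous_on_subset[OF g]) auto
  then obtain B where B: "\<And>x. x \<in> cball 0 R \<Longrightarrow> norm (g x) \<le> B"
    using compact_imp_bounded[of "g ` cball 0 R"] unfolding bounded_iff by blast
  show ?thesis
  proof (rule sqint_bound)
    have "continuous_on UNIV (\<lambda>z. p (fst z) (snd z))"
      by (intro continuous_on continuous_intros)
    from measurable_compose[OF _ borel_measurable_continuous_onI[OF this], of "\<lambda>x. (g x, w x)" lebesgue]
    show "(\<lambda>x. p (g x) (w x)) \<in> borel_measurable lebesgue"
      using w(1) g
      by (simp add: sqint_def borel_measurable_Pair measurable_completion borel_measurable_continuous_onI)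
    show "integrable lebesgue (\<lambda>x. (B * K)\<^sup>2 * (norm (w x))\<^sup>2)"
      using w(1) by (simp add: sqint_def)
    have "(norm (p (g x) (w x)))\<^sup>2 \<le> (B * K)\<^sup>2 * (norm (w x))\<^sup>2" for x
    proof (cases "x \<in> S")
      case True
      then have "norm (g x) \<le> B" using R B by blast
      then have "norm (g x) * norm (w x) * K \<le> B * norm (w x) * K"
        using K(2) by (intro mult_right_mono) auto
      with K(1)[of "g x" "w x"] have "norm (p (g x) (w x)) \<le> B * K * norm (w x)"
        by (simp add: mult_ac)
      from power_mono[OF this norm_ge_zero, of 2] show ?thesis by (simp add: power_mult_distrib)
    qed (simp add: w(3) zero_right)
    then show "AE x in lebesgue. (norm (p (g x) (w x)))\<^sup>2 \<le> (B * K)\<^sup>2 * (norm (w x))\<^sup>2" by simp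
  qed
qed

text \<open>The cutoff is moved onto the test field, where \<open>\<beta> curl \<phi> = curl
  (\<beta> \<phi>) - grad \<beta> \<times> \<phi>\<close> holds classically; the last term, moved
  back, is the product rule's contribution to the curl.\<close>

lemma curl_pair_cutoff:
  assumes wc: "curl_pair S w c" and S: "bounded S" and \<beta>: "\<beta> \<in> C_inf" "closed T" "\<And>x. x \<notin> T \<Longrightarrow> \<beta> x = 0"
  shows "curl_pair (S \<inter> T) (\<lambda>x. \<beta> x *\<^sub>R w x) (\<lambda>x. \<beta> x *\<^sub>R c x + ccross (grad \<beta> x) (w x))"
  unfolding curl_pair_def
proof (intro conjI ballI)
  interpret C: bounded_bilinear ccross by (rule bounded_bilinear_ccross)
  have s: "sqint w" "sqint c" "\<And>x. x \<notin> S \<Longrightarrow> w x = 0" "\<And>x. x \<notin> S \<Longrightarrow> c x = 0"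
    using wc by (auto simp: curl_pair_def)
  note \<beta>c = C_inf_continuous[OF \<beta>(1)]
  show 1: "sqint (\<lambda>x. \<beta> x *\<^sub>R w x)"
    by (rule sqint_bilinear_bounded[OF s(1) S s(3) bounded_bilinear_scaleR \<beta>c])
  have 2: "sqint (\<lambda>x. \<beta> x *\<^sub>R c x)"
    by (rule sqint_bilinear_bounded[OF s(2) S s(4) bounded_bilinear_scaleR \<beta>c])
  have 3: "sqint (\<lambda>x. ccross (grad \<beta> x) (w x))"
    by (rule sqint_bilinear_bounded[OF s(1) S s(3) bounded_bilinear_ccross grad_continuous[OF \<beta>(1)]])
  show "sqint (\<lambda>x. \<beta> x *\<^sub>R c x + ccross (grad \<beta> x) (w x))" by (rule sqint_add[OF 2 3])
  show "\<forall>x. x \<notin> S \<inter> T \<longrightarrow> \<beta> x *\<^sub>R w x = 0 \<and> \<beta> x *\<^sub>R c x + ccross (grad \<beta> x) (w x) = 0"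
    using s(3,4) \<beta>(3) grad_eq_0[OF \<beta>(2,3)] by (auto simp: C.zero_left C.zero_right)
  fix \<phi> :: "real^3 \<Rightarrow> complex^3" assume \<phi>: "\<phi> \<in> C_inf"
  have \<phi>\<beta>: "(\<lambda>x. \<beta> x *\<^sub>R \<phi> x) \<in> C_inf" by (rule C_inf_scaleR[OF \<beta>(1) \<phi>])
  have i1: "integrable lebesgue (\<lambda>x. w x \<bullet> smooth_curl (\<lambda>x. \<beta> x *\<^sub>R \<phi> x) x)"
    by (rule test_integrable_inner[OF s(1) S _ continuous_smooth_curl[OF \<phi>\<beta>]]) (rule s)
  have i2: "integrable lebesgue (\<lambda>x. w x \<bullet> ccross (grad \<beta> x) (\<phi> x))"
  proof (rule test_integrable_inner[OF s(1) S])
    show "continuous_on UNIV (\<lambda>x. ccross (grad \<beta> x) (\<phi> x))"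
      by (intro C.continuous_on grad_continuous \<beta>(1) C_inf_continuous \<phi>)
  qed (rule s)
  have i3: "integrable lebesgue (\<lambda>x. c x \<bullet> (\<beta> x *\<^sub>R \<phi> x))"
    by (rule test_integrable_inner[OF s(2) S _ C_inf_continuous[OF \<phi>\<beta>]]) (rule s)
  have "(LINT x|lebesgue. (\<beta> x *\<^sub>R w x) \<bullet> smooth_curl \<phi> x) =
      (LINT x|lebesgue. w x \<bullet> smooth_curl (\<lambda>x. \<beta> x *\<^sub>R \<phi> x) x - w x \<bullet> ccross (grad \<beta> x) (\<phi> x))"
    by (simp add: smooth_curl_scale[OF \<beta>(1) \<phi>] inner_add_right)
  also have "\<dots> = (LINT x|lebesgue. c x \<bullet> (\<beta> x *\<^sub>R \<phi> x)) - (LINT x|lebesgue. w x \<bullet> ccross (grad \<beta> x) (\<phi> x))"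
    using wc \<phi>\<beta> i1 i2 by (simp add: curl_pair_def)
  also have "\<dots> = (LINT x|lebesgue. c x \<bullet> (\<beta> x *\<^sub>R \<phi> x) - w x \<bullet> ccross (grad \<beta> x) (\<phi> x))"
    using i2 i3 by simp
  also have "\<dots> = (LINT x|lebesgue. (\<beta> x *\<^sub>R c x + ccross (grad \<beta> x) (w x)) \<bullet> \<phi> x)"
    by (simp add: inner_add_left ccross_inner)
  finally show "(LINT x|lebesgue. (\<beta> x *\<^sub>R w x) \<bullet> smooth_curl \<phi> x) =
      (LINT x|lebesgue. (\<beta> x *\<^sub>R c x + ccross (grad \<beta> x) (w x)) \<bullet> \<phi> x)" .
qed

section \<open>Extension by zero\<close>

definition ext :: "'a set \<Rightarrow> ('a \<Rightarrow> 'b::real_normed_vector) \<Rightarrow> 'a \<Rightarrow> 'b" where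
  "ext S f x = indicator S x *\<^sub>R f x"

lemma ext_simps[simp]: "x \<in> S \<Longrightarrow> ext S f x = f x" "x \<notin> S \<Longrightarrow> ext S f x = 0"
  by (simp_all add: ext_def)

lemma integral_lebesgue_on:
  fixes f :: "'a::euclidean_space \<Rightarrow> 'b::euclidean_space"
  assumes "S \<in> sets lebesgue"
  shows "(LINT x|lebesgue_on S. f x) = (LINT x|lebesgue. ext S f x)"
  using assms by (simp add: integral_restrict_space ext_def)

lemma L2_iff_sqint:
  fixes f :: "real^3 \<Rightarrow> 'b::euclidean_space"
  assumes "S \<in> sets lebesgue"
  shows "f \<in> L2 S \<longleftrightarrow> sqint (ext S f)"
proof -
  have "(norm (ext S f x))\<^sup>2 = indicator S x *\<^sub>R (norm (f x))\<^sup>2" for x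
    by (simp add: ext_def indicator_def)
  then show ?thesis using assms
    by (simp add: L2_def sqint_def ext_def[abs_def] borel_measurable_restrict_space_iff integrable_restrict_space)
qed

lemma AE_lebesgue_on_iff:
  "S \<in> sets lebesgue \<Longrightarrow> (AE x in lebesgue_on S. Q x) \<longleftrightarrow> (AE x in lebesgue. x \<in> S \<longrightarrow> Q x)"
  by (simp add: AE_restrict_space_iff)

lemma sqint_indicator:
  assumes "sqint f" "A \<in> sets lebesgue"
  shows "sqint (\<lambda>x. indicator A x *\<^sub>R f x)"
proof (rule sqint_bound[OF _ sqint_integrable[OF assms(1)]])
  show "(\<lambda>x. indicator A x *\<^sub>R f x) \<in> borel_measurable lebesgue"
    using assms by (intro borel_measurable_scaleR) (auto simp: sqint_measurable)
qed (simp add: indicator_def)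

lemma norm_cls_mono:
  assumes "sqint f" "sqint g" "AE x in lebesgue. norm (f x) \<le> norm (g x)"
  shows "norm (cls f) \<le> norm (cls g)"
proof (rule power2_le_imp_le)
  show "(norm (cls f))\<^sup>2 \<le> (norm (cls g))\<^sup>2"
    unfolding norm_cls[OF assms(1)] norm_cls[OF assms(2)]
    using assms by (intro integral_mono_AE sqint_integrable) (auto elim!: eventually_mono intro: power_mono)
qed simp

lemma borel_representative_sqint:
  assumes "sqint f" "S \<in> sets borel" "\<And>x. x \<notin> S \<Longrightarrow> f x = 0"
  obtains g where "g \<in> borel_measurable borel" "sqint g" "AE x in lebesgue. f x = g x" "\<And>x. x \<notin> S \<Longrightarrow> g x = 0"
proof -
  obtain g where g: "g \<in> borel_measurable borel" "AE x in lebesgue. f x = g x"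
    using borel_representative[OF sqint_measurable[OF assms(1)]] by blast
  define g' where "g' x = indicator S x *\<^sub>R g x" for x
  have m: "g' \<in> borel_measurable borel"
    unfolding g'_def using g(1) assms(2) by (intro borel_measurable_scaleR) auto
  have AE: "AE x in lebesgue. f x = g' x"
    using g(2)
  proof eventually_elim
    case (elim x)
    then show ?case using assms(3)[of x] by (cases "x \<in> S") (auto simp: g'_def)
  qed
  have "sqint g'" by (rule sqint_cong_AE[OF assms(1) AE measurable_completion]) (use m in simp)
  with m AE that show ?thesis by (auto simp: g'_def)
qed

lemma mollify_integrable:
  fixes w :: "'a::euclidean_space \<Rightarrow> 'b::euclidean_space"
  assumes "w \<in> borel_measurable borel" "sqint w" "bounded S" "\<And>x. x \<notin> S \<Longrightarrow> w x = 0" "continuous_on UNIV k"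
  shows "integrable lborel (\<lambda>y. k (x - y) *\<^sub>R w y)"
proof -
  have c: "continuous_on UNIV (\<lambda>y. k (x - y))"
    by (intro continuous_on_compose2[OF assms(5)] continuous_intros) auto
  have "integrable lebesgue (\<lambda>y. k (x - y) *\<^sub>R w y)"
    using test_integrable[OF assms(2,3,4) c bounded_bilinear.flip[OF bounded_bilinear_scaleR]] .
  moreover have "(\<lambda>y. k (x - y) *\<^sub>R w y) \<in> borel_measurable borel"
    using assms(1) c by (intro borel_measurable_scaleR) (auto intro: borel_measurable_continuous_onI)
  ultimately show ?thesis by (simp add: integrable_completion)
qed

text \<open>Testing with translates of a kernel supported near \<open>0\<close> shows that the mollification of \<open>g\<close>
  vanishes away from the boundary; shrink the support.\<close>

lemma fundamental_lemma:
  fixes g :: "real^3 \<Rightarrow> complex^3"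
  assumes \<Omega>: "open \<Omega>" "bounded \<Omega>" and g: "sqint g" "\<And>x. x \<notin> \<Omega> \<Longrightarrow> g x = 0"
    and zero: "\<And>\<phi>. \<phi> \<in> C_inf_c \<Omega> \<Longrightarrow> (LINT x|lebesgue. cdot (g x) (\<phi> x)) = 0"
  shows "AE x in lebesgue. g x = 0"
proof -
  obtain g' where g': "g' \<in> borel_measurable borel" "sqint g'" "AE x in lebesgue. g x = g' x" "\<And>x. x \<notin> \<Omega> \<Longrightarrow> g' x = 0"
    by (rule borel_representative_sqint[where f = g, OF g(1) borel_open[OF \<Omega>(1)]], rule g(2), assumption)
      (rule that)
  define A where "A d = {x. infdist x (- \<Omega>) > d}" for d
  have A_open: "open (A d)" for d
    unfolding A_def by (intro open_Collect_less continuous_intros)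
  have A_sub: "cball x d \<subseteq> \<Omega>" if "x \<in> A d" for x d
  proof
    fix y assume "y \<in> cball x d"
    then show "y \<in> \<Omega>"
      using that infdist_le[of y "- \<Omega>" x] by (cases "y \<in> \<Omega>") (simp_all add: A_def)
  qed
  have van: "AE x in lebesgue. x \<in> A d \<longrightarrow> g' x = 0" if d: "d > 0" for d
  proof -
    let ?h = "\<lambda>x. indicator (A d) x *\<^sub>R g' x"
    have Am: "A d \<in> sets lebesgue" using A_open[of d] by simp
    have sh: "sqint ?h" by (rule sqint_indicator[OF g'(2) Am])
    have "norm (cls ?h) \<le> e" if e: "e > 0" for e
    proof -
      obtain t where t: "t > 0" "\<And>z. norm z < t \<Longrightarrow> norm (cls (\<lambda>x. g' (x - z)) - cls g') < e"
        using translation_small[OF g'(1,2) e] by blast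
      \<comment> \<open>Radius at most \<open>t\<close> keeps the mollification error below
        \<open>e\<close>; radius at most \<open>d\<close> keeps the reflected kernel at a point of
        \<open>A d\<close> supported in \<Omega>, so that it is an admissible test function.\<close>
      define r where "r = min t d"
      have r: "r > 0" using t d by (simp add: r_def)
      obtain k :: "real^3 \<Rightarrow> real" where k: "k \<in> C_inf" "\<And>x. k x \<ge> 0" "\<And>x. x \<notin> ball 0 r \<Longrightarrow> k x = 0"
        "integrable lborel k" "(LINT x|lborel. k x) = 1"
        by (rule smooth_kernel_exists[OF r, of 0]) (rule that)
      have "norm (cls (\<lambda>x. g' (x - z)) - cls g') \<le> e" if "k z \<noteq> 0" for z
      proof -
        have "norm z < t" using k(3)[of z] that by (auto simp: r_def)
        from t(2)[OF this] show ?thesis by simp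
      qed
      note m = mollify_approx[OF k(2,4,5) g'(1,2) this]
      have zero_on_A: "mollify k g' x = 0" if x: "x \<in> A d" for x
      proof -
        have int: "integrable lborel (\<lambda>y. k (x - y) *\<^sub>R g' y)"
          by (rule mollify_integrable[OF g'(1,2) \<Omega>(2) g'(4) C_inf_continuous[OF k(1)]])
        have "mollify k g' x $ i = 0" for i
        proof -
          \<comment> \<open>Testing with the reflected kernel times the \<open>i\<close>-th unit
            vector yields the \<open>i\<close>-th component of the mollification at
            \<open>x\<close>.\<close>
          define \<phi> :: "real^3 \<Rightarrow> complex^3" where "\<phi> y = k (x + (-1) *\<^sub>R y) *\<^sub>R axis i 1" for y
          have "\<phi> \<in> C_inf"
            unfolding \<phi>_def by (rule C_inf_scaleR[OF C_inf_affine[OF k(1)] C_inf_const])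
          moreover have "\<phi> y = 0" if "y \<notin> cball x d" for y
          proof -
            have "x - y \<notin> ball 0 r" using that by (simp add: r_def dist_norm norm_minus_commute[of y x])
            then have "k (x - y) = 0" by (rule k(3))
            then show ?thesis by (simp add: \<phi>_def)
          qed
          ultimately have "\<phi> \<in> C_inf_c \<Omega>"
            unfolding C_inf_c_def using A_sub[OF x] by (auto intro!: exI[of _ "cball x d"])
          then have "(LINT y|lebesgue. cdot (g y) (\<phi> y)) = 0" by (rule zero)
          also have "(LINT y|lebesgue. cdot (g y) (\<phi> y)) = (LINT y|lebesgue. k (x - y) *\<^sub>R g' y $ i)"
          proof (rule integral_cong_AE)
            have *: "cdot a (\<phi> y) = k (x - y) *\<^sub>R a $ i" for a y
              by (simp add: cdot_def \<phi>_def axis_def if_distrib scaleR_conv_of_real[where 'a = complex] mult.commute cong: if_cong)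
            have c: "continuous_on UNIV (\<lambda>y. k (x - y))"
              by (intro continuous_on_compose2[OF C_inf_continuous[OF k(1), of UNIV]] continuous_intros) auto
            have km: "(\<lambda>y. k (x - y)) \<in> borel_measurable lebesgue"
              using c by (simp add: measurable_completion borel_measurable_continuous_onI)
            have nm: "(\<lambda>y. u y $ i) \<in> borel_measurable lebesgue" if "sqint u" for u :: "real^3 \<Rightarrow> complex^3"
              using measurable_compose[OF sqint_measurable[OF that]
                  borel_measurable_continuous_onI[OF linear_continuous_on[OF bounded_linear_vec_nth]]] .
            show "(\<lambda>y. cdot (g y) (\<phi> y)) \<in> borel_measurable lebesgue"
              unfolding * by (intro borel_measurable_scaleR km nm g)
            show "(\<lambda>y. k (x - y) *\<^sub>R g' y $ i) \<in> borel_measurable lebesgue"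
              by (intro borel_measurable_scaleR km nm g')
            show "AE y in lebesgue. cdot (g y) (\<phi> y) = k (x - y) *\<^sub>R g' y $ i"
              using g'(3) by eventually_elim (simp add: *)
          qed
          also have "\<dots> = (LINT y|lborel. (k (x - y) *\<^sub>R g' y) $ i)"
            using measurable_compose[OF borel_measurable_integrable[OF int]
                borel_measurable_continuous_onI[OF linear_continuous_on[OF bounded_linear_vec_nth]], of i]
            by (simp add: integral_completion)
          also have "\<dots> = mollify k g' x $ i"
            unfolding mollify_def by (rule integral_bounded_linear[OF bounded_linear_vec_nth int])
          finally show ?thesis by simp
        qed
        then show ?thesis by (simp add: vec_eq_iff)
      qed
      have "norm (cls ?h) \<le> norm (cls (\<lambda>x. mollify k g' x - g' x))"
      proof (rule norm_cls_mono[OF sh])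
        show "sqint (\<lambda>x. mollify k g' x - g' x)" by (rule sqint_diff[OF m(2) g'(2)])
        have "norm (?h x) \<le> norm (mollify k g' x - g' x)" for x
          using zero_on_A[of x] by (cases "x \<in> A d") auto
        then show "AE x in lebesgue. norm (?h x) \<le> norm (mollify k g' x - g' x)" by simp
      qed
      also have "\<dots> \<le> e" using m(3) by (simp add: cls_diff[OF m(2) g'(2)])
      finally show ?thesis .
    qed
    then have "norm (cls ?h) \<le> 0 + e" if "e > 0" for e using that by simp
    then have "norm (cls ?h) \<le> 0" by (rule field_le_epsilon)
    then have "cls ?h = 0" by (simp only: norm_le_zero_iff)
    then have "cls ?h = cls (\<lambda>x. 0)" by (simp only: zero_cls)
    then have "AE x in lebesgue. ?h x = 0" using cls_eq_iff[OF sh sqint_0] by blast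
    then show ?thesis by eventually_elim (auto simp: indicator_def split: if_splits)
  qed
  \<comment> \<open>The sets \<open>A (1 / (n + 1))\<close> exhaust the open set \<Omega>, whose
    complement is closed and nonempty.\<close>
  have "AE x in lebesgue. \<forall>n. x \<in> A (1 / real (Suc n)) \<longrightarrow> g' x = 0"
    unfolding AE_all_countable using van by auto
  then show ?thesis
    using g'(3)
  proof eventually_elim
    case (elim x)
    show ?case
    proof (cases "x \<in> \<Omega>")
      case True
      have "\<Omega> \<noteq> UNIV" using \<Omega>(2) not_bounded_UNIV[where 'a = "real^3"] by blast
      then have "- \<Omega> \<noteq> {}" by blast
      then have "infdist x (- \<Omega>) > 0"
        using True \<Omega>(1) in_closed_iff_infdist_zero[of "- \<Omega>" x] infdist_nonneg[of x "- \<Omega>"]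
        by (metis Compl_iff closed_Compl less_eq_real_def)
      then obtain n where "1 / real (Suc n) < infdist x (- \<Omega>)" by (rule nat_approx_posE)
      then have "x \<in> A (1 / real (Suc n))" by (simp add: A_def)
      then have "g' x = 0" using elim(1) by blast
      then show ?thesis using elim(2) by (simp only:)
    next
      case False
      then show ?thesis by (rule g(2))
    qed
  qed
qed

section \<open>The space \<open>H\<^sub>0(curl)\<close> as a closed graph\<close>

lemma curl_weak:
  assumes "w \<in> H_curl \<Omega>"
  shows "curl \<Omega> w \<in> L2 \<Omega>" "has_weak_curl \<Omega> w (curl \<Omega> w)"
proof -
  have "\<exists>c. c \<in> L2 \<Omega> \<and> has_weak_curl \<Omega> w c" using assms by (auto simp: H_curl_def)
  from someI_ex[OF this] show "curl \<Omega> w \<in> L2 \<Omega>" "has_weak_curl \<Omega> w (curl \<Omega> w)"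
    by (simp_all add: curl_def)
qed

lemma ext_cdot: "ext S (\<lambda>x. cdot (f x) (g x)) x = cdot (ext S f x) (g x)"
  by (simp add: ext_def indicator_def cdot_def)

lemma H0_curl_imp_pair:
  assumes \<Omega>: "open \<Omega>" "bounded \<Omega>" and w: "w \<in> H0_curl \<Omega>"
  shows "curl_pair \<Omega> (ext \<Omega> w) (ext \<Omega> (curl \<Omega> w))"
proof -
  have m: "\<Omega> \<in> sets lebesgue" using \<Omega> by simp
  have H: "w \<in> H_curl \<Omega>" using w by (simp add: H0_curl_def)
  have s: "sqint (ext \<Omega> w)" "sqint (ext \<Omega> (curl \<Omega> w))"
    using H curl_weak(1)[OF H] by (auto simp: L2_iff_sqint[OF m, symmetric] H_curl_def)
  show ?thesis
  proof (subst curl_pair_iff_cdot[OF \<Omega>(2) _ s], simp, intro ballI)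
    fix \<phi> :: "real^3 \<Rightarrow> complex^3" assume "\<phi> \<in> C_inf"
    then have "tangential_trace \<Omega> w \<phi> = 0" using w by (simp add: H0_curl_def)
    then show "(LINT x|lebesgue. cdot (ext \<Omega> w x) (smooth_curl \<phi> x)) = (LINT x|lebesgue. cdot (ext \<Omega> (curl \<Omega> w) x) (\<phi> x))"
      by (simp add: tangential_trace_def integral_lebesgue_on[OF m] ext_cdot[abs_def])
  qed
qed

text \<open>Testing with compactly supported fields only, \<open>c\<close> is a weak curl, and the
  fundamental lemma identifies it with the representative chosen by \<open>curl\<close>. The
  remaining test fields then say that the trace vanishes.\<close>

lemma pair_imp_H0_curl:
  assumes \<Omega>: "open \<Omega>" "bounded \<Omega>" and wc: "curl_pair \<Omega> (ext \<Omega> w) c"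
  shows "w \<in> H0_curl \<Omega>" "AE x in lebesgue. ext \<Omega> (curl \<Omega> w) x = c x"
proof -
  have m: "\<Omega> \<in> sets lebesgue" using \<Omega> by simp
  have s: "sqint (ext \<Omega> w)" "sqint c" and c0: "\<And>x. x \<notin> \<Omega> \<Longrightarrow> c x = 0"
    using wc by (auto simp: curl_pair_def)
  have ec: "ext \<Omega> c = c" using c0 by (auto simp: ext_def indicator_def fun_eq_iff)
  have eq: "(LINT x|lebesgue. cdot (ext \<Omega> w x) (smooth_curl \<phi> x)) = (LINT x|lebesgue. cdot (c x) (\<phi> x))"
    if "\<phi> \<in> C_inf" for \<phi>
    using wc that curl_pair_iff_cdot[OF \<Omega>(2) _ s] c0 by auto
  have wk: "has_weak_curl \<Omega> w c"
    using eq by (simp add: has_weak_curl_def C_inf_c_def integral_lebesgue_on[OF m] ext_cdot[abs_def] ec)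
  have L2: "w \<in> L2 \<Omega>" "c \<in> L2 \<Omega>" using s by (simp_all add: L2_iff_sqint[OF m] ec)
  then have H: "w \<in> H_curl \<Omega>" using wk by (auto simp: H_curl_def)
  note cu = curl_weak[OF H]
  let ?c = "ext \<Omega> (curl \<Omega> w)"
  have s': "sqint ?c" using cu(1) by (simp add: L2_iff_sqint[OF m])
  have i: "integrable lebesgue (\<lambda>x. cdot (u x) (\<phi> x))"
    if "sqint u" "\<And>x. x \<notin> \<Omega> \<Longrightarrow> u x = 0" "\<phi> \<in> C_inf" for u \<phi>
    by (rule test_integrable[OF that(1) \<Omega>(2) _ C_inf_continuous[OF that(3)] bounded_bilinear_cdot]) (rule that)
  have "AE x in lebesgue. ?c x - c x = 0"
  proof (rule fundamental_lemma[OF \<Omega> sqint_diff[OF s' s(2)]])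
    fix \<phi> :: "real^3 \<Rightarrow> complex^3" assume \<phi>: "\<phi> \<in> C_inf_c \<Omega>"
    then have \<phi>': "\<phi> \<in> C_inf" by (simp add: C_inf_c_def)
    have "(LINT x|lebesgue. cdot (?c x) (\<phi> x)) = (LINT x|lebesgue. cdot (c x) (\<phi> x))"
      using cu(2) wk \<phi> by (simp add: has_weak_curl_def integral_lebesgue_on[OF m] ext_cdot[abs_def] ec)
    then show "(LINT x|lebesgue. cdot (?c x - c x) (\<phi> x)) = 0"
      using i[OF s' _ \<phi>'] i[OF s(2) c0 \<phi>']
      by (simp add: bounded_bilinear.diff_left[OF bounded_bilinear_cdot])
  qed (simp add: c0)
  then show AE: "AE x in lebesgue. ?c x = c x" by eventually_elim simp
  have "tangential_trace \<Omega> w \<phi> = 0" if \<phi>: "\<phi> \<in> C_inf" for \<phi>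
  proof -
    have "(LINT x|lebesgue. cdot (?c x) (\<phi> x)) = (LINT x|lebesgue. cdot (c x) (\<phi> x))"
      by (rule integral_cong_AE)
         (use AE i[OF s' _ \<phi>] i[OF s(2) c0 \<phi>] in \<open>auto elim!: eventually_mono\<close>)
    then show ?thesis
      using eq[OF \<phi>] by (simp add: tangential_trace_def integral_lebesgue_on[OF m] ext_cdot[abs_def])
  qed
  then show "w \<in> H0_curl \<Omega>" using H by (simp add: H0_curl_def)
qed

text \<open>The embedding into the product space: the product norm of the image is the graph norm of
  H(curl), so one limit controls the field and its curl.\<close>

definition state_vec :: "(real^3) set \<Rightarrow> (real^3 \<Rightarrow> complex^3) \<Rightarrow> (real^3, complex^3) l2 \<times> (real^3, complex^3) l2" where
  "state_vec \<Omega> w = (cls (ext \<Omega> w), cls (ext \<Omega> (curl \<Omega> w)))"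

lemma state_vec_pair:
  assumes \<Omega>: "open \<Omega>" "bounded \<Omega>" and wc: "curl_pair \<Omega> (ext \<Omega> w) c"
  shows "w \<in> H0_curl \<Omega>" "state_vec \<Omega> w = (cls (ext \<Omega> w), cls c)"
proof -
  show w: "w \<in> H0_curl \<Omega>" by (rule pair_imp_H0_curl[OF assms])
  have "sqint (ext \<Omega> (curl \<Omega> w))" "sqint c"
    using H0_curl_imp_pair[OF \<Omega> w] wc by (auto simp: curl_pair_def)
  then show "state_vec \<Omega> w = (cls (ext \<Omega> w), cls c)"
    using pair_imp_H0_curl(2)[OF assms] by (simp add: state_vec_def cls_eq_iff)
qed

lemma curl_graph_eq:
  assumes \<Omega>: "open \<Omega>" "bounded \<Omega>"
  shows "curl_graph \<Omega> = state_vec \<Omega> ` H0_curl \<Omega>"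
proof (intro equalityI subsetI)
  fix x assume "x \<in> curl_graph \<Omega>"
  then obtain w c where *: "x = (cls w, cls c)" "curl_pair \<Omega> w c" by (auto simp: curl_graph_def)
  have "ext \<Omega> w = w" using *(2) by (auto simp: curl_pair_def ext_def indicator_def fun_eq_iff)
  with state_vec_pair[OF \<Omega>, of w c] * show "x \<in> state_vec \<Omega> ` H0_curl \<Omega>"
    by (metis image_eqI)
next
  fix x assume "x \<in> state_vec \<Omega> ` H0_curl \<Omega>"
  then show "x \<in> curl_graph \<Omega>"
    using H0_curl_imp_pair[OF \<Omega>] by (auto simp: curl_graph_def state_vec_def)
qed

section \<open>Density of compactly supported fields\<close>

lemma C_inf_onorm_le:
  assumes "g \<in> C_inf" "\<And>i. norm (pderiv_at i g x) \<le> B"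
  shows "onorm (\<lambda>h. \<Sum>i\<in>UNIV. (h $ i) *\<^sub>R pderiv_at i g x) \<le> 3 * B"
proof (rule onorm_le)
  fix h :: "real^3"
  have "norm (\<Sum>i\<in>UNIV. (h $ i) *\<^sub>R pderiv_at i g x) \<le> (\<Sum>i\<in>(UNIV :: 3 set). norm h * B)"
    using assms(2) by (intro sum_norm_le) (auto intro!: mult_mono component_le_norm_cart)
  then show "norm (\<Sum>i\<in>UNIV. (h $ i) *\<^sub>R pderiv_at i g x) \<le> 3 * B * norm h" by (simp add: mult_ac)
qed

lemma C_inf_lipschitz:
  fixes g :: "real^3 \<Rightarrow> real"
  assumes g: "g \<in> C_inf" "compact T" "\<And>x. x \<notin> T \<Longrightarrow> g x = 0"
  obtains L where "L \<ge> 0" "\<And>x y. \<bar>g x - g y\<bar> \<le> L * norm (x - y)"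
proof -
  have bdd: "\<exists>B. \<forall>x. norm (pderiv_at i g x) \<le> B" for i
  proof -
    have "compact (pderiv_at i g ` T)"
      by (intro compact_continuous_image C_inf_continuous C_inf_pderiv g)
    from compact_imp_bounded[OF this] obtain B where B: "\<forall>y\<in>pderiv_at i g ` T. norm y \<le> B"
      unfolding bounded_iff by blast
    have "norm (pderiv_at i g x) \<le> max B 0" for x
    proof (cases "x \<in> T")
      case False
      then have "grad g x = 0" using grad_eq_0[of T g x] g compact_imp_closed by blast
      then have "pderiv_at i g x = 0" by (simp add: grad_def vec_eq_iff)
      then show ?thesis by simp
    qed (use B in force)
    then show ?thesis by blast
  qed
  then obtain B where B: "\<And>i x. norm (pderiv_at i g x) \<le> B i" by metis
  define M where "M = Max (range B)"
  have M: "norm (pderiv_at i g x) \<le> M" for i x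
    unfolding M_def by (rule order_trans[OF B Max_ge]) auto
  have "M \<ge> 0" using M[of 1 0] norm_ge_zero order_trans by blast
  have "norm (g x - g y) \<le> 3 * M * norm (x - y)" for x y
    by (rule differentiable_bound[where S = UNIV and f' = "\<lambda>x h. \<Sum>i\<in>UNIV. (h $ i) *\<^sub>R pderiv_at i g x"])
       (use C_inf_has_derivative[OF g(1)] C_inf_onorm_le[OF g(1) M] in auto)
  with \<open>M \<ge> 0\<close> that[of "3 * M"] show ?thesis by simp
qed

text \<open>The partial derivatives have compact support and hence are Lipschitz. So the remainder
  as a function of the increment has derivative at most \<open>M |h|\<close> on the ball of radius
  \<open>|h|\<close>, and the mean value inequality gives the second factor
  \<open>|h|\<close>.\<close>

lemma C_inf_taylor:
  fixes g :: "real^3 \<Rightarrow> real"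
  assumes g: "g \<in> C_inf" "compact T" "\<And>x. x \<notin> T \<Longrightarrow> g x = 0"
  obtains M where "M \<ge> 0" "\<And>x h. \<bar>g (x + h) - g x - (\<Sum>i\<in>UNIV. (h $ i) * pderiv_at i g x)\<bar> \<le> M * (norm h)\<^sup>2"
proof -
  have "\<exists>L\<ge>0. \<forall>x y. \<bar>pderiv_at i g x - pderiv_at i g y\<bar> \<le> L * norm (x - y)" for i
  proof -
    have "pderiv_at i g x = 0" if "x \<notin> T" for x
    proof -
      have "grad g x = 0" using grad_eq_0[of T g x] g that compact_imp_closed by blast
      then show ?thesis by (simp add: grad_def vec_eq_iff)
    qed
    from C_inf_lipschitz[OF C_inf_pderiv[OF g(1)] g(2) this] show ?thesis by metis
  qed
  then obtain L where L: "\<And>i. L i \<ge> 0" "\<And>i x y. \<bar>pderiv_at i g x - pderiv_at i g y\<bar> \<le> L i * norm (x - y)"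
    by metis
  define M where "M = sum L UNIV"
  have "M \<ge> 0" unfolding M_def using L by (intro sum_nonneg) auto
  have "\<bar>g (x + h) - g x - (\<Sum>i\<in>UNIV. (h $ i) * pderiv_at i g x)\<bar> \<le> M * (norm h)\<^sup>2" for x h
  proof -
    define G where "G u = g (x + u) - (\<Sum>i\<in>UNIV. (u $ i) * pderiv_at i g x)" for u :: "real^3"
    define G' where "G' u k = (\<Sum>i\<in>UNIV. (k $ i) * (pderiv_at i g (x + u) - pderiv_at i g x))" for u k :: "real^3"
    have "norm (G h - G 0) \<le> (M * norm h) * norm (h - 0)"
    proof (rule differentiable_bound[where S = "cball 0 (norm h)" and f' = G'])
      fix u :: "real^3" assume u: "u \<in> cball 0 (norm h)"
      have "(g has_derivative (\<lambda>k. \<Sum>i\<in>UNIV. (k $ i) *\<^sub>R pderiv_at i g (x + u))) (at (x + u))"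
        by (rule C_inf_has_derivative[OF g(1)])
      then have "((\<lambda>u :: real^3. g (x + u)) has_derivative (\<lambda>k. \<Sum>i\<in>UNIV. (k $ i) *\<^sub>R pderiv_at i g (x + u))) (at u)"
        by (intro has_derivative_compose[where f = "\<lambda>u. x + u" and f' = "\<lambda>k. k" and g = g])
           (auto intro!: derivative_eq_intros)
      moreover have "bounded_linear (\<lambda>u :: real^3. \<Sum>i\<in>UNIV. (u $ i) * pderiv_at i g x)"
        by (intro bounded_linear_sum bounded_linear_compose[OF bounded_linear_mult_left bounded_linear_vec_nth])
      from has_derivative_diff[OF calculation bounded_linear_imp_has_derivative[OF this]]
      have "(G has_derivative G' u) (at u)"
        by (simp add: G_def[abs_def] G'_def[abs_def] sum_subtractf right_diff_distrib)
      then show "(G has_derivative G' u) (at u within cball 0 (norm h))"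
        by (rule has_derivative_at_withinI)
      show "onorm (G' u) \<le> M * norm h"
      proof (rule onorm_le)
        fix k :: "real^3"
        have "norm (G' u k) \<le> (\<Sum>i\<in>UNIV. norm k * (L i * norm h))"
          unfolding G'_def
        proof (rule sum_norm_le)
          fix i :: 3
          have "\<bar>pderiv_at i g (x + u) - pderiv_at i g x\<bar> \<le> L i * norm u" using L(2)[of i "x + u" x] by simp
          also have "\<dots> \<le> L i * norm h" using u L(1) by (intro mult_left_mono) auto
          finally show "norm ((k $ i) * (pderiv_at i g (x + u) - pderiv_at i g x)) \<le> norm k * (L i * norm h)"
            unfolding norm_mult by (intro mult_mono) (simp_all add: component_le_norm_cart)
        qed
        also have "\<dots> = M * norm h * norm k"
          by (simp add: M_def sum_distrib_left sum_distrib_right mult_ac)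
        finally show "norm (G' u k) \<le> M * norm h * norm k" .
      qed
    qed auto
    then show ?thesis by (simp add: G_def power2_eq_square mult_ac algebra_simps)
  qed
  with \<open>M \<ge> 0\<close> that show ?thesis by blast
qed

text \<open>A Taylor expansion with uniform constants is all that the interpolation estimate needs;
  \<open>c\<close> plays the role of the curl of \<open>v\<close>.\<close>

definition nice_field :: "(real^3) set \<Rightarrow> (real^3 \<Rightarrow> complex^3) \<Rightarrow> (real^3 \<Rightarrow> complex^3) \<Rightarrow> bool" where
  "nice_field \<Omega> v c \<longleftrightarrow> sqint v \<and> sqint c \<and>
     (\<exists>K. compact K \<and> K \<subseteq> \<Omega> \<and> (\<forall>x. x \<notin> K \<longrightarrow> v x = 0 \<and> c x = 0)) \<and>
     (\<exists>L\<ge>0. \<forall>x y. norm (v x - v y) \<le> L * norm (x - y)) \<and>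
     (\<exists>M\<ge>0. \<exists>D. \<forall>x. (\<forall>h. norm (v (x + h) - v x - (\<Sum>i\<in>UNIV. (h $ i) *\<^sub>R D x i)) \<le> M * (norm h)\<^sup>2)
        \<and> c x = (\<Sum>i\<in>UNIV. ccross (axis i 1) (D x i)))"

lemma nice_fieldE:
  assumes "nice_field \<Omega> v c"
  obtains K L M D where "sqint v" "sqint c" "compact K" "K \<subseteq> \<Omega>" "\<And>x. x \<notin> K \<Longrightarrow> v x = 0 \<and> c x = 0"
    "L \<ge> 0" "\<And>x y. norm (v x - v y) \<le> L * norm (x - y)" "M \<ge> 0"
    "\<And>x h. norm (v (x + h) - v x - (\<Sum>i\<in>UNIV. (h $ i) *\<^sub>R D x i)) \<le> M * (norm h)\<^sup>2"
    "\<And>x. c x = (\<Sum>i\<in>UNIV. ccross (axis i 1) (D x i))"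
proof -
  note n = assms[unfolded nice_field_def]
  from n[THEN conjunct2, THEN conjunct2, THEN conjunct1] obtain K
    where K: "compact K" "K \<subseteq> \<Omega>" "\<forall>x. x \<notin> K \<longrightarrow> v x = 0 \<and> c x = 0" by (elim exE conjE)
  from n[THEN conjunct2, THEN conjunct2, THEN conjunct2, THEN conjunct1] obtain L
    where L: "L \<ge> 0" "\<forall>x y. norm (v x - v y) \<le> L * norm (x - y)" by (elim exE conjE)
  from n[THEN conjunct2, THEN conjunct2, THEN conjunct2, THEN conjunct2] obtain M D
    where M: "M \<ge> 0" "\<forall>x. (\<forall>h. norm (v (x + h) - v x - (\<Sum>i\<in>UNIV. (h $ i) *\<^sub>R D x i)) \<le> M * (norm h)\<^sup>2)
        \<and> c x = (\<Sum>i\<in>UNIV. ccross (axis i 1) (D x i))" by (elim exE conjE)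
  show ?thesis
    by (rule that[OF n[THEN conjunct1] n[THEN conjunct2, THEN conjunct1] K(1,2) _ L(1) L(2)[rule_format] M(1)
          M(2)[rule_format, THEN conjunct1, rule_format] M(2)[rule_format, THEN conjunct2]])
       (use K(3) in blast)
qed

lemma nice_fieldI:
  assumes "sqint v" "sqint c" "compact K" "K \<subseteq> \<Omega>" "\<And>x. x \<notin> K \<Longrightarrow> v x = 0 \<and> c x = 0"
    "L \<ge> 0" "\<And>x y. norm (v x - v y) \<le> L * norm (x - y)" "M \<ge> 0"
    "\<And>x h. norm (v (x + h) - v x - (\<Sum>i\<in>UNIV. (h $ i) *\<^sub>R D x i)) \<le> M * (norm h)\<^sup>2"
    "\<And>x. c x = (\<Sum>i\<in>UNIV. ccross (axis i 1) (D x i))"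
  shows "nice_field \<Omega> v c"
proof -
  have "\<exists>K. compact K \<and> K \<subseteq> \<Omega> \<and> (\<forall>x. x \<notin> K \<longrightarrow> v x = 0 \<and> c x = 0)"
    using assms(3-5) by (intro exI[of _ K]) auto
  moreover have "\<exists>L\<ge>0. \<forall>x y. norm (v x - v y) \<le> L * norm (x - y)"
    using assms(6,7) by (intro exI[of _ L]) auto
  moreover have "\<forall>x. (\<forall>h. norm (v (x + h) - v x - (\<Sum>i\<in>UNIV. (h $ i) *\<^sub>R D x i)) \<le> M * (norm h)\<^sup>2)
        \<and> c x = (\<Sum>i\<in>UNIV. ccross (axis i 1) (D x i))"
    by (intro allI conjI assms(9,10))
  ultimately show ?thesis
    unfolding nice_field_def using assms(1,2,8) by (intro conjI) (assumption | rule exI conjI)+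
qed

lemma nice_field_0: "nice_field \<Omega> (\<lambda>x. 0) (\<lambda>x. 0)"
  by (rule nice_fieldI[where K = "{}" and L = 0 and M = 0 and D = "\<lambda>x i. 0"])
     (auto simp: sqint_0 bounded_bilinear.zero_right[OF bounded_bilinear_ccross])

lemma nice_field_add:
  assumes "nice_field \<Omega> v c" "nice_field \<Omega> v' c'"
  shows "nice_field \<Omega> (\<lambda>x. v x + v' x) (\<lambda>x. c x + c' x)"
proof -
  interpret C: bounded_bilinear ccross by (rule bounded_bilinear_ccross)
  obtain K L M D where 1: "sqint v" "sqint c" "compact K" "K \<subseteq> \<Omega>" "\<And>x. x \<notin> K \<Longrightarrow> v x = 0 \<and> c x = 0"
    "L \<ge> 0" "\<And>x y. norm (v x - v y) \<le> L * norm (x - y)" "M \<ge> 0"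
    "\<And>x h. norm (v (x + h) - v x - (\<Sum>i\<in>UNIV. (h $ i) *\<^sub>R D x i)) \<le> M * (norm h)\<^sup>2"
    "\<And>x. c x = (\<Sum>i\<in>UNIV. ccross (axis i 1) (D x i))"
    by (rule nice_fieldE[OF assms(1)]) (rule that)
  obtain K' L' M' D' where 2: "sqint v'" "sqint c'" "compact K'" "K' \<subseteq> \<Omega>" "\<And>x. x \<notin> K' \<Longrightarrow> v' x = 0 \<and> c' x = 0"
    "L' \<ge> 0" "\<And>x y. norm (v' x - v' y) \<le> L' * norm (x - y)" "M' \<ge> 0"
    "\<And>x h. norm (v' (x + h) - v' x - (\<Sum>i\<in>UNIV. (h $ i) *\<^sub>R D' x i)) \<le> M' * (norm h)\<^sup>2"
    "\<And>x. c' x = (\<Sum>i\<in>UNIV. ccross (axis i 1) (D' x i))"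
    by (rule nice_fieldE[OF assms(2)]) (rule that)
  show ?thesis
  proof (rule nice_fieldI[where K = "K \<union> K'" and L = "L + L'" and M = "M + M'" and D = "\<lambda>x i. D x i + D' x i"])
    show "norm (v x + v' x - (v y + v' y)) \<le> (L + L') * norm (x - y)" for x y
      using norm_triangle_ineq[of "v x - v y" "v' x - v' y"] 1(7)[of x y] 2(7)[of x y]
      by (simp add: algebra_simps)
    show "norm (v (x + h) + v' (x + h) - (v x + v' x) - (\<Sum>i\<in>UNIV. (h $ i) *\<^sub>R (D x i + D' x i))) \<le> (M + M') * (norm h)\<^sup>2" for x h
      using norm_triangle_ineq[of "v (x + h) - v x - (\<Sum>i\<in>UNIV. (h $ i) *\<^sub>R D x i)"
          "v' (x + h) - v' x - (\<Sum>i\<in>UNIV. (h $ i) *\<^sub>R D' x i)"] 1(9)[of x h] 2(9)[of x h]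
      by (simp add: algebra_simps sum.distrib scaleR_add_right)
    show "c x + c' x = (\<Sum>i\<in>UNIV. ccross (axis i 1) (D x i + D' x i))" for x
      by (simp add: 1(10) 2(10) C.add_right sum.distrib)
    show "v x + v' x = 0 \<and> c x + c' x = 0" if "x \<notin> K \<union> K'" for x
      using that 1(5)[of x] 2(5)[of x] by simp
    show "K \<union> K' \<subseteq> \<Omega>" using 1(4) 2(4) by blast
    show "compact (K \<union> K')" using 1(3) 2(3) by (rule compact_Un)
  qed (use 1(6,8) 2(6,8) sqint_add[OF 1(1) 2(1)] sqint_add[OF 1(2) 2(2)] in simp_all)
qed

text \<open>All differences fall on the kernel, so the Lipschitz and Taylor constants of the
  mollified field are those of \<open>k\<close> times the L1 norm of \<open>w\<close>. The set
  \<open>K\<close> has to hold the support of \<open>w\<close> displaced by the support of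
  \<open>k\<close>.\<close>

lemma nice_field_mollify:
  assumes wc: "curl_pair S w c" and S: "bounded S" and wb: "w \<in> borel_measurable borel" and cb: "c \<in> borel_measurable borel"
    and k: "k \<in> C_inf" "\<And>x. k x \<ge> 0" "\<And>x. x \<notin> ball s \<eta> \<Longrightarrow> k x = 0" "integrable lborel k" "(LINT x|lborel. k x) = 1"
    and sq: "sqint (mollify k w)" "sqint (mollify k c)"
    and K: "compact K" "K \<subseteq> \<Omega>" "\<And>x y. y \<in> S \<Longrightarrow> x - y \<in> ball s \<eta> \<Longrightarrow> x \<in> K"
  shows "nice_field \<Omega> (mollify k w) (mollify k c)"
proof -
  interpret C: bounded_bilinear ccross by (rule bounded_bilinear_ccross)
  have s: "sqint w" "sqint c" and z: "\<And>x. x \<notin> S \<Longrightarrow> w x = 0" "\<And>x. x \<notin> S \<Longrightarrow> c x = 0"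
    using wc by (auto simp: curl_pair_def)
  have kc: "x \<notin> cball s \<eta> \<Longrightarrow> k x = 0" for x using k(3)[of x] by auto
  have intw: "integrable lborel (\<lambda>y. q (x - y) *\<^sub>R w y)" and intc: "integrable lborel (\<lambda>y. q (x - y) *\<^sub>R c y)"
    if "q \<in> C_inf" for q :: "real^3 \<Rightarrow> real" and x
    by (rule mollify_integrable[OF wb s(1) S _ C_inf_continuous[OF that]], rule z, assumption)
       (rule mollify_integrable[OF cb s(2) S _ C_inf_continuous[OF that]], rule z, assumption)
  have w1: "integrable lborel w"
    using intw[OF C_inf_const[of 1]] by simp
  define W where "W = (LINT y|lborel. norm (w y))"
  have W: "W \<ge> 0" unfolding W_def by simp
  have bound: "norm (LINT y|lborel. q y *\<^sub>R w y) \<le> B * W"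
    if "\<And>y. \<bar>q y\<bar> \<le> B" "integrable lborel (\<lambda>y. q y *\<^sub>R w y)" for q B
  proof -
    have "norm (LINT y|lborel. q y *\<^sub>R w y) \<le> (LINT y|lborel. norm (q y *\<^sub>R w y))" by (rule integral_norm_bound)
    also have "\<dots> \<le> (LINT y|lborel. B * norm (w y))"
      by (intro integral_mono integrable_norm[OF that(2)] integrable_mult_right integrable_norm[OF w1])
         (use that(1) in \<open>auto intro: mult_right_mono\<close>)
    finally show ?thesis by (simp add: W_def)
  qed
  have cT: "compact (cball s \<eta>)" by simp
  obtain L where L: "L \<ge> 0" "\<And>x y. \<bar>k x - k y\<bar> \<le> L * norm (x - y)"
    by (rule C_inf_lipschitz[OF k(1) cT kc]) (auto intro: that)
  obtain M where M: "M \<ge> 0"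
    "\<And>x h. \<bar>k (x + h) - k x - (\<Sum>i\<in>UNIV. (h $ i) * pderiv_at i k x)\<bar> \<le> M * (norm h)\<^sup>2"
    by (rule C_inf_taylor[OF k(1) cT kc]) (auto intro: that)
  define D where "D x i = mollify (pderiv_at i k) w x" for x i
  have pk: "pderiv_at i k \<in> C_inf" for i by (rule C_inf_pderiv[OF k(1)])
  have van: "mollify k u x = 0" if "x \<notin> K" "\<And>x. x \<notin> S \<Longrightarrow> u x = 0" for x and u :: "real^3 \<Rightarrow> complex^3"
  proof -
    have "k (x - y) *\<^sub>R u y = 0" for y
      using K(3)[of y x] k(3)[of "x - y"] that by (cases "y \<in> S") auto
    then show ?thesis by (simp only: mollify_def Bochner_Integration.integral_zero)
  qed
  have lip: "norm (mollify k w x - mollify k w y) \<le> (L * W) * norm (x - y)" for x y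
  proof -
    have "mollify k w x - mollify k w y = (LINT z|lborel. (k (x - z) - k (y - z)) *\<^sub>R w z)"
      using intw[OF k(1)] by (simp add: mollify_def scaleR_diff_left)
    also have "norm \<dots> \<le> (L * norm (x - y)) * W"
    proof (rule bound)
      show "\<bar>k (x - z) - k (y - z)\<bar> \<le> L * norm (x - y)" for z using L(2)[of "x - z" "y - z"] by simp
      show "integrable lborel (\<lambda>z. (k (x - z) - k (y - z)) *\<^sub>R w z)"
        using intw[OF k(1)] by (simp add: scaleR_diff_left)
    qed
    finally show ?thesis by (simp add: mult_ac)
  qed
  have tay: "norm (mollify k w (x + h) - mollify k w x - (\<Sum>i\<in>UNIV. (h $ i) *\<^sub>R D x i)) \<le> (M * W) * (norm h)\<^sup>2" for x h
  proof -
    let ?q = "\<lambda>z. k (x + h - z) - k (x - z) - (\<Sum>i\<in>UNIV. (h $ i) * pderiv_at i k (x - z))"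
    have eq: "?q z *\<^sub>R w z = k (x + h - z) *\<^sub>R w z - k (x - z) *\<^sub>R w z - (\<Sum>i\<in>UNIV. (h $ i) *\<^sub>R (pderiv_at i k (x - z) *\<^sub>R w z))" for z
      by (simp add: scaleR_diff_left scaleR_sum_left)
    have int: "integrable lborel (\<lambda>z. ?q z *\<^sub>R w z)"
      unfolding eq by (intro Bochner_Integration.integrable_diff Bochner_Integration.integrable_sum
          integrable_scaleR_right intw k(1) pk)
    have "(LINT z|lborel. ?q z *\<^sub>R w z) = mollify k w (x + h) - mollify k w x - (\<Sum>i\<in>UNIV. (h $ i) *\<^sub>R D x i)"
    proof -
      have i3: "integrable lborel (\<lambda>z. (h $ i) *\<^sub>R (pderiv_at i k (x - z) *\<^sub>R w z))" for i
        by (intro integrable_scaleR_right intw pk)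
      have "(LINT z|lborel. (\<Sum>i\<in>UNIV. (h $ i) *\<^sub>R (pderiv_at i k (x - z) *\<^sub>R w z))) = (\<Sum>i\<in>UNIV. (h $ i) *\<^sub>R D x i)"
        unfolding Bochner_Integration.integral_sum[OF i3] D_def mollify_def
        by (intro sum.cong refl integral_scaleR_right)
      then show ?thesis
        unfolding eq mollify_def
        by (simp only: Bochner_Integration.integral_diff Bochner_Integration.integrable_diff
            intw[OF k(1)] Bochner_Integration.integrable_sum[OF i3])
    qed
    moreover have "norm (LINT z|lborel. ?q z *\<^sub>R w z) \<le> (M * (norm h)\<^sup>2) * W"
    proof (rule bound[OF _ int])
      show "\<bar>?q z\<bar> \<le> M * (norm h)\<^sup>2" for z using M(2)[of "x - z" h] by (simp add: algebra_simps)
    qed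
    ultimately show ?thesis by (simp add: mult_ac)
  qed
  have crl: "mollify k c x = (\<Sum>i\<in>UNIV. ccross (axis i 1) (D x i))" for x
  proof -
    \<comment> \<open>Test with the reflected kernel times \<open>b\<close>. The sign from
      differentiating \<open>k (x - y)\<close> in \<open>y\<close> cancels the sign from moving the
      cross product to the other factor.\<close>
    have "mollify k c x \<bullet> b = (\<Sum>i\<in>UNIV. ccross (axis i 1) (D x i)) \<bullet> b" for b
    proof -
      define \<phi> where "\<phi> y = k (x + (-1) *\<^sub>R y) *\<^sub>R b" for y
      have kx: "(\<lambda>y. k (x + (-1) *\<^sub>R y)) \<in> C_inf" by (rule C_inf_affine[OF k(1)])
      have \<phi>: "\<phi> \<in> C_inf"
        unfolding \<phi>_def by (rule C_inf_scaleR[OF kx C_inf_const])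
      have pd: "pderiv_at i \<phi> y = - (pderiv_at i k (x - y) *\<^sub>R b)" for i y
      proof -
        have "(k has_derivative frechet_derivative k (at (x - y))) (at (x - y))"
          using C_inf_differentiable[OF k(1)] frechet_derivative_works by blast
        then have 1: "((\<lambda>y. k (x - y)) has_derivative (\<lambda>h. frechet_derivative k (at (x - y)) (- h))) (at y)"
          by (intro has_derivative_compose[where f = "\<lambda>y. x - y" and f' = "\<lambda>h. - h" and g = k])
             (auto intro!: derivative_eq_intros)
        have "linear (frechet_derivative k (at (x - y)))"
          using C_inf_differentiable[OF k(1)] by (rule linear_frechet_derivative)
        with has_derivative_scaleR_left[OF 1, of b] show ?thesis
          unfolding \<phi>_def by (subst pderiv_at_eq) (auto simp: pderiv_at_def linear_neg)
      qed
      have cu: "w y \<bullet> smooth_curl \<phi> y = (\<Sum>i\<in>UNIV. ccross (axis i 1) (pderiv_at i k (x - y) *\<^sub>R w y)) \<bullet> b" for y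
        unfolding smooth_curl_eq pd
        by (simp add: C.minus_right C.scaleR_right inner_sum_left inner_sum_right ccross_inner sum_negf)
      have i1: "integrable lborel (\<lambda>y. ccross (axis i 1) (pderiv_at i k (x - y) *\<^sub>R w y))" for i
        by (rule integrable_bounded_linear[OF C.bounded_linear_right intw[OF pk]])
      have i2: "integrable lborel (\<lambda>y. \<Sum>i\<in>UNIV. ccross (axis i 1) (pderiv_at i k (x - y) *\<^sub>R w y))"
        by (intro Bochner_Integration.integrable_sum i1)
      have "mollify k c x \<bullet> b = (LINT y|lborel. (k (x - y) *\<^sub>R c y) \<bullet> b)"
        unfolding mollify_def by (rule integral_inner_left[symmetric]) (simp add: intc[OF k(1)])
      also have "\<dots> = (LINT y|lborel. c y \<bullet> \<phi> y)" by (simp add: \<phi>_def mult.commute)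
      also have "\<dots> = (LINT y|lebesgue. c y \<bullet> \<phi> y)"
        using cb C_inf_continuous[OF \<phi>]
        by (intro integral_completion[symmetric] borel_measurable_inner) (auto intro: borel_measurable_continuous_onI)
      also have "\<dots> = (LINT y|lebesgue. w y \<bullet> smooth_curl \<phi> y)"
        using wc \<phi> by (simp add: curl_pair_def)
      also have "\<dots> = (LINT y|lborel. w y \<bullet> smooth_curl \<phi> y)"
        using wb continuous_smooth_curl[OF \<phi>]
        by (intro integral_completion borel_measurable_inner) (auto intro: borel_measurable_continuous_onI)
      also have "\<dots> = (LINT y|lborel. (\<Sum>i\<in>UNIV. ccross (axis i 1) (pderiv_at i k (x - y) *\<^sub>R w y))) \<bullet> b"
        unfolding cu by (rule integral_inner_left) (simp add: i2)
      also have "(LINT y|lborel. (\<Sum>i\<in>UNIV. ccross (axis i 1) (pderiv_at i k (x - y) *\<^sub>R w y))) = (\<Sum>i\<in>UNIV. ccross (axis i 1) (D x i))"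
        unfolding D_def mollify_def
        by (subst Bochner_Integration.integral_sum, rule i1, intro sum.cong refl
            integral_bounded_linear[OF C.bounded_linear_right intw[OF pk]])
      finally show ?thesis .
    qed
    then show ?thesis by (metis vector_eq_rdot)
  qed
  show ?thesis
    by (rule nice_fieldI[OF sq K(1,2) _ _ lip _ tay crl]) (use van z L(1) M(1) W in auto)
qed

text \<open>A short push along \<open>e\<close> leaves every point of \<Omega> near \<open>p\<close>
  with a margin \<open>\<eta>\<close> that depends on the length \<open>\<delta>\<close> of the push
  but not on the point. At interior points \<open>e = 0\<close> is allowed.\<close>

definition local_shift :: "(real^3) set \<Rightarrow> real^3 \<Rightarrow> real \<Rightarrow> bool" where
  "local_shift \<Omega> p r \<longleftrightarrow> r > 0 \<and> (\<exists>e \<delta>\<^sub>0. \<delta>\<^sub>0 > 0 \<and> (\<forall>\<delta>. 0 < \<delta> \<and> \<delta> < \<delta>\<^sub>0 \<longrightarrow>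
     (\<exists>\<eta>>0. \<forall>y\<in>\<Omega> \<inter> cball p r. ball (y + \<delta> *\<^sub>R e) \<eta> \<subseteq> \<Omega>)))"

text \<open>At a boundary point, the direction \<open>e\<close> is the vertical one in the local epigraph coordinates.\<close>

lemma local_shift_exists:
  assumes \<Omega>: "open \<Omega>" "lipschitz_boundary \<Omega>" and p: "p \<in> closure \<Omega>"
  shows "\<exists>r. local_shift \<Omega> p r"
proof (cases "p \<in> \<Omega>")
  case True
  then obtain r where r: "r > 0" "cball p r \<subseteq> \<Omega>" using \<Omega>(1) open_contains_cball by blast
  have "ball (y + \<delta> *\<^sub>R 0) (r/2) \<subseteq> \<Omega>" if "y \<in> \<Omega> \<inter> cball p (r/2)" for y and \<delta> :: real
  proof
    fix x assume "x \<in> ball (y + \<delta> *\<^sub>R 0) (r/2)"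
    then have "dist p x \<le> r" using that dist_triangle[of p x y] by simp
    then show "x \<in> \<Omega>" using r(2) by auto
  qed
  then have "local_shift \<Omega> p (r/2)"
    unfolding local_shift_def using r(1)
    by (intro conjI exI[of _ "0 :: real^3"] exI[of _ "1 :: real"] allI impI exI[of _ "r/2"]) auto
  then show ?thesis by blast
next
  case False
  then have "p \<in> frontier \<Omega>" using p \<Omega>(1) by (simp add: frontier_def interior_open)
  then obtain Q :: "real^3 \<Rightarrow> real^3" and R L and \<gamma> :: "real^2 \<Rightarrow> real" where
    Q: "orthogonal_transformation Q" and R: "0 < R" and \<gamma>: "L-lipschitz_on UNIV \<gamma>" and
    epi: "\<And>y. y \<in> ball p R \<Longrightarrow> y \<in> \<Omega> \<longleftrightarrow> \<gamma> (vector [Q (y - p) $ 1, Q (y - p) $ 2]) < Q (y - p) $ 3"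
    using \<Omega>(2) unfolding lipschitz_boundary_def by blast
  have L: "L \<ge> 0" using \<gamma> by (rule lipschitz_on_nonneg)
  have lin: "linear Q" using Q by (simp add: orthogonal_transformation_def)
  obtain e where e: "Q e = axis 3 1" using orthogonal_transformation_surj[OF Q] by (metis surjD)
  have ne: "norm e = 1" using orthogonal_transformation_norm[OF Q, of e] e by simp
  have "\<exists>\<eta>>0. \<forall>y\<in>\<Omega> \<inter> cball p (R/4). ball (y + \<delta> *\<^sub>R e) \<eta> \<subseteq> \<Omega>" if \<delta>: "0 < \<delta> \<and> \<delta> < R / 4" for \<delta>
  proof -
    \<comment> \<open>A deviation \<open>z\<close> from the vertical push raises the graph by at
      most \<open>L |z|\<close> and costs at most \<open>|z|\<close> in height; the gain
      \<open>\<delta>\<close> covers both as long as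
      \<open>(1 + L) |z| \<le> \<delta>\<close>.\<close>
    define \<eta> where "\<eta> = \<delta> / (1 + L)"
    have \<eta>: "\<eta> > 0" "\<eta> \<le> \<delta>" "\<eta> * (1 + L) = \<delta>" using \<delta> L by (auto simp: \<eta>_def field_simps)
    have "ball (y + \<delta> *\<^sub>R e) \<eta> \<subseteq> \<Omega>" if y: "y \<in> \<Omega> \<inter> cball p (R/4)" for y
    proof
      fix x assume x: "x \<in> ball (y + \<delta> *\<^sub>R e) \<eta>"
      define z where "z = x - y - \<delta> *\<^sub>R e"
      have z: "norm z < \<eta>" using x by (simp add: z_def dist_norm norm_minus_commute algebra_simps)
      have xe: "x - p = (y - p) + \<delta> *\<^sub>R e + z" by (simp add: z_def)
      have "norm (x - p) \<le> norm (y - p) + \<delta> + norm z"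
        unfolding xe using norm_triangle_ineq[of "y - p + \<delta> *\<^sub>R e" z] norm_triangle_ineq[of "y - p" "\<delta> *\<^sub>R e"] \<delta> ne
        by simp
      \<comment> \<open>Base point, push and deviation contribute at most \<open>R/4\<close> each,
        so the point stays in the coordinate patch.\<close>
      then have xb: "x \<in> ball p R" using y z \<eta> \<delta> by (simp add: dist_norm norm_minus_commute)
      have yb: "y \<in> ball p R" using y R by auto
      have Qx: "Q (x - p) = Q (y - p) + \<delta> *\<^sub>R axis 3 1 + Q z"
        unfolding xe using lin by (simp add: linear_add linear_cmul e)
      have Qz: "norm (Q z) = norm z" by (rule orthogonal_transformation_norm[OF Q])
      let ?X = "vector [Q (x - p) $ 1, Q (x - p) $ 2] :: real^2" and ?Y = "vector [Q (y - p) $ 1, Q (y - p) $ 2] :: real^2"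
      have "norm (?X - ?Y) \<le> norm (Q z)"
        unfolding norm_vec_def L2_set_def
        by (rule real_sqrt_le_mono) (simp add: Qx sum_2 sum_3 axis_def)
      then have "\<bar>\<gamma> ?X - \<gamma> ?Y\<bar> \<le> L * norm z"
        using lipschitz_onD[OF \<gamma>, of ?X ?Y] L Qz mult_left_mono[of "norm (?X - ?Y)" "norm z" L]
        by (simp add: dist_norm)
      moreover have "\<gamma> ?Y < Q (y - p) $ 3" using epi[OF yb] y by blast
      moreover have "Q (x - p) $ 3 \<ge> Q (y - p) $ 3 + \<delta> - norm z"
        using component_le_norm_cart[of "Q z" 3] Qz by (simp add: Qx axis_def)
      moreover have "L * norm z + norm z \<le> \<delta>"
      proof -
        have "norm z * (1 + L) \<le> \<eta> * (1 + L)" using z L by (intro mult_right_mono) auto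
        then show ?thesis using \<eta>(3) by (simp add: algebra_simps)
      qed
      ultimately have "\<gamma> ?X < Q (x - p) $ 3" by linarith
      then show "x \<in> \<Omega>" using epi[OF xb] by blast
    qed
    with \<eta>(1) show ?thesis by blast
  qed
  then have "local_shift \<Omega> p (R/4)"
    unfolding local_shift_def using R by (intro conjI exI[of _ e] exI[of _ "R/4"] allI) simp_all
  then show ?thesis by blast
qed

definition nice_graph :: "(real^3) set \<Rightarrow> ((real^3, complex^3) l2 \<times> (real^3, complex^3) l2) set" where
  "nice_graph \<Omega> = {(cls v, cls c) |v c. nice_field \<Omega> v c}"

lemma closure_nice_graph_add:
  assumes "x \<in> closure (nice_graph \<Omega>)" "y \<in> closure (nice_graph \<Omega>)"
  shows "x + y \<in> closure (nice_graph \<Omega>)"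
proof -
  obtain X Y where X: "\<And>n. X n \<in> nice_graph \<Omega>" "X \<longlonglongrightarrow> x" and Y: "\<And>n. Y n \<in> nice_graph \<Omega>" "Y \<longlonglongrightarrow> y"
    using assms unfolding closure_sequential by metis
  have "X n + Y n \<in> nice_graph \<Omega>" for n
  proof -
    obtain v c v' c' where *: "X n = (cls v, cls c)" "nice_field \<Omega> v c" "Y n = (cls v', cls c')" "nice_field \<Omega> v' c'"
      using X(1)[of n] Y(1)[of n] unfolding nice_graph_def by blast
    have "X n + Y n = (cls (\<lambda>x. v x + v' x), cls (\<lambda>x. c x + c' x))"
      using * by (simp add: nice_field_def cls_add)
    then show ?thesis using nice_field_add[OF *(2,4)] unfolding nice_graph_def by blast
  qed
  then show ?thesis unfolding closure_sequential
    using tendsto_add[OF X(2) Y(2)] by (intro exI[of _ "\<lambda>n. X n + Y n"]) blast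
qed

text \<open>A kernel centred at \<open>\<delta> *\<^sub>R e\<close> pushes the field into the domain
  and smooths it in one mollification, and the translation estimate handles both effects
  together.\<close>

lemma local_density:
  assumes \<Omega>: "open \<Omega>" "bounded \<Omega>" and sh: "local_shift \<Omega> p r" and wc: "curl_pair (\<Omega> \<inter> cball p r) w c"
  shows "(cls w, cls c) \<in> closure (nice_graph \<Omega>)"
proof -
  let ?S = "\<Omega> \<inter> cball p r"
  have S: "?S \<in> sets borel" "bounded ?S" using \<Omega> by auto
  have s: "sqint w" "sqint c" and z: "\<And>x. x \<notin> ?S \<Longrightarrow> w x = 0" "\<And>x. x \<notin> ?S \<Longrightarrow> c x = 0"
    using wc by (auto simp: curl_pair_def)
  obtain w' where w': "w' \<in> borel_measurable borel" "sqint w'" "AE x in lebesgue. w x = w' x" "\<And>x. x \<notin> ?S \<Longrightarrow> w' x = 0"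
    by (rule borel_representative_sqint[where f = w, OF s(1) S(1)], rule z, assumption) (rule that)
  obtain c' where c': "c' \<in> borel_measurable borel" "sqint c'" "AE x in lebesgue. c x = c' x" "\<And>x. x \<notin> ?S \<Longrightarrow> c' x = 0"
    by (rule borel_representative_sqint[where f = c, OF s(2) S(1)], rule z, assumption) (rule that)
  have wc': "curl_pair ?S w' c'"
    by (rule curl_pair_cong_AE[OF wc w'(2) c'(2) w'(3) c'(3)]) (use w'(4) c'(4) in blast)
  have eq: "(cls w, cls c) = (cls w', cls c')" using s w' c' by (simp add: cls_eq_iff)
  show ?thesis unfolding eq
  proof (rule closure_approachable[THEN iffD2], intro allI impI)
    fix \<epsilon> :: real assume \<epsilon>: "\<epsilon> > 0"
    obtain t1 where t1: "t1 > 0" "\<And>z. norm z < t1 \<Longrightarrow> norm (cls (\<lambda>x. w' (x - z)) - cls w') < \<epsilon> / 3"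
      using translation_small[OF w'(1,2), of "\<epsilon> / 3"] \<epsilon> by auto
    obtain t2 where t2: "t2 > 0" "\<And>z. norm z < t2 \<Longrightarrow> norm (cls (\<lambda>x. c' (x - z)) - cls c') < \<epsilon> / 3"
      using translation_small[OF c'(1,2), of "\<epsilon> / 3"] \<epsilon> by auto
    define t where "t = min t1 t2"
    have t: "t > 0" using t1 t2 by (simp add: t_def)
    obtain e \<delta>\<^sub>0 where e: "\<delta>\<^sub>0 > 0" "\<And>\<delta>. 0 < \<delta> \<Longrightarrow> \<delta> < \<delta>\<^sub>0 \<Longrightarrow> \<exists>\<eta>>0. \<forall>y\<in>?S. ball (y + \<delta> *\<^sub>R e) \<eta> \<subseteq> \<Omega>"
      using sh unfolding local_shift_def by blast
    \<comment> \<open>Half of the admissible translation length \<open>t\<close> is spent on the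
      push, the other half on the radius of the kernel.\<close>
    define \<delta> where "\<delta> = min (\<delta>\<^sub>0 / 2) (t / (2 * (norm e + 1)))"
    have ne: "norm e + 1 > 0" using norm_ge_zero[of e] by linarith
    have \<delta>: "0 < \<delta>" "\<delta> < \<delta>\<^sub>0" using e(1) t ne by (auto simp: \<delta>_def min_less_iff_disj)
    have \<delta>e: "norm (\<delta> *\<^sub>R e) \<le> t / 2"
    proof -
      have "norm (\<delta> *\<^sub>R e) \<le> t / (2 * (norm e + 1)) * (norm e + 1)"
        using \<delta>(1) unfolding norm_scaleR by (intro mult_mono) (auto simp: \<delta>_def)
      also have "t / (2 * q) * q = t / 2" if "q > 0" for q :: real using that by simp
      then have "t / (2 * (norm e + 1)) * (norm e + 1) = t / 2" using ne by blast
      finally show ?thesis .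
    qed
    obtain \<eta> where \<eta>: "\<eta> > 0" "\<And>y. y \<in> ?S \<Longrightarrow> ball (y + \<delta> *\<^sub>R e) \<eta> \<subseteq> \<Omega>" using e(2)[OF \<delta>] by blast
    \<comment> \<open>Half of the margin \<open>\<eta>\<close> is kept back so that the closure of
      the displaced support, not only the support itself, stays in \<Omega>.\<close>
    define \<rho> where "\<rho> = min (\<eta> / 2) (t / 2)"
    have \<rho>: "\<rho> > 0" "\<rho> \<le> \<eta> / 2" "\<rho> \<le> t / 2" using \<eta> t by (auto simp: \<rho>_def)
    obtain k :: "real^3 \<Rightarrow> real" where k: "k \<in> C_inf" "\<And>x. k x \<ge> 0" "\<And>x. x \<notin> ball (\<delta> *\<^sub>R e) \<rho> \<Longrightarrow> k x = 0"
      "integrable lborel k" "(LINT x|lborel. k x) = 1"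
      by (rule smooth_kernel_exists[OF \<rho>(1), of "\<delta> *\<^sub>R e"]) (rule that)
    have ksup: "norm z < t" if "k z \<noteq> 0" for z
    proof -
      have "norm (z - \<delta> *\<^sub>R e) < \<rho>" using k(3)[of z] that by (auto simp: dist_norm norm_minus_commute)
      then show ?thesis using norm_triangle_ineq[of "z - \<delta> *\<^sub>R e" "\<delta> *\<^sub>R e"] \<rho>(3) \<delta>e by simp
    qed
    have "norm (cls (\<lambda>x. w' (x - z)) - cls w') \<le> \<epsilon> / 3" "norm (cls (\<lambda>x. c' (x - z)) - cls c') \<le> \<epsilon> / 3" if "k z \<noteq> 0" for z
      using t1(2)[of z] t2(2)[of z] ksup[OF that] by (auto simp: t_def)
    note mw = mollify_approx[OF k(2,4,5) w'(1,2) this(1)] and mc = mollify_approx[OF k(2,4,5) c'(1,2) this(2)]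
    define K where "K = closure (\<Union>y\<in>?S. ball (y + \<delta> *\<^sub>R e) \<rho>)"
    have "nice_field \<Omega> (mollify k w') (mollify k c')"
    proof (rule nice_field_mollify[OF wc' S(2) w'(1) c'(1) k mw(2) mc(2)])
      have "(\<Union>y\<in>?S. ball (y + \<delta> *\<^sub>R e) \<rho>) \<subseteq> \<Omega>"
      proof (rule UN_least)
        fix y assume "y \<in> ?S"
        have "\<rho> \<le> \<eta>" using \<rho>(2) \<eta>(1) by linarith
        from order_trans[OF subset_ball[OF this] \<eta>(2)[OF \<open>y \<in> ?S\<close>]]
        show "ball (y + \<delta> *\<^sub>R e) \<rho> \<subseteq> \<Omega>" .
      qed
      then have "bounded (\<Union>y\<in>?S. ball (y + \<delta> *\<^sub>R e) \<rho>)" using \<Omega>(2) bounded_subset by blast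
      then show "compact K" by (simp add: K_def compact_closure)
      show "K \<subseteq> \<Omega>"
      proof
        fix x assume "x \<in> K"
        then obtain x' where x': "x' \<in> (\<Union>y\<in>?S. ball (y + \<delta> *\<^sub>R e) \<rho>)" "dist x' x < \<eta> / 2"
          using half_gt_zero[OF \<eta>(1)] unfolding K_def closure_approachable by blast
        then obtain y where y: "y \<in> ?S" "dist (y + \<delta> *\<^sub>R e) x' < \<rho>" by auto
        have "dist (y + \<delta> *\<^sub>R e) x < \<eta>"
          using dist_triangle[of "y + \<delta> *\<^sub>R e" x x'] y(2) x'(2) \<rho>(2) by linarith
        then show "x \<in> \<Omega>" using \<eta>(2)[OF y(1)] by auto
      qed
      fix x y assume "y \<in> ?S" "x - y \<in> ball (\<delta> *\<^sub>R e) \<rho>"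
      moreover from this(2) have "x \<in> ball (y + \<delta> *\<^sub>R e) \<rho>" by (simp add: dist_norm algebra_simps)
      ultimately have "x \<in> (\<Union>y\<in>?S. ball (y + \<delta> *\<^sub>R e) \<rho>)" by (intro UN_I)
      then show "x \<in> K" unfolding K_def by (rule subsetD[OF closure_subset])
    qed
    then have "(cls (mollify k w'), cls (mollify k c')) \<in> nice_graph \<Omega>" unfolding nice_graph_def by blast
    moreover have "dist (cls (mollify k w'), cls (mollify k c')) (cls w', cls c') < \<epsilon>"
    proof -
      have "dist (cls (mollify k w'), cls (mollify k c')) (cls w', cls c')
          \<le> dist (cls (mollify k w')) (cls w') + dist (cls (mollify k c')) (cls c')"
        unfolding dist_Pair_Pair by (rule sqrt_sum_squares_le_sum) auto
      also have "\<dots> \<le> \<epsilon> / 3 + \<epsilon> / 3" using mw(3) mc(3) by (intro add_mono) (auto simp: dist_norm)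
      finally show ?thesis using \<epsilon> by simp
    qed
    ultimately show "\<exists>y\<in>nice_graph \<Omega>. dist y (cls w', cls c') < \<epsilon>" by blast
  qed
qed

text \<open>Instead of a partition of unity, one cutoff is split off per ball of a finite cover.
  What remains vanishes on that ball, so it is carried by the union of the others and the induction
  continues.\<close>

lemma curl_graph_dense:
  assumes \<Omega>: "open \<Omega>" "bounded \<Omega>" "lipschitz_boundary \<Omega>"
  shows "curl_graph \<Omega> \<subseteq> closure (nice_graph \<Omega>)"
proof -
  have "\<forall>p\<in>closure \<Omega>. \<exists>r. local_shift \<Omega> p r" using local_shift_exists[OF \<Omega>(1,3)] by blast
  then obtain r where r: "\<And>p. p \<in> closure \<Omega> \<Longrightarrow> local_shift \<Omega> p (r p)" by metis
  have rp: "r p > 0" if "p \<in> closure \<Omega>" for p using r[OF that] by (simp add: local_shift_def)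
  have cpt: "compact (closure \<Omega>)" using \<Omega>(2) by (simp add: compact_closure)
  have cov: "closure \<Omega> \<subseteq> (\<Union>p\<in>closure \<Omega>. ball p (r p / 2))" using rp by fastforce
  obtain I where I: "I \<subseteq> closure \<Omega>" "finite I" "closure \<Omega> \<subseteq> (\<Union>p\<in>I. ball p (r p / 2))"
    by (rule compactE_image[OF cpt _ cov]) (auto intro: that)
  have *: "(cls w, cls c) \<in> closure (nice_graph \<Omega>)"
    if "finite I" "I \<subseteq> closure \<Omega>" "curl_pair \<Omega> w c" "\<And>x. x \<notin> (\<Union>p\<in>I. ball p (r p / 2)) \<Longrightarrow> w x = 0 \<and> c x = 0" for I w c
    using that
  proof (induction I arbitrary: w c rule: finite_induct)
    case empty
    then have "w = (\<lambda>x. 0)" "c = (\<lambda>x. 0)" by auto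
    then have "(cls w, cls c) \<in> nice_graph \<Omega>" unfolding nice_graph_def using nice_field_0 by blast
    then show ?case using closure_subset by blast
  next
    case (insert p I)
    interpret C: bounded_bilinear ccross by (rule bounded_bilinear_ccross)
    have p: "p \<in> closure \<Omega>" using insert.prems by blast
    obtain \<beta> :: "real^3 \<Rightarrow> real" where \<beta>: "\<beta> \<in> C_inf" "\<And>x. x \<in> ball p (r p / 2) \<Longrightarrow> \<beta> x = 1"
      "\<And>x. x \<notin> ball p (r p) \<Longrightarrow> \<beta> x = 0"
      by (rule smooth_cutoff_exists[of "r p / 2" "r p" p]) (use rp[OF p] that in auto)
    have \<beta>0: "\<beta> x = 0" if "x \<notin> cball p (r p)" for x using \<beta>(3)[of x] that by auto
    define w1 c1 where "w1 x = \<beta> x *\<^sub>R w x" and "c1 x = \<beta> x *\<^sub>R c x + ccross (grad \<beta> x) (w x)" for x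
    define w2 c2 where "w2 x = w x - w1 x" and "c2 x = c x - c1 x" for x
    have p1: "curl_pair (\<Omega> \<inter> cball p (r p)) w1 c1"
      unfolding w1_def c1_def by (rule curl_pair_cutoff[OF insert.prems(2) \<Omega>(2) \<beta>(1) closed_cball \<beta>0])
    have p1': "curl_pair \<Omega> w1 c1" by (rule curl_pair_mono[OF p1]) auto
    have p2: "curl_pair \<Omega> w2 c2"
      using curl_pair_add[OF \<Omega>(2) insert.prems(2) curl_pair_scaleR[OF p1', of "-1"]]
      by (simp add: w2_def[abs_def] c2_def[abs_def])
    have z: "w2 x = 0 \<and> c2 x = 0" if x: "x \<notin> (\<Union>p\<in>I. ball p (r p / 2))" for x
    proof (cases "x \<in> ball p (r p / 2)")
      case True
      \<comment> \<open>Here the cutoff is constant, so the product rule adds nothing and the curl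
        of the remainder vanishes as well.\<close>
      have "grad \<beta> x = 0" by (rule grad_locally_constant[OF open_ball \<beta>(2) True])
      then show ?thesis using \<beta>(2)[OF True] by (simp add: w2_def c2_def w1_def c1_def C.zero_left)
    next
      case False
      then have "w x = 0 \<and> c x = 0" using insert.prems(3)[of x] x by auto
      then show ?thesis by (simp add: w2_def c2_def w1_def c1_def C.zero_right)
    qed
    have 1: "(cls w1, cls c1) \<in> closure (nice_graph \<Omega>)"
      by (rule local_density[OF \<Omega>(1,2) r[OF p] p1])
    have 2: "(cls w2, cls c2) \<in> closure (nice_graph \<Omega>)"
      by (rule insert.IH[OF _ p2 z]) (use insert.prems in auto)
    have "(cls w, cls c) = (cls w1, cls c1) + (cls w2, cls c2)"
      using p1' p2 by (simp add: curl_pair_def cls_add) (simp add: w2_def c2_def)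
    then show ?case using closure_nice_graph_add[OF 1 2] by simp
  qed
  show ?thesis
  proof
    fix x assume "x \<in> curl_graph \<Omega>"
    then obtain w c where x: "x = (cls w, cls c)" "curl_pair \<Omega> w c" by (auto simp: curl_graph_def)
    have "w y = 0 \<and> c y = 0" if "y \<notin> (\<Union>p\<in>I. ball p (r p / 2))" for y
      using I(3) that closure_subset[of \<Omega>] x(2) unfolding curl_pair_def by blast
    then show "x \<in> closure (nice_graph \<Omega>)" using *[OF I(2,1) x(2)] x(1) by blast
  qed
qed

section \<open>Lipschitz potentials\<close>

definition cvec :: "real^3 \<Rightarrow> complex^3" where
  "cvec a = (\<chi> i. of_real (a $ i))"

lemma bounded_linear_cvec: "bounded_linear cvec"
  unfolding linear_conv_bounded_linear[symmetric] linear_iff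
  by (auto simp: cvec_def vec_eq_iff scaleR_conv_of_real[where 'a = complex])

interpretation ccross: bounded_bilinear ccross by (rule bounded_bilinear_ccross)

lemma norm_cvec: "norm (cvec a) = norm a"
  by (simp add: cvec_def norm_vec_def L2_set_def)

text \<open>\<open>F\<close> is the almost everywhere defined gradient of the Lipschitz function \<open>f\<close>.\<close>

definition lip_potential :: "(real^3 \<Rightarrow> real) \<Rightarrow> (real^3 \<Rightarrow> real^3) \<Rightarrow> bool" where
  "lip_potential f F \<longleftrightarrow> (\<exists>L\<ge>0. \<forall>x y. \<bar>f x - f y\<bar> \<le> L * norm (x - y)) \<and>
     (\<exists>R. \<forall>x. x \<notin> cball 0 R \<longrightarrow> f x = 0 \<and> F x = 0) \<and>
     F \<in> borel_measurable borel \<and> (\<exists>B. \<forall>x. norm (F x) \<le> B) \<and>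
     (\<forall>i. AE x in lborel. ((\<lambda>t. f (x + t *\<^sub>R axis i 1)) has_real_derivative F x $ i) (at 0))"

lemma lip_potentialE:
  assumes "lip_potential f F"
  obtains L R B where "L \<ge> 0" "\<And>x y. \<bar>f x - f y\<bar> \<le> L * norm (x - y)" "\<And>x. x \<notin> cball 0 R \<Longrightarrow> f x = 0 \<and> F x = 0"
    "F \<in> borel_measurable borel" "\<And>x. norm (F x) \<le> B"
    "\<And>i. AE x in lborel. ((\<lambda>t. f (x + t *\<^sub>R axis i 1)) has_real_derivative F x $ i) (at 0)"
  using assms unfolding lip_potential_def by (elim conjE exE) blast

lemma lip_continuous:
  assumes "\<And>x y. \<bar>f x - f y\<bar> \<le> L * norm (x - y)" "L \<ge> 0"
  shows "continuous_on UNIV (f :: real^3 \<Rightarrow> real)"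
proof -
  have "L-lipschitz_on UNIV f" using assms by (auto intro!: lipschitz_onI simp: dist_norm)
  then show ?thesis by (rule lipschitz_on_continuous_on)
qed

lemma integrable_bounded_support:
  fixes f :: "'a::euclidean_space \<Rightarrow> 'b::euclidean_space"
  assumes "f \<in> borel_measurable lborel" "\<And>x. norm (f x) \<le> B" "\<And>x. x \<notin> cball 0 R \<Longrightarrow> f x = 0"
  shows "integrable lborel f"
proof (rule Bochner_Integration.integrable_bound[OF _ assms(1)])
  show "integrable lborel (\<lambda>x. indicator (cball (0 :: 'a) R) x * B)"
    by (intro integrable_mult_left integrable_real_indicator emeasure_bounded_finite) auto
  have "norm (f x) \<le> norm (indicator (cball 0 R) x * B)" for x
    using assms(2)[of x] assms(3)[of x] by (cases "x \<in> cball 0 R") auto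
  then show "AE x in lborel. norm (f x) \<le> norm (indicator (cball 0 R) x * B)" by simp
qed

lemma integrable_continuous_support:
  fixes f :: "'a::euclidean_space \<Rightarrow> real"
  assumes "continuous_on UNIV f" "\<And>x. x \<notin> cball 0 R \<Longrightarrow> f x = 0"
  shows "integrable lborel f"
proof -
  have "integrable lborel (\<lambda>x. indicator (cball 0 R) x *\<^sub>R f x)"
    by (intro borel_integrable_compact continuous_on_subset[OF assms(1)]) auto
  moreover have "(\<lambda>x. indicator (cball 0 R) x *\<^sub>R f x) = f"
    using assms(2) by (auto simp: indicator_def fun_eq_iff)
  ultimately show ?thesis by simp
qed

text \<open>Both difference quotients expand to translates \<open>A(a) = \<integral> g(x + a) h(x) dx\<close>, and the result
  \<open>A(t e\<^sub>i) - A(t e\<^sub>i + t e\<^sub>j) - A(0) + A(t e\<^sub>j)\<close> is symmetric in \<open>i\<close> and \<open>j\<close>.\<close>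

lemma difference_quotient_symmetry:
  fixes g h :: "real^3 \<Rightarrow> real" and a b :: "real^3"
  assumes g: "continuous_on UNIV g" and h: "continuous_on UNIV h" "\<And>x. x \<notin> cball 0 R \<Longrightarrow> h x = 0"
  shows "(LINT x|lborel. (g (x + a) - g x) * (h x - h (x - b))) = (LINT x|lborel. (g (x + b) - g x) * (h x - h (x - a)))"
proof -
  define A where "A a = (LINT x|lborel. g (x + a) * h x)" for a
  have i: "integrable lborel (\<lambda>x. g (x + a) * h x)" for a
    by (rule integrable_continuous_support[where R = R])
       (intro continuous_intros continuous_on_compose2[OF g] h(1), auto simp: h(2))
  have m: "(\<lambda>x. g (x + a) * h x) \<in> borel_measurable borel" for a
    using borel_measurable_integrable[OF i[of a]] by simp
  have sh: "(\<lambda>x. g (x + a) * h (x - b)) = (\<lambda>x. g ((x - b) + (a + b)) * h (x - b))" for a b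
    by (simp add: algebra_simps)
  have i': "integrable lborel (\<lambda>x. g (x + a) * h (x - b))" for a b
    unfolding sh using lborel_integrable_shift[OF m[of "a + b"], of b] i[of "a + b"] by simp
  have A': "(LINT x|lborel. g (x + a) * h (x - b)) = A (a + b)" for a b
    unfolding sh A_def using lborel_integral_shift[OF m[of "a + b"], of b] by simp
  have "(LINT x|lborel. (g (x + a) - g x) * (h x - h (x - b))) = A a - A (a + b) - A 0 + A b" for a b
  proof -
    have "(LINT x|lborel. (g (x + a) - g x) * (h x - h (x - b))) =
        (LINT x|lborel. g (x + a) * h x - g (x + a) * h (x - b) - g (x + 0) * h x + g (x + 0) * h (x - b))"
      by (simp add: algebra_simps)
    also have "\<dots> = A a - A (a + b) - A 0 + A (0 + b)"
      using i i' by (simp only: Bochner_Integration.integral_diff Bochner_Integration.integral_add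
          Bochner_Integration.integrable_diff A_def[symmetric] A')
    finally show ?thesis by simp
  qed
  from this[of a b] this[of b a] show ?thesis by (simp add: add.commute)
qed

lemma directional_quotient_tendsto:
  fixes f :: "real^3 \<Rightarrow> real"
  assumes "((\<lambda>t. f (x + t *\<^sub>R e)) has_real_derivative d) (at 0)"
  shows "(\<lambda>n. (f (x + (1 / real (Suc n)) *\<^sub>R e) - f x) * real (Suc n)) \<longlonglongrightarrow> d"
    and "(\<lambda>n. (f x - f (x - (1 / real (Suc n)) *\<^sub>R e)) * real (Suc n)) \<longlonglongrightarrow> d"
proof -
  have D: "((\<lambda>t. (f (x + t *\<^sub>R e) - f x) / t) \<longlongrightarrow> d) (at 0)"
    using assms by (simp add: DERIV_def)
  have l: "(\<lambda>n. 1 / real (Suc n)) \<longlonglongrightarrow> 0"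
    using LIMSEQ_inverse_real_of_nat by (simp add: inverse_eq_divide)
  have l': "(\<lambda>n. - (1 / real (Suc n))) \<longlonglongrightarrow> 0" using tendsto_minus[OF l] by simp
  have "filterlim (\<lambda>n. 1 / real (Suc n)) (at 0) sequentially"
    using l by (auto simp: filterlim_at)
  from filterlim_compose[OF D this]
  show "(\<lambda>n. (f (x + (1 / real (Suc n)) *\<^sub>R e) - f x) * real (Suc n)) \<longlonglongrightarrow> d" by simp
  have "filterlim (\<lambda>n. - (1 / real (Suc n))) (at 0) sequentially"
    using l' by (auto simp: filterlim_at)
  from filterlim_compose[OF D this]
  show "(\<lambda>n. (f x - f (x - (1 / real (Suc n)) *\<^sub>R e)) * real (Suc n)) \<longlonglongrightarrow> d"
    by (simp add: algebra_simps)
qed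

text \<open>The mixed second derivatives of \<open>g\<close>, integrated against \<open>h\<close>,
  do not depend on their order, although neither function has second derivatives: forward quotients
  of \<open>g\<close> times backward quotients of \<open>h\<close> are symmetric exactly, and
  dominated convergence passes to the gradients.\<close>

lemma lip_potential_symmetry:
  assumes g: "lip_potential g G" and h: "lip_potential h H"
  shows "(LINT x|lborel. G x $ i * H x $ j) = (LINT x|lborel. G x $ j * H x $ i)"
proof -
  obtain L R B where g: "L \<ge> 0" "\<And>x y. \<bar>g x - g y\<bar> \<le> L * norm (x - y)" "\<And>x. x \<notin> cball 0 R \<Longrightarrow> g x = 0 \<and> G x = 0"
    "G \<in> borel_measurable borel" "\<And>x. norm (G x) \<le> B"
    "\<And>i. AE x in lborel. ((\<lambda>t. g (x + t *\<^sub>R axis i 1)) has_real_derivative G x $ i) (at 0)"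
    by (rule lip_potentialE[OF g]) (rule that)
  obtain L' R' B' where h: "L' \<ge> 0" "\<And>x y. \<bar>h x - h y\<bar> \<le> L' * norm (x - y)" "\<And>x. x \<notin> cball 0 R' \<Longrightarrow> h x = 0 \<and> H x = 0"
    "H \<in> borel_measurable borel" "\<And>x. norm (H x) \<le> B'"
    "\<And>i. AE x in lborel. ((\<lambda>t. h (x + t *\<^sub>R axis i 1)) has_real_derivative H x $ i) (at 0)"
    by (rule lip_potentialE[OF h]) (rule that)
  have gc: "continuous_on UNIV g" and hc: "continuous_on UNIV h"
    using lip_continuous g h by blast+
  let ?e = "\<lambda>i n. (1 / real (Suc n)) *\<^sub>R axis i (1 :: real) :: real^3"
  define P where "P i j n x = ((g (x + ?e i n) - g x) * real (Suc n)) * ((h x - h (x - ?e j n)) * real (Suc n))" for i j n x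
  have Pm: "P i j n \<in> borel_measurable lborel" for i j n
  proof -
    have "continuous_on UNIV (P i j n)"
      unfolding P_def[abs_def]
      by (intro continuous_intros continuous_on_compose2[OF gc] continuous_on_compose2[OF hc] gc hc) auto
    then show ?thesis by (simp add: borel_measurable_continuous_onI)
  qed
  have Pb: "norm (P i j n x) \<le> indicator (cball 0 (R' + 1)) x * (L * L')" for i j n x
  proof (cases "x \<in> cball 0 (R' + 1)")
    case True
    have "\<bar>(g (x + ?e i n) - g x) * real (Suc n)\<bar> \<le> L"
      using mult_right_mono[OF g(2)[of "x + ?e i n" x], of "real (Suc n)"] by (simp add: abs_mult)
    moreover have "\<bar>(h x - h (x - ?e j n)) * real (Suc n)\<bar> \<le> L'"
      using mult_right_mono[OF h(2)[of x "x - ?e j n"], of "real (Suc n)"] by (simp add: abs_mult)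
    ultimately have "norm (P i j n x) \<le> L * L'"
      unfolding P_def norm_mult real_norm_def abs_mult[symmetric]
      by (subst abs_mult) (rule mult_mono, use g(1) in auto)
    then show ?thesis using True by simp
  next
    case False
    \<comment> \<open>Steps have length at most 1, so both points of the backward quotient lie
      outside the support of \<open>h\<close>; hence the radius \<open>R' + 1\<close> of the
      dominating function.\<close>
    have e1: "norm (?e j n) \<le> 1" by simp
    have nx: "norm x > R' + 1" using False by simp
    have "R' < norm (x - ?e j n)"
      using norm_triangle_ineq2[of x "?e j n"] e1 nx by linarith
    moreover have "R' < norm x" using False by simp
    ultimately have "h x = 0" "h (x - ?e j n) = 0" using h(3) by auto
    then show ?thesis using False by (simp add: P_def)
  qed
  have lim: "(\<lambda>n. LINT x|lborel. P i j n x) \<longlonglongrightarrow> (LINT x|lborel. G x $ i * H x $ j)" for i j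
  proof (rule integral_dominated_convergence)
    show "integrable lborel (\<lambda>x :: real^3. indicator (cball 0 (R' + 1)) x * (L * L'))"
      by (intro integrable_mult_left integrable_real_indicator emeasure_bounded_finite) auto
    show "AE x in lborel. (\<lambda>n. P i j n x) \<longlonglongrightarrow> G x $ i * H x $ j"
      using g(6)[of i] h(6)[of j]
    proof eventually_elim
      case (elim x)
      show ?case unfolding P_def
        by (intro tendsto_mult directional_quotient_tendsto elim)
    qed
    have c: "G \<in> borel_measurable lborel" "H \<in> borel_measurable lborel" using g(4) h(4) by simp_all
    have "(\<lambda>x. u x $ k) \<in> borel_measurable lborel" if "u \<in> borel_measurable lborel" for u :: "real^3 \<Rightarrow> real^3" and k
      using measurable_compose[OF that borel_measurable_continuous_onI[OF linear_continuous_on[OF bounded_linear_vec_nth]]] .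
    with c show "(\<lambda>x. G x $ i * H x $ j) \<in> borel_measurable lborel" by simp
  qed (use Pm Pb in auto)
  have "(LINT x|lborel. P i j n x) = (LINT x|lborel. P j i n x)" for n
  proof -
    have "P i j n x = (real (Suc n))\<^sup>2 * ((g (x + ?e i n) - g x) * (h x - h (x - ?e j n)))" for i j x
      by (simp add: P_def power2_eq_square mult_ac)
    then show ?thesis
      using difference_quotient_symmetry[OF gc hc, of R' "?e i n" "?e j n"] h(3) by simp
  qed
  then show ?thesis using LIMSEQ_unique[OF lim[of i j]] lim[of j i] by simp
qed

lemma lip_potential_mult:
  assumes f: "lip_potential f F" and \<psi>: "\<psi> \<in> C_inf"
  shows "lip_potential (\<lambda>x. f x * \<psi> x) (\<lambda>x. \<psi> x *\<^sub>R F x + f x *\<^sub>R grad \<psi> x)"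
proof -
  obtain L R B where f: "L \<ge> 0" "\<And>x y. \<bar>f x - f y\<bar> \<le> L * norm (x - y)" "\<And>x. x \<notin> cball 0 R \<Longrightarrow> f x = 0 \<and> F x = 0"
    "F \<in> borel_measurable borel" "\<And>x. norm (F x) \<le> B"
    "\<And>i. AE x in lborel. ((\<lambda>t. f (x + t *\<^sub>R axis i 1)) has_real_derivative F x $ i) (at 0)"
    by (rule lip_potentialE[OF f]) (rule that)
  define r where "r = \<bar>R\<bar> + 1"
  have r: "r > 0" "R < r" by (auto simp: r_def)
  have f0: "f x = 0" "F x = 0" if "x \<notin> ball 0 r" for x using f(3)[of x] that r(2) by auto
  \<comment> \<open>On the whole space \<psi> need be neither bounded nor Lipschitz. Its cut-off
    version \<open>\<theta>\<close> is both, and the product with \<open>f\<close> is the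
    same.\<close>
  obtain \<beta> :: "real^3 \<Rightarrow> real" where \<beta>: "\<beta> \<in> C_inf" "\<And>x. x \<in> ball 0 r \<Longrightarrow> \<beta> x = 1" "\<And>x. x \<notin> ball 0 (r + 1) \<Longrightarrow> \<beta> x = 0"
    by (rule smooth_cutoff_exists[of r "r + 1" 0]) (use r that in auto)
  define \<theta> where "\<theta> x = \<beta> x * \<psi> x" for x
  have \<theta>: "\<theta> \<in> C_inf" unfolding \<theta>_def[abs_def] by (rule C_inf_mult[OF \<beta>(1) \<psi>])
  have \<theta>0: "\<theta> x = 0" if "x \<notin> cball 0 (r + 1)" for x using \<beta>(3)[of x] that by (auto simp: \<theta>_def)
  have eq: "f x * \<psi> x = f x * \<theta> x" for x
    using f0(1)[of x] \<beta>(2)[of x] by (cases "x \<in> ball 0 r") (auto simp: \<theta>_def)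
  obtain M where M: "M \<ge> 0" "\<And>x y. \<bar>\<theta> x - \<theta> y\<bar> \<le> M * norm (x - y)"
    by (rule C_inf_lipschitz[OF \<theta> compact_cball[of 0 "r + 1"]], erule \<theta>0) (rule that)
  have bdd: "\<exists>b\<ge>0. \<forall>x\<in>cball 0 (r + 1). norm (u x) \<le> b" if "continuous_on UNIV u" for u :: "real^3 \<Rightarrow> 'b::real_normed_vector"
  proof -
    have "compact (u ` cball 0 (r + 1))"
      by (intro compact_continuous_image continuous_on_subset[OF that]) auto
    from compact_imp_bounded[OF this] obtain b where "\<forall>x\<in>cball 0 (r + 1). norm (u x) \<le> b"
      unfolding bounded_iff by blast
    then show ?thesis by (intro exI[of _ "max b 0"]) auto
  qed
  have fc: "continuous_on UNIV f" using lip_continuous f by blast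
  obtain bf where bf: "bf \<ge> 0" "\<And>x. \<bar>f x\<bar> \<le> bf"
    using bdd[OF fc] f0(1) by (metis abs_zero cball_def mem_ball mem_cball real_norm_def add_increasing2 less_imp_le not_less zero_le_one)
  obtain b\<theta> where b\<theta>: "b\<theta> \<ge> 0" "\<And>x. \<bar>\<theta> x\<bar> \<le> b\<theta>"
    using bdd[OF C_inf_continuous[OF \<theta>]] \<theta>0 by (metis abs_zero real_norm_def)
  obtain b\<psi> where b\<psi>: "b\<psi> \<ge> 0" "\<And>x. x \<in> cball 0 (r + 1) \<Longrightarrow> \<bar>\<psi> x\<bar> \<le> b\<psi>"
    using bdd[OF C_inf_continuous[OF \<psi>]] by auto
  obtain bg where bg: "bg \<ge> 0" "\<And>x. x \<in> cball 0 (r + 1) \<Longrightarrow> norm (grad \<psi> x) \<le> bg"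
    using bdd[OF grad_continuous[OF \<psi>]] by auto
  show ?thesis unfolding lip_potential_def
  proof (intro conjI allI)
    have "\<bar>f x * \<psi> x - f y * \<psi> y\<bar> \<le> (bf * M + b\<theta> * L) * norm (x - y)" for x y
    proof -
      have "f x * \<psi> x - f y * \<psi> y = f x * (\<theta> x - \<theta> y) + \<theta> y * (f x - f y)"
        unfolding eq by (simp add: algebra_simps)
      also have "\<bar>\<dots>\<bar> \<le> \<bar>f x\<bar> * \<bar>\<theta> x - \<theta> y\<bar> + \<bar>\<theta> y\<bar> * \<bar>f x - f y\<bar>"
        using abs_triangle_ineq by (simp add: abs_mult[symmetric])
      also have "\<dots> \<le> bf * (M * norm (x - y)) + b\<theta> * (L * norm (x - y))"
        using bf b\<theta> M f(1,2) by (intro add_mono mult_mono) auto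
      finally show ?thesis by (simp add: algebra_simps)
    qed
    moreover have "bf * M + b\<theta> * L \<ge> 0" using bf b\<theta> M f(1) by simp
    ultimately show "\<exists>L\<ge>0. \<forall>x y. \<bar>f x * \<psi> x - f y * \<psi> y\<bar> \<le> L * norm (x - y)" by blast
    show "\<exists>R. \<forall>x. x \<notin> cball 0 R \<longrightarrow> f x * \<psi> x = 0 \<and> \<psi> x *\<^sub>R F x + f x *\<^sub>R grad \<psi> x = 0"
      using f(3) by (intro exI[of _ R]) auto
    show "(\<lambda>x. \<psi> x *\<^sub>R F x + f x *\<^sub>R grad \<psi> x) \<in> borel_measurable borel"
      using f(4) C_inf_continuous[OF \<psi>, of UNIV] grad_continuous[OF \<psi>] fc
      by (intro borel_measurable_add borel_measurable_scaleR) (auto intro: borel_measurable_continuous_onI)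
    have B: "B \<ge> 0" using f(5)[of 0] norm_ge_zero[of "F 0"] by linarith
    have "norm (\<psi> x *\<^sub>R F x + f x *\<^sub>R grad \<psi> x) \<le> b\<psi> * B + bf * bg" for x
    proof (cases "x \<in> cball 0 (r + 1)")
      case True
      have "norm (\<psi> x *\<^sub>R F x + f x *\<^sub>R grad \<psi> x) \<le> \<bar>\<psi> x\<bar> * norm (F x) + \<bar>f x\<bar> * norm (grad \<psi> x)"
        using norm_triangle_ineq[of "\<psi> x *\<^sub>R F x" "f x *\<^sub>R grad \<psi> x"] by simp
      also have "\<dots> \<le> b\<psi> * B + bf * bg"
        using True b\<psi> bf bg f(5) by (intro add_mono mult_mono) auto
      finally show ?thesis .
    next
      case False
      then have "x \<notin> ball 0 r" by auto
      then show ?thesis using f0[of x] b\<psi>(1) B bf(1) bg(1) by simp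
    qed
    then show "\<exists>B. \<forall>x. norm (\<psi> x *\<^sub>R F x + f x *\<^sub>R grad \<psi> x) \<le> B" by blast
    fix i
    show "AE x in lborel. ((\<lambda>t. f (x + t *\<^sub>R axis i 1) * \<psi> (x + t *\<^sub>R axis i 1)) has_real_derivative
        (\<psi> x *\<^sub>R F x + f x *\<^sub>R grad \<psi> x) $ i) (at 0)"
      using f(6)[of i]
    proof eventually_elim
      case (elim x)
      have "(\<psi> has_derivative frechet_derivative \<psi> (at (x + 0 *\<^sub>R axis i 1))) (at (x + 0 *\<^sub>R axis i 1))"
        using C_inf_differentiable[OF \<psi>] frechet_derivative_works by blast
      then have "((\<lambda>t. \<psi> (x + t *\<^sub>R axis i 1)) has_derivative (\<lambda>t. frechet_derivative \<psi> (at (x + 0 *\<^sub>R axis i 1)) (t *\<^sub>R axis i 1))) (at 0)"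
        by (intro has_derivative_compose[where f = "\<lambda>t. x + t *\<^sub>R axis i 1" and f' = "\<lambda>t. t *\<^sub>R axis i 1" and g = \<psi>])
           (auto intro!: derivative_eq_intros)
      moreover have "frechet_derivative \<psi> (at (x + 0 *\<^sub>R axis i 1)) (t *\<^sub>R axis i 1) = pderiv_at i \<psi> x * t" for t
        using linear_cmul[OF linear_frechet_derivative[OF C_inf_differentiable[OF \<psi>, of x]], of t "axis i 1"]
        by (simp add: pderiv_at_def mult.commute)
      ultimately have "((\<lambda>t. \<psi> (x + t *\<^sub>R axis i 1)) has_real_derivative pderiv_at i \<psi> x) (at 0)"
        by (simp add: has_field_derivative_def)
      from DERIV_mult[OF elim this] show ?case
        by (simp add: grad_def mult.commute add.commute)
    qed
  qed
qed

text \<open>This is \<open>curl (grad g) = 0\<close> tested with \<open>f \<psi>\<close>: the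
  symmetry lemma for the potentials \<open>g\<close> and \<open>f \<psi>\<close>, with the gradient
  of the product split by the product rule.\<close>

lemma lip_potential_green:
  assumes f: "lip_potential f F" and g: "lip_potential g G" and \<psi>: "\<psi> \<in> C_inf"
  shows "(LINT x|lborel. f x * (G x $ i * pderiv_at j \<psi> x - G x $ j * pderiv_at i \<psi> x)) =
    (LINT x|lborel. \<psi> x * (G x $ j * F x $ i - G x $ i * F x $ j))"
    and "integrable lborel (\<lambda>x. f x * (G x $ i * pderiv_at j \<psi> x))"
    and "integrable lborel (\<lambda>x. \<psi> x * (G x $ i * F x $ j))"
proof -
  obtain L R B where f': "L \<ge> 0" "\<And>x y. \<bar>f x - f y\<bar> \<le> L * norm (x - y)" "\<And>x. x \<notin> cball 0 R \<Longrightarrow> f x = 0 \<and> F x = 0"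
    "F \<in> borel_measurable borel" "\<And>x. norm (F x) \<le> B"
    "\<And>i. AE x in lborel. ((\<lambda>t. f (x + t *\<^sub>R axis i 1)) has_real_derivative F x $ i) (at 0)"
    by (rule lip_potentialE[OF f]) (rule that)
  obtain B' where g': "G \<in> borel_measurable borel" "\<And>x. norm (G x) \<le> B'"
    by (rule lip_potentialE[OF g]) (rule that)
  have cm: "(\<lambda>x. u x $ k) \<in> borel_measurable lborel" if "u \<in> borel_measurable borel" for u :: "real^3 \<Rightarrow> real^3" and k
    using measurable_compose[OF that borel_measurable_continuous_onI[OF linear_continuous_on[OF bounded_linear_vec_nth]]]
    by simp
  have fc: "continuous_on UNIV f" using lip_continuous f' by blast
  have int: "integrable lborel (\<lambda>x. q x * (G x $ i * p x))"
    if q: "continuous_on UNIV q" and p: "p \<in> borel_measurable lborel" "\<And>x. \<bar>p x\<bar> \<le> b" "\<And>x. x \<notin> cball 0 R \<Longrightarrow> p x = 0"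
    for q p :: "real^3 \<Rightarrow> real" and b i
  proof -
    have "compact (q ` cball 0 R)"
      by (intro compact_continuous_image continuous_on_subset[OF q]) auto
    from compact_imp_bounded[OF this] obtain bq where bq: "\<forall>x\<in>cball 0 R. norm (q x) \<le> bq"
      unfolding bounded_iff by blast
    have "norm (q x * (G x $ i * p x)) \<le> \<bar>bq\<bar> * (\<bar>B'\<bar> * \<bar>b\<bar>)" for x
    proof (cases "x \<in> cball 0 R")
      case True
      have "\<bar>G x $ i\<bar> \<le> \<bar>B'\<bar>" using component_le_norm_cart[of "G x" i] g'(2)[of x] by linarith
      moreover have "\<bar>p x\<bar> \<le> \<bar>b\<bar>" using p(2)[of x] by linarith
      moreover have "\<bar>q x\<bar> \<le> \<bar>bq\<bar>" using bq True by force
      ultimately show ?thesis unfolding real_norm_def abs_mult by (intro mult_mono) auto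
    qed (simp add: p(3))
    note bd = this
    have ms: "(\<lambda>x. q x * (G x $ i * p x)) \<in> borel_measurable lborel"
      using borel_measurable_continuous_onI[OF q] cm[OF g'(1)] p(1) by simp
    show ?thesis
      by (rule integrable_bounded_support[OF ms bd, where R = R]) (simp add: p(3))
  qed
  have i1: "integrable lborel (\<lambda>x. f x * (G x $ i * pderiv_at j \<psi> x))" for i j
  proof -
    have "integrable lborel (\<lambda>x. pderiv_at j \<psi> x * (G x $ i * f x))"
    proof (rule int[OF C_inf_continuous[OF C_inf_pderiv[OF \<psi>]]])
      show "f \<in> borel_measurable lborel" using borel_measurable_continuous_onI[OF fc] by simp
      have "\<bar>f x\<bar> \<le> L * (norm x + (\<bar>R\<bar> + 1))" for x
      proof -
        \<comment> \<open>A point outside the support, where \<open>f\<close> vanishes, turns the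
          Lipschitz estimate into a bound for \<open>f\<close>.\<close>
        have "f ((\<bar>R\<bar> + 1) *\<^sub>R axis 1 1) = 0" using f'(3)[of "(\<bar>R\<bar> + 1) *\<^sub>R axis 1 1"] by simp
        then have "\<bar>f x\<bar> \<le> L * norm (x - (\<bar>R\<bar> + 1) *\<^sub>R axis 1 1)" using f'(2)[of x "(\<bar>R\<bar> + 1) *\<^sub>R axis 1 1"] by simp
        also have "\<dots> \<le> L * (norm x + (\<bar>R\<bar> + 1))"
          using norm_triangle_ineq4[of x "(\<bar>R\<bar> + 1) *\<^sub>R axis 1 1"] f'(1) by (intro mult_left_mono) auto
        finally show ?thesis .
      qed
      note * = this
      show "\<bar>f x\<bar> \<le> L * (\<bar>R\<bar> + (\<bar>R\<bar> + 1))" for x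
      proof (cases "x \<in> cball 0 R")
        case True
        then have "L * (norm x + (\<bar>R\<bar> + 1)) \<le> L * (\<bar>R\<bar> + (\<bar>R\<bar> + 1))" using f'(1) by (intro mult_left_mono) auto
        then show ?thesis using *[of x] by linarith
      qed (use f'(1,3) in simp)
    qed (use f'(3) in blast)
    then show ?thesis by (simp add: mult_ac)
  qed
  have i2: "integrable lborel (\<lambda>x. \<psi> x * (G x $ i * F x $ j))" for i j
  proof (rule int[OF C_inf_continuous[OF \<psi>] cm[OF f'(4)]])
    show "\<bar>F x $ j\<bar> \<le> B" for x using component_le_norm_cart[of "F x" j] f'(5)[of x] by linarith
    show "F x $ j = 0" if "x \<notin> cball 0 R" for x using f'(3)[OF that] by simp
  qed
  show "integrable lborel (\<lambda>x. f x * (G x $ i * pderiv_at j \<psi> x))" by (rule i1)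
  show "integrable lborel (\<lambda>x. \<psi> x * (G x $ i * F x $ j))" by (rule i2)
  have eq: "(LINT x|lborel. G x $ i * (\<psi> x *\<^sub>R F x + f x *\<^sub>R grad \<psi> x) $ j) =
      (LINT x|lborel. \<psi> x * (G x $ i * F x $ j)) + (LINT x|lborel. f x * (G x $ i * pderiv_at j \<psi> x))" for i j
    using Bochner_Integration.integral_add[OF i2[of i j] i1[of i j]] by (simp add: grad_def algebra_simps)
  have "(LINT x|lborel. f x * (G x $ i * pderiv_at j \<psi> x)) - (LINT x|lborel. f x * (G x $ j * pderiv_at i \<psi> x))
      = (LINT x|lborel. \<psi> x * (G x $ j * F x $ i)) - (LINT x|lborel. \<psi> x * (G x $ i * F x $ j))"
    using lip_potential_symmetry[OF g lip_potential_mult[OF f \<psi>], of i j] unfolding eq by linarith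
  then show "(LINT x|lborel. f x * (G x $ i * pderiv_at j \<psi> x - G x $ j * pderiv_at i \<psi> x)) =
    (LINT x|lborel. \<psi> x * (G x $ j * F x $ i - G x $ i * F x $ j))"
    using i1 i2 by (simp add: right_diff_distrib)
qed

text \<open>\<open>curl (f grad g) = grad f \<times> grad g\<close>, the building block of the
  Whitney forms. Only \<open>f\<close> has to vanish outside \<open>S\<close>.\<close>

lemma lip_potential_curl_pair:
  assumes f: "lip_potential f F" and g: "lip_potential g G"
    and S: "\<And>x. x \<notin> S \<Longrightarrow> f x = 0 \<and> F x = 0"
  shows "curl_pair S (\<lambda>x. f x *\<^sub>R cvec (G x)) (\<lambda>x. ccross (F x) (cvec (G x)))"
proof -
  obtain L R B where f': "L \<ge> 0" "\<And>x y. \<bar>f x - f y\<bar> \<le> L * norm (x - y)" "\<And>x. x \<notin> cball 0 R \<Longrightarrow> f x = 0 \<and> F x = 0"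
    "F \<in> borel_measurable borel" "\<And>x. norm (F x) \<le> B"
    "\<And>i. AE x in lborel. ((\<lambda>t. f (x + t *\<^sub>R axis i 1)) has_real_derivative F x $ i) (at 0)"
    by (rule lip_potentialE[OF f]) (rule that)
  obtain B' where g': "G \<in> borel_measurable borel" "\<And>x. norm (G x) \<le> B'"
    by (rule lip_potentialE[OF g]) (rule that)
  have fc: "continuous_on UNIV f" using lip_continuous f' by blast
  have cG: "(\<lambda>x. cvec (G x)) \<in> borel_measurable borel"
    using measurable_compose[OF g'(1) borel_measurable_continuous_onI[OF linear_continuous_on[OF bounded_linear_cvec]]] .
  have sqG: "sqint (\<lambda>x. indicator (cball 0 R) x *\<^sub>R cvec (G x))"
  proof (subst sqint_borel_iff)
    show m: "(\<lambda>x. indicator (cball 0 R) x *\<^sub>R cvec (G x)) \<in> borel_measurable borel"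
      by (intro borel_measurable_scaleR borel_measurable_indicator cG) auto
    show "integrable lborel (\<lambda>x. (norm (indicator (cball 0 R) x *\<^sub>R cvec (G x)))\<^sup>2)"
    proof (rule integrable_bounded_support[where R = R and B = "B'\<^sup>2"])
      fix x
      have "(norm (indicator (cball 0 R) x *\<^sub>R cvec (G x)))\<^sup>2 \<le> B'\<^sup>2"
      proof (rule power_mono)
        show "norm (indicator (cball 0 R) x *\<^sub>R cvec (G x)) \<le> B'"
          using g'(2)[of x] order_trans[OF norm_ge_zero g'(2)[of x]]
          by (cases "x \<in> cball 0 R") (simp_all add: norm_cvec)
      qed simp
      then show "norm ((norm (indicator (cball 0 R) x *\<^sub>R cvec (G x)))\<^sup>2) \<le> B'\<^sup>2" by simp
      have "(\<lambda>x. indicator (cball 0 R) x *\<^sub>R cvec (G x)) \<in> borel_measurable lborel" using m by simp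
      then show "(\<lambda>x. (norm (indicator (cball 0 R) x *\<^sub>R cvec (G x)))\<^sup>2) \<in> borel_measurable lborel"
        by (simp del: norm_scaleR)
    qed simp
  qed
  have s1: "sqint (\<lambda>x. f x *\<^sub>R cvec (G x))"
  proof -
    have "sqint (\<lambda>x. f x *\<^sub>R (indicator (cball 0 R) x *\<^sub>R cvec (G x)))"
      by (rule sqint_bilinear_bounded[OF sqG bounded_cball[of 0 R] _ bounded_bilinear_scaleR fc]) simp
    moreover have "f x *\<^sub>R (indicator (cball 0 R) x *\<^sub>R cvec (G x)) = f x *\<^sub>R cvec (G x)" for x
      using f'(3)[of x] by (cases "x \<in> cball 0 R") auto
    ultimately show ?thesis by (simp only:)
  qed
  have s2: "sqint (\<lambda>x. ccross (F x) (cvec (G x)))"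
  proof (rule sqint_bound)
    show "integrable lebesgue (\<lambda>x. (4 * B)\<^sup>2 * (norm (indicator (cball 0 R) x *\<^sub>R cvec (G x)))\<^sup>2)"
      using sqint_integrable[OF sqG] by (rule integrable_mult_right)
    have "continuous_on UNIV (\<lambda>z. ccross (fst z) (snd z))"
      by (intro ccross.continuous_on continuous_intros)
    from measurable_compose[OF _ borel_measurable_continuous_onI[OF this], of "\<lambda>x. (F x, cvec (G x))" borel]
    show "(\<lambda>x. ccross (F x) (cvec (G x))) \<in> borel_measurable lebesgue"
      using f'(4) cG by (intro measurable_completion) (simp add: borel_measurable_Pair)
    have "(norm (ccross (F x) (cvec (G x))))\<^sup>2 \<le> (4 * B)\<^sup>2 * (norm (indicator (cball 0 R) x *\<^sub>R cvec (G x)))\<^sup>2" for x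
    proof (cases "x \<in> cball 0 R")
      case True
      have "norm (ccross (F x) (cvec (G x))) \<le> 4 * norm (F x) * norm (cvec (G x))" by (rule norm_ccross_le)
      also have "\<dots> \<le> 4 * B * norm (cvec (G x))" using f'(5)[of x] by (intro mult_right_mono) auto
      finally have "(norm (ccross (F x) (cvec (G x))))\<^sup>2 \<le> (4 * B * norm (cvec (G x)))\<^sup>2" by (rule power_mono) simp
      then show ?thesis using True by (simp add: power_mult_distrib)
    qed (use f'(3)[of x] in \<open>simp add: ccross.zero_left\<close>)
    then show "AE x in lebesgue. (norm (ccross (F x) (cvec (G x))))\<^sup>2 \<le> (4 * B)\<^sup>2 * (norm (indicator (cball 0 R) x *\<^sub>R cvec (G x)))\<^sup>2"
      by simp
  qed
  show ?thesis unfolding curl_pair_def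
  proof (intro conjI ballI s1 s2)
    show "\<forall>x. x \<notin> S \<longrightarrow> f x *\<^sub>R cvec (G x) = 0 \<and> ccross (F x) (cvec (G x)) = 0"
      using S by (auto simp: ccross.zero_left)
    fix \<phi> :: "real^3 \<Rightarrow> complex^3" assume \<phi>: "\<phi> \<in> C_inf"
    \<comment> \<open>The field and its curl are real, so the real inner product sees just the real
      parts of the test components; the three cyclic index triples each give one instance of Green's
      identity.\<close>
    define \<psi> where "\<psi> k x = Re (\<phi> x $ k)" for k x
    have bl: "bounded_linear (\<lambda>b :: complex^3. Re (b $ k))" for k
      by (rule bounded_linear_compose[OF bounded_linear_Re bounded_linear_vec_nth])
    have \<psi>: "\<psi> k \<in> C_inf" for k unfolding \<psi>_def[abs_def] by (rule C_inf_linear[OF bl \<phi>])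
    have pd: "pderiv_at i (\<psi> k) x = Re (pderiv_at i \<phi> x $ k)" for i k x
      unfolding \<psi>_def[abs_def] by (rule pderiv_at_linear[OF bl \<phi>])
    let ?A = "\<lambda>i j k x. f x * (G x $ i * pderiv_at j (\<psi> k) x - G x $ j * pderiv_at i (\<psi> k) x)"
    let ?C = "\<lambda>i j k x. \<psi> k x * (G x $ j * F x $ i - G x $ i * F x $ j)"
    have iA: "integrable lborel (?A i j k)" and iC: "integrable lborel (?C i j k)" for i j k
      using lip_potential_green(2,3)[OF f g \<psi>[of k]] by (simp_all add: right_diff_distrib)
    have l: "(f x *\<^sub>R cvec (G x)) \<bullet> smooth_curl \<phi> x = ?A 1 2 3 x + ?A 2 3 1 x + ?A 3 1 2 x" for x
      by (simp add: smooth_curl_def cvec_def inner_vec_def inner_complex_def sum_3 pd scaleR_conv_of_real[where 'a = complex] algebra_simps)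
    have r: "ccross (F x) (cvec (G x)) \<bullet> \<phi> x = ?C 1 2 3 x + ?C 2 3 1 x + ?C 3 1 2 x" for x
      by (simp add: \<psi>_def ccross_def cvec_def inner_vec_def inner_complex_def sum_3 algebra_simps)
    have "(LINT x|lebesgue. (f x *\<^sub>R cvec (G x)) \<bullet> smooth_curl \<phi> x) = (LINT x|lborel. ?A 1 2 3 x + ?A 2 3 1 x + ?A 3 1 2 x)"
      unfolding l by (rule integral_completion)
        (intro borel_measurable_add borel_measurable_integrable[OF iA])
    also have "\<dots> = (LINT x|lborel. ?C 1 2 3 x + ?C 2 3 1 x + ?C 3 1 2 x)"
      using iA iC lip_potential_green(1)[OF f g \<psi>]
      by (simp only: Bochner_Integration.integral_add Bochner_Integration.integrable_add)
    also have "\<dots> = (LINT x|lebesgue. ccross (F x) (cvec (G x)) \<bullet> \<phi> x)"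
      unfolding r by (rule integral_completion[symmetric])
        (intro borel_measurable_add borel_measurable_integrable[OF iC])
    finally show "(LINT x|lebesgue. (f x *\<^sub>R cvec (G x)) \<bullet> smooth_curl \<phi> x) = (LINT x|lebesgue. ccross (F x) (cvec (G x)) \<bullet> \<phi> x)" .
  qed
qed

section \<open>Barycentric coordinates\<close>

definition verts :: "(real^3) set \<Rightarrow> (real^3) set" where
  "verts K = {p. p extreme_point_of K}"

lemma simplex_verts:
  assumes "3 simplex K"
  shows "\<not> affine_dependent (verts K)" "card (verts K) = 4" "K = convex hull verts K" "finite (verts K)"
    "compact K" "convex K" "affine hull verts K = UNIV"
proof -
  obtain C where C: "\<not> affine_dependent C" "int (card C) = 3 + 1" "K = convex hull C"
    using assms unfolding simplex_def by blast
  have "verts K = C"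
    unfolding verts_def C(3) using extreme_point_of_convex_hull_affine_independent[OF C(1)] by blast
  then show 1: "\<not> affine_dependent (verts K)" "card (verts K) = 4" "K = convex hull verts K"
    using C by auto
  show "finite (verts K)" using 1(1) by (rule aff_independent_finite)
  show "compact K" "convex K"
    using assms by (auto intro: polytope_imp_compact simplex_imp_polytope polytope_imp_convex)
  show "affine hull verts K = UNIV"
    using 1 by (intro affine_independent_span_eq) auto
qed

text \<open>Along every edge leaving \<open>p\<close> the barycentric coordinate drops from 1 to 0,
  which fixes its constant gradient.\<close>

definition bary_grad :: "(real^3) set \<Rightarrow> real^3 \<Rightarrow> real^3" where
  "bary_grad K p = (SOME g. \<forall>q\<in>verts K - {p}. g \<bullet> (q - p) = -1)"

definition bary :: "(real^3) set \<Rightarrow> real^3 \<Rightarrow> real^3 \<Rightarrow> real" where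
  "bary K p x = 1 + bary_grad K p \<bullet> (x - p)"

lemma bary_vert:
  assumes K: "3 simplex K" and p: "p \<in> verts K" and q: "q \<in> verts K"
  shows "bary K p q = (if q = p then 1 else 0)"
proof -
  let ?B = "(\<lambda>x. - p + x) ` (verts K - {p})"
  have "independent ?B"
    \<comment> \<open>Affine independence makes the edges at \<open>p\<close> linearly independent,
      so a linear functional with value -1 on each of them exists; its adjoint supplies the
      vector.\<close>
    using simplex_verts(1)[OF K] affine_dependent_iff_dependent2[OF p] by blast
  then obtain f :: "real^3 \<Rightarrow> real" where f: "linear f" "\<forall>x\<in>?B. f x = -1"
    using linear_independent_extend[of ?B "\<lambda>x. -1"] by auto
  have "f x = adjoint f 1 \<bullet> x" for x
    using adjoint_works[OF f(1), of x 1] by (simp add: inner_commute)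
  then have "\<forall>q\<in>verts K - {p}. adjoint f 1 \<bullet> (q - p) = -1" using f(2) by auto
  then have "\<forall>q\<in>verts K - {p}. bary_grad K p \<bullet> (q - p) = -1"
    unfolding bary_grad_def by (rule someI)
  then show ?thesis using q by (auto simp: bary_def)
qed

lemma bary_affine: "bary K p (x + h) = bary K p x + bary_grad K p \<bullet> h"
  by (simp add: bary_def inner_diff_right inner_add_right)

lemma bary_combination:
  assumes K: "3 simplex K" and p: "p \<in> verts K" and F: "finite F" "F \<subseteq> verts K" "sum u F = 1"
  shows "bary K p (\<Sum>q\<in>F. u q *\<^sub>R q) = (if p \<in> F then u p else 0)"
proof -
  have "(\<Sum>q\<in>F. u q *\<^sub>R q) - p = (\<Sum>q\<in>F. u q *\<^sub>R (q - p))"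
    using F(3) by (simp add: scaleR_diff_right sum_subtractf scaleR_sum_left[symmetric])
  then have "bary K p (\<Sum>q\<in>F. u q *\<^sub>R q) = 1 + (\<Sum>q\<in>F. u q * (bary_grad K p \<bullet> (q - p)))"
    by (simp add: bary_def inner_sum_right)
  also have "\<dots> = (\<Sum>q\<in>F. u q * bary K p q)"
    using F(3) by (simp add: bary_def distrib_left sum.distrib)
  also have "\<dots> = (\<Sum>q\<in>F. if q = p then u q else 0)"
    by (rule sum.cong) (use bary_vert[OF K p] F(2) in auto)
  also have "\<dots> = (if p \<in> F then u p else 0)"
    using F(1) by (simp add: sum.delta)
  finally show ?thesis .
qed

lemma bary_sum:
  assumes K: "3 simplex K"
  shows "(\<Sum>p\<in>verts K. bary K p x) = 1" "(\<Sum>p\<in>verts K. bary K p x *\<^sub>R p) = x"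
proof -
  have "x \<in> affine hull verts K" using simplex_verts(7)[OF K] by simp
  then obtain u where u: "sum u (verts K) = 1" "(\<Sum>v\<in>verts K. u v *\<^sub>R v) = x"
    unfolding affine_hull_finite[OF simplex_verts(4)[OF K]] by blast
  have "bary K p x = u p" if "p \<in> verts K" for p
    using bary_combination[OF K that simplex_verts(4)[OF K] subset_refl u(1)] that u(2) by simp
  then show "(\<Sum>p\<in>verts K. bary K p x) = 1" "(\<Sum>p\<in>verts K. bary K p x *\<^sub>R p) = x"
    using u by simp_all
qed

lemma bary_grad_sum:
  assumes K: "3 simplex K"
  shows "(\<Sum>p\<in>verts K. bary_grad K p) = 0" "(\<Sum>p\<in>verts K. (bary_grad K p \<bullet> h) *\<^sub>R p) = h"
proof -
  have b: "bary_grad K p \<bullet> h = bary K p h - bary K p 0" for p h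
    using bary_affine[of K p 0 h] by simp
  have "(\<Sum>p\<in>verts K. bary_grad K p) \<bullet> h = 0" for h
    by (simp add: inner_sum_left b sum_subtractf bary_sum(1)[OF K])
  then show "(\<Sum>p\<in>verts K. bary_grad K p) = 0" by (metis inner_eq_zero_iff)
  show "(\<Sum>p\<in>verts K. (bary_grad K p \<bullet> h) *\<^sub>R p) = h"
    by (simp add: b scaleR_diff_left sum_subtractf bary_sum(2)[OF K])
qed

lemma bary_grad_dual:
  assumes K: "3 simplex K"
  shows "(\<Sum>p\<in>verts K. bary_grad K p $ l * p $ k) = (if l = k then 1 else 0)"
proof -
  have "(\<Sum>p\<in>verts K. (bary_grad K p \<bullet> axis l 1) *\<^sub>R p) $ k = axis l 1 $ k"
    by (simp add: bary_grad_sum(2)[OF K])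
  moreover have "bary_grad K p \<bullet> axis l 1 = bary_grad K p $ l" for p by (simp add: inner_axis)
  ultimately show ?thesis by (simp add: axis_def)
qed

text \<open>Krein-Milman for the face. Its extreme points are extreme points of the simplex, so the
  weights are barycentric coordinates for every cell having this face.\<close>

lemma face_combination:
  assumes K: "3 simplex K" and F: "F face_of K" "x \<in> F"
  obtains u where "finite (verts F)" "verts F \<subseteq> verts K" "\<And>q. q \<in> verts F \<Longrightarrow> u q \<ge> 0" "sum u (verts F) = 1"
    "(\<Sum>q\<in>verts F. u q *\<^sub>R q) = x"
proof -
  have sub: "verts F \<subseteq> verts K"
    using extreme_point_of_face[OF F(1)] by (auto simp: verts_def)
  have fin: "finite (verts F)" using sub simplex_verts(4)[OF K] finite_subset by blast
  have "compact F" "convex F"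
    using face_of_imp_compact[OF simplex_verts(6,5)[OF K] F(1)] face_of_imp_convex[OF F(1)] by auto
  then have "F = convex hull verts F"
    unfolding verts_def by (rule Krein_Milman_Minkowski)
  then have "x \<in> convex hull verts F" using F(2) by simp
  then obtain u where "\<forall>q\<in>verts F. 0 \<le> u q" "sum u (verts F) = 1" "(\<Sum>q\<in>verts F. u q *\<^sub>R q) = x"
    unfolding convex_hull_finite[OF fin] by blast
  then show ?thesis using that fin sub by blast
qed

lemma bary_range:
  assumes K: "3 simplex K" and p: "p \<in> verts K" and x: "x \<in> K"
  shows "0 \<le> bary K p x" "bary K p x \<le> 1"
proof -
  have nn: "0 \<le> bary K p x" if p: "p \<in> verts K" for p
  proof -
    have "K face_of K" using simplex_verts(6)[OF K] by (rule face_of_refl)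
    from face_combination[OF K this x] obtain u where u: "finite (verts K)" "\<And>q. q \<in> verts K \<Longrightarrow> u q \<ge> 0" "sum u (verts K) = 1"
      "(\<Sum>q\<in>verts K. u q *\<^sub>R q) = x"
      by auto
    then show ?thesis using bary_combination[OF K p u(1) subset_refl u(3)] p by simp
  qed
  show "0 \<le> bary K p x" by (rule nn[OF p])
  have "bary K p x \<le> (\<Sum>q\<in>verts K. bary K q x)"
    using simplex_verts(4)[OF K] p nn by (intro member_le_sum) auto
  then show "bary K p x \<le> 1" using bary_sum(1)[OF K] by simp
qed

text \<open>Crossing an inscribed ball of radius \<open>r\<close> in the gradient direction changes
  the coordinate by \<open>2 r\<close> times the norm of the gradient, and the coordinate stays in
  [0, 1] on \<open>K\<close>. Shape regularity trades the inscribed ball for the diameter.\<close>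

lemma bary_grad_bound:
  assumes K: "3 simplex K" and p: "p \<in> verts K" and \<kappa>: "diameter K \<le> \<kappa> * inball_diameter K"
  shows "norm (bary_grad K p) * diameter K \<le> max \<kappa> 0"
proof (cases "bary_grad K p = 0")
  case False
  define n where "n = norm (bary_grad K p)"
  have n: "n > 0" using False by (simp add: n_def)
  let ?R = "{2 * r |r. 0 \<le> r \<and> (\<exists>c. cball c r \<subseteq> K)}"
  have ub: "y \<le> 1 / n" if "y \<in> ?R" for y
  proof -
    from that have "\<exists>r. y = 2 * r \<and> 0 \<le> r \<and> (\<exists>c. cball c r \<subseteq> K)" by simp
    then obtain r c where r: "y = 2 * r" "0 \<le> r" "cball c r \<subseteq> K" by (elim exE conjE)
    define e where "e = (r / n) *\<^sub>R bary_grad K p"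
    have "norm e = r" using r(2) n by (simp add: e_def n_def)
    then have "c + e \<in> K" "c - e \<in> K" using r(3) by (auto simp: dist_norm)
    moreover have "bary K p (c + e) - bary K p (c - e) = 2 * (bary_grad K p \<bullet> e)"
      using bary_affine[of K p "c" e] bary_affine[of K p c "- e"] by simp
    moreover have "bary_grad K p \<bullet> e = r * n"
      using n by (simp add: e_def n_def power2_norm_eq_inner[symmetric] power2_eq_square)
    ultimately have "2 * (r * n) \<le> 1"
      using bary_range[OF K p, of "c + e"] bary_range[OF K p, of "c - e"] by linarith
    then show ?thesis using n r(1) by (simp add: field_simps)
  qed
  have "K \<noteq> {}" using p by (auto simp: verts_def extreme_point_of_def)
  then obtain c where "c \<in> K" by blast
  then have "\<exists>c. cball c 0 \<subseteq> K" by (intro exI[of _ c]) simp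
  then have ne: "0 \<in> ?R" by (intro CollectI exI[of _ "0 :: real"]) simp
  have le: "inball_diameter K \<le> 1 / n"
    unfolding inball_diameter_def using ne by (intro cSup_least[OF _ ub]) blast+
  have ge: "0 \<le> inball_diameter K"
    unfolding inball_diameter_def by (intro cSup_upper[OF ne] bdd_aboveI[OF ub])
  have "diameter K \<le> max \<kappa> 0 * inball_diameter K"
    using \<kappa> ge mult_right_mono[of \<kappa> "max \<kappa> 0" "inball_diameter K"] by linarith
  also have "\<dots> \<le> max \<kappa> 0 * (1 / n)" by (rule mult_left_mono[OF le]) simp
  finally have "n * diameter K \<le> n * (max \<kappa> 0 * (1 / n))" using n by (intro mult_left_mono) auto
  then show ?thesis using n by (simp add: n_def)
qed simp

section \<open>Hat functions\<close>

locale mesh =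
  fixes \<T> :: "(real^3) set set"
  assumes fin: "finite \<T>" and simp3: "\<And>K. K \<in> \<T> \<Longrightarrow> 3 simplex K"
    and conf: "\<And>K K'. K \<in> \<T> \<Longrightarrow> K' \<in> \<T> \<Longrightarrow> (K \<inter> K') face_of K"
begin

text \<open>Any cell through \<open>x\<close> with vertex \<open>p\<close> may be chosen:
  \<open>hat_on\<close> shows that conformity makes the value independent of it.\<close>

definition hat :: "real^3 \<Rightarrow> real^3 \<Rightarrow> real" where
  "hat p x = (if \<exists>K\<in>\<T>. x \<in> K \<and> p \<in> verts K then bary (SOME K. K \<in> \<T> \<and> x \<in> K \<and> p \<in> verts K) p x else 0)"

text \<open>The interiors are disjoint, so at most one term is nonzero. The value 0 on the cell
  boundaries is harmless, these being null sets, and the finite sum is Borel measurable.\<close>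

definition hat_grad :: "real^3 \<Rightarrow> real^3 \<Rightarrow> real^3" where
  "hat_grad p x = (\<Sum>K\<in>\<T>. indicator (interior K) x *\<^sub>R (if p \<in> verts K then bary_grad K p else 0))"

text \<open>The point lies in the common face and is a combination of the vertices of that face
  alone. These are vertices of both cells, so both sets of coordinates are the weights of this
  combination.\<close>

lemma bary_common_face:
  assumes K: "K \<in> \<T>" "K' \<in> \<T>" and x: "x \<in> K" "x \<in> K'" and p: "p \<in> verts K'"
  shows "bary K' p x = (if p \<in> verts K then bary K p x else 0)"
proof -
  let ?F = "K \<inter> K'"
  have F: "?F face_of K" "?F face_of K'" "x \<in> ?F"
    using conf[OF K] conf[OF K(2,1)] x by (auto simp: Int_commute)
  obtain u where u: "finite (verts ?F)" "verts ?F \<subseteq> verts K" "sum u (verts ?F) = 1" "(\<Sum>q\<in>verts ?F. u q *\<^sub>R q) = x"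
    by (rule face_combination[OF simp3[OF K(1)] F(1,3)]) (rule that)
  have sub': "verts ?F \<subseteq> verts K'"
    using extreme_point_of_face[OF F(2)] by (auto simp: verts_def)
  have "bary K' p x = (if p \<in> verts ?F then u p else 0)"
    using bary_combination[OF simp3[OF K(2)] p u(1) sub' u(3)] u(4) by simp
  moreover have "bary K p x = (if p \<in> verts ?F then u p else 0)" if "p \<in> verts K"
    using bary_combination[OF simp3[OF K(1)] that u(1,2,3)] u(4) by simp
  ultimately show ?thesis using u(2) by auto
qed

lemma hat_on:
  assumes K: "K \<in> \<T>" and x: "x \<in> K"
  shows "hat p x = (if p \<in> verts K then bary K p x else 0)"
proof (cases "\<exists>K\<in>\<T>. x \<in> K \<and> p \<in> verts K")
  case True
  define K' where "K' = (SOME K. K \<in> \<T> \<and> x \<in> K \<and> p \<in> verts K)"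
  from True have "\<exists>K. K \<in> \<T> \<and> x \<in> K \<and> p \<in> verts K" by blast
  then have "K' \<in> \<T> \<and> x \<in> K' \<and> p \<in> verts K'"
    unfolding K'_def by (rule someI_ex)
  then have "bary K' p x = (if p \<in> verts K then bary K p x else 0)"
    by (intro bary_common_face[OF K _ x]) auto
  then show ?thesis using True by (simp only: hat_def K'_def if_True)
next
  case False
  then show ?thesis using K x by (auto simp: hat_def)
qed

lemma hat_outside: "x \<notin> \<Union>\<T> \<Longrightarrow> hat p x = 0"
  by (auto simp: hat_def)

lemma interior_unique:
  assumes "K \<in> \<T>" "K' \<in> \<T>" "x \<in> interior K" "x \<in> interior K'"
  shows "K' = K"
proof -
  have "K \<inter> K' = K"
    using face_of_disjoint_interior[OF conf[OF assms(1,2)]] assms interior_subset by blast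
  moreover have "K' \<inter> K = K'"
    using face_of_disjoint_interior[OF conf[OF assms(2,1)]] assms interior_subset by blast
  ultimately show ?thesis by blast
qed

lemma hat_grad_interior:
  assumes K: "K \<in> \<T>" and x: "x \<in> interior K"
  shows "hat_grad p x = (if p \<in> verts K then bary_grad K p else 0)"
proof -
  have "hat_grad p x = (\<Sum>K'\<in>\<T>. if K' = K then (if p \<in> verts K then bary_grad K p else 0) else 0)"
    unfolding hat_grad_def
  proof (rule sum.cong[OF refl])
    fix K' assume K': "K' \<in> \<T>"
    show "indicator (interior K') x *\<^sub>R (if p \<in> verts K' then bary_grad K' p else 0) =
      (if K' = K then (if p \<in> verts K then bary_grad K p else 0) else 0)"
      using interior_unique[OF K K' x] interior_subset[of K'] x by (cases "x \<in> interior K'") auto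
  qed
  then show ?thesis using fin K by (simp add: sum.delta)
qed

lemma hat_grad_exterior: "x \<notin> \<Union>\<T> \<Longrightarrow> hat_grad p x = 0"
  unfolding hat_grad_def using interior_subset by (intro sum.neutral) (auto simp: indicator_def)

lemma AE_interior: "AE x in lebesgue. x \<in> \<Union>\<T> \<longrightarrow> (\<exists>K\<in>\<T>. x \<in> interior K)"
proof -
  have "negligible (\<Union>K\<in>\<T>. frontier K)"
    using fin simplex_verts(6)[OF simp3] by (intro negligible_Union) (auto intro: negligible_convex_frontier)
  then have "AE x in lebesgue. x \<notin> (\<Union>K\<in>\<T>. frontier K)"
    unfolding negligible_iff_null_sets by (rule AE_not_in)
  then show ?thesis
  proof eventually_elim
    case (elim x)
    then show ?case
      using closure_subset by (fastforce simp: frontier_def)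
  qed
qed

lemma closed_cells: "K \<in> \<T> \<Longrightarrow> closed K"
  using simplex_verts(5)[OF simp3] compact_imp_closed by blast

lemma closed_mesh: "closed (\<Union>\<T>)"
  using fin closed_cells by (intro closed_Union) auto

lemma compact_mesh: "compact (\<Union>\<T>)"
  using fin simplex_verts(5)[OF simp3] by (intro compact_Union) auto

end

text \<open>Points in different pieces are compared along the segment between them: the pieces pull
  back to finitely many closed sets covering [0, 1], where Lipschitz bounds can be glued without
  enlarging the constant.\<close>

lemma lipschitz_closed_cover:
  fixes f :: "'a::real_normed_vector \<Rightarrow> 'b::metric_space"
  assumes fin: "finite \<S>" and cl: "\<And>S. S \<in> \<S> \<Longrightarrow> closed S" and cov: "\<Union>\<S> = UNIV"
    and lip: "\<And>S. S \<in> \<S> \<Longrightarrow> L-lipschitz_on S f" and L: "L \<ge> 0"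
  shows "L-lipschitz_on UNIV f"
proof (rule lipschitz_onI[OF _ L])
  fix x y :: 'a
  define s where "s t = x + t *\<^sub>R (y - x)" for t :: real
  define U where "U S = s -` S" for S
  have "(L * norm (y - x))-lipschitz_on {0..1} (f \<circ> s)"
  proof (rule lipschitz_on_closed_Union[where I = \<S> and U = U])
    fix S assume S: "S \<in> \<S>"
    show "(L * norm (y - x))-lipschitz_on (U S) (f \<circ> s)"
    proof (rule lipschitz_onI)
      fix a b assume "a \<in> U S" "b \<in> U S"
      then have "dist (f (s a)) (f (s b)) \<le> L * dist (s a) (s b)"
        using lipschitz_onD[OF lip[OF S]] by (auto simp: U_def)
      also have "dist (s a) (s b) = norm (y - x) * dist a b"
        by (simp add: s_def dist_norm scaleR_diff_left[symmetric] mult.commute)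
      finally show "dist ((f \<circ> s) a) ((f \<circ> s) b) \<le> L * norm (y - x) * dist a b" by (simp add: mult_ac)
    qed (use L in simp)
    show "closed (U S)"
      unfolding U_def s_def by (intro continuous_closed_vimage cl S continuous_intros)
  qed (use fin L cov in \<open>auto simp: U_def\<close>)
  from lipschitz_onD[OF this, of 0 1] show "dist (f x) (f y) \<le> L * dist x y"
    by (simp add: s_def dist_norm norm_minus_commute)
qed

context mesh
begin

text \<open>The condition on \<open>p\<close> says that its star stays inside the open set \<Omega>.
  Hat functions at boundary vertices would jump at the boundary when extended by zero and are
  excluded.\<close>

lemma hat_potential:
  assumes \<Omega>: "open \<Omega>" "\<Omega> \<subseteq> \<Union>\<T>" and p: "\<And>K. K \<in> \<T> \<Longrightarrow> p \<in> verts K \<Longrightarrow> K \<subseteq> \<Omega>"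
  shows "lip_potential (hat p) (hat_grad p)" "\<And>x. x \<notin> \<Omega> \<Longrightarrow> hat p x = 0 \<and> hat_grad p x = 0"
proof -
  show out: "hat p x = 0 \<and> hat_grad p x = 0" if x: "x \<notin> \<Omega>" for x
  proof
    show "hat p x = 0" using p x by (auto simp: hat_def)
    show "hat_grad p x = 0" unfolding hat_grad_def
    proof (rule sum.neutral, rule ballI)
      fix K assume "K \<in> \<T>"
      then show "indicator (interior K) x *\<^sub>R (if p \<in> verts K then bary_grad K p else 0) = 0"
        using p[of K] x interior_subset[of K] by (auto simp: indicator_def)
    qed
  qed
  define L where "L = (\<Sum>K\<in>\<T>. norm (bary_grad K p))"
  have L: "L \<ge> 0" unfolding L_def by (intro sum_nonneg) simp
  have gL: "norm (bary_grad K p) \<le> L" if "K \<in> \<T>" for K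
    unfolding L_def using fin that by (intro member_le_sum) auto
  have "L-lipschitz_on UNIV (hat p)"
  \<comment> \<open>The complement of \<Omega> joins the cells as one more closed piece, on which
    the hat function is zero.\<close>
  proof (rule lipschitz_closed_cover[where \<S> = "insert (- \<Omega>) \<T>"])
    show "\<Union> (insert (- \<Omega>) \<T>) = UNIV" using \<Omega>(2) by auto
    show "closed S" if "S \<in> insert (- \<Omega>) \<T>" for S
      using that \<Omega>(1) closed_cells by auto
    fix S assume "S \<in> insert (- \<Omega>) \<T>"
    then consider "S = - \<Omega>" | "S \<in> \<T>" by blast
    then show "L-lipschitz_on S (hat p)"
    proof cases
      case 1
      then show ?thesis using L out by (intro lipschitz_onI) auto
    next
      case 2
      show ?thesis
      proof (rule lipschitz_onI[OF _ L])
        fix x y assume xy: "x \<in> S" "y \<in> S"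
        have "\<bar>bary S p x - bary S p y\<bar> \<le> L * norm (x - y)"
        proof -
          have "bary S p x - bary S p y = bary_grad S p \<bullet> (x - y)"
            by (simp add: bary_def inner_diff_right)
          also have "\<bar>\<dots>\<bar> \<le> norm (bary_grad S p) * norm (x - y)" by (rule Cauchy_Schwarz_ineq2)
          also have "\<dots> \<le> L * norm (x - y)" using gL[OF 2] by (rule mult_right_mono) simp
          finally show ?thesis .
        qed
        then show "dist (hat p x) (hat p y) \<le> L * dist x y"
          using L by (simp add: hat_on[OF 2 xy(1)] hat_on[OF 2 xy(2)] dist_norm)
      qed
    qed
  qed (use fin L in auto)
  note lip = this
  obtain R where R: "\<Union>\<T> \<subseteq> ball 0 R"
    using bounded_subset_ballD[OF compact_imp_bounded[OF compact_mesh], of 0] by blast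
  have AE: "AE x in lborel. x \<notin> (\<Union>K\<in>\<T>. frontier K)"
  proof -
    have "negligible (\<Union>K\<in>\<T>. frontier K)"
      using fin simplex_verts(6)[OF simp3] by (intro negligible_Union) (auto intro: negligible_convex_frontier)
    moreover have "(\<Union>K\<in>\<T>. frontier K) \<in> sets lborel"
      using fin by (intro sets.finite_UN) (auto intro: borel_closed frontier_closed)
    ultimately have "(\<Union>K\<in>\<T>. frontier K) \<in> null_sets lborel"
      by (simp add: negligible_iff_null_sets null_sets_completion_iff)
    then show ?thesis by (rule AE_not_in)
  qed
  show "lip_potential (hat p) (hat_grad p)" unfolding lip_potential_def
  proof (intro conjI allI)
    show "\<exists>L\<ge>0. \<forall>x y. \<bar>hat p x - hat p y\<bar> \<le> L * norm (x - y)"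
      using lipschitz_onD[OF lip] L by (intro exI[of _ L]) (auto simp: dist_norm)
    show "\<exists>R. \<forall>x. x \<notin> cball 0 R \<longrightarrow> hat p x = 0 \<and> hat_grad p x = 0"
      using R hat_outside hat_grad_exterior ball_subset_cball by (intro exI[of _ R]) blast
    show "hat_grad p \<in> borel_measurable borel"
      unfolding hat_grad_def[abs_def]
      by (intro borel_measurable_sum borel_measurable_scaleR borel_measurable_indicator) auto
    have "norm (hat_grad p x) \<le> L" for x
      unfolding hat_grad_def L_def by (intro sum_norm_le) (auto simp: indicator_def)
    then show "\<exists>B. \<forall>x. norm (hat_grad p x) \<le> B" by blast
    fix i
    show "AE x in lborel. ((\<lambda>t. hat p (x + t *\<^sub>R axis i 1)) has_real_derivative hat_grad p x $ i) (at 0)"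
      using AE
    proof eventually_elim
      case (elim x)
      have loc: "((\<lambda>t. hat p (x + t *\<^sub>R axis i 1)) has_real_derivative d) (at 0)"
        if U: "open U" "x \<in> U" and eq: "\<And>y. y \<in> U \<Longrightarrow> hat p y = c + g \<bullet> y" and d: "d = g $ i" for U c g d
      proof -
        have D: "((\<lambda>t. c + g \<bullet> (x + t *\<^sub>R axis i 1)) has_real_derivative d) (at 0)"
          unfolding inner_add_right inner_scaleR_right d by (auto intro!: derivative_eq_intros simp: inner_axis)
        have "open ((\<lambda>t. x + t *\<^sub>R axis i 1) -` U)"
          by (intro continuous_open_vimage U(1) continuous_intros)
        then show ?thesis
          by (rule has_field_derivative_transform_within_open[OF D]) (use U(2) eq in auto)
      qed
      show ?case
      proof (cases "x \<in> \<Union>\<T>")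
        case True
        then obtain K where K: "K \<in> \<T>" "x \<in> K" by blast
        then have x: "x \<in> interior K" using elim closure_subset by (fastforce simp: frontier_def)
        show ?thesis
        proof (cases "p \<in> verts K")
          case p: True
          show ?thesis
          proof (rule loc[OF open_interior x, where c = "1 - bary_grad K p \<bullet> p" and g = "bary_grad K p"])
            show "hat p y = 1 - bary_grad K p \<bullet> p + bary_grad K p \<bullet> y" if "y \<in> interior K" for y
              using hat_on[OF K(1), of y p] that interior_subset[of K] p by (auto simp: bary_def inner_diff_right)
          qed (use hat_grad_interior[OF K(1) x] p in simp)
        next
          case p: False
          show ?thesis
          proof (rule loc[OF open_interior x, where c = 0 and g = 0])
            show "hat p y = 0 + 0 \<bullet> y" if "y \<in> interior K" for y
              using hat_on[OF K(1), of y p] that interior_subset[of K] p by auto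
          qed (use hat_grad_interior[OF K(1) x] p in simp)
        qed
      next
        case False
        show ?thesis
        proof (rule loc[where U = "- \<Union>\<T>" and c = 0 and g = 0])
          show "open (- \<Union>\<T>)" using closed_mesh by (rule open_Compl)
        qed (use False hat_outside hat_grad_exterior in auto)
      qed
    qed
  qed
qed

end

section \<open>Interpolation in the lowest-order Nedelec space\<close>

lemma norm_cdot_le: "norm (cdot a b) \<le> 3 * norm a * norm b"
proof -
  have "norm (cdot a b) \<le> (\<Sum>i\<in>(UNIV :: 3 set). norm a * norm b)"
    unfolding cdot_def
  proof (rule sum_norm_le)
    fix i
    show "norm (a $ i * b $ i) \<le> norm a * norm b"
      unfolding norm_mult by (intro mult_mono Finite_Cartesian_Product.norm_nth_le) auto
  qed
  then show ?thesis by simp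
qed

lemma ccross_vscale: "ccross a (z *s b) = z *s ccross a b"
  by (simp add: ccross_def vec_eq_iff forall_3 algebra_simps)

lemma ccross_anti: "ccross a (cvec b) = - ccross b (cvec a)"
  by (simp add: ccross_def cvec_def vec_eq_iff forall_3 algebra_simps)

lemma ccross_ccross: "ccross x (ccross a (cvec b)) = (b \<bullet> x) *\<^sub>R cvec a - (a \<bullet> x) *\<^sub>R cvec b"
  by (simp add: ccross_def cvec_def vec_eq_iff forall_3 inner_vec_def sum_3
      scaleR_conv_of_real[where 'a = complex] algebra_simps)

lemma vscale_sum_right: "z *s (\<Sum>i\<in>A. f i :: complex^3) = (\<Sum>i\<in>A. z *s f i)"
  by (simp add: vec_eq_iff sum_distrib_left)

definition edge_dof :: "(real^3 \<Rightarrow> complex^3) \<Rightarrow> real^3 \<Rightarrow> real^3 \<Rightarrow> complex" where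
  "edge_dof v p q = cdot (v p + v q) (cvec (q - p)) / 2"

text \<open>The Whitney form \<open>\<Sum>\<^sub>e (\<integral>\<^sub>e v \<cdot> t) (\<lambda>\<^sub>p \<nabla>\<lambda>\<^sub>q - \<lambda>\<^sub>q \<nabla>\<lambda>\<^sub>p)\<close>, with the trapezoidal rule for the edge
  integrals. These are antisymmetric in \<open>p\<close> and \<open>q\<close>, so the sum may run over ordered pairs.\<close>

definition loc_field :: "(real^3 \<Rightarrow> complex^3) \<Rightarrow> (real^3) set \<Rightarrow> real^3 \<Rightarrow> complex^3" where
  "loc_field v K x = (\<Sum>p\<in>verts K. \<Sum>q\<in>verts K. edge_dof v p q *s (bary K p x *\<^sub>R cvec (bary_grad K q)))"

definition loc_curl :: "(real^3 \<Rightarrow> complex^3) \<Rightarrow> (real^3) set \<Rightarrow> complex^3" where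
  "loc_curl v K = (\<Sum>p\<in>verts K. \<Sum>q\<in>verts K. edge_dof v p q *s ccross (bary_grad K p) (cvec (bary_grad K q)))"

lemma edge_dof_anti: "edge_dof v q p = - edge_dof v p q"
proof -
  have "cvec (p - q) = - cvec (q - p)" by (simp add: cvec_def vec_eq_iff)
  then show ?thesis
    by (simp add: edge_dof_def bounded_bilinear.minus_right[OF bounded_bilinear_cdot] add.commute)
qed

text \<open>Antisymmetry of the edge values pairs the linear terms of \<open>(p, q)\<close> and
  \<open>(q, p)\<close> into \<open>(g_p . x) g_q - (g_q . x) g_p\<close>, which is
  \<open>x \<times> (g_q \<times> g_p)\<close> by the triple product formula. The factor 1/2 in
  \<open>b\<close> comes from counting every pair twice.\<close>

lemma loc_field_nedelec: "\<exists>a b. \<forall>x. loc_field v K x = a + ccross x b"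
proof -
  let ?V = "verts K" and ?g = "bary_grad K" and ?d = "edge_dof v"
  define a where "a = (\<Sum>p\<in>?V. \<Sum>q\<in>?V. ?d p q *s ((1 - ?g p \<bullet> p) *\<^sub>R cvec (?g q)))"
  define b where "b = (\<Sum>p\<in>?V. \<Sum>q\<in>?V. (?d p q / 2) *s ccross (?g q) (cvec (?g p)))"
  have "loc_field v K x = a + ccross x b" for x
  proof -
    let ?T = "\<lambda>p q. ?d p q *s ((?g p \<bullet> x) *\<^sub>R cvec (?g q))"
    have "loc_field v K x = a + (\<Sum>p\<in>?V. \<Sum>q\<in>?V. ?T p q)"
      unfolding loc_field_def a_def sum.distrib[symmetric]
    proof (intro sum.cong refl)
      fix p q
      have "bary K p x = (1 - ?g p \<bullet> p) + ?g p \<bullet> x" by (simp add: bary_def inner_diff_right)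
      then show "?d p q *s (bary K p x *\<^sub>R cvec (?g q)) = ?d p q *s ((1 - ?g p \<bullet> p) *\<^sub>R cvec (?g q)) + ?T p q"
        by (simp only: scaleR_add_left vector_add_ldistrib)
    qed
    also have "(\<Sum>p\<in>?V. \<Sum>q\<in>?V. ?T p q) = ccross x b"
    proof -
      have "(\<Sum>p\<in>?V. \<Sum>q\<in>?V. ?T p q) = (\<Sum>p\<in>?V. \<Sum>q\<in>?V. ?T q p)" by (rule sum.swap)
      then have "2 *\<^sub>R (\<Sum>p\<in>?V. \<Sum>q\<in>?V. ?T p q) = (\<Sum>p\<in>?V. \<Sum>q\<in>?V. ?T p q + ?T q p)"
        by (simp add: sum.distrib scaleR_2)
      also have "\<dots> = (\<Sum>p\<in>?V. \<Sum>q\<in>?V. 2 *\<^sub>R ((?d p q / 2) *s ccross x (ccross (?g q) (cvec (?g p)))))"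
      proof (intro sum.cong refl)
        fix p q
        show "?T p q + ?T q p = 2 *\<^sub>R ((?d p q / 2) *s ccross x (ccross (?g q) (cvec (?g p))))"
          unfolding ccross_ccross edge_dof_anti[of v q p]
          by (simp add: vec_eq_iff scaleR_conv_of_real[where 'a = complex] algebra_simps)
      qed
      also have "\<dots> = 2 *\<^sub>R ccross x b"
        by (simp add: b_def ccross.sum_right ccross_vscale scaleR_sum_right)
      finally show ?thesis by simp
    qed
    finally show ?thesis .
  qed
  then show ?thesis by blast
qed

text \<open>The affine function \<open>a . (x - p)\<close> is interpolated exactly from its vertex
  values, and its gradient is \<open>a\<close>. The base point \<open>p\<close> is
  arbitrary.\<close>

lemma bary_grad_reproduces:
  assumes K: "3 simplex K"
  shows "(\<Sum>q\<in>verts K. cdot a (cvec (q - p)) *s cvec (bary_grad K q)) = a"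
proof -
  let ?V = "verts K" and ?g = "bary_grad K"
  have g0: "(\<Sum>q\<in>?V. ?g q $ l) = 0" for l
    using arg_cong[OF bary_grad_sum(1)[OF K], of "\<lambda>x. x $ l"] by simp
  have dual: "(\<Sum>q\<in>?V. (q - p) $ k * ?g q $ l) = (if l = k then 1 else 0)" for k l
  proof -
    have "(\<Sum>q\<in>?V. (q - p) $ k * ?g q $ l) = (\<Sum>q\<in>?V. ?g q $ l * q $ k) - p $ k * (\<Sum>q\<in>?V. ?g q $ l)"
      by (simp add: algebra_simps sum_subtractf sum_distrib_left)
    then show ?thesis using bary_grad_dual[OF K, of l k] g0 by simp
  qed
  have "(\<Sum>q\<in>?V. cdot a (cvec (q - p)) *s cvec (?g q)) $ l = a $ l" for l
  proof -
    have "(\<Sum>q\<in>?V. cdot a (cvec (q - p)) *s cvec (?g q)) $ l =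
        (\<Sum>q\<in>?V. \<Sum>k\<in>UNIV. a $ k * of_real ((q - p) $ k * ?g q $ l))"
      by (simp add: cdot_def cvec_def sum_distrib_left sum_distrib_right mult_ac)
    also have "\<dots> = (\<Sum>k\<in>UNIV. a $ k * of_real (\<Sum>q\<in>?V. (q - p) $ k * ?g q $ l))"
      by (subst sum.swap) (simp add: sum_distrib_left)
    also have "\<dots> = (\<Sum>k\<in>UNIV. if l = k then a $ k else 0)"
      unfolding dual by (rule sum.cong) auto
    finally show ?thesis by (simp add: sum.delta)
  qed
  then show ?thesis by (simp add: vec_eq_iff)
qed

text \<open>Whitney interpolation reproduces the constant field \<open>v x\<close>. Each edge value
  of \<open>v\<close> differs from that of the constant by at most \<open>3 L d^2\<close>, one
  factor \<open>d\<close> is absorbed by the gradient bound \<kappa>, and there are 16 ordered pairs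
  of vertices: \<open>48 = 16 * 3\<close>.\<close>

lemma loc_field_error:
  assumes K: "3 simplex K" and \<kappa>: "diameter K \<le> \<kappa> * inball_diameter K" "\<kappa> \<ge> 0"
    and L: "\<And>x y. norm (v x - v y) \<le> L * norm (x - y)" "L \<ge> 0" and x: "x \<in> K"
  shows "norm (loc_field v K x - v x) \<le> 48 * L * \<kappa> * diameter K"
proof -
  let ?V = "verts K" and ?g = "bary_grad K"
  define d where "d = diameter K"
  have bK: "bounded K" using simplex_verts(5)[OF K] by (rule compact_imp_bounded)
  have VK: "?V \<subseteq> K" by (auto simp: verts_def extreme_point_of_def)
  have dist: "norm (y - z) \<le> d" if "y \<in> K" "z \<in> K" for y z
    using diameter_bounded_bound[OF bK that] by (simp add: d_def dist_norm)
  have d0: "d \<ge> 0" using dist[OF x x] by simp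
  have gd: "norm (?g q) * d \<le> \<kappa>" if "q \<in> ?V" for q
    using bary_grad_bound[OF K that \<kappa>(1)] \<kappa>(2) by (simp add: d_def)
  define E where "E p q = edge_dof v p q - cdot (v x) (cvec (q - p))" for p q
  have E: "norm (E p q) \<le> 3 * L * d * d" if pq: "p \<in> ?V" "q \<in> ?V" for p q
  proof -
    have pqK: "p \<in> K" "q \<in> K" using pq VK by auto
    have "E p q = cdot ((v p - v x) + (v q - v x)) (cvec (q - p)) / 2"
      by (simp add: E_def edge_dof_def cdot_def sum_divide_distrib sum_subtractf[symmetric] field_simps)
    then have "norm (E p q) = norm (cdot ((v p - v x) + (v q - v x)) (cvec (q - p))) / 2"
      by (simp only: norm_divide norm_numeral)
    also have "\<dots> \<le> (3 * norm ((v p - v x) + (v q - v x)) * norm (q - p)) / 2"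
      using norm_cdot_le[of "(v p - v x) + (v q - v x)" "cvec (q - p)"] by (simp add: norm_cvec)
    also have "\<dots> \<le> (3 * (2 * (L * d)) * d) / 2"
    proof -
      have "norm (v p - v x) \<le> L * d" "norm (v q - v x) \<le> L * d"
        using L(1)[of p x] L(1)[of q x] mult_left_mono[OF dist[OF pqK(1) x] L(2)] mult_left_mono[OF dist[OF pqK(2) x] L(2)]
        by linarith+
      then have "norm ((v p - v x) + (v q - v x)) \<le> 2 * (L * d)"
        using norm_triangle_ineq[of "v p - v x" "v q - v x"] by linarith
      then have "norm ((v p - v x) + (v q - v x)) * norm (q - p) \<le> 2 * (L * d) * d"
        using dist[OF pqK(2,1)] L(2) d0 by (intro mult_mono) auto
      then show ?thesis by (simp add: mult_ac)
    qed
    finally show ?thesis by (simp add: mult_ac)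
  qed
  have "loc_field v K x = (\<Sum>p\<in>?V. \<Sum>q\<in>?V. E p q *s (bary K p x *\<^sub>R cvec (?g q)))
      + (\<Sum>p\<in>?V. \<Sum>q\<in>?V. cdot (v x) (cvec (q - p)) *s (bary K p x *\<^sub>R cvec (?g q)))"
    unfolding loc_field_def sum.distrib[symmetric]
    by (intro sum.cong refl) (simp add: E_def vec_eq_iff algebra_simps)
  also have "(\<Sum>p\<in>?V. \<Sum>q\<in>?V. cdot (v x) (cvec (q - p)) *s (bary K p x *\<^sub>R cvec (?g q)))
      = (\<Sum>p\<in>?V. bary K p x *\<^sub>R (\<Sum>q\<in>?V. cdot (v x) (cvec (q - p)) *s cvec (?g q)))"
    unfolding scaleR_sum_right
    by (intro sum.cong refl) (simp add: vec_eq_iff scaleR_conv_of_real[where 'a = complex] mult_ac)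
  also have "\<dots> = v x"
    unfolding bary_grad_reproduces[OF K] by (simp add: scaleR_sum_left[symmetric] bary_sum(1)[OF K])
  finally have "loc_field v K x - v x = (\<Sum>p\<in>?V. \<Sum>q\<in>?V. E p q *s (bary K p x *\<^sub>R cvec (?g q)))" by simp
  also have "norm \<dots> \<le> (\<Sum>p\<in>?V. \<Sum>q\<in>?V. 3 * L * d * \<kappa>)"
  proof (intro sum_norm_le)
    fix p q assume pq: "p \<in> ?V" "q \<in> ?V"
    have "norm (E p q *s (bary K p x *\<^sub>R cvec (?g q))) = norm (E p q) * (bary K p x * norm (?g q))"
      using bary_range[OF K pq(1) x] by (simp add: norm_vscale norm_cvec)
    also have "\<dots> \<le> (3 * L * d * d) * (1 * norm (?g q))"
      using bary_range[OF K pq(1) x] E[OF pq] L(2) d0 by (intro mult_mono) auto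
    also have "\<dots> = 3 * L * d * (norm (?g q) * d)" by simp
    also have "\<dots> \<le> 3 * L * d * \<kappa>"
      using gd[OF pq(2)] L(2) d0 by (intro mult_left_mono) auto
    finally show "norm (E p q *s (bary K p x *\<^sub>R cvec (?g q))) \<le> 3 * L * d * \<kappa>" .
  qed
  also have "\<dots> = 48 * L * \<kappa> * d" using simplex_verts(2)[OF K] by simp
  finally show ?thesis by (simp add: d_def)
qed

text \<open>By antisymmetry the curl of the Whitney interpolant is the curl of the nodal interpolant
  \<open>\<Sum>\<^sub>p \<lambda>\<^sub>p v(p)\<close>.\<close>

lemma loc_curl_nodal:
  assumes K: "3 simplex K"
  shows "loc_curl v K = (\<Sum>p\<in>verts K. ccross (bary_grad K p) (v p))"
proof -
  let ?V = "verts K" and ?g = "bary_grad K"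
  define X where "X p q = ccross (?g p) (cvec (?g q))" for p q
  define A where "A p q = cdot (v p) (cvec q)" for p q
  have anti: "X q p = - X p q" for p q unfolding X_def by (rule ccross_anti)
  have X1: "(\<Sum>p\<in>?V. X p q) = 0" for q
    unfolding X_def ccross.sum_left[symmetric] bary_grad_sum(1)[OF K] by (rule ccross.zero_left)
  have X2: "(\<Sum>q\<in>?V. X p q) = 0" for p
    unfolding X_def ccross.sum_right[symmetric] linear_sum[OF bounded_linear.linear[OF bounded_linear_cvec], symmetric]
      bary_grad_sum(1)[OF K] linear_0[OF bounded_linear.linear[OF bounded_linear_cvec]] by (rule ccross.zero_right)
  \<comment> \<open>The two terms depending on one vertex only are annihilated because the gradients
    sum to zero; the last term equals the first after exchanging \<open>p\<close> and
    \<open>q\<close>, by antisymmetry of \<open>X\<close>.\<close>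
  have d: "edge_dof v p q = (A p q + A q q - A p p - A q p) / 2" for p q
    by (simp add: edge_dof_def A_def cdot_def cvec_def sum.distrib[symmetric] sum_subtractf[symmetric] algebra_simps)
  have e1: "(\<Sum>p\<in>?V. \<Sum>q\<in>?V. A q q *s X p q) = 0"
    by (subst sum.swap) (simp add: vscale_sum_right[symmetric] X1)
  have e2: "(\<Sum>p\<in>?V. \<Sum>q\<in>?V. A p p *s X p q) = 0"
    by (simp add: vscale_sum_right[symmetric] X2)
  have e3: "(\<Sum>p\<in>?V. \<Sum>q\<in>?V. A q p *s X p q) = - (\<Sum>p\<in>?V. \<Sum>q\<in>?V. A p q *s X p q)"
  proof -
    have "(\<Sum>p\<in>?V. \<Sum>q\<in>?V. A q p *s X p q) = (\<Sum>p\<in>?V. \<Sum>q\<in>?V. A p q *s X q p)" by (rule sum.swap)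
    also have "\<dots> = (\<Sum>p\<in>?V. \<Sum>q\<in>?V. - (A p q *s X p q))"
    proof (intro sum.cong refl)
      fix p q show "A p q *s X q p = - (A p q *s X p q)" by (subst anti) (simp add: vec_eq_iff)
    qed
    finally show ?thesis by (simp only: sum_negf)
  qed
  have "2 *\<^sub>R loc_curl v K = (\<Sum>p\<in>?V. \<Sum>q\<in>?V. A p q *s X p q) + (\<Sum>p\<in>?V. \<Sum>q\<in>?V. A q q *s X p q)
      - (\<Sum>p\<in>?V. \<Sum>q\<in>?V. A p p *s X p q) - (\<Sum>p\<in>?V. \<Sum>q\<in>?V. A q p *s X p q)"
    unfolding loc_curl_def scaleR_sum_right sum.distrib[symmetric] sum_subtractf[symmetric]
    by (intro sum.cong refl) (simp add: d X_def[symmetric] vec_eq_iff scaleR_conv_of_real[where 'a = complex] field_simps)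
  also have "\<dots> = 2 *\<^sub>R (\<Sum>p\<in>?V. \<Sum>q\<in>?V. A p q *s X p q)"
    by (simp add: e1 e2 e3 scaleR_2)
  finally have "loc_curl v K = (\<Sum>p\<in>?V. \<Sum>q\<in>?V. A p q *s X p q)" by simp
  \<comment> \<open>The inner sum reproduces \<open>v p\<close>, with the origin as base
    point.\<close>
  also have "\<dots> = (\<Sum>p\<in>?V. ccross (?g p) (\<Sum>q\<in>?V. cdot (v p) (cvec (q - 0)) *s cvec (?g q)))"
    by (simp add: X_def A_def ccross.sum_right ccross_vscale)
  finally show ?thesis unfolding bary_grad_reproduces[OF K] .
qed

text \<open>Insert the Taylor expansion at \<open>x\<close> into the nodal formula: the constant
  part drops out as the gradients sum to zero, the linear part gives \<open>c\<close> exactly, and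
  the remainder is quadratic in the diameter. \<open>16 = 4 * 4\<close>, four vertices and the
  constant of the cross product.\<close>

lemma loc_curl_error:
  assumes K: "3 simplex K" and \<kappa>: "diameter K \<le> \<kappa> * inball_diameter K" "\<kappa> \<ge> 0"
    and M: "\<And>h. norm (v (x + h) - v x - (\<Sum>i\<in>UNIV. (h $ i) *\<^sub>R D i)) \<le> M * (norm h)\<^sup>2" "M \<ge> 0"
    and c: "c = (\<Sum>i\<in>UNIV. ccross (axis i 1) (D i))" and x: "x \<in> K"
  shows "norm (loc_curl v K - c) \<le> 16 * M * \<kappa> * diameter K"
proof -
  let ?V = "verts K" and ?g = "bary_grad K"
  define d where "d = diameter K"
  have bK: "bounded K" using simplex_verts(5)[OF K] by (rule compact_imp_bounded)
  have VK: "?V \<subseteq> K" by (auto simp: verts_def extreme_point_of_def)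
  have dist: "norm (y - z) \<le> d" if "y \<in> K" "z \<in> K" for y z
    using diameter_bounded_bound[OF bK that] by (simp add: d_def dist_norm)
  have d0: "d \<ge> 0" using dist[OF x x] by simp
  have gd: "norm (?g q) * d \<le> \<kappa>" if "q \<in> ?V" for q
    using bary_grad_bound[OF K that \<kappa>(1)] \<kappa>(2) by (simp add: d_def)
  define R where "R p = v p - v x - (\<Sum>i\<in>UNIV. ((p - x) $ i) *\<^sub>R D i)" for p
  have R: "norm (R p) \<le> M * (d * d)" if "p \<in> ?V" for p
  proof -
    have "norm (R p) \<le> M * (norm (p - x))\<^sup>2" using M(1)[of "p - x"] by (simp add: R_def)
    also have "\<dots> \<le> M * (d * d)"
      unfolding power2_eq_square using M(2) dist[of p x] that VK x d0 by (intro mult_left_mono mult_mono) auto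
    finally show ?thesis .
  qed
  have g0: "(\<Sum>q\<in>?V. ?g q $ l) = 0" for l
    using arg_cong[OF bary_grad_sum(1)[OF K], of "\<lambda>x. x $ l"] by simp
  have ax: "(\<Sum>p\<in>?V. ((p - x) $ i) *\<^sub>R ?g p) = axis i 1" for i
  proof -
    have "(\<Sum>p\<in>?V. ((p - x) $ i) *\<^sub>R ?g p) $ l = axis i 1 $ l" for l
    proof -
      have "(\<Sum>p\<in>?V. ((p - x) $ i) *\<^sub>R ?g p) $ l = (\<Sum>p\<in>?V. ?g p $ l * p $ i) - x $ i * (\<Sum>p\<in>?V. ?g p $ l)"
        by (simp add: algebra_simps sum_subtractf sum_distrib_left)
      then show ?thesis using bary_grad_dual[OF K, of l i] g0 by (simp add: axis_def)
    qed
    then show ?thesis by (simp add: vec_eq_iff)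
  qed
  have "(\<Sum>p\<in>?V. ccross (?g p) (\<Sum>i\<in>UNIV. ((p - x) $ i) *\<^sub>R D i)) = (\<Sum>i\<in>UNIV. ccross (\<Sum>p\<in>?V. ((p - x) $ i) *\<^sub>R ?g p) (D i))"
    unfolding ccross.sum_right ccross.sum_left by (subst sum.swap) (simp add: ccross.scaleR_left ccross.scaleR_right)
  then have t2: "(\<Sum>p\<in>?V. ccross (?g p) (\<Sum>i\<in>UNIV. ((p - x) $ i) *\<^sub>R D i)) = c"
    unfolding ax c .
  have t1: "(\<Sum>p\<in>?V. ccross (?g p) (v x)) = 0"
    unfolding ccross.sum_left[symmetric] bary_grad_sum(1)[OF K] by (rule ccross.zero_left)
  have "loc_curl v K = (\<Sum>p\<in>?V. ccross (?g p) (v x + (\<Sum>i\<in>UNIV. ((p - x) $ i) *\<^sub>R D i) + R p))"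
    unfolding loc_curl_nodal[OF K] by (simp add: R_def)
  also have "\<dots> = c + (\<Sum>p\<in>?V. ccross (?g p) (R p))"
    unfolding ccross.add_right sum.distrib t1 t2 by simp
  finally have "loc_curl v K - c = (\<Sum>p\<in>?V. ccross (?g p) (R p))" by simp
  also have "norm \<dots> \<le> (\<Sum>p\<in>?V. 4 * M * d * \<kappa>)"
  proof (rule sum_norm_le)
    fix p assume p: "p \<in> ?V"
    have "norm (ccross (?g p) (R p)) \<le> 4 * norm (?g p) * norm (R p)" by (rule norm_ccross_le)
    also have "\<dots> \<le> 4 * norm (?g p) * (M * (d * d))" using R[OF p] by (intro mult_left_mono) auto
    also have "\<dots> = 4 * M * d * (norm (?g p) * d)" by simp
    also have "\<dots> \<le> 4 * M * d * \<kappa>" using gd[OF p] M(2) d0 by (intro mult_left_mono) auto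
    finally show "norm (ccross (?g p) (R p)) \<le> 4 * M * d * \<kappa>" .
  qed
  also have "\<dots> = 16 * M * \<kappa> * d" using simplex_verts(2)[OF K] by simp
  finally show ?thesis by (simp add: d_def)
qed

section \<open>The global interpolant\<close>

lemma curl_pair_sum:
  assumes "bounded S" "finite I" "\<And>i. i \<in> I \<Longrightarrow> curl_pair S (w i) (c i)"
  shows "curl_pair S (\<lambda>x. \<Sum>i\<in>I. w i x) (\<lambda>x. \<Sum>i\<in>I. c i x)"
  using assms(2,3) by (induction rule: finite_induct) (auto simp: curl_pair_0 curl_pair_add[OF assms(1)])

lemma norm_cls_le_bounded:
  assumes f: "sqint f" and S: "S \<in> lmeasurable" and B: "B \<ge> 0"
    and le: "AE x in lebesgue. norm (f x) \<le> B * indicator S x"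
  shows "norm (cls f) \<le> B * sqrt (measure lebesgue S)"
proof (rule power2_le_imp_le)
  have "(norm (cls f))\<^sup>2 = (LINT x|lebesgue. (norm (f x))\<^sup>2)" by (rule norm_cls[OF f])
  also have "\<dots> \<le> (LINT x|lebesgue. B\<^sup>2 * indicator S x)"
  proof (rule integral_mono_AE[OF sqint_integrable[OF f]])
    show "integrable lebesgue (\<lambda>x. B\<^sup>2 * indicator S x)"
      using S by (intro integrable_mult_right integrable_real_indicator) (auto simp: fmeasurable_def)
    show "AE x in lebesgue. (norm (f x))\<^sup>2 \<le> B\<^sup>2 * indicator S x"
      using le
    proof eventually_elim
      case (elim x)
      from power_mono[OF elim norm_ge_zero, of 2] show ?case
        by (cases "x \<in> S") (simp_all add: power_mult_distrib)
    qed
  qed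
  also have "\<dots> = (B * sqrt (measure lebesgue S))\<^sup>2"
    using S by (simp add: power_mult_distrib fmeasurable_def)
  finally show "(norm (cls f))\<^sup>2 \<le> (B * sqrt (measure lebesgue S))\<^sup>2" .
qed (use B in simp)

context mesh
begin

text \<open>All ordered pairs from \<open>I\<close> are summed, whether or not an edge joins them:
  inside a cell \<open>hat p\<close> and \<open>hat_grad q\<close> are both nonzero only if
  \<open>p\<close> and \<open>q\<close> are vertices of that cell.\<close>

definition whitney :: "(real^3 \<Rightarrow> complex^3) \<Rightarrow> (real^3) set \<Rightarrow> real^3 \<Rightarrow> complex^3" where
  "whitney v I x = (\<Sum>(p, q)\<in>I \<times> I. edge_dof v p q *s (hat p x *\<^sub>R cvec (hat_grad q x)))"

definition whitney_curl :: "(real^3 \<Rightarrow> complex^3) \<Rightarrow> (real^3) set \<Rightarrow> real^3 \<Rightarrow> complex^3" where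
  "whitney_curl v I x = (\<Sum>(p, q)\<in>I \<times> I. edge_dof v p q *s ccross (hat_grad p x) (cvec (hat_grad q x)))"

lemma whitney_curl_pair:
  assumes \<Omega>: "open \<Omega>" "bounded \<Omega>" "\<Omega> \<subseteq> \<Union>\<T>" and I: "finite I" "\<And>p K. p \<in> I \<Longrightarrow> K \<in> \<T> \<Longrightarrow> p \<in> verts K \<Longrightarrow> K \<subseteq> \<Omega>"
  shows "curl_pair \<Omega> (whitney v I) (whitney_curl v I)"
proof -
  have "curl_pair \<Omega> (\<lambda>x. edge_dof v (fst i) (snd i) *s (hat (fst i) x *\<^sub>R cvec (hat_grad (snd i) x)))
    (\<lambda>x. edge_dof v (fst i) (snd i) *s ccross (hat_grad (fst i) x) (cvec (hat_grad (snd i) x)))" if "i \<in> I \<times> I" for i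
  proof (intro curl_pair_vscale lip_potential_curl_pair)
    have i: "fst i \<in> I" "snd i \<in> I" using that by auto
    show "lip_potential (hat (fst i)) (hat_grad (fst i))" "lip_potential (hat (snd i)) (hat_grad (snd i))"
      by (rule hat_potential(1)[OF \<Omega>(1,3) I(2)[OF i(1)]], assumption+)
         (rule hat_potential(1)[OF \<Omega>(1,3) I(2)[OF i(2)]], assumption+)
    show "hat (fst i) x = 0 \<and> hat_grad (fst i) x = 0" if "x \<notin> \<Omega>" for x
      by (rule hat_potential(2)[OF \<Omega>(1,3) I(2)[OF i(1)] that])
  qed
  from curl_pair_sum[OF \<Omega>(2) finite_cartesian_product[OF I(1,1)] this]
  show ?thesis by (simp add: whitney_def[abs_def] whitney_curl_def[abs_def] case_prod_beta)
qed

lemma whitney_local: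
  assumes I: "finite I" and K: "K \<in> \<T>" "x \<in> interior K"
    and z: "\<And>p q. p \<in> verts K \<Longrightarrow> q \<in> verts K \<Longrightarrow> p \<notin> I \<or> q \<notin> I \<Longrightarrow> edge_dof v p q = 0"
  shows "whitney v I x = loc_field v K x" "whitney_curl v I x = loc_curl v K"
proof -
  have xK: "x \<in> K" using K(2) interior_subset by blast
  have fV: "finite (verts K)" using simplex_verts(4)[OF simp3[OF K(1)]] .
  note h = hat_on[OF K(1) xK] hat_grad_interior[OF K]
  note cvec_0 = linear_0[OF bounded_linear.linear[OF bounded_linear_cvec]]
  have reindex: "(\<Sum>i\<in>I \<times> I. F i) = (\<Sum>i\<in>verts K \<times> verts K. G i)"
    if "\<And>p q. p \<notin> verts K \<or> q \<notin> verts K \<Longrightarrow> F (p, q) = 0"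
      "\<And>p q. edge_dof v p q = 0 \<Longrightarrow> G (p, q) = 0"
      "\<And>p q. p \<in> verts K \<Longrightarrow> q \<in> verts K \<Longrightarrow> F (p, q) = G (p, q)" for F G :: "(real^3) \<times> (real^3) \<Rightarrow> complex^3"
  proof (rule sum.mono_neutral_cong)
    fix i assume "i \<in> verts K \<times> verts K - I \<times> I"
    then obtain p q where i: "i = (p, q)" "p \<in> verts K" "q \<in> verts K" "p \<notin> I \<or> q \<notin> I" by auto
    show "G i = 0" unfolding i(1) by (rule that(2)[OF z[OF i(2-4)]])
  next
    fix i assume "i \<in> I \<times> I - verts K \<times> verts K"
    then obtain p q where i: "i = (p, q)" "p \<notin> verts K \<or> q \<notin> verts K" by auto
    show "F i = 0" unfolding i(1) by (rule that(1)[OF i(2)])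
  next
    fix i assume "i \<in> I \<times> I \<inter> verts K \<times> verts K"
    then show "F i = G i" using that(3) by auto
  qed (use I fV in auto)
  show "whitney v I x = loc_field v K x"
    unfolding whitney_def loc_field_def sum.cartesian_product
    by (rule reindex) (auto simp: h cvec_0)
  show "whitney_curl v I x = loc_curl v K"
    unfolding whitney_curl_def loc_curl_def sum.cartesian_product
    by (rule reindex) (auto simp: h cvec_0 ccross.zero_left ccross.zero_right)
qed

text \<open>The local errors bound the global one pointwise almost everywhere, and passing to L2
  costs the square root of the measure of \<Omega>.\<close>

lemma nedelec_interpolation:
  assumes \<Omega>: "open \<Omega>" "bounded \<Omega>" "\<Union>\<T> = closure \<Omega>"
    and h: "\<And>K. K \<in> \<T> \<Longrightarrow> diameter K \<le> h" and \<kappa>: "\<kappa> \<ge> 0" "\<And>K. K \<in> \<T> \<Longrightarrow> diameter K \<le> \<kappa> * inball_diameter K"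
    and s: "sqint v" "sqint c" and S: "S \<subseteq> \<Omega>" "\<And>x. x \<notin> S \<Longrightarrow> v x = 0 \<and> c x = 0"
    and \<delta>: "\<And>y. y \<in> S \<Longrightarrow> ball y \<delta> \<subseteq> \<Omega>" "2 * h < \<delta>" "h \<ge> 0"
    and L: "L \<ge> 0" "\<And>x y. norm (v x - v y) \<le> L * norm (x - y)"
    and M: "M \<ge> 0" "\<And>x h. norm (v (x + h) - v x - (\<Sum>i\<in>UNIV. (h $ i) *\<^sub>R D x i)) \<le> M * (norm h)\<^sup>2"
    and c: "\<And>x. c x = (\<Sum>i\<in>UNIV. ccross (axis i 1) (D x i))"
  shows "\<exists>W\<in>nedelec_space \<Omega> \<T>. dist (state_vec \<Omega> W) (cls v, cls c) \<le> (48 * L + 16 * M) * \<kappa> * h * sqrt (measure lebesgue \<Omega>)"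
proof -
  \<comment> \<open>Close enough to the support of the field that the star of such a vertex stays
    within \<open>2 h < \<delta>\<close> of it, hence in \<Omega>; far enough from it to contain all
    vertices of any cell that carries a nonzero vertex value.\<close>
  define I where "I = {p \<in> (\<Union>K\<in>\<T>. verts K). \<exists>y\<in>S. dist p y \<le> h}"
  have VK: "verts K \<subseteq> K" for K by (auto simp: verts_def extreme_point_of_def)
  have dK: "dist x y \<le> h" if "K \<in> \<T>" "x \<in> K" "y \<in> K" for x y K
  proof -
    have "bounded K" using simplex_verts(5)[OF simp3[OF that(1)]] by (rule compact_imp_bounded)
    from diameter_bounded_bound[OF this that(2,3)] h[OF that(1)] show ?thesis by linarith
  qed
  have sub: "\<Omega> \<subseteq> \<Union>\<T>" using \<Omega>(3) closure_subset by blast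
  have finI: "finite I"
    unfolding I_def using fin simplex_verts(4)[OF simp3] by auto
  have star: "K \<subseteq> \<Omega>" if p: "p \<in> I" and K: "K \<in> \<T>" "p \<in> verts K" for p K
  proof
    fix x assume x: "x \<in> K"
    obtain y where y: "y \<in> S" "dist p y \<le> h" using p by (auto simp: I_def)
    have "dist y x \<le> 2 * h"
      using dK[OF K(1) x, of p] K(2) VK[of K] y(2) dist_triangle[of y x p] by (simp add: dist_commute subset_iff)
    then have "x \<in> ball y \<delta>" using \<delta>(2) by simp
    then show "x \<in> \<Omega>" using \<delta>(1)[OF y(1)] by blast
  qed
  \<comment> \<open>A nonzero value at either vertex would put both \<open>p\<close> and
    \<open>q\<close> within distance \<open>h\<close> of the support, hence into
    \<open>I\<close>.\<close>
  have z: "edge_dof v p q = 0" if "K \<in> \<T>" and p: "p \<in> verts K" and q: "q \<in> verts K" and "p \<notin> I \<or> q \<notin> I" for p q K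
  proof -
    have "v p' = 0" if "p' \<in> verts K" for p'
    proof (rule ccontr)
      assume "v p' \<noteq> 0"
      then have "p' \<in> S" using S(2) by blast
      moreover have "dist p p' \<le> h" "dist q p' \<le> h"
        using dK[OF \<open>K \<in> \<T>\<close>] VK[of K] p q that by blast+
      ultimately have "p \<in> I" "q \<in> I" unfolding I_def using \<open>K \<in> \<T>\<close> p q by blast+
      then show False using \<open>p \<notin> I \<or> q \<notin> I\<close> by blast
    qed
    then show ?thesis using p q
      by (simp add: edge_dof_def bounded_bilinear.zero_left[OF bounded_bilinear_cdot])
  qed
  define W where "W = whitney v I"
  define Wc where "Wc = whitney_curl v I"
  have pair: "curl_pair \<Omega> W Wc"
    unfolding W_def Wc_def by (rule whitney_curl_pair[OF \<Omega>(1,2) sub finI star])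
  have s': "sqint W" "sqint Wc" and out: "\<And>x. x \<notin> \<Omega> \<Longrightarrow> W x = 0" "\<And>x. x \<notin> \<Omega> \<Longrightarrow> Wc x = 0"
    using pair by (auto simp: curl_pair_def)
  have "ext \<Omega> W = W" using out by (auto simp: ext_def indicator_def fun_eq_iff)
  then have W: "W \<in> H0_curl \<Omega>" "state_vec \<Omega> W = (cls W, cls Wc)"
    using state_vec_pair[OF \<Omega>(1,2), of W Wc] pair by simp_all
  have loc: "W x = loc_field v K x" "Wc x = loc_curl v K" if "K \<in> \<T>" "x \<in> interior K" for K x
    unfolding W_def Wc_def using whitney_local[OF finI that z[OF that(1)]] by auto
  have "W \<in> nedelec_space \<Omega> \<T>"
    unfolding nedelec_space_def
  proof (intro CollectI conjI W(1) ballI)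
    fix K assume K: "K \<in> \<T>"
    obtain a b where ab: "\<And>x. loc_field v K x = a + ccross x b" using loc_field_nedelec by blast
    have "negligible (frontier K)"
      using simplex_verts(6)[OF simp3[OF K]] by (rule negligible_convex_frontier)
    then have "AE x in lebesgue. x \<notin> frontier K"
      unfolding negligible_iff_null_sets by (rule AE_not_in)
    then have "AE x in lebesgue. x \<in> K \<longrightarrow> W x = a + ccross x b"
    proof eventually_elim
      case (elim x)
      show ?case
      proof
        assume "x \<in> K"
        then have "x \<in> interior K" using elim closure_subset[of K] by (auto simp: frontier_def)
        then show "W x = a + ccross x b" using loc(1)[OF K] ab by simp
      qed
    qed
    moreover have "K \<in> sets lebesgue" using closed_cells[OF K] by simp
    ultimately show "\<exists>a b. AE x in lebesgue_on K. W x = a + ccross x b"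
      using AE_lebesgue_on_iff by blast
  qed
  moreover have "dist (state_vec \<Omega> W) (cls v, cls c) \<le> (48 * L + 16 * M) * \<kappa> * h * sqrt (measure lebesgue \<Omega>)"
  proof -
    have m: "\<Omega> \<in> lmeasurable" using \<Omega>(1,2) by (simp add: lmeasurable_open)
    have v0: "v x = 0" "c x = 0" if "x \<notin> \<Omega>" for x using S that by auto
    have ptw: "AE x in lebesgue. norm (W x - v x) \<le> (48 * L * \<kappa> * h) * indicator \<Omega> x
        \<and> norm (Wc x - c x) \<le> (16 * M * \<kappa> * h) * indicator \<Omega> x"
      using AE_interior
    proof eventually_elim
      case (elim x)
      show ?case
      proof (cases "x \<in> \<Omega>")
        case True
        then obtain K where K: "K \<in> \<T>" "x \<in> interior K" using elim sub by blast
        have xK: "x \<in> K" using K(2) interior_subset by blast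
        have "norm (W x - v x) \<le> 48 * L * \<kappa> * diameter K"
          unfolding loc(1)[OF K] by (rule loc_field_error[OF simp3[OF K(1)] \<kappa>(2)[OF K(1)] \<kappa>(1) L(2,1) xK])
        also have "\<dots> \<le> 48 * L * \<kappa> * h" using h[OF K(1)] L(1) \<kappa>(1) by (intro mult_left_mono) auto
        finally have 1: "norm (W x - v x) \<le> 48 * L * \<kappa> * h" .
        have "norm (Wc x - c x) \<le> 16 * M * \<kappa> * diameter K"
          unfolding loc(2)[OF K] by (rule loc_curl_error[OF simp3[OF K(1)] \<kappa>(2)[OF K(1)] \<kappa>(1) M(2,1) c xK])
        also have "\<dots> \<le> 16 * M * \<kappa> * h" using h[OF K(1)] M(1) \<kappa>(1) by (intro mult_left_mono) auto
        finally have 2: "norm (Wc x - c x) \<le> 16 * M * \<kappa> * h" .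
        show ?thesis using 1 2 True by simp
      next
        case False
        then show ?thesis using out v0 by simp
      qed
    qed
    have 1: "norm (cls W - cls v) \<le> 48 * L * \<kappa> * h * sqrt (measure lebesgue \<Omega>)"
      unfolding cls_diff[OF s'(1) s(1)]
      by (rule norm_cls_le_bounded[OF sqint_diff[OF s'(1) s(1)] m])
         (use ptw L(1) \<kappa>(1) \<delta>(3) in \<open>auto elim: eventually_mono\<close>)
    have 2: "norm (cls Wc - cls c) \<le> 16 * M * \<kappa> * h * sqrt (measure lebesgue \<Omega>)"
      unfolding cls_diff[OF s'(2) s(2)]
      by (rule norm_cls_le_bounded[OF sqint_diff[OF s'(2) s(2)] m])
         (use ptw M(1) \<kappa>(1) \<delta>(3) in \<open>auto elim: eventually_mono\<close>)
    have "dist (state_vec \<Omega> W) (cls v, cls c) \<le> dist (cls W) (cls v) + dist (cls Wc) (cls c)"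
      unfolding W(2) dist_Pair_Pair by (rule sqrt_sum_squares_le_sum) auto
    with 1 2 show ?thesis by (simp add: dist_norm algebra_simps)
  qed
  ultimately show ?thesis by blast
qed

end

text \<open>The threshold \<open>h\<^sub>0\<close> depends on \<open>z\<close>, \<open>e\<close> and
  the shape constant but not on the mesh: the smooth approximation is fixed before any mesh is
  chosen.\<close>

lemma nedelec_dense:
  assumes \<Omega>: "open \<Omega>" "bounded \<Omega>" "lipschitz_boundary \<Omega>" and z: "z \<in> curl_graph \<Omega>" and \<kappa>: "\<kappa> \<ge> 0" and e: "e > 0"
  shows "\<exists>h\<^sub>0>0. \<forall>\<T> h. mesh \<T> \<longrightarrow> \<Union>\<T> = closure \<Omega> \<longrightarrow> (\<forall>K\<in>\<T>. diameter K \<le> h \<and> diameter K \<le> \<kappa> * inball_diameter K) \<longrightarrow>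
     0 \<le> h \<longrightarrow> h < h\<^sub>0 \<longrightarrow> (\<exists>W\<in>nedelec_space \<Omega> \<T>. dist (state_vec \<Omega> W) z < e)"
proof -
  have "z \<in> closure (nice_graph \<Omega>)" using curl_graph_dense[OF \<Omega>] z by blast
  then obtain y where y: "y \<in> nice_graph \<Omega>" "dist y z < e / 2"
    using half_gt_zero[OF e] unfolding closure_approachable by blast
  from y(1) obtain v c where vc: "y = (cls v, cls c)" "nice_field \<Omega> v c" unfolding nice_graph_def by blast
  obtain S L M D where n: "sqint v" "sqint c" "compact S" "S \<subseteq> \<Omega>" "\<And>x. x \<notin> S \<Longrightarrow> v x = 0 \<and> c x = 0"
    "L \<ge> 0" "\<And>x y. norm (v x - v y) \<le> L * norm (x - y)" "M \<ge> 0"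
    "\<And>x h. norm (v (x + h) - v x - (\<Sum>i\<in>UNIV. (h $ i) *\<^sub>R D x i)) \<le> M * (norm h)\<^sup>2"
    "\<And>x. c x = (\<Sum>i\<in>UNIV. ccross (axis i 1) (D x i))"
    by (rule nice_fieldE[OF vc(2)]) (rule that)
  obtain \<delta> where \<delta>: "\<delta> > 0" "(\<Union>y\<in>S. ball y \<delta>) \<subseteq> \<Omega>"
    by (rule compact_subset_open_imp_ball_epsilon_subset[OF n(3) \<Omega>(1) n(4)])
  define C where "C = (48 * L + 16 * M) * \<kappa> * sqrt (measure lebesgue \<Omega>)"
  have C: "C \<ge> 0" unfolding C_def using n(6,8) \<kappa> by simp
  \<comment> \<open>The first bound gives \<open>2 h < \<delta>\<close>, the second makes the
    interpolation error smaller than \<open>e / 2\<close>; \<open>C + 1\<close> avoids dividing by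
    zero.\<close>
  define h\<^sub>0 where "h\<^sub>0 = min (\<delta> / 2) (e / (2 * (C + 1)))"
  have h0: "h\<^sub>0 > 0" using \<delta>(1) e C by (simp add: h\<^sub>0_def)
  show ?thesis
  proof (intro exI[of _ h\<^sub>0] conjI h0 allI impI)
    fix \<T> h
    assume m: "mesh \<T>" "\<Union>\<T> = closure \<Omega>" "\<forall>K\<in>\<T>. diameter K \<le> h \<and> diameter K \<le> \<kappa> * inball_diameter K"
      and h: "0 \<le> h" "h < h\<^sub>0"
    interpret mesh \<T> by (rule m(1))
    have "\<exists>W\<in>nedelec_space \<Omega> \<T>. dist (state_vec \<Omega> W) (cls v, cls c) \<le> (48 * L + 16 * M) * \<kappa> * h * sqrt (measure lebesgue \<Omega>)"
    proof (rule nedelec_interpolation[OF \<Omega>(1,2) m(2) _ \<kappa> _ n(1,2,4,5) _ _ h(1) n(6,7,8,9,10)])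
      show "ball y \<delta> \<subseteq> \<Omega>" if "y \<in> S" for y using \<delta>(2) that by blast
      show "2 * h < \<delta>" using h(2) by (simp add: h\<^sub>0_def)
    qed (use m(3) in auto)
    then obtain W where W: "W \<in> nedelec_space \<Omega> \<T>" "dist (state_vec \<Omega> W) y \<le> C * h"
      unfolding vc(1) by (auto simp: C_def mult_ac)
    have "C * h \<le> (C + 1) * h" using h(1) by (simp add: algebra_simps)
    also have "\<dots> < (C + 1) * (e / (2 * (C + 1)))" using h(2) C by (intro mult_strict_left_mono) (auto simp: h\<^sub>0_def)
    also have "a * (e / (2 * a)) = e / 2" if "a > 0" for a :: real using that by simp
    then have "(C + 1) * (e / (2 * (C + 1))) = e / 2" using C by (smt (verit))
    finally have "dist (state_vec \<Omega> W) z < e"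
      using W(2) y(2) dist_triangle[of "state_vec \<Omega> W" z y] by linarith
    with W(1) show "\<exists>W\<in>nedelec_space \<Omega> \<T>. dist (state_vec \<Omega> W) z < e" by blast
  qed
qed

section \<open>Trial spaces\<close>

text \<open>Complex linearity serves the passage between real parts and complex equations;
  closedness of the image gives the completeness that Lax-Milgram asks for.\<close>

definition trial_space :: "(real^3) set \<Rightarrow> (real^3 \<Rightarrow> complex^3) set \<Rightarrow> bool" where
  "trial_space \<Omega> W \<longleftrightarrow> W \<subseteq> H0_curl \<Omega> \<and> (\<lambda>x. 0) \<in> W \<and> (\<forall>w\<in>W. \<forall>w'\<in>W. (\<lambda>x. w x + w' x) \<in> W) \<and>
     (\<forall>w\<in>W. \<forall>z. (\<lambda>x. z *s w x) \<in> W) \<and> closed (state_vec \<Omega> ` W)"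

lemma ext_add: "ext S (\<lambda>x. f x + g x) = (\<lambda>x. ext S f x + ext S g x)"
  by (auto simp: ext_def scaleR_add_right)

lemma ext_vscale: "ext S (\<lambda>x. z *s f x) = (\<lambda>x. z *s (ext S f x :: complex^3))"
  by (auto simp: ext_def indicator_def)

lemma H0_curl_add:
  assumes \<Omega>: "open \<Omega>" "bounded \<Omega>" and w: "w \<in> H0_curl \<Omega>" "w' \<in> H0_curl \<Omega>"
  shows "(\<lambda>x. w x + w' x) \<in> H0_curl \<Omega>" "state_vec \<Omega> (\<lambda>x. w x + w' x) = state_vec \<Omega> w + state_vec \<Omega> w'"
proof -
  note p = H0_curl_imp_pair[OF \<Omega> w(1)] H0_curl_imp_pair[OF \<Omega> w(2)]
  from curl_pair_add[OF \<Omega>(2) p]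
  have "curl_pair \<Omega> (ext \<Omega> (\<lambda>x. w x + w' x)) (\<lambda>x. ext \<Omega> (curl \<Omega> w) x + ext \<Omega> (curl \<Omega> w') x)"
    by (simp add: ext_add)
  from state_vec_pair[OF \<Omega> this] show "(\<lambda>x. w x + w' x) \<in> H0_curl \<Omega>"
    "state_vec \<Omega> (\<lambda>x. w x + w' x) = state_vec \<Omega> w + state_vec \<Omega> w'"
    using p by (simp_all add: state_vec_def[of \<Omega> w] state_vec_def[of \<Omega> w'] curl_pair_def ext_add cls_add)
qed

lemma H0_curl_vscale:
  assumes \<Omega>: "open \<Omega>" "bounded \<Omega>" and w: "w \<in> H0_curl \<Omega>"
  shows "(\<lambda>x. z *s w x) \<in> H0_curl \<Omega>"
    "state_vec \<Omega> (\<lambda>x. z *s w x) = (cls (\<lambda>x. z *s ext \<Omega> w x), cls (\<lambda>x. z *s ext \<Omega> (curl \<Omega> w) x))"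
    "AE x in lebesgue. ext \<Omega> (curl \<Omega> (\<lambda>x. z *s w x)) x = z *s ext \<Omega> (curl \<Omega> w) x"
proof -
  from curl_pair_vscale[OF H0_curl_imp_pair[OF \<Omega> w], of z]
  have p: "curl_pair \<Omega> (ext \<Omega> (\<lambda>x. z *s w x)) (\<lambda>x. z *s ext \<Omega> (curl \<Omega> w) x)"
    by (simp add: ext_vscale)
  from state_vec_pair[OF \<Omega> p] show "(\<lambda>x. z *s w x) \<in> H0_curl \<Omega>"
    "state_vec \<Omega> (\<lambda>x. z *s w x) = (cls (\<lambda>x. z *s ext \<Omega> w x), cls (\<lambda>x. z *s ext \<Omega> (curl \<Omega> w) x))"
    by (simp_all add: ext_vscale)
  show "AE x in lebesgue. ext \<Omega> (curl \<Omega> (\<lambda>x. z *s w x)) x = z *s ext \<Omega> (curl \<Omega> w) x"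
    by (rule pair_imp_H0_curl(2)[OF \<Omega> p])
qed

lemma of_real_vscale: "of_real r *s (b :: complex^3) = r *\<^sub>R b"
  by (simp add: vec_eq_iff scaleR_conv_of_real[where 'a = complex])

lemma trial_space_subspace:
  assumes \<Omega>: "open \<Omega>" "bounded \<Omega>" and W: "trial_space \<Omega> W"
  shows "subspace (state_vec \<Omega> ` W)"
proof (rule subspaceI)
  have H: "w \<in> H0_curl \<Omega>" if "w \<in> W" for w using W that by (auto simp: trial_space_def)
  have sc: "(\<lambda>x. z *s w x) \<in> W" if "w \<in> W" for w z using W that by (auto simp: trial_space_def)
  have real_scale: "r *\<^sub>R state_vec \<Omega> w = state_vec \<Omega> (\<lambda>x. of_real r *s w x)" if "w \<in> W" for r w
    using H0_curl_imp_pair[OF \<Omega> H[OF that]] H0_curl_vscale(2)[OF \<Omega> H[OF that], of "of_real r"]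
    by (simp add: of_real_vscale state_vec_def[of \<Omega> w] curl_pair_def cls_scaleR)
  have z: "(\<lambda>x. 0) \<in> W" using W by (simp add: trial_space_def)
  have "0 = state_vec \<Omega> (\<lambda>x. of_real 0 *s (0 :: complex^3))"
    using real_scale[OF z, of 0] by simp
  then show "0 \<in> state_vec \<Omega> ` W" using sc[OF z] by blast
  show "x + y \<in> state_vec \<Omega> ` W" if "x \<in> state_vec \<Omega> ` W" "y \<in> state_vec \<Omega> ` W" for x y
  proof -
    obtain w where 1: "x = state_vec \<Omega> w" "w \<in> W" using \<open>x \<in> state_vec \<Omega> ` W\<close> by (rule imageE)
    obtain w' where 2: "y = state_vec \<Omega> w'" "w' \<in> W" using \<open>y \<in> state_vec \<Omega> ` W\<close> by (rule imageE)
    note * = 1 2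
    have sW: "(\<lambda>x. w x + w' x) \<in> W" using W * by (simp add: trial_space_def)
    have eq: "x + y = state_vec \<Omega> (\<lambda>x. w x + w' x)"
      unfolding *(1,3) by (rule H0_curl_add(2)[OF \<Omega> H[OF *(2)] H[OF *(4)], symmetric])
    show ?thesis unfolding eq using sW by (rule imageI)
  qed
  show "r *\<^sub>R x \<in> state_vec \<Omega> ` W" if "x \<in> state_vec \<Omega> ` W" for r x
    using that real_scale sc by auto
qed

lemma trial_space_H0_curl:
  assumes \<Omega>: "open \<Omega>" "bounded \<Omega>"
  shows "trial_space \<Omega> (H0_curl \<Omega>)"
proof -
  have "ext \<Omega> (\<lambda>x. 0 :: complex^3) = (\<lambda>x. 0)" by (simp add: ext_def fun_eq_iff)
  then have "(\<lambda>x. 0) \<in> H0_curl \<Omega>"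
    using pair_imp_H0_curl(1)[OF \<Omega>, of "\<lambda>x. 0" "\<lambda>x. 0"] curl_pair_0 by simp
  moreover have "closed (state_vec \<Omega> ` H0_curl \<Omega>)"
    unfolding curl_graph_eq[OF \<Omega>, symmetric] using \<Omega> by (intro curl_graph_closed) auto
  ultimately show ?thesis
    unfolding trial_space_def using H0_curl_add(1)[OF \<Omega>] H0_curl_vscale(1)[OF \<Omega>] by blast
qed

text \<open>If \<open>a\<^sub>n + x \<times> b\<^sub>n\<close> converges on a set of positive measure, the vectors \<open>y\<close> for which
  \<open>y \<times> b\<^sub>n\<close> converges form a subspace of positive measure, that is, the whole space.\<close>

lemma nedelec_limit:
  fixes a b :: "nat \<Rightarrow> complex^3" and g :: "real^3 \<Rightarrow> complex^3"
  assumes G: "\<not> negligible G" and conv: "\<And>x. x \<in> G \<Longrightarrow> (\<lambda>n. a n + ccross x (b n)) \<longlonglongrightarrow> g x"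
  shows "\<exists>a b. \<forall>x\<in>G. g x = a + ccross x b"
proof -
  obtain x0 where x0: "x0 \<in> G" using G by (metis ex_in_conv negligible_empty)
  define Y where "Y = {y. convergent (\<lambda>n. ccross y (b n))}"
  have Y: "subspace Y"
    unfolding Y_def by (rule subspaceI)
      (auto simp: ccross.zero_left ccross.add_left ccross.scaleR_left convergent_const intro: convergent_add
        bounded_linear.convergent[OF bounded_linear_scaleR_right])
  have GY: "x - x0 \<in> Y" if "x \<in> G" for x
    using tendsto_diff[OF conv[OF that] conv[OF x0]]
    by (auto simp: Y_def ccross.diff_left convergent_def)
  have "Y = UNIV"
  proof (rule ccontr)
    assume "Y \<noteq> UNIV"
    have sY: "span Y = Y" using Y by (simp only: span_eq_iff)
    have "span Y \<noteq> UNIV" unfolding sY by fact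
    then have "dim Y < DIM(real^3)" using dim_eq_full[of Y] dim_subset_UNIV[of Y] by (simp add: less_le)
    then have "negligible Y" by (rule negligible_lowdim)
    then have "negligible ((+) x0 ` Y)" by (rule negligible_translation)
    moreover have "G \<subseteq> (+) x0 ` Y"
    proof
      fix x assume "x \<in> G"
      from GY[OF this] show "x \<in> (+) x0 ` Y" by (intro image_eqI[of _ _ "x - x0"]) auto
    qed
    ultimately show False using G negligible_subset by blast
  qed
  then have ax: "convergent (\<lambda>n. ccross (axis i 1) (b n))" for i by (auto simp: Y_def)
  have comp: "convergent (\<lambda>n. ccross (axis i 1) (b n) $ j)" for i j
    using bounded_linear.convergent[OF bounded_linear_vec_nth ax] .
  have "convergent (\<lambda>n. b n $ j)" for j
  proof -
    have "b n $ 1 = ccross (axis 3 1) (b n) $ 2" "b n $ 2 = ccross (axis 1 1) (b n) $ 3"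
      "b n $ 3 = ccross (axis 2 1) (b n) $ 1" for n
      by (simp_all add: ccross_def axis_def)
    then have "convergent (\<lambda>n. b n $ 1)" "convergent (\<lambda>n. b n $ 2)" "convergent (\<lambda>n. b n $ 3)"
      using comp by simp_all
    then show ?thesis using exhaust_3[of j] by auto
  qed
  then have "\<forall>j. \<exists>l. (\<lambda>n. b n $ j) \<longlonglongrightarrow> l" by (auto simp: convergent_def)
  then obtain l where l: "\<And>j. (\<lambda>n. b n $ j) \<longlonglongrightarrow> l j" by metis
  define b' where "b' = (\<chi> j. l j)"
  have b': "b \<longlonglongrightarrow> b'" by (rule vec_tendstoI) (simp add: b'_def l)
  define a' where "a' = g x0 - ccross x0 b'"
  have "(\<lambda>n. (a n + ccross x0 (b n)) - ccross x0 (b n)) \<longlonglongrightarrow> a'"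
    unfolding a'_def by (intro tendsto_diff conv[OF x0] bounded_linear.tendsto[OF ccross.bounded_linear_right] b')
  then have a': "a \<longlonglongrightarrow> a'" by simp
  have "g x = a' + ccross x b'" if "x \<in> G" for x
    by (rule LIMSEQ_unique[OF conv[OF that]])
       (intro tendsto_add a' bounded_linear.tendsto[OF ccross.bounded_linear_right] b')
  then show ?thesis by blast
qed

text \<open>A Lipschitz domain lies on one side of its boundary: right below the graph there are
  balls free of \<Omega> arbitrarily close to a boundary point. Hence the interior of a cell, known
  to lie in \<open>closure \<Omega>\<close>, lies in \<Omega>, where fields are determined.\<close>

lemma interior_closure_lipschitz:
  assumes \<Omega>: "open \<Omega>" "lipschitz_boundary \<Omega>"
  shows "interior (closure \<Omega>) \<subseteq> \<Omega>"
proof (rule subsetI, rule ccontr)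
  fix p assume p: "p \<in> interior (closure \<Omega>)" "p \<notin> \<Omega>"
  then have "p \<in> frontier \<Omega>" using \<Omega>(1) interior_subset by (auto simp: frontier_def interior_open)
  then obtain Q :: "real^3 \<Rightarrow> real^3" and R L and \<gamma> :: "real^2 \<Rightarrow> real" where
    Q: "orthogonal_transformation Q" and R: "0 < R" and \<gamma>: "L-lipschitz_on UNIV \<gamma>" and
    epi: "\<And>y. y \<in> ball p R \<Longrightarrow> y \<in> \<Omega> \<longleftrightarrow> \<gamma> (vector [Q (y - p) $ 1, Q (y - p) $ 2]) < Q (y - p) $ 3"
    using \<Omega>(2) unfolding lipschitz_boundary_def by blast
  have lin: "linear Q" using Q by (simp add: orthogonal_transformation_def)
  obtain e where e: "Q e = axis 3 1" using orthogonal_transformation_surj[OF Q] by (metis surjD)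
  have ne: "norm e = 1" using orthogonal_transformation_norm[OF Q, of e] e by simp
  have L: "L \<ge> 0" using \<gamma> by (rule lipschitz_on_nonneg)
  have g0: "\<gamma> (vector [0, 0]) \<ge> 0"
    using epi[of p] p(2) R linear_0[OF lin] by simp
  obtain r where r: "r > 0" "ball p r \<subseteq> closure \<Omega>" using p(1) by (auto simp: mem_interior)
  \<comment> \<open>As in the push into the domain, a deviation smaller than
    \<open>t / (1 + L)\<close> cannot undo a descent by \<open>t\<close>.\<close>
  define t where "t = min (R / 3) (r / 2)"
  have t: "t > 0" "t < R / 2" "t < r" using R r(1) by (auto simp: t_def)
  define s where "s = t / (1 + L)"
  have s: "s > 0" "s \<le> t" "s * (1 + L) = t" using t(1) L by (auto simp: s_def field_simps)
  have "ball (p - t *\<^sub>R e) s \<inter> \<Omega> = {}"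
  proof (rule ccontr)
    assume "ball (p - t *\<^sub>R e) s \<inter> \<Omega> \<noteq> {}"
    then obtain y where y: "y \<in> ball (p - t *\<^sub>R e) s" "y \<in> \<Omega>" by blast
    define z where "z = y - p + t *\<^sub>R e"
    have z: "norm z < s" using y(1) by (simp add: z_def dist_norm norm_minus_commute algebra_simps)
    have yp: "y - p = z - t *\<^sub>R e" by (simp add: z_def)
    have "norm (y - p) \<le> norm z + t"
      unfolding yp using norm_triangle_ineq4[of z "t *\<^sub>R e"] ne t(1) by simp
    then have yb: "y \<in> ball p R" using z s(2) t(2) by (simp add: dist_norm norm_minus_commute)
    have Qy: "Q (y - p) = Q z - t *\<^sub>R axis 3 1"
      unfolding yp using lin by (simp add: linear_diff linear_cmul e)
    have Qz: "norm (Q z) = norm z" by (rule orthogonal_transformation_norm[OF Q])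
    let ?Y = "vector [Q (y - p) $ 1, Q (y - p) $ 2] :: real^2"
    have "norm (?Y - vector [0, 0]) \<le> norm (Q z)"
      unfolding norm_vec_def L2_set_def
      by (rule real_sqrt_le_mono) (simp add: Qy sum_2 sum_3 axis_def)
    then have "\<bar>\<gamma> ?Y - \<gamma> (vector [0, 0])\<bar> \<le> L * norm z"
      using lipschitz_onD[OF \<gamma>, of ?Y "vector [0, 0]"] L Qz mult_left_mono[of "norm (?Y - vector [0, 0])" "norm z" L]
      by (simp add: dist_norm)
    moreover have "\<gamma> ?Y < Q (y - p) $ 3" using epi[OF yb] y(2) by blast
    moreover have "Q (y - p) $ 3 \<le> norm z - t"
      using component_le_norm_cart[of "Q z" 3] Qz by (simp add: Qy axis_def)
    moreover have "norm z * (1 + L) < s * (1 + L)" using z L by (intro mult_strict_right_mono) auto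
    ultimately show False using g0 s(3) by (simp add: algebra_simps)
  qed
  moreover have "p - t *\<^sub>R e \<in> closure \<Omega>" using r(2) t ne by (auto simp: dist_norm)
  ultimately show False
    using s(1) unfolding closure_approachable by (force simp: dist_commute)
qed

section \<open>The Nedelec space as a trial space\<close>

lemma nedelec_space_add:
  assumes \<Omega>: "open \<Omega>" "bounded \<Omega>" and w: "w \<in> nedelec_space \<Omega> \<T>" "w' \<in> nedelec_space \<Omega> \<T>"
  shows "(\<lambda>x. w x + w' x) \<in> nedelec_space \<Omega> \<T>"
  unfolding nedelec_space_def
proof (intro CollectI conjI ballI)
  show "(\<lambda>x. w x + w' x) \<in> H0_curl \<Omega>"
    using w by (intro H0_curl_add(1)[OF \<Omega>]) (auto simp: nedelec_space_def)
  fix K assume "K \<in> \<T>"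
  then obtain a b a' b' where 1: "AE x in lebesgue_on K. w x = a + ccross x b" and 2: "AE x in lebesgue_on K. w' x = a' + ccross x b'"
    using w unfolding nedelec_space_def by blast
  have "AE x in lebesgue_on K. w x + w' x = (a + a') + ccross x (b + b')"
    using 1 2 by eventually_elim (simp add: ccross.add_right)
  then show "\<exists>a b. AE x in lebesgue_on K. w x + w' x = a + ccross x b" by blast
qed

lemma nedelec_space_vscale:
  assumes \<Omega>: "open \<Omega>" "bounded \<Omega>" and w: "w \<in> nedelec_space \<Omega> \<T>"
  shows "(\<lambda>x. z *s w x) \<in> nedelec_space \<Omega> \<T>"
  unfolding nedelec_space_def
proof (intro CollectI conjI ballI)
  show "(\<lambda>x. z *s w x) \<in> H0_curl \<Omega>"
    using w by (intro H0_curl_vscale(1)[OF \<Omega>]) (auto simp: nedelec_space_def)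
  fix K assume "K \<in> \<T>"
  then obtain a b where 1: "AE x in lebesgue_on K. w x = a + ccross x b"
    using w unfolding nedelec_space_def by blast
  have "AE x in lebesgue_on K. z *s w x = z *s a + ccross x (z *s b)"
    using 1 by eventually_elim (simp add: ccross_vscale vector_add_ldistrib)
  then show "\<exists>a b. AE x in lebesgue_on K. z *s w x = a + ccross x b" by blast
qed

text \<open>A subsequence converges almost everywhere, and on each cell a pointwise limit of fields
  \<open>a + x \<times> b\<close> has the same form. That the limit stays in H_0(curl) is the
  closedness of the graph.\<close>

lemma (in mesh) nedelec_space_closed:
  assumes \<Omega>: "open \<Omega>" "bounded \<Omega>" "lipschitz_boundary \<Omega>" and T: "\<Union>\<T> = closure \<Omega>"
  shows "closed (state_vec \<Omega> ` nedelec_space \<Omega> \<T>)"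
  unfolding closed_sequential_limits
proof (intro allI impI, elim conjE)
  fix X l assume X: "\<forall>n. X n \<in> state_vec \<Omega> ` nedelec_space \<Omega> \<T>" and l: "X \<longlonglongrightarrow> l"
  have "\<forall>n. \<exists>w. w \<in> nedelec_space \<Omega> \<T> \<and> X n = state_vec \<Omega> w" using X by blast
  from choice[OF this] obtain w where w: "\<And>n. w n \<in> nedelec_space \<Omega> \<T>" "\<And>n. X n = state_vec \<Omega> (w n)" by blast
  have wH: "w n \<in> H0_curl \<Omega>" for n using w(1)[of n] by (simp add: nedelec_space_def)
  have m: "\<Omega> \<in> sets lebesgue" using \<Omega>(1) by simp
  have s: "sqint (ext \<Omega> (w n))" for n
    using H0_curl_imp_pair[OF \<Omega>(1,2) wH] by (auto simp: curl_pair_def)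
  have lim: "(\<lambda>n. cls (ext \<Omega> (w n))) \<longlonglongrightarrow> fst l"
    using tendsto_fst[OF l] by (simp add: w(2) state_vec_def)
  obtain r g where g: "strict_mono r" "sqint g" "fst l = cls g" "\<And>x. x \<notin> \<Omega> \<Longrightarrow> g x = 0"
    "AE x in lebesgue. (\<lambda>n. ext \<Omega> (w (r n)) x) \<longlonglongrightarrow> g x"
    by (rule l2_limit_representative[OF s lim _ m]) (auto intro: that)
  have "X n \<in> curl_graph \<Omega>" for n using w(2) wH unfolding curl_graph_eq[OF \<Omega>(1,2)] by blast
  then have "l \<in> curl_graph \<Omega>"
    using curl_graph_closed[OF \<Omega>(2) m] l unfolding closed_sequential_limits by blast
  then obtain w' c' where w': "l = (cls w', cls c')" "curl_pair \<Omega> w' c'" unfolding curl_graph_def by blast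
  have "AE x in lebesgue. w' x = g x"
    using g(2,3) w' cls_eq_iff[of w' g] by (simp add: curl_pair_def)
  then have pair: "curl_pair \<Omega> g c'"
    by (intro curl_pair_cong_AE[OF w'(2) g(2)]) (use w'(2) g(4) in \<open>auto simp: curl_pair_def\<close>)
  have "ext \<Omega> g = g" using g(4) by (auto simp: ext_def indicator_def fun_eq_iff)
  then have gH: "g \<in> H0_curl \<Omega>" "state_vec \<Omega> g = l"
    using state_vec_pair[OF \<Omega>(1,2), of g c'] pair g(3) w'(1) by simp_all
  have "g \<in> nedelec_space \<Omega> \<T>" unfolding nedelec_space_def
  proof (intro CollectI conjI gH(1) ballI)
    fix K assume K: "K \<in> \<T>"
    have Km: "K \<in> sets lebesgue" using closed_cells[OF K] by simp
    have "interior K \<subseteq> interior (closure \<Omega>)" using K T by (intro interior_mono) blast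
    then have intK: "interior K \<subseteq> \<Omega>" using interior_closure_lipschitz[OF \<Omega>(1,3)] by blast
    have "\<forall>n. \<exists>p. AE x in lebesgue_on K. w n x = fst p + ccross x (snd p)"
      using w(1) K unfolding nedelec_space_def by fastforce
    from choice[OF this] obtain p where "\<And>n. AE x in lebesgue_on K. w n x = fst (p n) + ccross x (snd (p n))" by blast
    then have p: "\<And>n. AE x in lebesgue. x \<in> K \<longrightarrow> w n x = fst (p n) + ccross x (snd (p n))"
      by (simp only: AE_lebesgue_on_iff[OF Km])
    have "negligible (frontier K)"
      using simplex_verts(6)[OF simp3[OF K]] by (rule negligible_convex_frontier)
    then have fr: "AE x in lebesgue. x \<notin> frontier K"
      unfolding negligible_iff_null_sets by (rule AE_not_in)
    \<comment> \<open>The points of \<open>K\<close> where the polynomials themselves converge,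
      which are almost all of \<open>K\<close>.\<close>
    define G where "G = {x \<in> K. (\<lambda>n. fst (p (r n)) + ccross x (snd (p (r n)))) \<longlonglongrightarrow> g x}"
    have pall: "AE x in lebesgue. \<forall>n. x \<in> K \<longrightarrow> w n x = fst (p n) + ccross x (snd (p n))"
      unfolding AE_all_countable by (intro allI p)
    have AEG: "AE x in lebesgue. x \<in> K \<longrightarrow> x \<in> G"
      using g(5) fr pall
    proof eventually_elim
      case (elim x)
      show ?case
      proof
        assume x: "x \<in> K"
        then have "x \<in> interior K" using elim(2) closure_subset[of K] by (auto simp: frontier_def)
        then have "x \<in> \<Omega>" using intK by blast
        then have "ext \<Omega> (w (r n)) x = fst (p (r n)) + ccross x (snd (p (r n)))" for n
          using elim(3) x by simp
        then show "x \<in> G" using elim(1) x by (simp add: G_def)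
      qed
    qed
    have "\<exists>a b. AE x in lebesgue. x \<in> K \<longrightarrow> g x = a + ccross x b"
    proof (cases "negligible G")
      \<comment> \<open>Then \<open>K\<close> itself is a null set, and any polynomial will
        do.\<close>
      case True
      then have "AE x in lebesgue. x \<notin> G" unfolding negligible_iff_null_sets by (rule AE_not_in)
      with AEG have "AE x in lebesgue. x \<in> K \<longrightarrow> g x = 0 + ccross x 0" by eventually_elim blast
      then show ?thesis by blast
    next
      case False
      have "\<exists>a b. \<forall>x\<in>G. g x = a + ccross x b"
        by (rule nedelec_limit[OF False, where a = "\<lambda>n. fst (p (r n))" and b = "\<lambda>n. snd (p (r n))"])
          (simp add: G_def)
      then obtain a b where ab: "\<forall>x\<in>G. g x = a + ccross x b" by blast
      from AEG have "AE x in lebesgue. x \<in> K \<longrightarrow> g x = a + ccross x b"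
        by eventually_elim (use ab in blast)
      then show ?thesis by blast
    qed
    then show "\<exists>a b. AE x in lebesgue_on K. g x = a + ccross x b"
      using AE_lebesgue_on_iff[OF Km] by blast
  qed
  then show "l \<in> state_vec \<Omega> ` nedelec_space \<Omega> \<T>" using gH(2) by blast
qed

lemma (in mesh) trial_space_nedelec:
  assumes \<Omega>: "open \<Omega>" "bounded \<Omega>" "lipschitz_boundary \<Omega>" and T: "\<Union>\<T> = closure \<Omega>"
  shows "trial_space \<Omega> (nedelec_space \<Omega> \<T>)"
proof -
  have "(\<lambda>x. 0) \<in> H0_curl \<Omega>"
    using trial_space_H0_curl[OF \<Omega>(1,2)] by (simp add: trial_space_def)
  moreover have "AE x in lebesgue_on K. (0 :: complex^3) = 0 + ccross x 0" for K
    by (simp add: ccross.zero_right)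
  ultimately have "(\<lambda>x. 0) \<in> nedelec_space \<Omega> \<T>" unfolding nedelec_space_def by blast
  moreover have "nedelec_space \<Omega> \<T> \<subseteq> H0_curl \<Omega>" by (auto simp: nedelec_space_def)
  ultimately show ?thesis
    unfolding trial_space_def
    using nedelec_space_add[OF \<Omega>(1,2)] nedelec_space_vscale[OF \<Omega>(1,2)] nedelec_space_closed[OF \<Omega> T] by blast
qed

section \<open>Multiplication operators\<close>

definition mult_bound :: "(real^3 \<Rightarrow> complex) \<Rightarrow> real \<Rightarrow> bool" where
  "mult_bound m B \<longleftrightarrow> m \<in> borel_measurable lebesgue \<and> B \<ge> 0 \<and> (AE x in lebesgue. norm (m x) \<le> B)"

text \<open>Multiplication acts on classes through an arbitrary representative. For bounded
  multipliers \<open>mop_cls\<close> shows that the choice does not matter.\<close>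

definition mop :: "(real^3 \<Rightarrow> complex) \<Rightarrow> (real^3, complex^3) l2 \<Rightarrow> (real^3, complex^3) l2" where
  "mop m F = cls (\<lambda>x. m x *s (SOME f. sqint f \<and> F = cls f) x)"

lemma sqint_mult:
  fixes f :: "real^3 \<Rightarrow> complex^3"
  assumes m: "mult_bound m B" and f: "sqint f"
  shows "sqint (\<lambda>x. m x *s f x)" "norm (cls (\<lambda>x. m x *s f x)) \<le> B * norm (cls f)"
proof -
  have B: "B \<ge> 0" and AE: "AE x in lebesgue. norm (m x) \<le> B" using m by (auto simp: mult_bound_def)
  have "continuous_on UNIV (\<lambda>z :: complex \<times> (complex^3). fst z *s snd z)"
    unfolding vector_scalar_mult_def by (intro continuous_on_vec_lambda continuous_intros)
  from measurable_compose[OF _ borel_measurable_continuous_onI[OF this], of "\<lambda>x. (m x, f x)" lebesgue]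
  have ms: "(\<lambda>x. m x *s f x) \<in> borel_measurable lebesgue"
    using m sqint_measurable[OF f] by (simp add: mult_bound_def borel_measurable_Pair)
  have le: "AE x in lebesgue. norm (m x *s f x) \<le> norm (B *\<^sub>R f x)"
    using AE by eventually_elim (use B in \<open>simp add: norm_vscale mult_right_mono\<close>)
  show s: "sqint (\<lambda>x. m x *s f x)"
  proof (rule sqint_bound[OF ms])
    show "integrable lebesgue (\<lambda>x. (norm (B *\<^sub>R f x))\<^sup>2)" by (rule sqint_integrable[OF sqint_scaleR[OF f]])
    show "AE x in lebesgue. (norm (m x *s f x))\<^sup>2 \<le> (norm (B *\<^sub>R f x))\<^sup>2"
      using le by eventually_elim (rule power_mono, auto)
  qed
  have "norm (cls (\<lambda>x. m x *s f x)) \<le> norm (cls (\<lambda>x. B *\<^sub>R f x))"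
    by (rule norm_cls_mono[OF s sqint_scaleR[OF f] le])
  then show "norm (cls (\<lambda>x. m x *s f x)) \<le> B * norm (cls f)"
    using B by (simp add: cls_scaleR[OF f, symmetric])
qed

lemma mop_cls:
  assumes m: "mult_bound m B" and f: "sqint f"
  shows "mop m (cls f) = cls (\<lambda>x. m x *s f x)"
proof -
  define g where "g = (SOME g. sqint g \<and> cls f = cls g)"
  have "\<exists>g. sqint g \<and> cls f = cls g" using f by blast
  then have g: "sqint g \<and> cls f = cls g" unfolding g_def by (rule someI_ex)
  then have "AE x in lebesgue. f x = g x" using cls_eq_iff[OF f, of g] by simp
  then have "AE x in lebesgue. m x *s g x = m x *s f x" by eventually_elim simp
  then show ?thesis
    using sqint_mult(1)[OF m f] sqint_mult(1)[OF m, of g] g unfolding mop_def g_def[symmetric] by (subst cls_eq_iff) auto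
qed

lemma bounded_linear_mop:
  assumes m: "mult_bound m B"
  shows "bounded_linear (mop m)" "norm (mop m F) \<le> B * norm F"
proof -
  show b: "norm (mop m F) \<le> B * norm F" for F
    by (rule l2_representative[of F]) (simp add: mop_cls[OF m] sqint_mult(2)[OF m])
  show "bounded_linear (mop m)"
  proof (rule bounded_linear_intro[where K = B])
    fix F G :: "(real^3, complex^3) l2" and r :: real
    obtain f where f: "sqint f" "F = cls f" by (rule l2_representative[of F]) (rule that)
    obtain g where g: "sqint g" "G = cls g" by (rule l2_representative[of G]) (rule that)
    show "mop m (F + G) = mop m F + mop m G"
      using f g cls_add[OF sqint_mult(1)[OF m f(1)] sqint_mult(1)[OF m g(1)]]
      by (simp add: cls_add sqint_add mop_cls[OF m] vector_add_ldistrib)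
    have "m x *s (r *\<^sub>R f x) = r *\<^sub>R (m x *s f x)" for x
      by (simp add: vec_eq_iff)
    then show "mop m (r *\<^sub>R F) = r *\<^sub>R mop m F"
      using f cls_scaleR[OF sqint_mult(1)[OF m f(1)]] by (simp add: cls_scaleR sqint_scaleR mop_cls[OF m])
    show "norm (mop m F) \<le> norm F * B" using b[of F] by (simp add: mult.commute)
  qed
qed

lemma inner_vscale_self: "(z *s (a :: complex^3)) \<bullet> a = Re z * (norm a)\<^sup>2"
  by (simp add: power2_norm_eq_inner inner_vec_def inner_complex_def sum_3 algebra_simps)

lemma mop_coercive:
  assumes m: "mult_bound m B" and f: "sqint f" "\<And>x. x \<notin> S \<Longrightarrow> f x = 0"
    and c: "AE x in lebesgue. x \<in> S \<longrightarrow> c \<le> Re (m x)"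
  shows "c * (norm (cls f))\<^sup>2 \<le> mop m (cls f) \<bullet> cls f"
proof -
  have "c * (norm (cls f))\<^sup>2 = (LINT x|lebesgue. c * (norm (f x))\<^sup>2)"
    by (simp add: norm_cls[OF f(1)])
  also have "\<dots> \<le> (LINT x|lebesgue. (m x *s f x) \<bullet> f x)"
  proof (rule integral_mono_AE)
    show "integrable lebesgue (\<lambda>x. c * (norm (f x))\<^sup>2)" using sqint_integrable[OF f(1)] by simp
    show "integrable lebesgue (\<lambda>x. (m x *s f x) \<bullet> f x)"
      by (rule sqint_inner_integrable[OF sqint_mult(1)[OF m f(1)] f(1)])
    show "AE x in lebesgue. c * (norm (f x))\<^sup>2 \<le> (m x *s f x) \<bullet> f x"
      using c
    proof eventually_elim
      case (elim x)
      then show ?case using f(2)[of x] by (cases "x \<in> S") (auto simp: inner_vscale_self intro: mult_right_mono)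
    qed
  qed
  also have "\<dots> = mop m (cls f) \<bullet> cls f"
    by (simp add: mop_cls[OF m f(1)] inner_cls[OF sqint_mult(1)[OF m f(1)] f(1)])
  finally show ?thesis .
qed

section \<open>The state equation\<close>

lemma mult_bound_diff:
  "mult_bound m B \<Longrightarrow> mult_bound m' B' \<Longrightarrow> mult_bound (\<lambda>x. m x - m' x) (B + B')"
  unfolding mult_bound_def
  by (auto elim!: eventually_elim2 intro: order_trans[OF norm_triangle_ineq4 add_mono])

lemma mop_diff:
  assumes "mult_bound m B" "mult_bound m' B'"
  shows "mop m F - mop m' F = mop (\<lambda>x. m x - m' x) F"
proof -
  obtain f where f: "sqint f" "F = cls f" by (rule l2_representative[of F]) (rule that)
  show ?thesis
    using f sqint_mult(1)[OF assms(1) f(1)] sqint_mult(1)[OF assms(2) f(1)]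
    by (simp add: mop_cls[OF assms(1)] mop_cls[OF assms(2)] mop_cls[OF mult_bound_diff[OF assms]] cls_diff vec.scale_left_diff_distrib)
qed

lemma bounded_bilinear_cdot_cnjv: "bounded_bilinear (\<lambda>v w. cdot v (cnjv w))"
  using bounded_bilinear.comp[OF bounded_bilinear_cdot bounded_linear_ident bounded_linear_cnjv] .

lemma L2_inner_ext:
  assumes "S \<in> sets lebesgue"
  shows "L2_inner S v w = (LINT x|lebesgue. cdot (ext S v x) (cnjv (ext S w x)))"
proof -
  have "ext S (\<lambda>x. \<Sum>i\<in>UNIV. v x $ i * cnj (w x $ i)) x = cdot (ext S v x) (cnjv (ext S w x))" for x
    by (simp add: ext_def indicator_def cdot_def cnjv_def)
  from Bochner_Integration.integral_cong[OF refl this] show ?thesis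
    unfolding L2_inner_def integral_lebesgue_on[OF assms] .
qed

lemma Re_vscale_cdot: "Re (z * cdot v (cnjv w)) = (z *s v) \<bullet> w"
  by (simp add: cdot_def cnjv_def inner_vec_def inner_complex_def sum_3 algebra_simps)

lemma Re_integral_vscale:
  fixes v w :: "real^3 \<Rightarrow> complex^3"
  assumes v: "sqint v" and w: "sqint w"
  shows "Re (z * (LINT x|lebesgue. cdot (v x) (cnjv (w x)))) = cls (\<lambda>x. z *s v x) \<bullet> cls w"
proof -
  have i: "integrable lebesgue (\<lambda>x. z * cdot (v x) (cnjv (w x)))"
    using sqint_prod_integrable[OF bounded_bilinear_cdot_cnjv v w] by simp
  have "Re (z * (LINT x|lebesgue. cdot (v x) (cnjv (w x)))) = Re (LINT x|lebesgue. z * cdot (v x) (cnjv (w x)))"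
    by simp
  also have "\<dots> = (LINT x|lebesgue. (z *s v x) \<bullet> w x)"
    unfolding Re_vscale_cdot[symmetric] by (rule integral_bounded_linear[OF bounded_linear_Re i, symmetric])
  finally show ?thesis using sqint_vscale[OF v] w by (simp add: inner_cls)
qed

text \<open>For large \<open>\<tau>\<close> the conductivity dominates the permittivity in \<open>\<zeta>_coercive\<close>.\<close>

locale state_problem =
  fixes \<Omega> :: "(real^3) set" and P :: "'l::finite \<Rightarrow> (real^3) set" and \<mu> :: "real^3 \<Rightarrow> real"
    and \<omega> :: real and \<zeta> :: "real^3 \<Rightarrow> complex" and f :: "real^3 \<Rightarrow> complex^3"
    and \<nu>\<^sub>0 \<nu>\<^sub>1 \<beta> \<tau> \<rho> \<alpha>\<^sub>0 :: real
  assumes open_dom: "open \<Omega>" and bounded_dom: "bounded \<Omega>"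
    and P_open: "\<And>k. open (P k)" and P_sub: "\<And>k. P k \<subseteq> \<Omega>" and P_disj: "\<And>k k'. k \<noteq> k' \<Longrightarrow> P k \<inter> P k' = {}"
    and P_cover: "AE x in lebesgue. x \<in> \<Omega> \<longrightarrow> (\<exists>k. x \<in> P k)"
    and \<mu>_meas: "\<mu> \<in> borel_measurable (lebesgue_on \<Omega>)"
    and \<nu>: "0 < \<nu>\<^sub>0" "AE x in lebesgue. x \<in> \<Omega> \<longrightarrow> \<nu>\<^sub>0 \<le> inverse (\<mu> x) \<and> inverse (\<mu> x) \<le> \<nu>\<^sub>1"
    and \<zeta>_meas: "\<zeta> \<in> borel_measurable (lebesgue_on \<Omega>)"
    and \<zeta>_bound: "0 \<le> \<beta>" "AE x in lebesgue. x \<in> \<Omega> \<longrightarrow> norm (\<zeta> x) \<le> \<beta>"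
    and \<zeta>_coercive: "0 < \<rho>" "AE x in lebesgue. x \<in> \<Omega> \<longrightarrow> \<rho> \<le> Re (- (1 + \<i> * of_real \<tau>) * of_real (\<omega>\<^sup>2) * \<zeta> x)"
    and \<alpha>\<^sub>0: "0 < \<alpha>\<^sub>0"
    and f: "f \<in> L2 \<Omega>"
begin

section \<open>The rotated form and its coercivity\<close>

abbreviation rot :: complex where "rot \<equiv> 1 + \<i> * of_real \<tau>"

definition m_curl :: "real^3 \<Rightarrow> complex" where
  "m_curl = ext \<Omega> (\<lambda>x. rot * of_real (inverse (\<mu> x)))"

definition m_mass :: "real^'l \<Rightarrow> real^3 \<Rightarrow> complex" where
  "m_mass u = ext \<Omega> (\<lambda>x. - rot * of_real (\<omega>\<^sup>2) * piecewise_scale P \<zeta> u x)"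

definition form_op :: "real^'l \<Rightarrow> (real^3, complex^3) l2 \<times> (real^3, complex^3) l2 \<Rightarrow> (real^3, complex^3) l2 \<times> (real^3, complex^3) l2" where
  "form_op u Y = (mop (m_mass u) (fst Y), mop m_curl (snd Y))"

definition load :: "(real^3, complex^3) l2 \<times> (real^3, complex^3) l2" where
  "load = (cls (\<lambda>x. rot *s ext \<Omega> f x), 0)"

lemma \<Omega>_meas: "\<Omega> \<in> sets lebesgue"
  using open_dom by simp

lemma ext_meas:
  fixes g :: "real^3 \<Rightarrow> 'b::euclidean_space"
  assumes "g \<in> borel_measurable (lebesgue_on \<Omega>)"
  shows "ext \<Omega> g \<in> borel_measurable lebesgue"
  using assms \<Omega>_meas by (simp add: ext_def[abs_def] borel_measurable_restrict_space_iff)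

lemma piecewise_scale_on:
  assumes "x \<in> P k"
  shows "piecewise_scale P \<zeta> u x = of_real (u $ k) * \<zeta> x"
proof -
  have "piecewise_scale P \<zeta> u x = (\<Sum>j\<in>UNIV. if j = k then of_real (u $ k) * \<zeta> x else 0)"
    unfolding piecewise_scale_def
    by (rule sum.cong) (use assms P_disj in auto)
  then show ?thesis by (simp add: sum.delta)
qed

lemma ext_piecewise_scale:
  "ext \<Omega> (piecewise_scale P \<zeta> u) x = (\<Sum>k\<in>UNIV. indicator (P k) x *\<^sub>R (of_real (u $ k) * ext \<Omega> \<zeta> x))"
  using P_sub by (cases "x \<in> \<Omega>") (auto simp: piecewise_scale_def indicator_def intro!: sum.cong sum.neutral)

lemma m_mass_eq: "m_mass u x = - rot * of_real (\<omega>\<^sup>2) * ext \<Omega> (piecewise_scale P \<zeta> u) x"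
  by (cases "x \<in> \<Omega>") (simp_all add: m_mass_def)

lemma m_curl_bound: "mult_bound m_curl (norm rot * \<bar>\<nu>\<^sub>1\<bar>)"
  unfolding mult_bound_def
proof (intro conjI)
  have "(\<lambda>x. rot * of_real (inverse (\<mu> x)) :: complex) \<in> borel_measurable (lebesgue_on \<Omega>)"
    using \<mu>_meas by measurable
  then show "m_curl \<in> borel_measurable lebesgue" unfolding m_curl_def by (rule ext_meas)
  show "AE x in lebesgue. norm (m_curl x) \<le> norm rot * \<bar>\<nu>\<^sub>1\<bar>"
    using \<nu>(2)
  proof eventually_elim
    case (elim x)
    show ?case
    proof (cases "x \<in> \<Omega>")
      case True
      then have "\<bar>inverse (\<mu> x)\<bar> \<le> \<bar>\<nu>\<^sub>1\<bar>" using elim \<nu>(1) by linarith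
      then have "norm rot * \<bar>inverse (\<mu> x)\<bar> \<le> norm rot * \<bar>\<nu>\<^sub>1\<bar>" by (rule mult_left_mono) simp
      then show ?thesis using True by (simp add: m_curl_def norm_mult norm_inverse)
    qed (simp add: m_curl_def)
  qed
qed simp

text \<open>The number of subdomains enters because the pieces of the coefficient are estimated one
  by one.\<close>

definition C_mass :: real where
  "C_mass = norm rot * \<omega>\<^sup>2 * real CARD('l) * \<beta>"

lemma C_mass_nonneg: "C_mass \<ge> 0"
  using \<zeta>_bound(1) by (simp add: C_mass_def)

lemma m_mass_bound: "mult_bound (m_mass u) (C_mass * norm u)"
  unfolding mult_bound_def
proof (intro conjI)
  have "(\<lambda>x. \<Sum>k\<in>UNIV. indicator (P k) x *\<^sub>R (of_real (u $ k) * ext \<Omega> \<zeta> x)) \<in> borel_measurable lebesgue"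
    using ext_meas[OF \<zeta>_meas] P_open
    by (intro borel_measurable_sum borel_measurable_scaleR borel_measurable_indicator borel_measurable_times) auto
  then show "m_mass u \<in> borel_measurable lebesgue"
    unfolding ext_piecewise_scale[symmetric] m_mass_eq[abs_def]
    by (rule borel_measurable_times[OF borel_measurable_const])
  show "AE x in lebesgue. norm (m_mass u x) \<le> C_mass * norm u"
    using \<zeta>_bound(2)
  proof eventually_elim
    case (elim x)
    have e: "norm (ext \<Omega> \<zeta> x) \<le> \<beta>" using elim \<zeta>_bound(1) by (cases "x \<in> \<Omega>") auto
    have "norm (ext \<Omega> (piecewise_scale P \<zeta> u) x) \<le> (\<Sum>k\<in>(UNIV :: 'l set). norm u * \<beta>)"
      unfolding ext_piecewise_scale
    proof (rule sum_norm_le)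
      fix k :: 'l
      have "norm (indicator (P k) x *\<^sub>R (of_real (u $ k) * ext \<Omega> \<zeta> x)) \<le> \<bar>u $ k\<bar> * norm (ext \<Omega> \<zeta> x)"
        by (simp add: indicator_def norm_mult)
      also have "\<dots> \<le> norm u * \<beta>" using e by (intro mult_mono component_le_norm_cart) auto
      finally show "norm (indicator (P k) x *\<^sub>R (of_real (u $ k) * ext \<Omega> \<zeta> x)) \<le> norm u * \<beta>" .
    qed
    also have "\<dots> = real CARD('l) * (norm u * \<beta>)" by simp
    finally have "norm rot * \<omega>\<^sup>2 * norm (ext \<Omega> (piecewise_scale P \<zeta> u) x) \<le> norm rot * \<omega>\<^sup>2 * (real CARD('l) * (norm u * \<beta>))"
      by (rule mult_left_mono) simp
    moreover have "norm (m_mass u x) = norm rot * \<omega>\<^sup>2 * norm (ext \<Omega> (piecewise_scale P \<zeta> u) x)"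
      unfolding m_mass_eq norm_mult norm_minus_cancel norm_of_real by simp
    ultimately show ?case by (simp add: C_mass_def mult_ac)
  qed
  show "0 \<le> C_mass * norm u" using C_mass_nonneg by simp
qed

lemma m_mass_diff: "(\<lambda>x. m_mass u x - m_mass u' x) = m_mass (u - u')"
proof
  fix x
  have "ext \<Omega> (piecewise_scale P \<zeta> (u - u')) x = ext \<Omega> (piecewise_scale P \<zeta> u) x - ext \<Omega> (piecewise_scale P \<zeta> u') x"
    unfolding ext_piecewise_scale sum_subtractf[symmetric]
    by (intro sum.cong refl) (simp add: algebra_simps)
  then show "m_mass u x - m_mass u' x = m_mass (u - u') x"
    by (simp only: m_mass_eq right_diff_distrib)
qed

lemma bounded_linear_form_op: "bounded_linear (form_op u)"
  unfolding form_op_def[abs_def]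
  by (intro bounded_linear_Pair bounded_linear_compose[OF bounded_linear_mop(1)[OF m_mass_bound] bounded_linear_fst]
      bounded_linear_compose[OF bounded_linear_mop(1)[OF m_curl_bound] bounded_linear_snd])

lemma bounded_bilinear_form: "bounded_bilinear (\<lambda>Y Z. form_op u Y \<bullet> Z)"
  using bounded_bilinear.comp[OF bounded_bilinear_inner bounded_linear_form_op bounded_linear_ident] .

text \<open>Only the mass term depends on the control, and it does so linearly. The difference is
  therefore the mass term of \<open>u - u'\<close>, which gives the perturbation bound for the
  Galerkin argument.\<close>

lemma form_diff:
  "\<bar>form_op u Y \<bullet> Z - form_op u' Y \<bullet> Z\<bar> \<le> (C_mass * norm (u - u')) * norm Y * norm Z"
proof -
  have "form_op u Y \<bullet> Z - form_op u' Y \<bullet> Z = mop (m_mass (u - u')) (fst Y) \<bullet> fst Z"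
    by (simp add: form_op_def inner_prod_def inner_diff_left[symmetric] mop_diff[OF m_mass_bound m_mass_bound] m_mass_diff)
  also have "\<bar>\<dots>\<bar> \<le> norm (mop (m_mass (u - u')) (fst Y)) * norm (fst Z)"
    by (rule Cauchy_Schwarz_ineq2)
  also have "\<dots> \<le> (C_mass * norm (u - u') * norm Y) * norm Z"
  proof (rule mult_mono)
    have "norm (mop (m_mass (u - u')) (fst Y)) \<le> C_mass * norm (u - u') * norm (fst Y)"
      by (rule bounded_linear_mop(2)[OF m_mass_bound])
    also have "\<dots> \<le> C_mass * norm (u - u') * norm Y"
      using C_mass_nonneg norm_fst_le[of "fst Y" "snd Y"] by (intro mult_left_mono) auto
    finally show "norm (mop (m_mass (u - u')) (fst Y)) \<le> C_mass * norm (u - u') * norm Y" .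
  qed (use C_mass_nonneg norm_snd_le[of "snd Y" "fst Y"] norm_fst_le[of "fst Z" "snd Z"] in auto)
  finally show ?thesis .
qed

text \<open>The rotation leaves the real part of the curl coefficient at \<open>1/\<mu>\<close> and
  makes that of the mass coefficient positive. Multiplying by control values at least
  \<open>\<alpha>\<^sub>0\<close> keeps the constant uniform over all admissible controls.\<close>

lemma form_coercive:
  assumes u: "\<And>k. \<alpha>\<^sub>0 \<le> u $ k" and Y: "Y \<in> curl_graph \<Omega>"
  shows "min \<nu>\<^sub>0 (\<alpha>\<^sub>0 * \<rho>) * (norm Y)\<^sup>2 \<le> form_op u Y \<bullet> Y"
proof -
  obtain w c where Y: "Y = (cls w, cls c)" "curl_pair \<Omega> w c" using Y by (auto simp: curl_graph_def)
  have s: "sqint w" "sqint c" "\<And>x. x \<notin> \<Omega> \<Longrightarrow> w x = 0" "\<And>x. x \<notin> \<Omega> \<Longrightarrow> c x = 0"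
    using Y(2) by (auto simp: curl_pair_def)
  have "AE x in lebesgue. x \<in> \<Omega> \<longrightarrow> \<alpha>\<^sub>0 * \<rho> \<le> Re (m_mass u x)"
    using P_cover \<zeta>_coercive(2)
  proof eventually_elim
    case (elim x)
    show ?case
    proof
      assume x: "x \<in> \<Omega>"
      then obtain k where k: "x \<in> P k" using elim(1) by blast
      have "m_mass u x = of_real (u $ k) * (- rot * of_real (\<omega>\<^sup>2) * \<zeta> x)"
        using x by (simp add: m_mass_def piecewise_scale_on[OF k] mult_ac)
      then have "Re (m_mass u x) = u $ k * Re (- rot * of_real (\<omega>\<^sup>2) * \<zeta> x)"
        by (simp only: Re_complex_of_real Im_complex_of_real times_complex.sel)
      also have "\<dots> \<ge> \<alpha>\<^sub>0 * \<rho>"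
        using elim(2) x u[of k] \<alpha>\<^sub>0 \<zeta>_coercive(1) by (intro mult_mono) auto
      finally show "\<alpha>\<^sub>0 * \<rho> \<le> Re (m_mass u x)" .
    qed
  qed
  from mop_coercive[OF m_mass_bound s(1,3) this]
  have 1: "\<alpha>\<^sub>0 * \<rho> * (norm (cls w))\<^sup>2 \<le> mop (m_mass u) (cls w) \<bullet> cls w" .
  have Re: "Re (rot * of_real r) = r" for r by simp
  have "AE x in lebesgue. x \<in> \<Omega> \<longrightarrow> \<nu>\<^sub>0 \<le> Re (m_curl x)"
    using \<nu>(2) by eventually_elim (auto simp: m_curl_def Re simp del: of_real_inverse times_complex.sel plus_complex.sel)
  from mop_coercive[OF m_curl_bound s(2,4) this]
  have 2: "\<nu>\<^sub>0 * (norm (cls c))\<^sup>2 \<le> mop m_curl (cls c) \<bullet> cls c" .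
  have "(norm Y)\<^sup>2 = (norm (cls w))\<^sup>2 + (norm (cls c))\<^sup>2"
    by (simp add: Y(1) norm_Pair)
  then have "min \<nu>\<^sub>0 (\<alpha>\<^sub>0 * \<rho>) * (norm Y)\<^sup>2 = min \<nu>\<^sub>0 (\<alpha>\<^sub>0 * \<rho>) * (norm (cls w))\<^sup>2 + min \<nu>\<^sub>0 (\<alpha>\<^sub>0 * \<rho>) * (norm (cls c))\<^sup>2"
    by (simp add: algebra_simps)
  also have "\<dots> \<le> \<alpha>\<^sub>0 * \<rho> * (norm (cls w))\<^sup>2 + \<nu>\<^sub>0 * (norm (cls c))\<^sup>2"
    by (intro add_mono mult_right_mono) auto
  also have "\<dots> \<le> form_op u Y \<bullet> Y"
    using 1 2 by (simp add: form_op_def Y(1))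
  finally show ?thesis .
qed

section \<open>From real parts back to the complex equation\<close>

definition residual :: "real^'l \<Rightarrow> (real^3 \<Rightarrow> complex^3) \<Rightarrow> (real^3 \<Rightarrow> complex^3) \<Rightarrow> complex" where
  "residual u y w = L2_inner \<Omega> (\<lambda>x. inverse (\<mu> x) *\<^sub>R curl \<Omega> y x) (curl \<Omega> w)
     - of_real (\<omega>\<^sup>2) * L2_inner \<Omega> (\<lambda>x. piecewise_scale P \<zeta> u x *s y x) w - L2_inner \<Omega> f w"

lemma H0_curl_sqint:
  "w \<in> H0_curl \<Omega> \<Longrightarrow> sqint (ext \<Omega> w)" "w \<in> H0_curl \<Omega> \<Longrightarrow> sqint (ext \<Omega> (curl \<Omega> w))"
  using H0_curl_imp_pair[OF open_dom bounded_dom] by (auto simp: curl_pair_def)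

lemma residual_eq:
  assumes y: "y \<in> H0_curl \<Omega>" and w: "w \<in> H0_curl \<Omega>"
  shows "Re (rot * residual u y w) = form_op u (state_vec \<Omega> y) \<bullet> state_vec \<Omega> w - load \<bullet> state_vec \<Omega> w"
proof -
  note sy = H0_curl_sqint[OF y] and sw = H0_curl_sqint[OF w]
  define m1 where "m1 = ext \<Omega> (\<lambda>x. complex_of_real (inverse (\<mu> x)))"
  define m2 where "m2 = ext \<Omega> (piecewise_scale P \<zeta> u)"
  have rot: "rot \<noteq> 0" by (simp add: complex_eq_iff)
  have m1: "m_curl x = rot * m1 x" for x by (cases "x \<in> \<Omega>") (simp_all add: m_curl_def m1_def)
  have m2: "m_mass u x = - (rot * of_real (\<omega>\<^sup>2)) * m2 x" for x
    by (simp only: m_mass_eq m2_def mult_minus_left)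
  have e1: "ext \<Omega> (\<lambda>x. inverse (\<mu> x) *\<^sub>R curl \<Omega> y x) = (\<lambda>x. m1 x *s ext \<Omega> (curl \<Omega> y) x)"
    by (auto simp: ext_def indicator_def m1_def of_real_vscale fun_eq_iff simp del: of_real_inverse)
  have e2: "ext \<Omega> (\<lambda>x. piecewise_scale P \<zeta> u x *s y x) = (\<lambda>x. m2 x *s ext \<Omega> y x)"
    by (auto simp: ext_def indicator_def m2_def fun_eq_iff)
  \<comment> \<open>The unrotated coefficient is the rotated one divided by the nonzero number
    \<open>rot\<close>, so its bound need not be proved again.\<close>
  have s1: "sqint (\<lambda>x. m1 x *s ext \<Omega> (curl \<Omega> y) x)"
  proof -
    have "sqint (\<lambda>x. inverse rot *s (m_curl x *s ext \<Omega> (curl \<Omega> y) x))"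
      by (rule sqint_vscale[OF sqint_mult(1)[OF m_curl_bound sy(2)]])
    then show ?thesis using rot by (simp add: m1 vec.scale_scale mult.assoc[symmetric])
  qed
  have s2: "sqint (\<lambda>x. of_real (\<omega>\<^sup>2) *s (m2 x *s ext \<Omega> y x))"
  proof -
    have "sqint (\<lambda>x. (- inverse rot) *s (m_mass u x *s ext \<Omega> y x))"
      by (rule sqint_vscale[OF sqint_mult(1)[OF m_mass_bound sy(1)]])
    then show ?thesis using rot by (simp add: m2 vec.scale_scale mult.assoc[symmetric])
  qed
  have sf: "sqint (ext \<Omega> f)" using f by (simp add: L2_iff_sqint[OF \<Omega>_meas])
  have t1: "Re (rot * L2_inner \<Omega> (\<lambda>x. inverse (\<mu> x) *\<^sub>R curl \<Omega> y x) (curl \<Omega> w)) = mop m_curl (cls (ext \<Omega> (curl \<Omega> y))) \<bullet> cls (ext \<Omega> (curl \<Omega> w))"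
    unfolding L2_inner_ext[OF \<Omega>_meas] e1 Re_integral_vscale[OF s1 sw(2)] mop_cls[OF m_curl_bound sy(2)]
    by (simp add: m1 vec.scale_scale)
  have t2: "Re (rot * (of_real (\<omega>\<^sup>2) * L2_inner \<Omega> (\<lambda>x. piecewise_scale P \<zeta> u x *s y x) w)) = - (mop (m_mass u) (cls (ext \<Omega> y)) \<bullet> cls (ext \<Omega> w))"
  proof -
    have eq: "of_real (\<omega>\<^sup>2) * L2_inner \<Omega> (\<lambda>x. piecewise_scale P \<zeta> u x *s y x) w =
        (LINT x|lebesgue. cdot (of_real (\<omega>\<^sup>2) *s (m2 x *s ext \<Omega> y x)) (cnjv (ext \<Omega> w x)))"
      unfolding L2_inner_ext[OF \<Omega>_meas] e2 integral_mult_right_zero[symmetric]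
      by (simp add: cdot_def sum_distrib_left mult_ac)
    have "Re (rot * (of_real (\<omega>\<^sup>2) * L2_inner \<Omega> (\<lambda>x. piecewise_scale P \<zeta> u x *s y x) w)) =
        cls (\<lambda>x. rot *s (of_real (\<omega>\<^sup>2) *s (m2 x *s ext \<Omega> y x))) \<bullet> cls (ext \<Omega> w)"
      unfolding eq by (rule Re_integral_vscale[OF s2 sw(1)])
    also have "(\<lambda>x. rot *s (of_real (\<omega>\<^sup>2) *s (m2 x *s ext \<Omega> y x))) = (\<lambda>x. (-1) *\<^sub>R (m_mass u x *s ext \<Omega> y x))"
      by (simp add: m2 vec.scale_scale fun_eq_iff vec_eq_iff mult_ac)
    also have "cls \<dots> = (-1) *\<^sub>R cls (\<lambda>x. m_mass u x *s ext \<Omega> y x)"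
      by (rule cls_scaleR[symmetric, OF sqint_mult(1)[OF m_mass_bound sy(1)]])
    finally show ?thesis by (simp add: mop_cls[OF m_mass_bound sy(1)])
  qed
  have t3: "Re (rot * L2_inner \<Omega> f w) = cls (\<lambda>x. rot *s ext \<Omega> f x) \<bullet> cls (ext \<Omega> w)"
    unfolding L2_inner_ext[OF \<Omega>_meas] by (rule Re_integral_vscale[OF sf sw(1)])
  have "rot * residual u y w = rot * L2_inner \<Omega> (\<lambda>x. inverse (\<mu> x) *\<^sub>R curl \<Omega> y x) (curl \<Omega> w)
      - rot * (of_real (\<omega>\<^sup>2) * L2_inner \<Omega> (\<lambda>x. piecewise_scale P \<zeta> u x *s y x) w) - rot * L2_inner \<Omega> f w"
    by (simp only: residual_def right_diff_distrib)
  then show ?thesis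
    by (simp only: minus_complex.sel t1 t2 t3) (simp add: form_op_def state_vec_def load_def)
qed

lemma residual_vscale:
  assumes y: "y \<in> H0_curl \<Omega>" and w: "w \<in> H0_curl \<Omega>"
  shows "residual u y (\<lambda>x. \<i> *s w x) = - \<i> * residual u y w"
proof -
  note s = H0_curl_vscale[OF open_dom bounded_dom w, of \<i>]
  have e: "cdot v (cnjv (\<i> *s b)) = - \<i> * cdot v (cnjv b)" for v b
    by (simp add: cdot_def cnjv_def sum_distrib_left sum_negf mult_ac)
  have 1: "L2_inner \<Omega> v (\<lambda>x. \<i> *s w x) = - \<i> * L2_inner \<Omega> v w" for v
    unfolding L2_inner_ext[OF \<Omega>_meas] ext_vscale e by simp
  \<comment> \<open>The curl picked for \<open>\<i> w\<close> agrees with \<open>\<i>\<close> times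
    the one picked for \<open>w\<close> only almost everywhere, so the integrands are compared up to
    null sets, which calls for measurability of \<open>v\<close>.\<close>
  have "L2_inner \<Omega> v (curl \<Omega> (\<lambda>x. \<i> *s w x)) = - \<i> * L2_inner \<Omega> v (curl \<Omega> w)"
    if "ext \<Omega> v \<in> borel_measurable lebesgue" for v
  proof -
    have cm: "(\<lambda>x. cdot (ext \<Omega> v x) (cnjv (g x))) \<in> borel_measurable lebesgue" if g: "g \<in> borel_measurable lebesgue" for g
    proof -
      have "continuous_on UNIV (\<lambda>z :: (complex^3) \<times> (complex^3). cdot (fst z) (cnjv (snd z)))"
        by (intro bounded_bilinear.continuous_on[OF bounded_bilinear_cdot_cnjv] continuous_intros)
      from measurable_compose[OF borel_measurable_Pair[OF \<open>ext \<Omega> v \<in> borel_measurable lebesgue\<close> g] borel_measurable_continuous_onI[OF this]]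
      show ?thesis by simp
    qed
    have "L2_inner \<Omega> v (curl \<Omega> (\<lambda>x. \<i> *s w x)) = (LINT x|lebesgue. cdot (ext \<Omega> v x) (cnjv (\<i> *s ext \<Omega> (curl \<Omega> w) x)))"
      unfolding L2_inner_ext[OF \<Omega>_meas]
    proof (rule integral_cong_AE)
      show "AE x in lebesgue. cdot (ext \<Omega> v x) (cnjv (ext \<Omega> (curl \<Omega> (\<lambda>x. \<i> *s w x)) x)) = cdot (ext \<Omega> v x) (cnjv (\<i> *s ext \<Omega> (curl \<Omega> w) x))"
        using s(3) by eventually_elim simp
    qed (use cm sqint_measurable[OF H0_curl_sqint(2)[OF s(1)]] sqint_measurable[OF sqint_vscale[OF H0_curl_sqint(2)[OF w]]] in auto)
    then show ?thesis unfolding e L2_inner_ext[OF \<Omega>_meas] by simp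
  qed
  moreover have "ext \<Omega> (\<lambda>x. inverse (\<mu> x) *\<^sub>R curl \<Omega> y x) \<in> borel_measurable lebesgue"
  proof -
    have "(\<lambda>x. ext \<Omega> (\<lambda>x. inverse (\<mu> x)) x *\<^sub>R ext \<Omega> (curl \<Omega> y) x) \<in> borel_measurable lebesgue"
      by (rule borel_measurable_scaleR[OF ext_meas[OF borel_measurable_inverse[OF \<mu>_meas]] sqint_measurable[OF H0_curl_sqint(2)[OF y]]])
    moreover have "ext \<Omega> (\<lambda>x. inverse (\<mu> x) *\<^sub>R curl \<Omega> y x) = (\<lambda>x. ext \<Omega> (\<lambda>x. inverse (\<mu> x)) x *\<^sub>R ext \<Omega> (curl \<Omega> y) x)"
      by (auto simp: ext_def indicator_def)
    ultimately show ?thesis by simp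
  qed
  ultimately show ?thesis
    unfolding residual_def 1 by (simp add: algebra_simps)
qed

text \<open>The residual is antilinear in the test field, so testing with \<open>\<i> w\<close>
  turns the imaginary part into a real part: the real equations for all test fields are equivalent
  to the complex ones.\<close>

lemma solves_iff:
  assumes W: "trial_space \<Omega> W"
  shows "solves_state_eq \<Omega> \<mu> \<omega> (piecewise_scale P \<zeta> u) f W y \<longleftrightarrow>
    y \<in> W \<and> (\<forall>Z\<in>state_vec \<Omega> ` W. form_op u (state_vec \<Omega> y) \<bullet> Z = load \<bullet> Z)"
proof -
  have H: "W \<subseteq> H0_curl \<Omega>" and i: "\<And>w. w \<in> W \<Longrightarrow> (\<lambda>x. \<i> *s w x) \<in> W"
    using W by (auto simp: trial_space_def)
  have "solves_state_eq \<Omega> \<mu> \<omega> (piecewise_scale P \<zeta> u) f W y \<longleftrightarrow> y \<in> W \<and> (\<forall>w\<in>W. residual u y w = 0)"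
    by (auto simp: solves_state_eq_def residual_def)
  also have "\<dots> \<longleftrightarrow> y \<in> W \<and> (\<forall>w\<in>W. Re (rot * residual u y w) = 0)"
  proof (intro conj_cong refl iffI ballI)
    fix w assume y: "y \<in> W" and R: "\<forall>w\<in>W. Re (rot * residual u y w) = 0" and w: "w \<in> W"
    have "Re (rot * residual u y (\<lambda>x. \<i> *s w x)) = 0" using R i[OF w] by blast
    moreover have "residual u y (\<lambda>x. \<i> *s w x) = - \<i> * residual u y w"
      using residual_vscale y w H by blast
    then have "rot * residual u y (\<lambda>x. \<i> *s w x) = - \<i> * (rot * residual u y w)" by (simp only: mult_ac)
    ultimately have "Im (rot * residual u y w) = 0" by simp
    with R w have "rot * residual u y w = 0" by (simp add: complex_eq_iff del: mult_eq_0_iff)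
    moreover have "rot \<noteq> 0" by (simp add: complex_eq_iff)
    ultimately show "residual u y w = 0" by simp
  qed simp
  also have "\<dots> \<longleftrightarrow> y \<in> W \<and> (\<forall>Z\<in>state_vec \<Omega> ` W. form_op u (state_vec \<Omega> y) \<bullet> Z = load \<bullet> Z)"
  proof -
    have "Re (rot * residual u y w) = 0 \<longleftrightarrow> form_op u (state_vec \<Omega> y) \<bullet> state_vec \<Omega> w = load \<bullet> state_vec \<Omega> w"
      if "y \<in> W" "w \<in> W" for w
    proof -
      have "y \<in> H0_curl \<Omega>" "w \<in> H0_curl \<Omega>" using that H by auto
      from residual_eq[OF this] show ?thesis by (simp only: right_minus_eq)
    qed
    then show ?thesis by blast
  qed
  finally show ?thesis .
qed

section \<open>Existence and convergence of the states\<close>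

abbreviation state :: "(real^3 \<Rightarrow> complex^3) set \<Rightarrow> real^'l \<Rightarrow> real^3 \<Rightarrow> complex^3" where
  "state \<equiv> control_to_state \<Omega> P \<mu> \<omega> \<zeta> f"

lemma state_solves:
  assumes W: "trial_space \<Omega> W" and u: "\<And>k. \<alpha>\<^sub>0 \<le> u $ k"
  shows "state W u \<in> W" "\<And>Z. Z \<in> state_vec \<Omega> ` W \<Longrightarrow> form_op u (state_vec \<Omega> (state W u)) \<bullet> Z = load \<bullet> Z"
proof -
  let ?V = "state_vec \<Omega> ` W"
  have V: "subspace ?V" "closed ?V" "?V \<subseteq> curl_graph \<Omega>"
    using trial_space_subspace[OF open_dom bounded_dom W] W curl_graph_eq[OF open_dom bounded_dom]
    by (auto simp: trial_space_def)
  have c: "complete ?V" by (rule iffD2[OF complete_eq_closed V(2)])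
  have pos: "min \<nu>\<^sub>0 (\<alpha>\<^sub>0 * \<rho>) > 0" using \<nu>(1) \<alpha>\<^sub>0 \<zeta>_coercive(1) by simp
  obtain Y where Y: "Y \<in> ?V" "\<And>Z. Z \<in> ?V \<Longrightarrow> form_op u Y \<bullet> Z = load \<bullet> Z"
    by (rule lax_milgram[OF V(1) c bounded_bilinear_form[of u] bounded_linear_inner_right[of load] pos])
       (use form_coercive[OF u] V(3) that in blast)+
  from Y(1) obtain y where y: "y \<in> W" "Y = state_vec \<Omega> y" by blast
  have "solves_state_eq \<Omega> \<mu> \<omega> (piecewise_scale P \<zeta> u) f W y"
    unfolding solves_iff[OF W] using y Y(2) by simp
  then have "solves_state_eq \<Omega> \<mu> \<omega> (piecewise_scale P \<zeta> u) f W (state W u)"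
    unfolding control_to_state_def by (rule someI[where P = "solves_state_eq \<Omega> \<mu> \<omega> (piecewise_scale P \<zeta> u) f W"])
  then show "state W u \<in> W" "\<And>Z. Z \<in> ?V \<Longrightarrow> form_op u (state_vec \<Omega> (state W u)) \<bullet> Z = load \<bullet> Z"
    unfolding solves_iff[OF W] by blast+
qed

text \<open>Density is assumed for each point of the graph separately and is used at the limit state
  alone. The convergence is in the graph norm, so the curls converge too, as the cost functional
  demands.\<close>

lemma discrete_states_converge:
  assumes W: "\<And>n. trial_space \<Omega> (W n)"
    and u: "\<And>n k. \<alpha>\<^sub>0 \<le> u n $ k" "u \<longlonglongrightarrow> u'" "\<And>k. \<alpha>\<^sub>0 \<le> u' $ k"
    and dense: "\<And>z e. z \<in> curl_graph \<Omega> \<Longrightarrow> e > 0 \<Longrightarrow> \<forall>\<^sub>F n in sequentially. \<exists>w\<in>W n. dist (state_vec \<Omega> w) z < e"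
  shows "(\<lambda>n. state_vec \<Omega> (state (W n) (u n))) \<longlonglongrightarrow> state_vec \<Omega> (state (H0_curl \<Omega>) u')"
proof -
  note gr = curl_graph_eq[OF open_dom bounded_dom]
  note H = trial_space_H0_curl[OF open_dom bounded_dom]
  have sub: "state_vec \<Omega> ` W n \<subseteq> curl_graph \<Omega>" for n using W[of n] unfolding gr trial_space_def by blast
  let ?y = "state_vec \<Omega> (state (H0_curl \<Omega>) u')"
  have y: "?y \<in> curl_graph \<Omega>" using state_solves(1)[OF H u(3)] unfolding gr by blast
  have ne: "state_vec \<Omega> ` W n \<noteq> {}" for n using W[of n] by (auto simp: trial_space_def)
  \<comment> \<open>Approximations whose distance is optimal up to \<open>1 / (n + 1)\<close>; the
    slack makes the choice possible for every \<open>n\<close> at once, whether or not the infimum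
    is attained.\<close>
  have "\<exists>v. v \<in> state_vec \<Omega> ` W n \<and> dist ?y v < infdist ?y (state_vec \<Omega> ` W n) + 1 / Suc n" for n
  proof (rule ccontr)
    assume "\<not> ?thesis"
    then have "infdist ?y (state_vec \<Omega> ` W n) + 1 / Suc n \<le> infdist ?y (state_vec \<Omega> ` W n)"
      using ne[of n] by (subst (2) infdist_def) (auto intro!: cINF_greatest simp: not_less)
    then show False by simp
  qed
  then have "\<exists>v. \<forall>n. v n \<in> state_vec \<Omega> ` W n \<and> dist ?y (v n) < infdist ?y (state_vec \<Omega> ` W n) + 1 / Suc n"
    by (intro choice allI)
  then obtain v where v: "\<And>n. v n \<in> state_vec \<Omega> ` W n" "\<And>n. dist ?y (v n) < infdist ?y (state_vec \<Omega> ` W n) + 1 / Suc n"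
    by blast
  have "(\<lambda>n. infdist ?y (state_vec \<Omega> ` W n)) \<longlonglongrightarrow> 0"
  proof (rule tendstoI)
    fix e :: real assume "e > 0"
    from dense[OF y this] show "\<forall>\<^sub>F n in sequentially. dist (infdist ?y (state_vec \<Omega> ` W n)) 0 < e"
    proof eventually_elim
      case (elim n)
      then obtain w where w: "w \<in> W n" "dist (state_vec \<Omega> w) ?y < e" by blast
      then have "infdist ?y (state_vec \<Omega> ` W n) \<le> dist ?y (state_vec \<Omega> w)" by (intro infdist_le) auto
      then show ?case using w(2) infdist_nonneg[of ?y "state_vec \<Omega> ` W n"] by (simp add: dist_commute)
    qed
  qed
  then have "(\<lambda>n. infdist ?y (state_vec \<Omega> ` W n) + 1 / Suc n) \<longlonglongrightarrow> 0 + 0"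
    using LIMSEQ_inverse_real_of_nat by (intro tendsto_add) (auto simp: inverse_eq_divide)
  then have lim: "(\<lambda>n. infdist ?y (state_vec \<Omega> ` W n) + 1 / Suc n) \<longlonglongrightarrow> 0" by simp
  have vy: "v \<longlonglongrightarrow> ?y"
    by (rule metric_tendsto_imp_tendsto[OF lim])
       (use v(2) in \<open>auto intro!: always_eventually less_imp_le simp: dist_commute intro: order_less_le_trans[OF _ abs_ge_self]\<close>)
  have e0: "(\<lambda>n. C_mass * norm (u n - u')) \<longlonglongrightarrow> 0"
    using tendsto_mult_right_zero[OF tendsto_norm_zero[OF LIM_zero[OF u(2)]]] .
  show ?thesis
  proof (rule galerkin_convergence[where V = "curl_graph \<Omega>" and V\<^sub>n = "\<lambda>n. state_vec \<Omega> ` W n" and b = "\<lambda>Y Z. form_op u' Y \<bullet> Z"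
        and b\<^sub>n = "\<lambda>n Y Z. form_op (u n) Y \<bullet> Z" and c = "min \<nu>\<^sub>0 (\<alpha>\<^sub>0 * \<rho>)" and e = "\<lambda>n. C_mass * norm (u n - u')"
        and F = "\<lambda>Z. load \<bullet> Z" and v = v])
    show "min \<nu>\<^sub>0 (\<alpha>\<^sub>0 * \<rho>) > 0" using \<nu>(1) \<alpha>\<^sub>0 \<zeta>_coercive(1) by simp
    show "subspace (state_vec \<Omega> ` W n)" for n by (rule trial_space_subspace[OF open_dom bounded_dom W])
    show "min \<nu>\<^sub>0 (\<alpha>\<^sub>0 * \<rho>) * (norm z)\<^sup>2 \<le> form_op (u n) z \<bullet> z" if "z \<in> state_vec \<Omega> ` W n" for n z
      by (rule form_coercive[OF u(1)]) (use that sub in blast)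
    show "state_vec \<Omega> (state (W n) (u n)) \<in> state_vec \<Omega> ` W n" for n
      using state_solves(1)[OF W u(1)] by blast
    show "form_op (u n) (state_vec \<Omega> (state (W n) (u n))) \<bullet> w = load \<bullet> w" if "w \<in> state_vec \<Omega> ` W n" for n w
      by (rule state_solves(2)[OF W u(1) that])
    show "form_op u' ?y \<bullet> w = load \<bullet> w" if "w \<in> curl_graph \<Omega>" for w
      by (rule state_solves(2)[OF H u(3)]) (use that gr in blast)
  qed (use sub bounded_bilinear_form form_diff e0 v(1) vy in auto)
qed

end

section \<open>Convergence of the discrete optimal controls\<close>

lemma L2_norm_diff:
  assumes S: "S \<in> sets lebesgue" and v: "v \<in> L2 S" and w: "w \<in> L2 S"
  shows "L2_norm S (\<lambda>x. v x - w x) = norm (cls (ext S v) - cls (ext S w))"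
proof -
  have s: "sqint (ext S v)" "sqint (ext S w)" using v w by (simp_all add: L2_iff_sqint[OF S])
  have d: "ext S (\<lambda>x. v x - w x) = (\<lambda>x. ext S v x - ext S w x)"
    by (simp add: ext_def fun_eq_iff scaleR_diff_right)
  have sd: "sqint (\<lambda>x. ext S v x - ext S w x)" by (rule sqint_diff[OF s])
  have "L2_norm S (\<lambda>x. v x - w x) = sqrt (Re (1 * (LINT x|lebesgue. cdot (ext S v x - ext S w x) (cnjv (ext S v x - ext S w x)))))"
    unfolding L2_norm_def L2_inner_ext[OF S] d by simp
  also have "\<dots> = sqrt (cls (\<lambda>x. ext S v x - ext S w x) \<bullet> cls (\<lambda>x. ext S v x - ext S w x))"
    unfolding Re_integral_vscale[OF sd sd] by simp
  finally show ?thesis by (simp add: norm_eq_sqrt_inner cls_diff[OF s])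
qed

lemma inball_diameter_nonneg:
  assumes K: "K \<noteq> {}" "bounded K"
  shows "0 \<le> inball_diameter K"
proof -
  obtain c where c: "c \<in> K" using K(1) by blast
  have "2 * 0 \<le> inball_diameter K"
    unfolding inball_diameter_def
  proof (rule cSup_upper)
    show "2 * 0 \<in> {2 * r |r. 0 \<le> r \<and> (\<exists>c. cball c r \<subseteq> K)}"
      using c by (intro CollectI exI[of _ "0::real"] conjI exI[of _ c]) auto
    have "2 * r \<le> diameter K" if "0 \<le> r" "cball c r \<subseteq> K" for r and c :: "real^3"
      using diameter_subset[OF that(2) K(2)] that(1) by simp
    then show "bdd_above {2 * r |r. 0 \<le> r \<and> (\<exists>c. cball c r \<subseteq> K)}"
      by (intro bdd_aboveI[of _ "diameter K"]) blast
  qed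
  then show ?thesis by simp
qed

lemma conforming_mesh_imp_mesh: "conforming_mesh \<Omega> \<T> \<Longrightarrow> mesh \<T>"
  by (auto simp: conforming_mesh_def triangulation_def mesh_def)

lemma U_ad_eq_cbox: "U_ad a b = cbox a b"
  by (auto simp: U_ad_def mem_box_cart)

lemma decreasing_sequence_in:
  fixes H :: "real set"
  assumes H: "H \<subseteq> {0<..}" "0 islimpt H"
  obtains s where "\<And>n. s n \<in> H" "\<And>m n. m < n \<Longrightarrow> s n < s m" "s \<longlonglongrightarrow> 0"
proof -
  have ex: "\<exists>x\<in>H. x < e" if "e > 0" for e
  proof -
    from H(2) that obtain x where "x \<in> H" "dist x 0 < e" unfolding islimpt_approachable by blast
    then show ?thesis by (intro bexI[of _ x]) auto
  qed
  have "\<exists>s. \<forall>n. (s n \<in> H \<and> s n < inverse (Suc n)) \<and> s (Suc n) < s n"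
  proof (rule dependent_nat_choice)
    show "\<exists>x. x \<in> H \<and> x < inverse (real (Suc 0))" using ex[of 1] by auto
    fix x n assume "x \<in> H \<and> x < inverse (real (Suc n))"
    then have "0 < min x (inverse (real (Suc (Suc n))))" using H(1) by auto
    from ex[OF this] show "\<exists>y. (y \<in> H \<and> y < inverse (real (Suc (Suc n)))) \<and> y < x" by auto
  qed
  then obtain s where s: "\<And>n. s n \<in> H" "\<And>n. s n < inverse (Suc n)" "\<And>n. s (Suc n) < s n" by blast
  show thesis
  proof (rule that[OF s(1)])
    show "s n < s m" if "m < n" for m n
      using lift_Suc_mono_less[of "\<lambda>n. - s n" m n] that s(3) by simp
    have "0 \<le> s n" for n using s(1)[of n] H(1) by (auto intro: less_imp_le)
    then show "s \<longlonglongrightarrow> 0"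
      by (intro tendsto_sandwich[OF _ _ tendsto_const LIMSEQ_inverse_real_of_nat] always_eventually allI)
         (use s(2) in \<open>auto intro: less_imp_le\<close>)
  qed
qed

text \<open>The product of the two imaginary parts contributes the positive term
  \<open>\<tau> \<omega> \<sigma>\<close>, which can outweigh the indefinite contribution
  \<open>- \<omega>^2 \<epsilon>\<close> of the unrotated form.\<close>

lemma eps_sigma_rotated:
  assumes "\<omega> > 0"
  shows "Re (- (1 + \<i> * of_real \<tau>) * of_real (\<omega>\<^sup>2) * eps_sigma \<omega> \<epsilon> \<sigma> x) = \<omega> * (\<tau> * \<sigma> x - \<omega> * \<epsilon> x)"
  using assms by (simp add: eps_sigma_def power2_eq_square field_simps)

theorem theorem5p2:
  fixes \<Omega> :: "(real^3) set"
    and P :: "'l::finite \<Rightarrow> (real^3) set"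
    and \<mu> \<epsilon> \<sigma> :: "real^3 \<Rightarrow> real"
    and \<omega> \<mu>\<^sub>0 \<epsilon>\<^sub>l \<epsilon>\<^sub>u \<sigma>\<^sub>l \<sigma>\<^sub>u \<alpha> :: real
    and f y\<^sub>\<Omega> E\<^sub>\<Omega> :: "real^3 \<Rightarrow> complex^3"
    and a b :: "real^'l"
    and H :: "real set"
    and \<T> :: "real \<Rightarrow> (real^3) set set"
    and \<T>\<^sub>0 :: "(real^3) set set"
    and j :: "real^'l \<Rightarrow> real"
    and j\<^sub>h :: "real \<Rightarrow> real^'l \<Rightarrow> real"
    and u\<^sub>h :: "real \<Rightarrow> real^'l"
  assumes domain: "polyhedral_lipschitz_domain \<Omega>" "simply_connected \<Omega>"
    and partition: "domain_partition \<Omega> P"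
    and omega: "\<omega> > 0"
    and mu: "\<mu> \<in> L_inf \<Omega>" "\<mu>\<^sub>0 > 0" "AE x in lebesgue_on \<Omega>. \<mu>\<^sub>0 \<le> \<mu> x"
    and eps: "\<epsilon> \<in> L_inf \<Omega>" "\<epsilon>\<^sub>l > 0" "AE x in lebesgue_on \<Omega>. \<epsilon>\<^sub>l \<le> \<epsilon> x \<and> \<epsilon> x \<le> \<epsilon>\<^sub>u"
    and sig: "\<sigma> \<in> L_inf \<Omega>" "\<sigma>\<^sub>l > 0" "AE x in lebesgue_on \<Omega>. \<sigma>\<^sub>l \<le> \<sigma> x \<and> \<sigma> x \<le> \<sigma>\<^sub>u"
    and fields: "f \<in> L2 \<Omega>" "y\<^sub>\<Omega> \<in> L2 \<Omega>" "E\<^sub>\<Omega> \<in> L2 \<Omega>"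
    and alpha: "\<alpha> > 0"
    and bounds: "\<forall>k. 0 < a $ k \<and> a $ k < b $ k"
    and mesh_sizes: "H \<subseteq> {0<..}" "0 islimpt H"
    and initial_mesh: "conforming_mesh \<Omega> \<T>\<^sub>0"
    and meshes: "\<forall>h\<in>H. conforming_mesh \<Omega> (\<T> h) \<and> mesh_refines (\<T> h) \<T>\<^sub>0
                   \<and> mesh_size (\<T> h) = h \<and> (\<forall>K\<in>\<T> h. \<exists>k. K \<subseteq> closure (P k))"
    and shape_regular: "shape_regular (\<T> ` H)"
    and j: "\<forall>u. j u = cost \<Omega> y\<^sub>\<Omega> E\<^sub>\<Omega> \<alpha>
              (control_to_state \<Omega> P \<mu> \<omega> (eps_sigma \<omega> \<epsilon> \<sigma>) f (H0_curl \<Omega>) u) u"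
    and j_h: "\<forall>h u. j\<^sub>h h u = cost \<Omega> y\<^sub>\<Omega> E\<^sub>\<Omega> \<alpha>
              (control_to_state \<Omega> P \<mu> \<omega> (eps_sigma \<omega> \<epsilon> \<sigma>) f (nedelec_space \<Omega> (\<T> h)) u) u"
    and f_div: "f \<in> H_div \<Omega>"
    and mu_PW: "(\<lambda>x. complex_of_real (\<mu> x)) \<in> PW1_inf \<Omega> P"
    and eps_sigma_PW: "eps_sigma \<omega> \<epsilon> \<sigma> \<in> PW1_inf \<Omega> P"
    and discrete_solutions: "\<forall>h\<in>H. global_solution (j\<^sub>h h) (U_ad a b) (u\<^sub>h h)"
  shows "\<exists>s u. (\<forall>n. s n \<in> H) \<and> (\<forall>n. s (Suc n) < s n) \<and> s \<longlonglongrightarrow> 0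
           \<and> (\<lambda>n. u\<^sub>h (s n)) \<longlonglongrightarrow> u \<and> global_solution j (U_ad a b) u"
proof -
  have \<Omega>: "open \<Omega>" "bounded \<Omega>" "lipschitz_boundary \<Omega>"
    using domain(1) by (auto simp: polyhedral_lipschitz_domain_def)
  have \<Omega>m: "\<Omega> \<in> sets lebesgue" using \<Omega>(1) by simp
  note AE_on = AE_lebesgue_on_iff[OF \<Omega>m]
  have P: "\<And>k. open (P k)" "\<And>k. P k \<subseteq> \<Omega>" "\<And>k k'. k \<noteq> k' \<Longrightarrow> P k \<inter> P k' = {}" "negligible (\<Omega> - (\<Union>k. P k))"
    using partition by (auto simp: domain_partition_def)
  have cover: "AE x in lebesgue. x \<in> \<Omega> \<longrightarrow> (\<exists>k. x \<in> P k)"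
    using AE_not_in[of "\<Omega> - (\<Union>k. P k)" lebesgue] P(4)
    by (simp add: negligible_iff_null_sets)
  let ?\<zeta> = "eps_sigma \<omega> \<epsilon> \<sigma>"
  \<comment> \<open>Chosen so that \<open>\<tau> \<sigma> - \<omega> \<epsilon> \<ge> 1\<close>
    almost everywhere, whence the coercivity constant \<omega> of the mass coefficient.\<close>
  define \<tau> where "\<tau> = (\<omega> * \<bar>\<epsilon>\<^sub>u\<bar> + 1) / \<sigma>\<^sub>l"
  \<comment> \<open>Positive, as the minimum of finitely many positive lower bounds, and a lower
    bound for all components of all admissible controls.\<close>
  define \<alpha>\<^sub>0 where "\<alpha>\<^sub>0 = Min (range (($) a))"
  obtain B where B: "AE x in lebesgue_on \<Omega>. norm (\<mu> x) \<le> B" using mu(1) by (auto simp: L_inf_def)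
  have \<zeta>: "?\<zeta> \<in> L_inf \<Omega>" using eps_sigma_PW by (simp add: PW1_inf_def)
  obtain \<beta> where \<beta>: "AE x in lebesgue_on \<Omega>. norm (?\<zeta> x) \<le> \<beta>" using \<zeta> by (auto simp: L_inf_def)
  \<comment> \<open>The bounds for \<open>1/\<mu>\<close> come from the essential bounds of \<mu>;
    \<open>\<bar>B\<bar> + 1\<close> is a positive upper bound whatever the sign of
    \<open>B\<close>.\<close>
  interpret state_problem \<Omega> P \<mu> \<omega> ?\<zeta> f "inverse (\<bar>B\<bar> + 1)" "inverse \<mu>\<^sub>0" "\<bar>\<beta>\<bar>" \<tau> \<omega> \<alpha>\<^sub>0
  proof
    show "\<mu> \<in> borel_measurable (lebesgue_on \<Omega>)" "?\<zeta> \<in> borel_measurable (lebesgue_on \<Omega>)"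
      using mu(1) \<zeta> by (simp_all add: L_inf_def)
    show "AE x in lebesgue. x \<in> \<Omega> \<longrightarrow> inverse (\<bar>B\<bar> + 1) \<le> inverse (\<mu> x) \<and> inverse (\<mu> x) \<le> inverse \<mu>\<^sub>0"
      using B[unfolded AE_on] mu(3)[unfolded AE_on]
    proof eventually_elim
      case (elim x)
      show ?case
      proof
        assume "x \<in> \<Omega>"
        then have "\<mu>\<^sub>0 \<le> \<mu> x" "\<mu> x \<le> \<bar>B\<bar> + 1" using elim by auto
        then show "inverse (\<bar>B\<bar> + 1) \<le> inverse (\<mu> x) \<and> inverse (\<mu> x) \<le> inverse \<mu>\<^sub>0"
          using mu(2) by (intro conjI le_imp_inverse_le) auto
      qed
    qed
    show "AE x in lebesgue. x \<in> \<Omega> \<longrightarrow> norm (?\<zeta> x) \<le> \<bar>\<beta>\<bar>"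
      using \<beta>[unfolded AE_on] by (auto elim!: eventually_mono)
    show "AE x in lebesgue. x \<in> \<Omega> \<longrightarrow> \<omega> \<le> Re (- (1 + \<i> * of_real \<tau>) * of_real (\<omega>\<^sup>2) * ?\<zeta> x)"
      using eps(3)[unfolded AE_on] sig(3)[unfolded AE_on]
    proof eventually_elim
      case (elim x)
      show ?case
      proof
        assume "x \<in> \<Omega>"
        then have e: "\<epsilon> x \<le> \<bar>\<epsilon>\<^sub>u\<bar>" "\<sigma>\<^sub>l \<le> \<sigma> x" using elim by auto
        have "\<omega> * \<bar>\<epsilon>\<^sub>u\<bar> + 1 = \<tau> * \<sigma>\<^sub>l" using sig(2) by (simp add: \<tau>_def)
        also have "\<dots> \<le> \<tau> * \<sigma> x" using e(2) omega sig(2) by (intro mult_left_mono) (auto simp: \<tau>_def)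
        finally have "1 \<le> \<tau> * \<sigma> x - \<omega> * \<epsilon> x" using mult_left_mono[OF e(1), of \<omega>] omega by linarith
        from mult_left_mono[OF this, of \<omega>] omega
        show "\<omega> \<le> Re (- (1 + \<i> * of_real \<tau>) * of_real (\<omega>\<^sup>2) * ?\<zeta> x)"
          unfolding eps_sigma_rotated[OF omega] by simp
      qed
    qed
    show "0 < \<alpha>\<^sub>0" using bounds by (simp add: \<alpha>\<^sub>0_def)
  qed (use \<Omega> P cover mu(2) omega fields(1) in auto)

  have le: "\<alpha>\<^sub>0 \<le> v $ k" if "v \<in> U_ad a b" for v k
  proof -
    have "\<alpha>\<^sub>0 \<le> a $ k" unfolding \<alpha>\<^sub>0_def by (rule Min_le) auto
    also have "\<dots> \<le> v $ k" using that by (simp add: U_ad_def)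
    finally show ?thesis .
  qed
  have mesh: "mesh (\<T> h)" "\<Union>(\<T> h) = closure \<Omega>" if "h \<in> H" for h
    using meshes that by (auto simp: conforming_mesh_def intro: conforming_mesh_imp_mesh)
  obtain \<kappa> where \<kappa>: "\<And>h K. h \<in> H \<Longrightarrow> K \<in> \<T> h \<Longrightarrow> diameter K \<le> \<kappa> * inball_diameter K"
    using shape_regular by (auto simp: shape_regular_def)
  have elem: "diameter K \<le> h \<and> diameter K \<le> max \<kappa> 0 * inball_diameter K" if h: "h \<in> H" and K: "K \<in> \<T> h" for h K
  proof -
    interpret mesh "\<T> h" by (rule mesh(1)[OF h])
    have "diameter K \<le> mesh_size (\<T> h)" unfolding mesh_size_def using fin K by (intro Max_ge) auto
    moreover have "0 \<le> inball_diameter K"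
    proof (rule inball_diameter_nonneg)
      show "K \<noteq> {}" using simp3[OF K] by (auto simp: simplex_empty)
      show "bounded K" using simp3[OF K] by (rule polytope_imp_bounded[OF simplex_imp_polytope])
    qed
    then have "\<kappa> * inball_diameter K \<le> max \<kappa> 0 * inball_diameter K" by (intro mult_right_mono) auto
    ultimately show ?thesis using \<kappa>[OF h K] meshes h by fastforce
  qed
  have trial: "trial_space \<Omega> (nedelec_space \<Omega> (\<T> h))" if "h \<in> H" for h
    by (rule mesh.trial_space_nedelec[OF mesh(1)[OF that] \<Omega> mesh(2)[OF that]])

  \<comment> \<open>The cost as a function of the state vector and the control, continuous on the
    product Hilbert space because it sees only the two L2 norms and the control.\<close>
  define J where "J Y u = 1/2 * (norm (fst Y - cls (ext \<Omega> y\<^sub>\<Omega>)))\<^sup>2 + 1/2 * (norm (snd Y - cls (ext \<Omega> E\<^sub>\<Omega>)))\<^sup>2 + \<alpha>/2 * (norm u)\<^sup>2"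
    for Y :: "(real^3, complex^3) l2 \<times> (real^3, complex^3) l2" and u :: "real^'l"
  have cost: "cost \<Omega> y\<^sub>\<Omega> E\<^sub>\<Omega> \<alpha> y u = J (state_vec \<Omega> y) u" if "y \<in> H0_curl \<Omega>" for y u
    using H0_curl_sqint[OF that] fields
    by (simp add: cost_def J_def state_vec_def L2_norm_diff[OF \<Omega>m] L2_iff_sqint[OF \<Omega>m])
  note H0 = trial_space_H0_curl[OF \<Omega>(1,2)]
  have sub: "W \<subseteq> H0_curl \<Omega>" if "trial_space \<Omega> W" for W using that by (simp add: trial_space_def)

  \<comment> \<open>Continuous convergence of the reduced functionals: the control may vary with the
    mesh. This one fact serves both the minimisers and the fixed competitors.\<close>
  have conv: "(\<lambda>n. j\<^sub>h (s n) (v n)) \<longlonglongrightarrow> j v'"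
    if s: "\<And>n. s n \<in> H" "s \<longlonglongrightarrow> 0" and v: "\<And>n. v n \<in> U_ad a b" "v \<longlonglongrightarrow> v'" and v': "v' \<in> U_ad a b" for s v v'
  proof -
    let ?W = "\<lambda>n. nedelec_space \<Omega> (\<T> (s n))"
    have "\<forall>\<^sub>F n in sequentially. \<exists>w\<in>?W n. dist (state_vec \<Omega> w) z < e" if z: "z \<in> curl_graph \<Omega>" and e: "e > 0" for z e
    proof -
      obtain h\<^sub>0 where h0: "h\<^sub>0 > 0" and
        dn: "\<forall>\<T> h. mesh \<T> \<longrightarrow> \<Union>\<T> = closure \<Omega> \<longrightarrow> (\<forall>K\<in>\<T>. diameter K \<le> h \<and> diameter K \<le> max \<kappa> 0 * inball_diameter K) \<longrightarrow>
          0 \<le> h \<longrightarrow> h < h\<^sub>0 \<longrightarrow> (\<exists>W\<in>nedelec_space \<Omega> \<T>. dist (state_vec \<Omega> W) z < e)"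
        using nedelec_dense[OF \<Omega> z max.cobounded2 e] by blast
      have "\<forall>\<^sub>F n in sequentially. s n < h\<^sub>0" by (rule order_tendstoD(2)[OF s(2) h0])
      then show ?thesis
      proof eventually_elim
        case (elim n)
        have "0 \<le> s n" using s(1)[of n] mesh_sizes(1) by (auto intro: less_imp_le)
        then show ?case using dn mesh[OF s(1)[of n]] elem[OF s(1)[of n]] elim by blast
      qed
    qed
    from discrete_states_converge[OF trial[OF s(1)] le[OF v(1)] v(2) le[OF v'] this]
    have lim: "(\<lambda>n. state_vec \<Omega> (state (?W n) (v n))) \<longlonglongrightarrow> state_vec \<Omega> (state (H0_curl \<Omega>) v')" .
    have "(\<lambda>n. J (state_vec \<Omega> (state (?W n) (v n))) (v n)) \<longlonglongrightarrow> J (state_vec \<Omega> (state (H0_curl \<Omega>) v')) v'"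
      unfolding J_def by (intro tendsto_intros lim v(2))
    moreover have "j\<^sub>h (s n) (v n) = J (state_vec \<Omega> (state (?W n) (v n))) (v n)" for n
      using cost[OF subsetD[OF sub[OF trial[OF s(1)]] state_solves(1)[OF trial[OF s(1)] le[OF v(1)]]]] by (simp only: j_h)
    moreover have "j v' = J (state_vec \<Omega> (state (H0_curl \<Omega>) v')) v'"
      using cost[OF state_solves(1)[OF H0 le[OF v']]] by (simp only: j)
    ultimately show ?thesis by simp
  qed

  obtain s\<^sub>0 where s0: "\<And>n. s\<^sub>0 n \<in> H" "\<And>m n. m < n \<Longrightarrow> s\<^sub>0 n < s\<^sub>0 m" "s\<^sub>0 \<longlonglongrightarrow> 0"
    by (rule decreasing_sequence_in[OF mesh_sizes]) (rule that)
  have opt: "u\<^sub>h h \<in> U_ad a b" "\<And>v. v \<in> U_ad a b \<Longrightarrow> j\<^sub>h h (u\<^sub>h h) \<le> j\<^sub>h h v" if "h \<in> H" for h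
    using discrete_solutions that by (auto simp: global_solution_def)
  have "seq_compact (U_ad a b)" unfolding U_ad_eq_cbox by (simp add: compact_imp_seq_compact)
  then obtain u r where u: "u \<in> U_ad a b" "strict_mono r" "((\<lambda>n. u\<^sub>h (s\<^sub>0 n)) \<circ> r) \<longlonglongrightarrow> u"
    by (rule seq_compactE[where f = "\<lambda>n. u\<^sub>h (s\<^sub>0 n)"]) (use opt(1)[OF s0(1)] in auto)
  define s where "s = s\<^sub>0 \<circ> r"
  have s: "\<And>n. s n \<in> H" "\<And>n. s (Suc n) < s n" "s \<longlonglongrightarrow> 0" "(\<lambda>n. u\<^sub>h (s n)) \<longlonglongrightarrow> u"
    using s0 u LIMSEQ_subseq_LIMSEQ[OF s0(3) u(2)] by (auto simp: s_def o_def strict_mono_def)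
  \<comment> \<open>An arbitrary competitor is admissible for every discrete problem, so the
    constant sequence \<open>v\<close> competes with the minimisers and the inequality passes to the
    limit on both sides.\<close>
  have "j u \<le> j v" if v: "v \<in> U_ad a b" for v
  proof (rule LIMSEQ_le)
    show "(\<lambda>n. j\<^sub>h (s n) (u\<^sub>h (s n))) \<longlonglongrightarrow> j u" by (rule conv[OF s(1,3) opt(1)[OF s(1)] s(4) u(1)])
    show "(\<lambda>n. j\<^sub>h (s n) v) \<longlonglongrightarrow> j v" by (rule conv[OF s(1,3) v tendsto_const v])
  qed (use opt(2)[OF s(1) v] in blast)
  then have "global_solution j (U_ad a b) u" using u(1) by (simp add: global_solution_def)
  with s show ?thesis by blast
qed

end
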